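(* Let $\mathfrak R$ be a set of representatives (exactly one from each orbit) of the orbits of the group $\mathfrak G=\mathrm{GL}(2,\mathbb F_2)$ acting on the set of functions $\tilde{\mathfrak F}(\mathbb F_2)$. Then every nilpotent Chernikov $2$-group with elementary top and with bottom $M^{(2)}$ is isomorphic to the group $G(\rho)$ for a uniquely defined function $\rho\in\mathfrak R$.
   Context: A Chernikov $2$-group $G$ is an extension of a finite direct sum $M$ of quasi-cyclic $2$-groups (groups of type $2^\infty$) by a finite $2$-group $H$, that is, $M$ is a normal subgroup of $G$ with $G/M\cong H$. The subgroup $M$ is the biggest abelian divisible subgroup of $G$; $H$ is called the top and $M$ the bottom of $G$. The top is elementary if $H$ is an elementary abelian $2$-group. $M^{(2)}=M_1\oplus M_2$ denotes the direct sum of two quasi-cyclic $2$-groups, and $a_k\in M_k$ ($k=1,2$) is the element of order $2$. Skew-symmetric matrices over $\mathbb F_2$ are understood as alternating (symmetric with zero diagonal). For a pair $\boldsymbol A=(A_1,A_2)$ of $N\times N$ skew-symmetric matrices over $\mathbb F_2$, $A_k=(a^{(k)}_{ij})$, the group $G(\boldsymbol A)$ is the extension of $M^{(2)}$ by the elementary abelian group $H_N=\langle h_1,\dots,h_N\mid h_i^2=1,\ h_ih_j=h_jh_i\rangle$ generated by $M^{(2)}$ and (lifts of) $h_1,\dots,h_N$ subject to $h_i^2=1$, $[h_i,a]=1$ for all $a\in M^{(2)}$, and $[h_i,h_j]=a^{(1)}_{ij}a_1+a^{(2)}_{ij}a_2$ (additive notation in $M^{(2)}$). Let $\Bbbk=\mathbb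 F_2$. An irreducible homogeneous polynomial $g\in\Bbbk[x_1,x_2]$ is unital if either $g=x_2$ or its leading coefficient with respect to $x_1$ equals $1$. $\mathbb P$ is the set of unital homogeneous irreducible polynomials in $\Bbbk[x_1,x_2]$, and $\tilde{\mathbb P}=\mathbb P\cup\{\varepsilon\}$, where $\varepsilon$ is an extra symbol. For $g\in\mathbb P$ and $Q\in\mathfrak G=\mathrm{GL}(2,\Bbbk)$, $Q*g$ is the unique $g'\in\mathbb P$ such that $g((x_1,x_2)Q)=\lambda g'$ for some non-zero $\lambda\in\Bbbk$; also $Q*\varepsilon=\varepsilon$. With $\mathbb N=\{1,2,\dots\}$, $\tilde{\mathfrak F}(\mathbb F_2)$ is the set of functions $\rho:\tilde{\mathbb P}\times\mathbb N\to\mathbb Z_{\ge0}$ such that $\rho(g,n)=0$ for almost all pairs $(g,n)$. The group $\mathfrak G$ acts on it by $(\rho*Q)(g,n)=\rho(Q*g,n)$. For $(g,n)\in\tilde{\mathbb P}\times\mathbb N$ define the pair $\boldsymbol A(g,n)$ of skew-symmetric matrices over $\mathbb F_2$ as follows. - If $g=x_2$: $\boldsymbol A(g,n)=\left(\begin{pmatrix}0&J_n\\ J_n^\top&0\end{pmatrix},\begin{pmatrix}0&I_n\\ I_n&0\end{pmatrix}\right)$, where $J_n$ is the $n\times n$ nilpotent Jordan block and $I_n$ the unit matrix. - If $g=\varepsilon$: $\boldsymbol A(g,n)=\left(\begin{pmatrix}0&I_{n+}\\ I_{n+}^\top&0\end{pmatrix},\begin{pmatrix}0&I_{n-}\\ I_{n-}^\top&0\end{pmatrix}\right)$,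 of dimension $2n-1$, where $I_{n+}$, $I_{n-}$ are the $n\times(n-1)$ matrices obtained from $I_{n-1}$ by adding a zero row at the bottom, respectively at the top (for $n=1$: the pair of $1\times1$ zero matrices). - Otherwise, with $f(x)=g(x,1)$ and $d=n\deg f$: $\boldsymbol A(g,n)=\left(\begin{pmatrix}0&I_d\\ I_d&0\end{pmatrix},\begin{pmatrix}0&\Phi\\ \Phi^\top&0\end{pmatrix}\right)$, where $\Phi$ is the Frobenius (companion) matrix with characteristic polynomial $f^n(x)=x^d+\lambda_1x^{d-1}+\dots+\lambda_d$, i.e. the $d\times d$ matrix with ones on the subdiagonal, last column $(\lambda_d,\dots,\lambda_1)^\top$ and zeros elsewhere. For $\rho\in\tilde{\mathfrak F}(\mathbb F_2)$ put $\tilde{\mathfrak A}^\rho=\bigoplus_{(g,n)}\boldsymbol A(g,n)^{\rho(g,n)}$ (block-diagonal direct sum of $\rho(g,n)$ copies of each $\boldsymbol A(g,n)$) and $G(\rho)=G(\tilde{\mathfrak A}^\rho)$. *)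

theory Defs
  imports
    "HOL-Algebra.Algebra"
    "HOL-Library.Z2"
    "HOL-Computational_Algebra.Polynomial_Factorial"
    "Jordan_Normal_Form.Jordan_Normal_Form"
begin

section \<open>Chernikov 2-groups\<close>

text \<open>The quasi-cyclic group of type \<open>2\<^sup>\<infinity>\<close>, written multiplicatively as the complex
  roots of unity of 2-power order.\<close>

definition quasicyclic2 :: "complex monoid" where
  "quasicyclic2 = \<lparr>carrier = {z. \<exists>k::nat. z ^ (2 ^ k) = 1}, Group.monoid.mult = (*), one = 1\<rparr>"

definition finite_2_group :: "('a, 'b) monoid_scheme \<Rightarrow> bool" where
  "finite_2_group H \<longleftrightarrow> group H \<and> finite (carrier H) \<and> (\<exists>k. Coset.order H = 2 ^ k)"

definition elementary_abelian_2_group :: "('a, 'b) monoid_scheme \<Rightarrow> bool" where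
  "elementary_abelian_2_group H \<longleftrightarrow>
     comm_group H \<and> (\<forall>x\<in>carrier H. x \<otimes>\<^bsub>H\<^esub> x = \<one>\<^bsub>H\<^esub>)"

definition chernikov_2_group :: "('a, 'b) monoid_scheme \<Rightarrow> 'a set \<Rightarrow> bool" where
  "chernikov_2_group G M \<longleftrightarrow>
     group G \<and> M \<lhd> G \<and>
     (\<exists>m::nat. G\<lparr>carrier := M\<rparr> \<cong> sum_group {..<m} (\<lambda>_. quasicyclic2)) \<and>
     finite_2_group (G Mod M)"

primrec lower_central :: "('a, 'b) monoid_scheme \<Rightarrow> nat \<Rightarrow> 'a set" where
  "lower_central G 0 = carrier G"
| "lower_central G (Suc k) =
     generate G {x \<otimes>\<^bsub>G\<^esub> y \<otimes>\<^bsub>G\<^esub> inv\<^bsub>G\<^esub> x \<otimes>\<^bsub>G\<^esub> inv\<^bsub>G\<^esub> y | x y.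
       x \<in> lower_central G k \<and> y \<in> carrier G}"

definition nilpotent_group :: "('a, 'b) monoid_scheme \<Rightarrow> bool" where
  "nilpotent_group G \<longleftrightarrow> group G \<and> (\<exists>k. lower_central G k = {\<one>\<^bsub>G\<^esub>})"

section \<open>Groups given by generators and relations\<close>

text \<open>A word is a list of signed letters; \<open>(x, False)\<close> is the formal inverse of \<open>(x, True)\<close>.
  A relation \<open>u = v\<close> between words is the pair \<open>(u, v)\<close>.\<close>

type_synonym 'g word = "('g \<times> bool) list"

inductive word_step :: "'g set \<Rightarrow> ('g word \<times> 'g word) set \<Rightarrow> 'g word \<Rightarrow> 'g word \<Rightarrow> bool"
  for S rels where
  cancel: "x \<in> S \<Longrightarrow> word_step S rels (p @ [(x, b), (x, \<not> b)] @ q) (p @ q)"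
| relation: "(u, v) \<in> rels \<Longrightarrow> word_step S rels (p @ u @ q) (p @ v @ q)"

definition presented_group ::
  "'g set \<Rightarrow> ('g word \<times> 'g word) set \<Rightarrow> 'g word set monoid" where
  "presented_group S rels =
     (let W = lists (S \<times> UNIV); eq = equivclp (word_step S rels) in
      \<lparr>carrier = W // {(u, v). u \<in> W \<and> v \<in> W \<and> eq u v},
       Group.monoid.mult = (\<lambda>U V. {w \<in> W. \<exists>x\<in>U. \<exists>y\<in>V. eq (x @ y) w}),
       one = {w \<in> W. eq [] w}\<rparr>)"

definition commutator_word :: "'g \<Rightarrow> 'g \<Rightarrow> 'g word" where
  "commutator_word x y = [(x, True), (y, True), (x, False), (y, False)]"

section \<open>The groups \<open>G(A)\<close>\<close>

definition M2 :: "(complex \<times> complex) monoid" where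
  "M2 = quasicyclic2 \<times>\<times> quasicyclic2"

text \<open>\<open>c\<^sub>1 a\<^sub>1 + c\<^sub>2 a\<^sub>2\<close>, where \<open>a\<^sub>k\<close> is the element of order 2, i.e. \<open>-1\<close>, of
  the \<open>k\<close>-th summand.\<close>

definition order2_elem :: "bit \<Rightarrow> bit \<Rightarrow> complex \<times> complex" where
  "order2_elem c1 c2 = (if c1 = 1 then -1 else 1, if c2 = 1 then -1 else 1)"

datatype gen = Bot "complex \<times> complex" | Lift nat

text \<open>The lifts \<open>h\<^sub>i\<close> are numbered from 0, as are rows and columns of matrices.\<close>

definition gens_of :: "nat \<Rightarrow> gen set" where
  "gens_of N = Bot ` carrier M2 \<union> Lift ` {..<N}"

definition rels_of :: "bit mat \<times> bit mat \<Rightarrow> (gen word \<times> gen word) set" where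
  "rels_of A = (let N = dim_row (fst A) in
     {([(Bot a, True), (Bot b, True)], [(Bot (a \<otimes>\<^bsub>M2\<^esub> b), True)]) | a b.
        a \<in> carrier M2 \<and> b \<in> carrier M2} \<union>
     {([(Lift i, True), (Lift i, True)], []) | i. i < N} \<union>
     {(commutator_word (Lift i) (Bot a), []) | i a. i < N \<and> a \<in> carrier M2} \<union>
     {(commutator_word (Lift i) (Lift j),
       [(Bot (order2_elem (fst A $$ (i, j)) (snd A $$ (i, j))), True)]) | i j. i < N \<and> j < N})"

definition group_of_pair :: "bit mat \<times> bit mat \<Rightarrow> gen word set monoid" where
  "group_of_pair A = presented_group (gens_of (dim_row (fst A))) (rels_of A)"

section \<open>Unital irreducible homogeneous polynomials over \<open>F\<^sub>2\<close>\<close>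

text \<open>\<open>F\<^sub>2[x\<^sub>1,x\<^sub>2]\<close> is represented as \<open>F\<^sub>2[x\<^sub>2][x\<^sub>1]\<close>: the coefficient of
  \<open>x\<^sub>1\<^sup>i x\<^sub>2\<^sup>j\<close> in \<open>g\<close> is \<open>coeff (coeff g i) j\<close>, and \<open>lead_coeff g\<close> is the
  leading coefficient with respect to \<open>x\<^sub>1\<close>.\<close>

type_synonym bipoly = "bit poly poly"

definition X1 :: bipoly where "X1 = [:0, 1:]"

definition X2 :: bipoly where "X2 = [:[:0, 1:]:]"

definition homogeneous :: "bipoly \<Rightarrow> bool" where
  "homogeneous g \<longleftrightarrow> (\<exists>d. \<forall>i j. coeff (coeff g i) j \<noteq> 0 \<longrightarrow> i + j = d)"

definition PP :: "bipoly set" where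
  "PP = {g. homogeneous g \<and> Factorial_Ring.irreducible g \<and> (g = X2 \<or> lead_coeff g = 1)}"

text \<open>\<open>None\<close> is the extra symbol \<open>\<epsilon>\<close>.\<close>

definition PPe :: "bipoly option set" where
  "PPe = insert None (Some ` PP)"

abbreviation scal :: "bit \<Rightarrow> bipoly" where
  "scal c \<equiv> [:[:c:]:]"

definition subst2 :: "bipoly \<Rightarrow> bipoly \<Rightarrow> bipoly \<Rightarrow> bipoly" where
  "subst2 g y1 y2 =
     (\<Sum>i\<le>degree g. \<Sum>j\<le>degree (coeff g i). scal (coeff (coeff g i) j) * y1 ^ i * y2 ^ j)"

definition GL2 :: "bit mat monoid" where
  "GL2 = units_of (ring_mat TYPE(bit) 2 ())"

text \<open>\<open>g((x\<^sub>1,x\<^sub>2)Q)\<close>, with \<open>(x\<^sub>1,x\<^sub>2)\<close> a row vector.\<close>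

definition subst_row :: "bit mat \<Rightarrow> bipoly \<Rightarrow> bipoly" where
  "subst_row Q g =
     subst2 g (scal (Q $$ (0, 0)) * X1 + scal (Q $$ (1, 0)) * X2)
              (scal (Q $$ (0, 1)) * X1 + scal (Q $$ (1, 1)) * X2)"

definition star :: "bit mat \<Rightarrow> bipoly \<Rightarrow> bipoly" where
  "star Q g = (THE g'. g' \<in> PP \<and> (\<exists>c. c \<noteq> 0 \<and> subst_row Q g = scal c * g'))"

section \<open>The functions \<open>\<rho>\<close> and the action of \<open>GL(2,F\<^sub>2)\<close>\<close>

type_synonym index = "bipoly option \<times> nat"

definition indices :: "index set" where
  "indices = PPe \<times> {1..}"

text \<open>Functions on \<open>indices\<close> are represented by total functions vanishing elsewhere.\<close>

definition FF :: "(index \<Rightarrow> nat) set" where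
  "FF = {\<rho>. finite {p. \<rho> p \<noteq> 0} \<and> {p. \<rho> p \<noteq> 0} \<subseteq> indices}"

definition act :: "bit mat \<Rightarrow> (index \<Rightarrow> nat) \<Rightarrow> index \<Rightarrow> nat" where
  "act Q \<rho> = (\<lambda>(g, n). if (g, n) \<in> indices then \<rho> (map_option (star Q) g, n) else 0)"

text \<open>\<open>act\<close> is a right action, \<open>act (Q \<otimes> R) \<rho> = act R (act Q \<rho>)\<close>; the set \<open>orbits GL2 FF act\<close>
  of its orbits is the same as for the corresponding left action.\<close>

definition orbit_representatives :: "(index \<Rightarrow> nat) set \<Rightarrow> bool" where
  "orbit_representatives R \<longleftrightarrow>
     R \<subseteq> FF \<and> (\<forall>orb\<in>orbits GL2 FF act. \<exists>!\<rho>. \<rho> \<in> R \<and> \<rho> \<in> orb)"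

section \<open>The canonical pairs and the groups \<open>G(\<rho>)\<close>\<close>

definition off_diag :: "bit mat \<Rightarrow> bit mat" where
  "off_diag B = four_block_mat (0\<^sub>m (dim_row B) (dim_row B)) B
                  (transpose_mat B) (0\<^sub>m (dim_col B) (dim_col B))"

definition I_plus :: "nat \<Rightarrow> bit mat" where
  "I_plus n = mat n (n - 1) (\<lambda>(i, j). if i = j then 1 else 0)"

definition I_minus :: "nat \<Rightarrow> bit mat" where
  "I_minus n = mat n (n - 1) (\<lambda>(i, j). if i = Suc j then 1 else 0)"

text \<open>The Frobenius matrix of the monic polynomial \<open>p = x\<^sup>d + \<lambda>\<^sub>1 x\<^bsup>d-1\<^esup> + \<dots> + \<lambda>\<^sub>d\<close>;
  counting rows from 0, the entry \<open>\<lambda>\<^bsub>d-i\<^esub>\<close> in row \<open>i\<close> of the last column is \<open>coeff p i\<close>.\<close>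

definition frobenius_mat :: "bit poly \<Rightarrow> bit mat" where
  "frobenius_mat p = mat (degree p) (degree p)
     (\<lambda>(i, j). if j = degree p - 1 then coeff p i else if i = Suc j then 1 else 0)"

text \<open>\<open>f(x) = g(x, 1)\<close>\<close>

definition dehomogenize :: "bipoly \<Rightarrow> bit poly" where
  "dehomogenize g = map_poly (\<lambda>c. poly c 1) g"

definition canonical_pair :: "index \<Rightarrow> bit mat \<times> bit mat" where
  "canonical_pair = (\<lambda>(h, n). case h of
       None \<Rightarrow> (off_diag (I_plus n), off_diag (I_minus n))
     | Some g \<Rightarrow>
         if g = X2 then (off_diag (jordan_block n 0), off_diag (1\<^sub>m n))
         else (let f = dehomogenize g; d = n * degree f in
               (off_diag (1\<^sub>m d), off_diag (frobenius_mat (f ^ n)))))"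

text \<open>The order of the summands is an arbitrary fixed choice; another order permutes the
  generators \<open>h\<^sub>i\<close> and so gives an isomorphic group.\<close>

definition summands :: "(index \<Rightarrow> nat) \<Rightarrow> index list" where
  "summands \<rho> = (SOME ps. \<forall>p. count_list ps p = \<rho> p)"

definition pair_of :: "(index \<Rightarrow> nat) \<Rightarrow> bit mat \<times> bit mat" where
  "pair_of \<rho> =
     (diag_block_mat (map (fst \<circ> canonical_pair) (summands \<rho>)),
      diag_block_mat (map (snd \<circ> canonical_pair) (summands \<rho>)))"

definition group_of :: "(index \<Rightarrow> nat) \<Rightarrow> gen word set monoid" where
  "group_of \<rho> = group_of_pair (pair_of \<rho>)"

end

theory Submission
  imports Defs "HOL-Library.Function_Algebras"
begin

text \<open>
  In a nilpotent Chernikov 2-group with elementary top the bottom is central: for \<open>m\<close> in the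
  bottom and any \<open>g\<close> the commutator map \<open>C m = [m, g]\<close> satisfies \<open>C (C m) = C (m\<^sup>2)\<close>, and since the
  bottom is divisible its values lie in all terms of the lower central series
  (\<open>chernikov_central\<close>). Divisibility also gives lifts of a basis of the top that are
  involutions. Their commutators have order at most two, so they are recorded by a pair of
  alternating matrices over \<open>F\<^sub>2\<close>, and the group is recovered from this pair as \<open>G(A)\<close>
  (\<open>iso_if_central_lifts\<close>).

  The pair depends on two choices. Changing the basis of the top replaces it by a congruent pair
  (\<open>change_lifts\<close>, \<open>coordinates_of_lifts\<close>). The embedding of \<open>M\<^sup>(\<^sup>2\<^sup>)\<close> has a canonical image, the
  set of fourth powers, and changing it by an automorphism of \<open>M\<^sup>(\<^sup>2\<^sup>)\<close> acts on the pair through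
  \<open>GL(2,F\<^sub>2)\<close>, where every matrix occurs (\<open>iota_transition\<close>, \<open>automorphism_realising\<close>). So
  isomorphism classes of groups correspond to pairs of alternating forms up to congruence and the
  action of \<open>GL(2,F\<^sub>2)\<close>.

  Pairs of alternating forms are classified by the multiplicities of the canonical blocks. For
  existence (\<open>exists_canonical_basis\<close>) a block is split off: a chain \<open>\<alpha>(v\<^sub>i\<^sub>+\<^sub>1, _) = \<beta>(v\<^sub>i, _)\<close> is
  isotropic for both forms because they are alternating, and a suitable extremal chain has a dual
  chain, given by the Fredholm alternative, which is the other half of the block. For uniqueness
  (\<open>count_canonical_twist\<close>) one counts the maps from forms of degree \<open>D - 1\<close> to \<open>V\<close> that are
  compatible with the pair and with a polynomial \<open>h\<close>. The counts are multiplicative over blocks,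
  and for \<open>h = 0\<close> and \<open>h = g\<^sup>n\<close> their second differences isolate the multiplicities. A linear
  substitution in the variables turns the count of a pair into that of the twisted pair, so twisting
  by \<open>Q\<close> acts on multiplicities exactly as \<open>\<rho> \<mapsto> \<rho> * Q\<close>. Hence the orbit of \<open>\<rho>\<close> is a complete
  invariant of the group.
\<close>


(* These rules turn ring operations on bits into bit operations, which blocks ring reasoning. *)
declare add_bit_eq_xor [simp del] mult_bit_eq_and [simp del] power_bit_unfold [simp del]

section \<open>Elementary abelian 2-groups\<close>

class boolean_group = ab_group_add +
  assumes add_self [simp]: "x + x = 0"
begin

lemma uminus_eq_self [simp]: "- x = x"
  using add_self[of x] by (simp add: minus_unique)

lemma minus_eq_add [simp]: "x - y = x + y"
  using diff_conv_add_uminus[of x y] by simp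

lemma add_eq_0_iff_eq: "x + y = 0 \<longleftrightarrow> x = y"
  by (metis add_self add_left_cancel)

lemma add_self_left [simp]: "x + (x + y) = y"
  by (simp flip: add.assoc)

lemma add_eq_iff: "x + y = z \<longleftrightarrow> x = z + y"
  by (metis add_self add.assoc add_0_right)

end

instance bit :: boolean_group
  by standard simp

instance poly :: (boolean_group) boolean_group
  by standard (simp add: poly_eq_iff)

instance "fun" :: (type, boolean_group) boolean_group
  by standard (simp add: fun_eq_iff)

definition subgrp :: "'v::boolean_group set => bool" where
  "subgrp V \<longleftrightarrow> 0 \<in> V \<and> (\<forall>x\<in>V. \<forall>y\<in>V. x + y \<in> V)"

lemma subgrpD: "subgrp V ==> 0 \<in> V" "subgrp V ==> x \<in> V ==> y \<in> V ==> x + y \<in> V"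
  by (auto simp: subgrp_def)

lemma subgrp_sum: "subgrp V ==> (!!i. i \<in> I ==> f i \<in> V) ==> sum f I \<in> V"
  by (induction I rule: infinite_finite_induct) (auto simp: subgrp_def)

definition additive_on :: "'v::boolean_group set => ('v => bit) => bool" where
  "additive_on V f \<longleftrightarrow> (\<forall>x\<in>V. \<forall>y\<in>V. f (x + y) = f x + f y)"

lemma additive_onD: "additive_on V f ==> x \<in> V ==> y \<in> V ==> f (x + y) = f x + f y"
  by (simp add: additive_on_def)

lemma additive_on_0: "additive_on V f ==> subgrp V ==> f 0 = 0"
  using additive_onD[of V f 0 0] by (auto simp: subgrp_def)

lemma additive_on_subset: "additive_on V f ==> W \<subseteq> V ==> additive_on W f"
  by (auto simp: additive_on_def)

lemma additive_on_sum:
  assumes "additive_on V f" "subgrp V" "!!i. i \<in> I ==> g i \<in> V"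
  shows "f (sum g I) = (\<Sum>i\<in>I. f (g i))"
  using assms(3)
proof (induction I rule: infinite_finite_induct)
  case (insert i I)
  then show ?case
    using assms(1,2) by (simp add: additive_onD subgrp_sum)
qed (use assms in \<open>auto simp: additive_on_0\<close>)

lemma additive_on_add: "additive_on V f ==> additive_on V g ==> additive_on V (\<lambda>x. f x + g x)"
  by (simp add: additive_on_def algebra_simps)

lemma additive_on_sum_fun:
  "(!!i. i \<in> I ==> additive_on V (f i)) ==> additive_on V (\<lambda>x. \<Sum>i\<in>I. f i x)"
  by (simp add: additive_on_def sum.distrib)

text \<open>Induction on \<open>F\<close>: if \<open>\<phi>\<close> does not vanish on the common kernel of
  the other functionals, then on that kernel it agrees with the removed one, so subtracting the
  latter reduces to the smaller set.\<close>

lemma functional_in_span: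
  assumes "finite F" "subgrp A" "!!f. f \<in> F ==> additive_on A f" "additive_on A \<phi>"
    and "!!x. x \<in> A ==> (!!f. f \<in> F ==> f x = 0) ==> \<phi> x = 0"
  shows "\<exists>S\<subseteq>F. \<forall>x\<in>A. \<phi> x = (\<Sum>f\<in>S. f x)"
  using assms
proof (induction F arbitrary: A rule: finite_induct)
  case empty
  then show ?case by auto
next
  case (insert f F)
  note add = insert.prems(2) and phi = insert.prems(3)
  let ?A = "{x \<in> A. f x = 0}"
  have f: "additive_on A f" using add by simp
  have "subgrp ?A"
    using insert.prems(1) f by (auto simp: subgrp_def additive_onD additive_on_0)
  then obtain S where S: "S \<subseteq> F" "\<forall>x\<in>?A. \<phi> x = (\<Sum>f\<in>S. f x)"
    using insert.IH[of ?A] add phi insert.prems(4)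
    by (smt (verit, ccfv_threshold) additive_on_subset insert_iff mem_Collect_eq subsetI)
  define \<psi> where "\<psi> x = \<phi> x + (\<Sum>f\<in>S. f x)" for x
  have psi: "additive_on A \<psi>"
    unfolding \<psi>_def using S add
    by (intro additive_on_add phi additive_on_sum_fun) auto
  have psi0: "\<psi> x = 0" if "x \<in> A" "f x = 0" for x
    using S that by (simp add: \<psi>_def)
  have fin: "finite S" using S insert.hyps finite_subset by auto
  show ?case
  proof (cases "\<exists>a\<in>A. \<psi> a ~= 0")
    case False
    then have "\<forall>x\<in>A. \<phi> x = (\<Sum>f\<in>S. f x)"
      by (auto simp: \<psi>_def add_eq_0_iff_eq)
    with S show ?thesis by blast
  next
    case True
    then obtain a where a: "a \<in> A" "\<psi> a = 1" by auto
    then have fa: "f a = 1" using psi0[of a] by fastforce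
    have "\<psi> x = f x" if x: "x \<in> A" for x
    proof (cases "f x = 0")
      case False
      then have "\<psi> (x + a) = 0"
        using x a fa f insert.prems(1) by (intro psi0) (auto simp: subgrpD additive_onD)
      then show ?thesis using psi x a False by (auto simp: additive_onD add_eq_0_iff_eq)
    qed (use psi0 x in auto)
    then have "\<phi> x = f x + (\<Sum>g\<in>S. g x)" if "x \<in> A" for x
      using that by (simp add: \<psi>_def add_eq_iff)
    then have "\<phi> x = (\<Sum>g\<in>insert f S. g x)" if "x \<in> A" for x
      using that fin S(1) insert.hyps(2) by (subst sum.insert) auto
    with S show ?thesis by (intro exI[of _ "insert f S"]) auto
  qed
qed

text \<open>The Fredholm alternative over \<open>F\<^sub>2\<close>: the functionals \<open>B _ y\<close> are
  closed under sums, so a member of their span is itself one of them. Every existence statement for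
  solutions of linear systems below goes back to this.\<close>

lemma functional_representation:
  fixes B :: "'a::boolean_group => 'b::boolean_group => bit"
  assumes A: "subgrp A" and Y: "subgrp Y" "finite Y"
    and B: "!!y. y \<in> Y ==> additive_on A (\<lambda>x. B x y)" "!!x. x \<in> A ==> additive_on Y (B x)"
    and \<phi>: "additive_on A \<phi>"
    and van: "!!x. x \<in> A ==> (!!y. y \<in> Y ==> B x y = 0) ==> \<phi> x = 0"
  shows "\<exists>y\<in>Y. \<forall>x\<in>A. \<phi> x = B x y"
proof -
  let ?F = "(\<lambda>y x. B x y) ` Y"
  have "\<exists>S\<subseteq>?F. \<forall>x\<in>A. \<phi> x = (\<Sum>f\<in>S. f x)"
  proof (rule functional_in_span[OF _ A _ \<phi>])
    show "\<phi> x = 0" if "x \<in> A" "!!f. f \<in> ?F ==> f x = 0" for x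
      using that(2)[OF imageI] by (intro van[OF that(1)]) auto
  qed (use Y B in auto)
  then obtain S where S: "S \<subseteq> ?F" "\<forall>x\<in>A. \<phi> x = (\<Sum>f\<in>S. f x)" by blast
  have "finite S" using S Y finite_subset by blast
  then have "S \<subseteq> ?F ==> \<exists>y\<in>Y. \<forall>x\<in>A. (\<Sum>f\<in>S. f x) = B x y"
  proof (induction S rule: finite_induct)
    case empty
    have "B x 0 = 0" if "x \<in> A" for x
      using B(2)[OF that] Y(1) additive_on_0 by blast
    then show ?case using Y(1) by (auto simp: subgrp_def)
  next
    case (insert f S)
    then obtain y z where "y \<in> Y" "\<forall>x\<in>A. (\<Sum>f\<in>S. f x) = B x y" "z \<in> Y" "f = (\<lambda>x. B x z)"
      by auto
    then show ?case
      using insert.hyps B(2) Y(1)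
      by (intro bexI[of _ "z + y"]) (auto simp: subgrpD additive_onD[of Y])
  qed
  with S show ?thesis by auto
qed

lemma sum_sign_additive:
  assumes "subgrp Y" "finite Y" "additive_on Y f"
  shows "(\<Sum>y\<in>Y. if f y = 0 then 1 else - 1 :: int) = (if \<forall>y\<in>Y. f y = 0 then int (card Y) else 0)"
proof (cases "\<forall>y\<in>Y. f y = 0")
  case False
  then obtain a where a: "a \<in> Y" "f a = 1" by auto
  let ?s = "\<lambda>y. if f y = 0 then 1 else - 1 :: int"
  have "(\<Sum>y\<in>Y. ?s y) = (\<Sum>y\<in>Y. ?s (a + y))"
    using a assms(1) by (intro sum.reindex_bij_witness[of _ "\<lambda>y. a + y" "\<lambda>y. a + y"]) (auto simp: subgrpD)
  also have "... = (\<Sum>y\<in>Y. - ?s y)"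
    using a assms by (intro sum.cong refl) (auto simp: additive_onD add_eq_0_iff_eq)
  finally show ?thesis using False by (auto simp: sum_negf)
qed (use assms in auto)

text \<open>Both sides count \<open>\<Sum>x\<in>A. \<Sum>y\<in>Y. (-1) ^ B x y\<close>. This replaces "row
  rank equals column rank" in all the counting arguments.\<close>

lemma card_left_right_kernel:
  fixes B :: "'a::boolean_group => 'b::boolean_group => bit"
  assumes A: "subgrp A" "finite A" and Y: "subgrp Y" "finite Y"
    and B: "!!y. y \<in> Y ==> additive_on A (\<lambda>x. B x y)" "!!x. x \<in> A ==> additive_on Y (B x)"
  shows "card {x\<in>A. \<forall>y\<in>Y. B x y = 0} * card Y = card {y\<in>Y. \<forall>x\<in>A. B x y = 0} * card A"
proof -
  let ?s = "\<lambda>x y. if B x y = 0 then 1 else - 1 :: int"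
  have "int (card {x\<in>A. \<forall>y\<in>Y. B x y = 0} * card Y) = (\<Sum>x\<in>A. if \<forall>y\<in>Y. B x y = 0 then int (card Y) else 0)"
    using A by (simp add: sum.If_cases Int_def conj_commute)
  also have "... = (\<Sum>x\<in>A. \<Sum>y\<in>Y. ?s x y)"
    using A Y B(2) by (intro sum.cong refl sum_sign_additive[symmetric]) auto
  also have "... = (\<Sum>y\<in>Y. \<Sum>x\<in>A. ?s x y)" by (rule sum.swap)
  also have "... = (\<Sum>y\<in>Y. if \<forall>x\<in>A. B x y = 0 then int (card A) else 0)"
    using A Y B(1) by (intro sum.cong refl sum_sign_additive) auto
  also have "... = int (card {y\<in>Y. \<forall>x\<in>A. B x y = 0} * card A)"
    using Y by (simp add: sum.If_cases Int_def conj_commute)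
  finally show ?thesis by linarith
qed

lemma separating_functional:
  assumes V: "subgrp V" "finite V" and v: "v \<in> V" "v ~= 0"
  shows "\<exists>\<phi>. additive_on V \<phi> \<and> \<phi> v = 1"
proof -
  let ?S = "{W. subgrp W \<and> W \<subseteq> V \<and> v \<notin> W}"
  have fin: "finite ?S" by (rule finite_subset[of _ "Pow V"]) (use V in auto)
  have "{0} \<in> ?S" using V v by (auto simp: subgrp_def)
  then have ne: "?S ~= {}" by blast
  have "\<exists>W\<in>?S. \<forall>U\<in>?S. W \<subseteq> U --> W = U"
    by (rule finite_has_maximal[OF fin ne])
  then obtain W where W0: "W \<in> ?S" "\<forall>U\<in>?S. W \<subseteq> U --> W = U"
    by (elim bexE) (rule that)
  then have W: "W \<in> ?S" "!!U. U \<in> ?S ==> W \<subseteq> U ==> W = U"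
    by simp_all
  have sub: "a + b \<in> W" if "a \<in> W" "b \<in> W" for a b using W(1) that by (simp add: subgrp_def)
  have out: "x + v \<in> W" if x: "x \<in> V" "x \<notin> W" for x
  proof (rule ccontr)
    assume n: "x + v \<notin> W"
    let ?U = "{y. y \<in> W \<or> x + y \<in> W}"
    have "a + b \<in> ?U" if "a \<in> ?U" "b \<in> ?U" for a b
    proof -
      have e: "(x + a) + b = x + (a + b)" "a + (x + b) = x + (a + b)" "(x + a) + (x + b) = a + b"
        by (simp_all add: ac_simps)
      show ?thesis
        using that sub[of a b] sub[of "x + a" b] sub[of a "x + b"] sub[of "x + a" "x + b"]
        unfolding e mem_Collect_eq by blast
    qed
    moreover have "0 \<in> ?U" using W(1) by (simp add: subgrp_def)
    ultimately have "subgrp ?U" unfolding subgrp_def by blast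
    moreover have "?U \<subseteq> V"
    proof
      fix y assume "y \<in> ?U"
      then consider "y \<in> V" | "x + y \<in> V" using W(1) by blast
      then show "y \<in> V" using subgrpD(2)[OF V(1) x(1), of "x + y"] by cases simp_all
    qed
    moreover have "v \<notin> ?U" using W(1) n by simp
    ultimately have "?U \<in> ?S" by simp
    then have eq: "W = ?U" by (rule W(2)) blast
    have "x \<in> ?U" using W(1) by (simp add: subgrp_def)
    then have "x \<in> W" by (rule subsetD[OF equalityD2[OF eq]])
    with x(2) show False by contradiction
  qed
  let ?p = "\<lambda>x. if x \<in> W then 0 else 1 :: bit"
  have "additive_on V ?p"
    unfolding additive_on_def
  proof (intro ballI)
    fix x y assume xy: "x \<in> V" "y \<in> V"
    consider "x \<in> W" "y \<in> W" | "x \<in> W" "y \<notin> W" | "x \<notin> W" "y \<in> W" | "x \<notin> W" "y \<notin> W" by blast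
    then show "?p (x + y) = ?p x + ?p y"
    proof cases
      case 2
      then have "x + y \<notin> W" using sub[of x "x + y"] by auto
      with 2 show ?thesis by simp
    next
      case 3
      then have "x + y \<notin> W" using sub[of y "x + y"] by (auto simp: ac_simps)
      with 3 show ?thesis by simp
    next
      case 4
      then have "(x + v) + (y + v) \<in> W" using 4 xy by (intro sub out)
      moreover have "(x + v) + (y + v) = x + y" by (simp add: ac_simps)
      ultimately have "x + y \<in> W" by simp
      with 4 show ?thesis by simp
    qed (use sub in auto)
  qed
  moreover have "?p v = 1" using W(1) by simp
  ultimately show ?thesis by (intro exI[of _ ?p] conjI)
qed

text \<open>Coordinate vectors of length \<open>n\<close> are polynomials of degree below \<open>n\<close>,
  which makes them elements of one type for all \<open>n\<close> and lets Frobenius matrices act by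
  multiplication modulo a polynomial.\<close>

definition vecs :: "nat => bit poly set" where
  "vecs n = {p. \<forall>i\<ge>n. coeff p i = 0}"

lemma subgrp_vecs: "subgrp (vecs n)"
  by (auto simp: subgrp_def vecs_def)

lemma vecs_0: "vecs 0 = {0}"
  by (auto simp: vecs_def poly_eq_iff)

lemma vecs_Suc: "vecs (Suc n) = (\<lambda>(c, p). pCons c p) ` (UNIV \<times> vecs n)"
proof (intro equalityI subsetI)
  fix p assume "p \<in> vecs (Suc n)"
  then show "p \<in> (\<lambda>(c, p). pCons c p) ` (UNIV \<times> vecs n)"
    by (cases p) (auto simp: vecs_def coeff_pCons split: nat.splits)
qed (auto simp: vecs_def coeff_pCons split: nat.splits)

lemma card_UNIV_bit: "card (UNIV :: bit set) = 2" "finite (UNIV :: bit set)"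
proof -
  have u: "(UNIV :: bit set) = {0, 1}" by auto
  show "card (UNIV :: bit set) = 2" unfolding u by simp
  show "finite (UNIV :: bit set)" unfolding u by simp
qed

lemma finite_card_vecs: "finite (vecs n) \<and> card (vecs n) = 2 ^ n"
proof (induction n)
  case (Suc n)
  have "inj_on (\<lambda>(c::bit, p). pCons c p) (UNIV \<times> vecs n)" by (auto simp: inj_on_def)
  then show ?case using Suc by (simp add: vecs_Suc card_image card_cartesian_product card_UNIV_bit)
qed (simp add: vecs_0)

lemma finite_vecs [simp]: "finite (vecs n)" and card_vecs: "card (vecs n) = 2 ^ n"
  using finite_card_vecs by auto

lemma vecs_degree: "p \<in> vecs n \<longleftrightarrow> p = 0 \<or> degree p < n"
proof
  assume "p \<in> vecs n"
  then show "p = 0 \<or> degree p < n"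
    using leading_coeff_0_iff[of p] linorder_not_less[of "degree p" n] by (auto simp: vecs_def)
qed (auto simp: vecs_def coeff_eq_0)

definition scl :: "bit => 'v::boolean_group => 'v" where
  "scl c x = (if c = 0 then 0 else x)"

lemma scl_simps [simp]: "scl 0 x = 0" "scl 1 x = x" "scl c 0 = 0"
  by (simp_all add: scl_def)

lemma scl_add: "scl (c + d) x = scl c x + scl d x"
  by (cases c; cases d) auto

lemma scl_add_right: "scl c (x + y) = scl c x + scl c y"
  by (cases c) auto

lemma scl_in: "subgrp V ==> x \<in> V ==> scl c x \<in> V"
  by (cases c) (auto simp: subgrp_def)

definition comb :: "'v::boolean_group list => bit poly => 'v" where
  "comb bs p = (\<Sum>i<length bs. scl (coeff p i) (bs ! i))"

lemma comb_add: "comb bs (p + q) = comb bs p + comb bs q"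
  by (simp add: comb_def scl_add sum.distrib)

lemma comb_0 [simp]: "comb bs 0 = 0" "comb [] p = 0"
  by (simp_all add: comb_def)

lemma comb_pCons: "comb (b # bs) (pCons c p) = scl c b + comb bs p"
  by (simp add: comb_def sum.lessThan_Suc_shift del: sum.lessThan_Suc)

lemma comb_cong: "(!!i. i < length bs ==> coeff p i = coeff q i) ==> comb bs p = comb bs q"
  by (simp add: comb_def)

lemma comb_monom: "i < length bs ==> comb bs (monom 1 i) = bs ! i"
  by (simp add: comb_def if_distrib[of "\<lambda>c. scl c _"] cong: if_cong)

lemma comb_append: "comb (bs @ cs) p = comb bs p + comb cs (poly_shift (length bs) p)"
proof -
  have "comb (bs @ cs) p = (\<Sum>i<length bs. scl (coeff p i) ((bs @ cs) ! i))
      + (\<Sum>i\<in>{length bs..<length bs + length cs}. scl (coeff p i) ((bs @ cs) ! i))"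
    unfolding comb_def length_append lessThan_atLeast0 by (rule sum.atLeastLessThan_concat[symmetric]) simp_all
  also have "(\<Sum>i\<in>{length bs..<length bs + length cs}. scl (coeff p i) ((bs @ cs) ! i))
      = comb cs (poly_shift (length bs) p)"
    unfolding comb_def
    by (rule sum.reindex_bij_witness[of _ "\<lambda>i. i + length bs" "\<lambda>i. i - length bs"])
      (auto simp: nth_append coeff_poly_shift)
  also have "(\<Sum>i<length bs. scl (coeff p i) ((bs @ cs) ! i)) = comb bs p"
    by (simp add: comb_def nth_append)
  finally show ?thesis .
qed

lemma comb_in: "subgrp V ==> set bs \<subseteq> V ==> comb bs p \<in> V"
  unfolding comb_def by (intro subgrp_sum scl_in) auto

lemma subgrp_range_comb: "subgrp (range (comb bs))"
  unfolding subgrp_def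
proof (intro conjI ballI)
  show "0 \<in> range (comb bs)" using rangeI[of "comb bs" 0] by simp
  fix x y assume "x \<in> range (comb bs)" "y \<in> range (comb bs)"
  then obtain p q where "x = comb bs p" "y = comb bs q" by auto
  then show "x + y \<in> range (comb bs)" using rangeI[of "comb bs" "p + q"] by (simp add: comb_add)
qed

lemma range_comb: "range (comb bs) = comb bs ` vecs (length bs)"
proof -
  have "comb bs p \<in> comb bs ` vecs (length bs)" for p
    by (rule image_eqI[of _ _ "poly_cutoff (length bs) p"])
      (simp_all add: vecs_def coeff_poly_cutoff cong: comb_cong)
  then show ?thesis by auto
qed

lemma finite_range_comb: "finite (range (comb bs))"
  by (simp add: range_comb)

lemma card_range_comb: "card (range (comb bs)) \<le> 2 ^ length bs"
  unfolding range_comb by (metis card_image_le card_vecs finite_vecs)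

lemma nth_in_range_comb: "b \<in> set bs ==> b \<in> range (comb bs)"
  by (metis comb_monom in_set_conv_nth rangeI)

definition basis :: "'v::boolean_group list => 'v set => bool" where
  "basis bs V \<longleftrightarrow> bij_betw (comb bs) (vecs (length bs)) V"

lemma basis_card: "basis bs V ==> card V = 2 ^ length bs"
  unfolding basis_def by (metis bij_betw_same_card card_vecs)

lemma basis_range: "basis bs V ==> V = range (comb bs)"
  by (auto simp: basis_def bij_betw_def range_comb)

lemma basisI:
  assumes "range (comb bs) = V" "!!p. p \<in> vecs (length bs) ==> comb bs p = 0 ==> p = 0"
  shows "basis bs V"
  unfolding basis_def bij_betw_def
proof
  show "inj_on (comb bs) (vecs (length bs))"
  proof (rule inj_onI)
    fix p q assume "p \<in> vecs (length bs)" "q \<in> vecs (length bs)" "comb bs p = comb bs q"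
    then have "p + q = 0"
      by (intro assms(2) subgrpD(2)[OF subgrp_vecs]) (simp_all add: comb_add)
    then show "p = q" by (simp add: add_eq_0_iff_eq)
  qed
  show "comb bs ` vecs (length bs) = V" using assms(1) range_comb[of bs] by simp
qed

lemma basis_indep: "basis bs V ==> p \<in> vecs (length bs) ==> comb bs p = 0 ==> p = 0"
  using inj_onD[of "comb bs" "vecs (length bs)" p 0] subgrpD(1)[OF subgrp_vecs[of "length bs"]]
  by (simp add: basis_def bij_betw_def)

lemma functional_comb:
  assumes "additive_on V f" "subgrp V" "set bs \<subseteq> V"
  shows "f (comb bs p) = (\<Sum>i<length bs. coeff p i * f (bs ! i))"
proof -
  have "f (scl c x) = c * f x" if "x \<in> V" for c x
    using assms that by (cases c) (auto simp: additive_on_0)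
  then show ?thesis
    unfolding comb_def using assms(3)
    by (subst additive_on_sum[OF assms(1,2)]) (auto intro!: scl_in[OF assms(2)] sum.cong simp: subset_iff)
qed

lemma dual_functional_comb:
  assumes "!!i. i < length bs ==> additive_on V (\<phi> i)" "subgrp V" "set bs \<subseteq> V"
    and "!!i j. i < length bs ==> j < length bs ==> \<phi> i (bs ! j) = (if i = j then 1 else 0)"
    and "i < length bs"
  shows "\<phi> i (comb bs p) = coeff p i"
proof -
  have "\<phi> i (comb bs p) = (\<Sum>j<length bs. if j = i then coeff p j else 0)"
    unfolding functional_comb[OF assms(1)[OF assms(5)] assms(2,3)]
    by (rule sum.cong) (use assms(4)[OF assms(5)] in auto)
  then show ?thesis using assms(5) by simp
qed

lemma basis_if_dual:
  assumes "!!i. i < length bs ==> additive_on V (\<phi> i)" "subgrp V" "set bs \<subseteq> V"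
    and "!!i j. i < length bs ==> j < length bs ==> \<phi> i (bs ! j) = (if i = j then 1 else 0)"
  shows "basis bs (range (comb bs))"
proof (rule basisI)
  fix p assume p: "p \<in> vecs (length bs)" "comb bs p = 0"
  have "coeff p i = 0" if i: "i < length bs" for i
  proof -
    have "coeff p i = \<phi> i (comb bs p)"
      by (rule dual_functional_comb[of bs V \<phi>, symmetric]) (fact assms i)+
    then show ?thesis using p assms(1)[OF i] assms(2) by (simp add: additive_on_0)
  qed
  then show "p = 0" using p by (auto simp: poly_eq_iff vecs_def) (metis linorder_not_less)
qed auto

text \<open>If the functionals \<open>\<phi>\<close> are dual to \<open>bs\<close>, then \<open>x - \<Sum>
  \<phi>\<^sub>i(x) b\<^sub>i\<close> projects onto their common kernel.\<close>

lemma basis_append_dual: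
  assumes ad: "!!i. i < length bs ==> additive_on V (\<phi> i)" and V: "subgrp V" "set bs \<subseteq> V"
    and dual: "!!i j. i < length bs ==> j < length bs ==> \<phi> i (bs ! j) = (if i = j then 1 else 0)"
    and cs: "basis cs {x \<in> V. \<forall>i<length bs. \<phi> i x = 0}"
  shows "basis (bs @ cs) V"
proof (rule basisI)
  let ?V = "{x \<in> V. \<forall>i<length bs. \<phi> i x = 0}"
  have V2: "?V = range (comb cs)" using cs by (rule basis_range)
  have coord: "\<phi> i (comb bs p) = coeff p i" if "i < length bs" for i p
    by (rule dual_functional_comb[of bs V \<phi>]) (fact ad V dual that)+
  have csV: "set cs \<subseteq> V"
  proof
    fix c assume "c \<in> set cs"
    then have "c \<in> ?V" unfolding V2 by (rule nth_in_range_comb)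
    then show "c \<in> V" by simp
  qed
  show "range (comb (bs @ cs)) = V"
  proof
    show "range (comb (bs @ cs)) \<subseteq> V" using comb_in[OF V(1), of "bs @ cs"] V(2) csV by (simp add: image_subset_iff)
    show "V \<subseteq> range (comb (bs @ cs))"
    proof
      fix x assume x: "x \<in> V"
      define p where "p = Poly (map (\<lambda>i. \<phi> i x) [0..<length bs])"
      have cp: "coeff p i = \<phi> i x" if "i < length bs" for i
        using that by (simp add: p_def nth_default_def)
      have "x + comb bs p \<in> ?V"
      proof -
      have "\<phi> i (x + comb bs p) = 0" if i: "i < length bs" for i
        using additive_onD[OF ad[OF i] x comb_in[OF V]] coord[OF i] cp[OF i] by simp
      then show ?thesis using subgrpD(2)[OF V(1) x comb_in[OF V]] by simp
    qed
      then obtain q where q: "q \<in> vecs (length cs)" "x + comb bs p = comb cs q"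
        unfolding V2 range_comb by (rule imageE) (rule that)
      define r where "r = poly_cutoff (length bs) p + monom 1 (length bs) * q"
      have "comb (bs @ cs) r = comb bs p + comb cs q"
        unfolding comb_append
        by (intro arg_cong2[of _ _ _ _ "(+)"] comb_cong)
          (auto simp: r_def coeff_poly_shift coeff_poly_cutoff coeff_monom_mult)
      also have "... = x" unfolding q(2)[symmetric] by (metis add.commute add_self_left)
      finally show "x \<in> range (comb (bs @ cs))" by (metis rangeI)
    qed
  qed
  fix p assume p: "p \<in> vecs (length (bs @ cs))" "comb (bs @ cs) p = 0"
  have inV: "comb cs q \<in> ?V" for q using V2 by auto
  have c0: "coeff p i = 0" if i: "i < length bs" for i
  proof -
    have "\<phi> i (comb (bs @ cs) p) = \<phi> i (comb bs p) + \<phi> i (comb cs (poly_shift (length bs) p))"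
      unfolding comb_append using inV[of "poly_shift (length bs) p"]
      by (intro additive_onD[OF ad[OF i]] comb_in[OF V]) auto
    moreover have "\<phi> i (comb cs (poly_shift (length bs) p)) = 0"
      using inV[of "poly_shift (length bs) p"] i by blast
    ultimately show ?thesis
      using coord[OF i] p(2) additive_on_0[OF ad[OF i] V(1)] by simp
  qed
  then have "comb bs p = 0" using comb_cong[of bs p 0] by simp
  then have "comb cs (poly_shift (length bs) p) = 0" using p by (simp add: comb_append)
  moreover have "poly_shift (length bs) p \<in> vecs (length cs)"
    using p by (auto simp: vecs_def coeff_poly_shift)
  ultimately have "poly_shift (length bs) p = 0" using basis_indep[OF cs] by blast
  then have "coeff p (i + length bs) = 0" for i by (metis coeff_0 coeff_poly_shift)
  then have "coeff p i = 0" if "i \<ge> length bs" for i by (metis le_add_diff_inverse2 that)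
  then show "p = 0" using c0 by (auto simp: poly_eq_iff) (metis linorder_not_less)
qed


section \<open>Alternating forms and Gram matrices\<close>

definition alt_form :: "('v::boolean_group => 'v => bit) => bool" where
  "alt_form \<alpha> \<longleftrightarrow> (\<forall>x y z. \<alpha> (x + y) z = \<alpha> x z + \<alpha> y z) \<and>
     (\<forall>x y z. \<alpha> x (y + z) = \<alpha> x y + \<alpha> x z) \<and> (\<forall>x. \<alpha> x x = 0)"

lemma alt_add: "alt_form \<alpha> ==> \<alpha> (x + y) z = \<alpha> x z + \<alpha> y z"
  and alt_add_right: "alt_form \<alpha> ==> \<alpha> x (y + z) = \<alpha> x y + \<alpha> x z"
  and alt_self: "alt_form \<alpha> ==> \<alpha> x x = 0"
  by (auto simp: alt_form_def)

lemma alt_sym: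
  assumes "alt_form \<alpha>"
  shows "\<alpha> x y = \<alpha> y x"
proof -
  have "\<alpha> (x + y) (x + y) = \<alpha> x y + \<alpha> y x"
    by (simp only: alt_add[OF assms] alt_add_right[OF assms]) (simp add: alt_self[OF assms])
  then show ?thesis using alt_self[OF assms, of "x + y"] by (simp add: add_eq_0_iff_eq)
qed

lemma subgrp_UNIV [simp]: "subgrp UNIV"
  by (simp add: subgrp_def)

lemma alt_additive: "alt_form \<alpha> ==> additive_on V (\<alpha> x)"
  and alt_additive_left: "alt_form \<alpha> ==> additive_on V (\<lambda>x. \<alpha> x y)"
  by (auto simp: additive_on_def alt_add alt_add_right)

lemma alt_0: "alt_form \<alpha> ==> \<alpha> 0 y = 0" and alt_0_right: "alt_form \<alpha> ==> \<alpha> y 0 = 0"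
  using additive_on_0[OF alt_additive_left subgrp_UNIV] additive_on_0[OF alt_additive subgrp_UNIV] by blast+

lemma alt_scl: "alt_form \<alpha> ==> \<alpha> (scl c x) y = c * \<alpha> x y"
  by (cases c) (auto simp: alt_0)

lemma alt_sum: "alt_form \<alpha> ==> \<alpha> (sum f I) y = (\<Sum>i\<in>I. \<alpha> (f i) y)"
  using additive_on_sum[OF alt_additive_left[of \<alpha> UNIV y], of I f] by simp

lemma alt_comb: "alt_form \<alpha> ==> \<alpha> (comb bs p) y = (\<Sum>i<length bs. coeff p i * \<alpha> (bs ! i) y)"
  using functional_comb[OF alt_additive_left[of \<alpha> UNIV y], of bs p] by simp

lemma alt_comb_0: "alt_form \<alpha> ==> (!!b. b \<in> set bs ==> \<alpha> b y = 0) ==> \<alpha> (comb bs p) y = 0"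
  by (simp add: alt_comb)

lemma alt_comb_comb_0:
  assumes "alt_form \<alpha>" "!!b c. b \<in> set bs ==> c \<in> set cs ==> \<alpha> b c = 0"
  shows "\<alpha> (comb bs p) (comb cs q) = 0"
proof (rule alt_comb_0[OF assms(1)])
  fix b assume "b \<in> set bs"
  then have "\<alpha> (comb cs q) b = 0"
    by (intro alt_comb_0[OF assms(1)]) (simp add: alt_sym[OF assms(1), of _ b] assms(2))
  then show "\<alpha> b (comb cs q) = 0" by (simp add: alt_sym[OF assms(1), of b])
qed

definition gram :: "('v => 'v => bit) => 'v list => bit mat" where
  "gram \<alpha> bs = mat (length bs) (length bs) (\<lambda>(i, j). \<alpha> (bs ! i) (bs ! j))"

lemma gram_append:
  assumes "alt_form \<alpha>" "!!b c. b \<in> set bs ==> c \<in> set cs ==> \<alpha> b c = 0"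
  shows "gram \<alpha> (bs @ cs) = four_block_mat (gram \<alpha> bs) (0\<^sub>m (length bs) (length cs))
           (0\<^sub>m (length cs) (length bs)) (gram \<alpha> cs)"
proof (rule eq_matI)
  have z: "\<alpha> (cs ! j) (bs ! i) = 0" "\<alpha> (bs ! i) (cs ! j) = 0" if "i < length bs" "j < length cs" for i j
    using assms(2)[of "bs ! i" "cs ! j"] that by (simp_all add: alt_sym[OF assms(1), of "cs ! j"])
  fix i j assume "i < dim_row (four_block_mat (gram \<alpha> bs) (0\<^sub>m (length bs) (length cs))
      (0\<^sub>m (length cs) (length bs)) (gram \<alpha> cs))"
    "j < dim_col (four_block_mat (gram \<alpha> bs) (0\<^sub>m (length bs) (length cs))
      (0\<^sub>m (length cs) (length bs)) (gram \<alpha> cs))"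
  then have ij: "i < length bs + length cs" "j < length bs + length cs" by (simp_all add: gram_def)
  then show "gram \<alpha> (bs @ cs) $$ (i, j) = four_block_mat (gram \<alpha> bs) (0\<^sub>m (length bs) (length cs))
      (0\<^sub>m (length cs) (length bs)) (gram \<alpha> cs) $$ (i, j)"
    using z[of i "j - length bs"] z[of j "i - length bs"]
    by (simp add: gram_def nth_append)
qed (simp_all add: gram_def)

lemma gram_off_diag:
  assumes \<alpha>: "alt_form \<alpha>" and B: "B \<in> carrier_mat (length us) (length ws)"
    and iso: "!!x y. x \<in> set us ==> y \<in> set us ==> \<alpha> x y = 0"
      "!!x y. x \<in> set ws ==> y \<in> set ws ==> \<alpha> x y = 0"
    and ent: "!!i j. i < length us ==> j < length ws ==> \<alpha> (us ! i) (ws ! j) = B $$ (i, j)"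
  shows "gram \<alpha> (us @ ws) = off_diag B"
proof (rule eq_matI)
  have d: "dim_row B = length us" "dim_col B = length ws" using B by auto
  fix i j assume "i < dim_row (off_diag B)" "j < dim_col (off_diag B)"
  then have ij: "i < length us + length ws" "j < length us + length ws"
    by (simp_all add: off_diag_def d)
  then show "gram \<alpha> (us @ ws) $$ (i, j) = off_diag B $$ (i, j)"
    using ent[of i "j - length us"] ent[of j "i - length us"] iso(1)[of "us ! i" "us ! j"]
      iso(2)[of "ws ! (i - length us)" "ws ! (j - length us)"]
      alt_sym[OF \<alpha>, of "ws ! (i - length us)" "us ! j"]
    by (simp add: gram_def off_diag_def nth_append d)
qed (use B in \<open>auto simp: gram_def off_diag_def\<close>)

text \<open>A pair of forms on \<open>V\<close> is in canonical form for the list \<open>ps\<close> of blocks.\<close>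

definition canonical_basis ::
  "('v::boolean_group => 'v => bit) => ('v => 'v => bit) => 'v set => 'v list => index list => bool" where
  "canonical_basis \<alpha> \<beta> V bs ps \<longleftrightarrow> basis bs V \<and> set ps \<subseteq> indices \<and>
     gram \<alpha> bs = diag_block_mat (map (fst \<circ> canonical_pair) ps) \<and>
     gram \<beta> bs = diag_block_mat (map (snd \<circ> canonical_pair) ps)"

lemma dim_gram [simp]: "dim_row (gram \<alpha> bs) = length bs" "dim_col (gram \<alpha> bs) = length bs"
  by (simp_all add: gram_def)

lemma diag_block_mat_gram_append:
  assumes "alt_form \<alpha>" "!!b c. b \<in> set bs ==> c \<in> set cs ==> \<alpha> b c = 0"
    and "gram \<alpha> bs = A" "gram \<alpha> cs = diag_block_mat As"
  shows "gram \<alpha> (bs @ cs) = diag_block_mat (A # As)"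
proof -
  have "dim_row A = length bs" "dim_col A = length bs" using assms(3) dim_gram by blast+
  moreover have "dim_row (diag_block_mat As) = length cs" "dim_col (diag_block_mat As) = length cs"
    using assms(4) dim_gram by metis+
  ultimately show ?thesis
    using gram_append[of \<alpha> bs cs, OF assms(1,2)] assms(3,4) by (simp add: Let_def)
qed

lemma subgrp_common_kernel:
  assumes "subgrp V" "!!i. i < n ==> additive_on V (\<phi> i)"
  shows "subgrp {x \<in> V. \<forall>i<n. \<phi> i x = 0}"
proof -
  have "\<phi> i (x + y) = 0" if "i < n" "x \<in> V" "y \<in> V" "\<phi> i x = 0" "\<phi> i y = 0" for i x y
    using additive_onD[OF assms(2)[OF that(1)] that(2,3)] that(4,5) by simp
  moreover have "\<phi> i 0 = 0" if "i < n" for i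
    using additive_on_0[OF assms(2)[OF that] assms(1)] .
  ultimately show ?thesis using assms(1) by (auto simp: subgrp_def)
qed

text \<open>A block given by two totally isotropic families splits off as soon as functionals dual to it cut
  out a complement that is orthogonal to it for both forms; the complement is a proper subgroup, so
  the induction hypothesis puts it into canonical form.\<close>

lemma split_block:
  fixes \<alpha> \<beta> :: "'v::boolean_group => 'v => bit"
  assumes V: "subgrp V" and \<alpha>: "alt_form \<alpha>" and \<beta>: "alt_form \<beta>"
    and IH: "!!W. subgrp W ==> W \<subset> V ==> \<exists>bs ps. canonical_basis \<alpha> \<beta> W bs ps"
    and p: "p \<in> indices" "canonical_pair p = (off_diag B1, off_diag B2)"
    and B: "B1 \<in> carrier_mat (length us) (length ws)" "B2 \<in> carrier_mat (length us) (length ws)"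
    and sub: "set us \<subseteq> V" "set ws \<subseteq> V" "us ~= []"
    and iso1: "!!x y. x \<in> set us ==> y \<in> set us ==> \<alpha> x y = 0 \<and> \<beta> x y = 0"
    and iso2: "!!x y. x \<in> set ws ==> y \<in> set ws ==> \<alpha> x y = 0 \<and> \<beta> x y = 0"
    and ent: "!!i j. i < length us ==> j < length ws ==>
        \<alpha> (us ! i) (ws ! j) = B1 $$ (i, j) \<and> \<beta> (us ! i) (ws ! j) = B2 $$ (i, j)"
    and ad: "!!i. i < length (us @ ws) ==> additive_on V (\<phi> i)"
    and dual: "!!i j. i < length (us @ ws) ==> j < length (us @ ws) ==>
        \<phi> i ((us @ ws) ! j) = (if i = j then 1 else 0)"
    and orth: "!!x b. x \<in> V ==> (!!i. i < length (us @ ws) ==> \<phi> i x = 0) ==>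
        b \<in> set us \<union> set ws ==> \<alpha> b x = 0 \<and> \<beta> b x = 0"
  shows "\<exists>bs ps. canonical_basis \<alpha> \<beta> V bs ps"
proof -
  let ?W = "{x \<in> V. \<forall>i<length (us @ ws). \<phi> i x = 0}"
  have W: "subgrp ?W" by (rule subgrp_common_kernel[OF V ad])
  have "us ! 0 \<notin> ?W"
  proof
    assume "us ! 0 \<in> ?W"
    then have "\<phi> 0 ((us @ ws) ! 0) = 0" using sub(3) by (auto simp: nth_append)
    then show False using dual[of 0 0] sub(3) by simp
  qed
  moreover have "us ! 0 \<in> V" using sub nth_mem[of 0 us] by auto
  ultimately have "?W \<subset> V" by blast
  then obtain cs ps where cs: "canonical_basis \<alpha> \<beta> ?W cs ps" using IH[OF W] by blast
  have bas: "basis (us @ ws @ cs) V"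
    using basis_append_dual[of "us @ ws" V \<phi> cs] ad V sub dual cs by (simp add: canonical_basis_def)
  have csW: "c \<in> ?W" if "c \<in> set cs" for c
    using cs basis_range[of cs ?W] nth_in_range_comb[OF that] by (simp add: canonical_basis_def)
  have o: "\<alpha> b c = 0 \<and> \<beta> b c = 0" if "b \<in> set (us @ ws)" "c \<in> set cs" for b c
    using csW[OF that(2)] that(1) by (intro orth) auto
  have "gram \<alpha> (us @ ws) = off_diag B1" "gram \<beta> (us @ ws) = off_diag B2"
    using gram_off_diag[OF \<alpha> B(1)] gram_off_diag[OF \<beta> B(2)] iso1 iso2 ent by auto
  then have "gram \<alpha> ((us @ ws) @ cs) = diag_block_mat (map (fst \<circ> canonical_pair) (p # ps))"
    "gram \<beta> ((us @ ws) @ cs) = diag_block_mat (map (snd \<circ> canonical_pair) (p # ps))"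
    using o cs p(2) unfolding list.map
    by (intro diag_block_mat_gram_append \<alpha> \<beta>; simp add: canonical_basis_def)+
  then have "canonical_basis \<alpha> \<beta> V (us @ ws @ cs) (p # ps)"
    using bas cs p(1) by (simp add: canonical_basis_def)
  then show ?thesis by blast
qed

text \<open>When one of the forms pairs \<open>us\<close> and \<open>ws\<close> perfectly, the dual
  functionals are given by that form itself.\<close>

lemma split_block_perfect:
  fixes \<alpha> \<beta> :: "'v::boolean_group => 'v => bit"
  assumes V: "subgrp V" and \<alpha>: "alt_form \<alpha>" and \<beta>: "alt_form \<beta>" and \<gamma>: "\<gamma> = \<alpha> \<or> \<gamma> = \<beta>"
    and IH: "!!W. subgrp W ==> W \<subset> V ==> \<exists>bs ps. canonical_basis \<alpha> \<beta> W bs ps"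
    and p: "p \<in> indices" "canonical_pair p = (off_diag B1, off_diag B2)"
    and B: "B1 \<in> carrier_mat n n" "B2 \<in> carrier_mat n n"
    and sub: "set us \<subseteq> V" "set ws \<subseteq> V" "n > 0" and len: "length us = n" "length ws = n"
    and iso1: "!!x y. x \<in> set us ==> y \<in> set us ==> \<alpha> x y = 0 \<and> \<beta> x y = 0"
    and iso2: "!!x y. x \<in> set ws ==> y \<in> set ws ==> \<alpha> x y = 0 \<and> \<beta> x y = 0"
    and ent: "!!i j. i < n ==> j < n ==>
        \<alpha> (us ! i) (ws ! j) = B1 $$ (i, j) \<and> \<beta> (us ! i) (ws ! j) = B2 $$ (i, j)"
    and dual: "!!i j. i < n ==> j < n ==> \<gamma> (us ! i) (ws ! j) = (if i = j then 1 else 0)"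
    and orth: "!!x b. x \<in> V ==> (!!y. y \<in> set us \<union> set ws ==> \<gamma> y x = 0) ==>
        b \<in> set us \<union> set ws ==> \<alpha> b x = 0 \<and> \<beta> b x = 0"
  shows "\<exists>bs ps. canonical_basis \<alpha> \<beta> V bs ps"
proof -
  have g: "alt_form \<gamma>" using \<alpha> \<beta> \<gamma> by blast
  have i1: "\<gamma> x y = 0" if "x \<in> set us" "y \<in> set us" for x y using \<gamma> iso1[OF that] by auto
  have i2: "\<gamma> x y = 0" if "x \<in> set ws" "y \<in> set ws" for x y using \<gamma> iso2[OF that] by auto
  define \<phi> where "\<phi> i = (if i < n then \<gamma> (ws ! i) else \<gamma> (us ! (i - n)))" for i
  show ?thesis
  proof (rule split_block[of V \<alpha> \<beta> p B1 B2 us ws \<phi>, OF V \<alpha> \<beta> IH p])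
    show "B1 \<in> carrier_mat (length us) (length ws)" "B2 \<in> carrier_mat (length us) (length ws)"
      using B len by auto
    show "us ~= []" using sub len by auto
    show "additive_on V (\<phi> i)" for i using g by (simp add: \<phi>_def alt_additive)
    show "\<phi> i ((us @ ws) ! j) = (if i = j then 1 else 0)"
      if "i < length (us @ ws)" "j < length (us @ ws)" for i j
    proof -
      consider "i < n" "j < n" | "i < n" "j \<ge> n" | "i \<ge> n" "j < n" | "i \<ge> n" "j \<ge> n" by linarith
      then show ?thesis
      proof cases
        case 1
        then show ?thesis
          using dual[of j i] len alt_sym[OF g, of "ws ! i"] by (auto simp: \<phi>_def nth_append)
      next
        case 2
        then show ?thesis
          using that len i2[of "ws ! i" "ws ! (j - n)"] by (auto simp: \<phi>_def nth_append)
      next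
        case 3
        then show ?thesis
          using that len i1[of "us ! (i - n)" "us ! j"] by (auto simp: \<phi>_def nth_append)
      next
        case 4
        then show ?thesis
          using that len dual[of "i - n" "j - n"] by (auto simp: \<phi>_def nth_append)
      qed
    qed
    show "\<alpha> b x = 0 \<and> \<beta> b x = 0" if x: "x \<in> V" "!!i. i < length (us @ ws) ==> \<phi> i x = 0"
        "b \<in> set us \<union> set ws" for x b
    proof (rule orth[OF x(1) _ x(3)])
      fix y assume "y \<in> set us \<union> set ws"
      then consider j where "j < n" "y = us ! j" | j where "j < n" "y = ws ! j"
        using len by (auto simp: in_set_conv_nth)
      then show "\<gamma> y x = 0"
      proof cases
        case 1
        then show ?thesis using x(2)[of "j + n"] len by (simp add: \<phi>_def)
      next
        case 2
        then show ?thesis using x(2)[of j] len by (simp add: \<phi>_def)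
      qed
    qed
  qed (use sub iso1 iso2 ent len in simp_all)
qed


section \<open>Chains for a pair of forms\<close>

text \<open>Along a chain the values \<open>\<alpha>(s\<^sub>i, s\<^sub>j)\<close> depend only on \<open>i +
  j\<close>; moving both indices to the middle gives either \<open>\<alpha>(s\<^sub>k,
  s\<^sub>k)\<close> or \<open>\<beta>(s\<^sub>k, s\<^sub>k)\<close>, which vanish. This is where
  alternation, rather than symmetry, matters, and it makes both halves of every block isotropic for
  free.\<close>

lemma chain_isotropic:
  assumes \<alpha>: "alt_form \<alpha>" and \<beta>: "alt_form \<beta>"
    and s: "!!i. i < L ==> s i \<in> V"
    and ch: "!!i y. Suc i < L ==> y \<in> V ==> \<alpha> (s (Suc i)) y = \<beta> (s i) y"
    and ij: "i < L" "j < L"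
  shows "\<alpha> (s i) (s j) = 0 \<and> \<beta> (s i) (s j) = 0"
proof -
  have A: "\<alpha> (s i) (s (i + k)) = 0" if "i + k < L" for i k
    using that
  proof (induction k arbitrary: i rule: less_induct)
    case (less k)
    show ?case
    proof (cases k)
      case 0
      then show ?thesis by (simp add: alt_self[OF \<alpha>])
    next
      case (Suc k')
      have "\<alpha> (s i) (s (i + k)) = \<beta> (s (i + k')) (s i)"
        using less.prems Suc ch[of "i + k'" "s i"] s by (simp add: alt_sym[OF \<alpha>, of "s i"])
      also have "... = 0"
      proof (cases k')
        case 0
        then show ?thesis by (simp add: alt_self[OF \<beta>])
      next
        case (Suc k'')
        have "\<beta> (s (i + k')) (s i) = \<alpha> (s (Suc i)) (s (i + k'))"
          using less.prems \<open>k = Suc k'\<close> Suc ch[of i "s (i + k')"] s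
          by (simp add: alt_sym[OF \<beta>, of _ "s i"])
        also have "... = 0"
          using less.IH[of k'' "Suc i"] less.prems \<open>k = Suc k'\<close> Suc by simp
        finally show ?thesis .
      qed
      finally show ?thesis .
    qed
  qed
  have A': "\<alpha> (s i) (s j) = 0" if "i < L" "j < L" for i j
    using A[of i "j - i"] A[of j "i - j"] that alt_sym[OF \<alpha>, of "s i" "s j"] by (cases "i \<le> j") auto
  have B: "\<beta> (s i) (s j) = 0" if "i < j" "j < L" for i j
    using ch[of i "s j"] A'[of "Suc i" j] s that by simp
  have "\<beta> (s i) (s j) = 0"
    using B[of i j] B[of j i] ij alt_sym[OF \<beta>, of "s i" "s j"] alt_self[OF \<beta>, of "s i"]
    by (cases i j rule: linorder_cases) auto
  with A' ij show ?thesis by blast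
qed

lemma finite_sequences:
  assumes "finite V"
  shows "finite {y :: nat => 'v. (\<forall>i. y i \<in> V) \<and> (\<forall>i\<ge>k. y i = z)}"
proof -
  have "{y. (\<forall>i. y i \<in> V) \<and> (\<forall>i\<ge>k. y i = z)} \<subseteq>
      {f. \<forall>i. (i \<in> {..<k} --> f i \<in> V) \<and> (i \<notin> {..<k} --> f i = z)}" by auto
  then show ?thesis
    using finite_set_of_finite_funs[of "{..<k}" V z] assms finite_subset by blast
qed

text \<open>The alternative for the linear system whose unknown is a chain starting at \<open>v\<close>: the
  obstruction to solving it is a chain \<open>w\<close> for the exchanged forms that detects
  \<open>v\<close>. A block is a chain together with such an obstruction.\<close>

lemma chain_alternative:
  fixes \<alpha> \<beta> :: "'v::boolean_group => 'v => bit"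
  assumes V: "subgrp V" "finite V" and \<alpha>: "alt_form \<alpha>" and \<beta>: "alt_form \<beta>"
    and v: "v \<in> V" and L: "k \<le> L" "0 < L"
    and no: "\<nexists>y. (\<forall>i. y i \<in> V) \<and> y 0 = v \<and> (\<forall>i<L. \<forall>z\<in>V. \<beta> (y (Suc i)) z = \<alpha> (y i) z) \<and>
      (\<forall>i>k. y i = 0)"
  shows "\<exists>w. (\<forall>i. w i \<in> V) \<and> (\<forall>i\<ge>L. w i = 0) \<and> \<alpha> v (w 0) = 1 \<and>
      (\<forall>j<k. \<forall>z\<in>V. \<alpha> (w (Suc j)) z = \<beta> (w j) z)"
proof (rule ccontr)
  assume contr: "\<not> ?thesis"
  define A where "A = {w. (\<forall>i. w i \<in> V) \<and> (\<forall>i\<ge>L. w i = 0)}"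
  define Y where "Y = {y. (\<forall>i. y i \<in> V) \<and> (\<forall>i\<ge>k. y i = 0)}"
  define B where "B w y = (\<Sum>j<k. \<beta> (w j) (y j) + \<alpha> (w (Suc j)) (y j))" for w y
  have V0: "0 \<in> V" using V(1) by (simp add: subgrp_def)
  have single: "B (\<lambda>l. if l = i then z else 0) y =
      (if i < k then \<beta> z (y i) else 0) + (if 0 < i \<and> i \<le> k then \<alpha> z (y (i - 1)) else 0)" for i z y
  proof -
    have "B (\<lambda>l. if l = i then z else 0) y =
      (\<Sum>j<k. if j = i then \<beta> z (y i) else 0) + (\<Sum>j<k. if Suc j = i then \<alpha> z (y j) else 0)"
      unfolding B_def sum.distrib
      by (intro arg_cong2[of _ _ _ _ "(+)"] sum.cong) (auto simp: alt_0[OF \<alpha>] alt_0[OF \<beta>])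
    also have "(\<Sum>j<k. if Suc j = i then \<alpha> z (y j) else 0) = (if 0 < i \<and> i \<le> k then \<alpha> z (y (i - 1)) else 0)"
      by (cases i) (auto simp: less_eq_Suc_le)
    finally show ?thesis by simp
  qed
  have singleY: "B w (\<lambda>l. if l = j then z else 0) = \<beta> (w j) z + \<alpha> (w (Suc j)) z" if "j < k" for w j z
  proof -
    have "B w (\<lambda>l. if l = j then z else 0) = (\<Sum>l<k. if l = j then \<beta> (w j) z + \<alpha> (w (Suc j)) z else 0)"
      unfolding B_def by (intro sum.cong) (auto simp: alt_0_right[OF \<alpha>] alt_0_right[OF \<beta>])
    then show ?thesis using that by simp
  qed
  have "\<exists>y\<in>Y. \<forall>w\<in>A. \<alpha> v (w 0) = B w y"
  proof (rule functional_representation)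
    show "subgrp A" "subgrp Y" using V(1) by (auto simp: A_def Y_def subgrp_def)
    show "finite Y" unfolding Y_def using V by (intro finite_sequences)
    show "additive_on A (\<lambda>w. B w y)" for y
      by (simp add: additive_on_def B_def alt_add[OF \<alpha>] alt_add[OF \<beta>] sum.distrib ac_simps)
    show "additive_on Y (B w)" for w
      by (simp add: additive_on_def B_def alt_add_right[OF \<alpha>] alt_add_right[OF \<beta>] sum.distrib ac_simps)
    show "additive_on A (\<lambda>w. \<alpha> v (w 0))"
      by (simp add: additive_on_def alt_add_right[OF \<alpha>])
    fix w assume w: "w \<in> A" "!!y. y \<in> Y ==> B w y = 0"
    have wc: "\<alpha> (w (Suc j)) z = \<beta> (w j) z" if "j < k" "z \<in> V" for j z
    proof -
      have "(\<lambda>l. if l = j then z else 0) \<in> Y" using that V0 by (auto simp: Y_def)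
      from w(2)[OF this] show ?thesis using singleY[OF that(1)] by (simp add: add_eq_0_iff_eq)
    qed
    show "\<alpha> v (w 0) = 0"
    proof (rule ccontr)
      assume "\<alpha> v (w 0) ~= 0"
      then have "\<exists>w. (\<forall>i. w i \<in> V) \<and> (\<forall>i\<ge>L. w i = 0) \<and> \<alpha> v (w 0) = 1 \<and>
          (\<forall>j<k. \<forall>z\<in>V. \<alpha> (w (Suc j)) z = \<beta> (w j) z)"
        using w(1) wc by (intro exI[of _ w]) (simp add: A_def)
      with contr show False by contradiction
    qed
  qed
  then obtain y where y: "y \<in> Y" "!!w. w \<in> A ==> \<alpha> v (w 0) = B w y" by (elim bexE) (rule that, simp_all)
  define s where "s i = (case i of 0 => v | Suc j => y j)" for i
  have "\<beta> (s (Suc i)) z = \<alpha> (s i) z" if "i < L" "z \<in> V" for i z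
  proof -
    have "(\<lambda>l. if l = i then z else 0) \<in> A" using that V0 by (auto simp: A_def)
    from y(2)[OF this] have e: "\<alpha> v (if 0 = i then z else 0) =
       (if i < k then \<beta> z (y i) else 0) + (if 0 < i \<and> i \<le> k then \<alpha> z (y (i - 1)) else 0)"
      unfolding single by simp
    have b: "(if i < k then \<beta> z (y i) else 0) = \<beta> (y i) z"
      using y(1) by (auto simp: Y_def alt_sym[OF \<beta>, of z] alt_0[OF \<beta>])
    show ?thesis
    proof (cases i)
      case 0
      then show ?thesis using e b by (simp add: s_def)
    next
      case (Suc j)
      have a: "(if 0 < i \<and> i \<le> k then \<alpha> z (y (i - 1)) else 0) = \<alpha> (y j) z"
        using y(1) Suc by (auto simp: Y_def alt_sym[OF \<alpha>, of z] alt_0[OF \<alpha>])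
      show ?thesis using e Suc unfolding a b by (simp add: s_def alt_0_right[OF \<alpha>] add_eq_0_iff_eq)
    qed
  qed
  moreover have "\<forall>i. s i \<in> V" using y(1) v by (auto simp: s_def Y_def split: nat.splits)
  moreover have "\<forall>i>k. s i = 0" using y(1) by (auto simp: s_def Y_def split: nat.splits)
  moreover have "s 0 = v" by (simp add: s_def)
  ultimately have "\<exists>y. (\<forall>i. y i \<in> V) \<and> y 0 = v \<and> (\<forall>i<L. \<forall>z\<in>V. \<beta> (y (Suc i)) z = \<alpha> (y i) z) \<and>
      (\<forall>i>k. y i = 0)"
    by (intro exI[of _ s] conjI) simp_all
  with no show False by contradiction
qed

text \<open>The pairing of the subgroup \<open>W\<close> with the independent family \<open>cs\<close> is
  nondegenerate on the side of \<open>cs\<close>, hence onto.\<close>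

lemma dual_family:
  fixes \<gamma> :: "'v::boolean_group => 'v => bit"
  assumes \<gamma>: "alt_form \<gamma>" and W: "subgrp W"
    and nd: "!!p. p \<in> vecs (length cs) ==> p ~= 0 ==> \<exists>y\<in>W. \<gamma> y (comb cs p) ~= 0"
  shows "\<exists>bs. length bs = length cs \<and> set bs \<subseteq> W \<and>
    (\<forall>i<length cs. \<forall>j<length cs. \<gamma> (bs ! i) (cs ! j) = (if i = j then 1 else 0))"
proof -
  let ?n = "length cs"
  have ex: "\<exists>b\<in>W. \<forall>j<?n. \<gamma> b (cs ! j) = (if i = j then 1 else 0)" if i: "i < ?n" for i
  proof (rule ccontr)
    assume contr: "\<not> ?thesis"
    define Y where "Y = {q \<in> vecs ?n. coeff q i = 0}"
    have "\<exists>q\<in>Y. \<forall>x\<in>W. \<gamma> x (cs ! i) = \<gamma> x (comb cs q)"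
    proof (rule functional_representation[OF W])
      show "subgrp Y" using subgrp_vecs[of ?n] by (auto simp: Y_def subgrp_def)
      show "finite Y" by (simp add: Y_def)
      show "additive_on W (\<lambda>x. \<gamma> x (comb cs q))" "additive_on W (\<lambda>x. \<gamma> x (cs ! i))" for q
        using \<gamma> by (simp_all add: alt_additive_left)
      show "additive_on Y (\<lambda>q. \<gamma> x (comb cs q))" for x
        by (simp add: additive_on_def comb_add alt_add_right[OF \<gamma>])
      fix x assume x: "x \<in> W" "!!q. q \<in> Y ==> \<gamma> x (comb cs q) = 0"
      have z: "\<gamma> x (cs ! j) = 0" if "j < ?n" "j ~= i" for j
        using x(2)[of "monom 1 j"] that by (simp add: Y_def vecs_def comb_monom)
      show "\<gamma> x (cs ! i) = 0"
      proof (rule ccontr)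
        assume "\<gamma> x (cs ! i) ~= 0"
        then have "\<forall>j<?n. \<gamma> x (cs ! j) = (if i = j then 1 else 0)" using z by auto
        with contr x(1) show False by blast
      qed
    qed
    then obtain q where q: "q \<in> Y" "\<forall>x\<in>W. \<gamma> x (cs ! i) = \<gamma> x (comb cs q)" by (elim bexE) (rule that)
    let ?p = "q + monom 1 i"
    have "?p \<in> vecs ?n" "coeff ?p i = 1" using q(1) i by (auto simp: Y_def vecs_def)
    moreover from this(2) have "?p ~= 0" by (intro notI) simp
    ultimately obtain y where "y \<in> W" "\<gamma> y (comb cs ?p) ~= 0" using nd[of ?p] by blast
    then show False using q(2) i by (simp add: comb_add comb_monom alt_add_right[OF \<gamma>])
  qed
  define b where "b i = (SOME b. b \<in> W \<and> (\<forall>j<?n. \<gamma> b (cs ! j) = (if i = j then 1 else 0)))" for i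
  have b: "b i \<in> W \<and> (\<forall>j<?n. \<gamma> (b i) (cs ! j) = (if i = j then 1 else 0))" if "i < ?n" for i
    unfolding b_def by (rule someI_ex) (use ex[OF that] in blast)
  show ?thesis
    using b by (intro exI[of _ "map b [0..<?n]"]) auto
qed

lemma dual_family_span:
  assumes \<gamma>: "alt_form \<gamma>" and len: "length bs = length cs" "length ws = length cs"
    and sub: "set bs \<subseteq> range (comb ws)"
    and dual: "!!i j. i < length cs ==> j < length cs ==> \<gamma> (bs ! i) (cs ! j) = (if i = j then 1 else 0)"
  shows "range (comb bs) = range (comb ws)"
proof (rule card_seteq[OF finite_range_comb])
  show "range (comb bs) \<subseteq> range (comb ws)"
    using comb_in[OF subgrp_range_comb sub] by auto
  have "basis bs (range (comb bs))"
    by (rule basis_if_dual[of _ UNIV "\<lambda>i y. \<gamma> y (cs ! i)"])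
      (use len dual in \<open>auto simp: alt_additive_left[OF \<gamma>]\<close>)
  then show "card (range (comb ws)) \<le> card (range (comb bs))"
    using card_range_comb[of ws] len by (simp add: basis_card)
qed


section \<open>Blocks of type \<open>\<epsilon>\<close> and \<open>x\<^sub>2\<close>\<close>

definition kernel_chain ::
  "('v::boolean_group => 'v => bit) => ('v => 'v => bit) => 'v set => nat => (nat => 'v) => bool" where
  "kernel_chain \<alpha> \<beta> V n v \<longleftrightarrow> (\<forall>i. v i \<in> V) \<and> (\<exists>i<n. v i ~= 0) \<and> (\<forall>z\<in>V. \<beta> (v 0) z = 0) \<and>
     (\<forall>i. Suc i < n --> (\<forall>z\<in>V. \<beta> (v (Suc i)) z = \<alpha> (v i) z)) \<and> (\<forall>z\<in>V. \<alpha> (v (n - 1)) z = 0)"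

lemma canonical_pair_None: "canonical_pair (None, n) = (off_diag (I_plus n), off_diag (I_minus n))"
  by (simp add: canonical_pair_def)

lemma None_in_indices: "n \<ge> 1 ==> (None, n) \<in> indices"
  by (simp add: indices_def PPe_def)

lemma I_plus_minus_carrier: "I_plus n \<in> carrier_mat n (n - 1)" "I_minus n \<in> carrier_mat n (n - 1)"
  by (simp_all add: I_plus_def I_minus_def)

text \<open>A shortest chain from \<open>0\<close> to \<open>0\<close> is one half of an
  \<open>\<epsilon>\<close>-block. Its minimality excludes the shorter chain in the alternative, and
  the obstruction obtained in this way is the other half.\<close>

lemma split_kernel_chain:
  fixes \<alpha> \<beta> :: "'v::boolean_group => 'v => bit"
  assumes V: "subgrp V" "finite V" and \<alpha>: "alt_form \<alpha>" and \<beta>: "alt_form \<beta>"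
    and IH: "!!W. subgrp W ==> W \<subset> V ==> \<exists>bs ps. canonical_basis \<alpha> \<beta> W bs ps"
    and chain: "\<exists>n v. kernel_chain \<alpha> \<beta> V n v"
  shows "\<exists>bs ps. canonical_basis \<alpha> \<beta> V bs ps"
proof -
  define n where "n = (LEAST n. \<exists>v. kernel_chain \<alpha> \<beta> V n v)"
  have "\<exists>v. kernel_chain \<alpha> \<beta> V n v" unfolding n_def using chain by (rule LeastI_ex)
  then obtain v where v: "kernel_chain \<alpha> \<beta> V n v" by blast
  have min: "n \<le> m" if "kernel_chain \<alpha> \<beta> V m u" for m u
    unfolding n_def by (rule Least_le) (rule exI[of _ u], rule that)
  have vV: "v i \<in> V" for i using v by (simp add: kernel_chain_def)
  have v0b: "\<beta> (v 0) z = 0" if "z \<in> V" for z using v that by (simp add: kernel_chain_def)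
  have vb: "\<beta> (v (Suc i)) z = \<alpha> (v i) z" if "Suc i < n" "z \<in> V" for i z
    using v that by (simp add: kernel_chain_def)
  have vn: "\<alpha> (v (n - 1)) z = 0" if "z \<in> V" for z using v that by (simp add: kernel_chain_def)
  obtain i0 where i0: "i0 < n" "v i0 ~= 0" using v by (auto simp: kernel_chain_def)
  have v0: "v 0 ~= 0"
  proof
    assume z: "v 0 = 0"
    then obtain i1 where i1: "i0 = Suc i1" using i0(2) by (cases i0) auto
    have "kernel_chain \<alpha> \<beta> V (n - 1) (\<lambda>i. v (Suc i))"
      unfolding kernel_chain_def
    proof (intro conjI allI ballI impI)
      show "v (Suc i) \<in> V" for i by (rule vV)
      show "\<exists>i<n - 1. v (Suc i) ~= 0" using i0 i1 by (intro exI[of _ i1]) auto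
      show "\<beta> (v (Suc 0)) y = 0" if "y \<in> V" for y
        using vb[of 0 y] i0 i1 that z by (simp add: alt_0[OF \<alpha>])
      show "\<beta> (v (Suc (Suc i))) y = \<alpha> (v (Suc i)) y" if "Suc i < n - 1" "y \<in> V" for i y
        using that by (intro vb) auto
      show "\<alpha> (v (Suc (n - 1 - 1))) y = 0" if "y \<in> V" for y
        using vn[OF that] i0 i1 by (simp add: Suc_diff_Suc)
    qed
    from min[OF this] i0(1) show False by linarith
  qed
  show ?thesis
  proof (cases "n = 1")
    case True
    obtain \<phi> where \<phi>: "additive_on V \<phi>" "\<phi> (v 0) = 1" using separating_functional[OF V vV v0] by blast
    show ?thesis
    proof (rule split_block[of V \<alpha> \<beta> "(None, 1)" "I_plus 1" "I_minus 1" "[v 0]" "[]" "\<lambda>_. \<phi>", OF V(1) \<alpha> \<beta> IH])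
      show "\<alpha> b x = 0 \<and> \<beta> b x = 0" if "x \<in> V" "b \<in> set [v 0] \<union> set []" for x b
        using that vn v0b True by simp
    qed (use \<phi> vV in \<open>auto simp: canonical_pair_None None_in_indices I_plus_def I_minus_def alt_self[OF \<alpha>] alt_self[OF \<beta>]\<close>)
  next
    case False
    then have n2: "n \<ge> 2" using i0 by linarith
    have "\<nexists>y. (\<forall>i. y i \<in> V) \<and> y 0 = v 0 \<and> (\<forall>i<n - 1. \<forall>z\<in>V. \<beta> (y (Suc i)) z = \<alpha> (y i) z) \<and>
      (\<forall>i>n - 2. y i = 0)"
    proof
      assume "\<exists>y. (\<forall>i. y i \<in> V) \<and> y 0 = v 0 \<and> (\<forall>i<n - 1. \<forall>z\<in>V. \<beta> (y (Suc i)) z = \<alpha> (y i) z) \<and>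
        (\<forall>i>n - 2. y i = 0)"
      then obtain y where y': "(\<forall>i. y i \<in> V) \<and> y 0 = v 0 \<and>
        (\<forall>i<n - 1. \<forall>z\<in>V. \<beta> (y (Suc i)) z = \<alpha> (y i) z) \<and> (\<forall>i>n - 2. y i = 0)"
        by (rule exE)
      have y: "y i \<in> V" "y 0 = v 0" "i < n - 1 ==> z \<in> V ==> \<beta> (y (Suc i)) z = \<alpha> (y i) z" for i z
        using y' by blast+
      have yn: "y (n - 1) = 0" using y' n2 by simp
      have "\<alpha> (y (n - 1 - 1)) z = 0" if "z \<in> V" for z
      proof -
        have "Suc (n - 1 - 1) = n - 1" using n2 by simp
        then show ?thesis using y(3)[of "n - 1 - 1" z] yn n2 that by (simp add: alt_0[OF \<beta>])
      qed
      then have "kernel_chain \<alpha> \<beta> V (n - 1) y"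
        using y v0 v0b n2 unfolding kernel_chain_def by (auto intro!: exI[of _ 0])
      from min[OF this] n2 show False by linarith
    qed
    from chain_alternative[OF V \<alpha> \<beta> vV _ _ this]
    have "\<exists>w. (\<forall>i. w i \<in> V) \<and> (\<forall>i\<ge>n - 1. w i = 0) \<and> \<alpha> (v 0) (w 0) = 1 \<and>
        (\<forall>j<n - 2. \<forall>z\<in>V. \<alpha> (w (Suc j)) z = \<beta> (w j) z)"
      using n2 by simp
    then obtain w where w: "(\<forall>i. w i \<in> V) \<and> (\<forall>i\<ge>n - 1. w i = 0) \<and> \<alpha> (v 0) (w 0) = 1 \<and>
        (\<forall>j<n - 2. \<forall>z\<in>V. \<alpha> (w (Suc j)) z = \<beta> (w j) z)"
      by (rule exE)
    have wV: "w i \<in> V" for i using w by blast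
    have w0: "\<alpha> (v 0) (w 0) = 1" using w by blast
    have wc: "\<alpha> (w (Suc j)) z = \<beta> (w j) z" if "j < n - 2" "z \<in> V" for j z
      using w that by blast
    define us where "us = map v [0..<n]"
    define ws where "ws = map w [0..<n - 1]"
    have len: "length us = n" "length ws = n - 1" by (simp_all add: us_def ws_def)
    have nth: "!!i. i < n ==> us ! i = v i" "!!i. i < n - 1 ==> ws ! i = w i"
      by (simp_all add: us_def ws_def)
    have step: "\<alpha> (v (Suc i)) (w (Suc j)) = \<alpha> (v i) (w j)" if "Suc i < n" "Suc j < n - 1" for i j
    proof -
      have "\<alpha> (v (Suc i)) (w (Suc j)) = \<beta> (v (Suc i)) (w j)"
        using wc[of j "v (Suc i)"] vV that by (simp add: alt_sym[OF \<alpha>, of "v (Suc i)"] alt_sym[OF \<beta>, of "v (Suc i)"])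
      also have "... = \<alpha> (v i) (w j)" using vb[of i "w j"] wV that by simp
      finally show ?thesis .
    qed
    have steps: "\<alpha> (v (i + k)) (w (j + k)) = \<alpha> (v i) (w j)" if "i + k < n" "j + k < n - 1" for i j k
      using that
    proof (induction k)
      case (Suc k)
      then show ?case using step[of "i + k" "j + k"] by simp
    qed simp
    have pair: "\<alpha> (v i) (w j) = (if i = j then 1 else 0)" if ij: "i < n" "j < n - 1" for i j
    proof (cases i j rule: linorder_cases)
      case less
      define d where "d = j - i - 1"
      have d: "j = Suc d + i" using less by (simp add: d_def)
      have "\<alpha> (v i) (w j) = \<alpha> (v 0) (w (Suc d))" using steps[of 0 i "Suc d"] ij d by simp
      also have "... = \<beta> (w d) (v 0)" using wc[of d "v 0"] ij d vV by (simp add: alt_sym[OF \<alpha>, of "v 0"])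
      also have "... = 0" using v0b[of "w d"] wV by (simp add: alt_sym[OF \<beta>, of "w d"])
      finally show ?thesis using less by simp
    next
      case equal
      then show ?thesis using steps[of 0 i 0] ij w0 by simp
    next
      case greater
      have "\<alpha> (v (i + (n - 1 - i))) (w (j + (n - 1 - i))) = \<alpha> (v i) (w j)"
        using greater ij by (intro steps) auto
      then show ?thesis using vn[of "w (j + (n - 1 - i))"] wV greater ij by simp
    qed
    have pairb: "\<beta> (v i) (w j) = (if i = Suc j then 1 else 0)" if ij: "i < n" "j < n - 1" for i j
    proof (cases i)
      case 0
      then show ?thesis using v0b[of "w j"] wV by simp
    next
      case (Suc i')
      then show ?thesis using vb[of i' "w j"] pair[of i' j] ij wV by simp
    qed
    have isov: "\<beta> (v i) (v j) = 0 \<and> \<alpha> (v i) (v j) = 0" if "i < n" "j < n" for i j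
      by (rule chain_isotropic[OF \<beta> \<alpha>, where L = n and V = V]) (use vV vb that in auto)
    have isow: "\<alpha> (w i) (w j) = 0 \<and> \<beta> (w i) (w j) = 0" if "i < n - 1" "j < n - 1" for i j
      by (rule chain_isotropic[OF \<alpha> \<beta>, where L = "n - 1" and V = V]) (use wV wc that in auto)
    define \<phi> where "\<phi> i = (if i < n - 1 then \<alpha> (w i) else if i = n - 1 then \<beta> (w (n - 2)) else \<alpha> (v (i - n)))" for i
    show ?thesis
    proof (rule split_block[of V \<alpha> \<beta> "(None, n)" "I_plus n" "I_minus n" us ws \<phi>, OF V(1) \<alpha> \<beta> IH])
      show "(None, n) \<in> indices" using n2 by (simp add: None_in_indices)
      show "canonical_pair (None, n) = (off_diag (I_plus n), off_diag (I_minus n))"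
        by (rule canonical_pair_None)
      show "I_plus n \<in> carrier_mat (length us) (length ws)" "I_minus n \<in> carrier_mat (length us) (length ws)"
        using I_plus_minus_carrier len by auto
      show "set us \<subseteq> V" "set ws \<subseteq> V" "us ~= []" using vV wV n2 by (auto simp: us_def ws_def)
      show "\<alpha> x y = 0 \<and> \<beta> x y = 0" if "x \<in> set us" "y \<in> set us" for x y
        using that isov by (auto simp: us_def)
      show "\<alpha> x y = 0 \<and> \<beta> x y = 0" if "x \<in> set ws" "y \<in> set ws" for x y
        using that isow by (auto simp: ws_def)
      show "\<alpha> (us ! i) (ws ! j) = I_plus n $$ (i, j) \<and> \<beta> (us ! i) (ws ! j) = I_minus n $$ (i, j)"
        if "i < length us" "j < length ws" for i j
        using that pair[of i j] pairb[of i j] by (simp add: len nth I_plus_def I_minus_def)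
      show "additive_on V (\<phi> i)" for i by (simp add: \<phi>_def alt_additive \<alpha> \<beta>)
      show "\<phi> i ((us @ ws) ! j) = (if i = j then 1 else 0)"
        if "i < length (us @ ws)" "j < length (us @ ws)" for i j
      proof -
        have L: "i < n + (n - 1)" "j < n + (n - 1)" using that len by simp_all
        show ?thesis
        proof (cases "j < n")
          case True
          then show ?thesis
            using L pair[of j i] pairb[of j "n - 2"] isov[of "i - n" j] n2
            by (auto simp: \<phi>_def nth_append len nth alt_sym[OF \<alpha>, of "w _"] alt_sym[OF \<beta>, of "w _"])
        next
          case False
          then show ?thesis
            using L isow[of i "j - n"] isow[of "n - 2" "j - n"] pair[of "i - n" "j - n"] n2
            by (auto simp: \<phi>_def nth_append len nth)
        qed
      qed
      show "\<alpha> b x = 0 \<and> \<beta> b x = 0" if x: "x \<in> V" "!!i. i < length (us @ ws) ==> \<phi> i x = 0"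
        "b \<in> set us \<union> set ws" for x b
      proof -
        have aw: "\<alpha> (w i) x = 0" if "i < n - 1" for i using x(2)[of i] that by (simp add: \<phi>_def len)
        have bw: "\<beta> (w i) x = 0" if "i < n - 1" for i
          using x(2)[of "n - 1"] wc[of i x] aw[of "Suc i"] that x(1) n2
          by (cases "i = n - 2") (auto simp: \<phi>_def len)
        have av: "\<alpha> (v i) x = 0" if "i < n" for i
        proof (cases "i = n - 1")
          case False
          then have "n + i < length (us @ ws)" "\<not> n + i < n - 1" "n + i ~= n - 1"
            using that n2 by (auto simp: len)
          then show ?thesis using x(2)[of "n + i"] by (simp add: \<phi>_def)
        qed (use vn[OF x(1)] in simp)
        have bv: "\<beta> (v i) x = 0" if "i < n" for i
          using vb[of "i - 1" x] v0b[OF x(1)] av[of "i - 1"] that x(1) by (cases i) auto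
        show ?thesis using x(3) aw bw av bv by (auto simp: us_def ws_def)
      qed
    qed
  qed
qed

text \<open>In a finite group an infinite chain from \<open>v\<close> repeats a value, and the difference of
  two of its tails would be a chain that starts in the kernel and breaks off.\<close>

lemma maximal_chain_start:
  fixes \<alpha> \<beta> :: "'v::boolean_group => 'v => bit"
  assumes V: "subgrp V" "finite V" and \<alpha>: "alt_form \<alpha>" and \<beta>: "alt_form \<beta>"
    and regular: "!!n v. \<not> kernel_chain \<alpha> \<beta> V n v"
    and v: "v \<in> V" "v ~= 0" "\<forall>z\<in>V. \<alpha> v z = 0"
  shows "\<exists>n\<ge>1. (\<exists>y. (\<forall>i. y i \<in> V) \<and> y 0 = v \<and> (\<forall>i. Suc i < n --> (\<forall>z\<in>V. \<alpha> (y (Suc i)) z = \<beta> (y i) z))) \<and>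
    \<not> (\<exists>y. (\<forall>i. y i \<in> V) \<and> y 0 = v \<and> (\<forall>i. i < n --> (\<forall>z\<in>V. \<alpha> (y (Suc i)) z = \<beta> (y i) z)))"
proof (rule ccontr)
  let ?P = "\<lambda>n. \<exists>y. (\<forall>i. y i \<in> V) \<and> y 0 = v \<and> (\<forall>i. i < n --> (\<forall>z\<in>V. \<alpha> (y (Suc i)) z = \<beta> (y i) z))"
  assume contr: "\<not> ?thesis"
  have step: "?P (Suc n)" if "?P n" for n
  proof (rule ccontr)
    assume no: "\<not> ?P (Suc n)"
    have "\<exists>y. (\<forall>i. y i \<in> V) \<and> y 0 = v \<and> (\<forall>i. Suc i < Suc n --> (\<forall>z\<in>V. \<alpha> (y (Suc i)) z = \<beta> (y i) z))"
      using that by simp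
    with no have "\<exists>n\<ge>1. (\<exists>y. (\<forall>i. y i \<in> V) \<and> y 0 = v \<and> (\<forall>i. Suc i < n --> (\<forall>z\<in>V. \<alpha> (y (Suc i)) z = \<beta> (y i) z))) \<and> \<not> ?P n"
      by (intro exI[of _ "Suc n"] conjI) simp_all
    with contr show False by contradiction
  qed
  have "?P n" for n
  proof (induction n)
    case 0
    show ?case by (rule exI[of _ "\<lambda>_. v"]) (use v in simp)
  qed (rule step)
  then have "?P (card V)" .
  then obtain y where y': "(\<forall>i. y i \<in> V) \<and> y 0 = v \<and>
      (\<forall>i. i < card V --> (\<forall>z\<in>V. \<alpha> (y (Suc i)) z = \<beta> (y i) z))" by (rule exE)
  have y: "y i \<in> V" "y 0 = v" "i < card V ==> z \<in> V ==> \<alpha> (y (Suc i)) z = \<beta> (y i) z" for i z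
    using y' by blast+
  have "\<not> inj_on y {..card V}"
  proof
    assume "inj_on y {..card V}"
    then have "card {..card V} \<le> card V" using y(1) V(2) by (intro card_inj_on_le[of y]) auto
    then show False by simp
  qed
  then obtain i' j' where ij': "i' \<le> card V" "j' \<le> card V" "y i' = y j'" "i' ~= j'"
    by (auto simp: inj_on_def)
  obtain i j where ij: "i < j" "j \<le> card V" "y i = y j"
  proof (cases "i' < j'")
    case True
    then show ?thesis using that[of i' j'] ij' by simp
  next
    case False
    then show ?thesis using that[of j' i'] ij' by simp
  qed
  define p where "p = j - i"
  define z where "z l = y l + (if l \<ge> p then y (l - p) else 0)" for l
  have zV: "z l \<in> V" for l using y(1) V(1) by (auto simp: z_def subgrp_def)
  have zj: "z j = 0" using ij by (simp add: z_def p_def)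
  have z0: "z 0 = v" using ij y(2) by (simp add: z_def p_def)
  have zc: "\<alpha> (z (Suc l)) x = \<beta> (z l) x" if l: "l < j" "x \<in> V" for l x
  proof (cases "Suc l \<ge> p")
    case False
    then show ?thesis using y(3)[of l x] l ij by (simp add: z_def)
  next
    case True
    show ?thesis
    proof (cases "Suc l = p")
      case True
      then show ?thesis using y(3)[of l x] l ij y(2) v(3) by (simp add: z_def alt_add[OF \<alpha>])
    next
      case False
      then have "Suc l - p = Suc (l - p)" using True by simp
      then show ?thesis using y(3)[of l x] y(3)[of "l - p" x] l ij True False
        by (simp add: z_def alt_add[OF \<alpha>] alt_add[OF \<beta>])
    qed
  qed
  have "kernel_chain \<alpha> \<beta> V j (\<lambda>l. z (j - 1 - l))"
    unfolding kernel_chain_def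
  proof (intro conjI allI ballI impI)
    show "z (j - 1 - i) \<in> V" for i by (rule zV)
    show "\<exists>i<j. z (j - 1 - i) ~= 0" using ij z0 v(2) by (intro exI[of _ "j - 1"]) auto
    show "\<beta> (z (j - 1 - 0)) x = 0" if "x \<in> V" for x
      using zc[of "j - 1" x] ij that zj by (simp add: alt_0[OF \<alpha>])
    show "\<beta> (z (j - 1 - Suc i)) x = \<alpha> (z (j - 1 - i)) x" if "Suc i < j" "x \<in> V" for i x
      using zc[of "j - 1 - Suc i" x] that by (simp add: Suc_diff_Suc)
    show "\<alpha> (z (j - 1 - (j - 1))) x = 0" if "x \<in> V" for x
      using z0 v(3)[rule_format, OF that] by simp
  qed
  with regular[of j "\<lambda>l. z (j - 1 - l)"] show False by contradiction
qed

lemma canonical_pair_X2: "canonical_pair (Some X2, n) = (off_diag (jordan_block n 0), off_diag (1\<^sub>m n))"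
  by (simp add: canonical_pair_def)

text \<open>With no kernel chain but a degenerate \<open>\<alpha>\<close>, a chain that cannot be continued
  pairs with its obstruction in a triangular Hankel matrix, so the obstruction contains a dual
  family. Together they form a block of type \<open>x\<^sub>2\<close>.\<close>

lemma split_infinite_block:
  fixes \<alpha> \<beta> :: "'v::boolean_group => 'v => bit"
  assumes V: "subgrp V" "finite V" and \<alpha>: "alt_form \<alpha>" and \<beta>: "alt_form \<beta>"
    and IH: "!!W. subgrp W ==> W \<subset> V ==> \<exists>bs ps. canonical_basis \<alpha> \<beta> W bs ps"
    and regular: "!!n v. \<not> kernel_chain \<alpha> \<beta> V n v"
    and v: "v \<in> V" "v ~= 0" "\<forall>z\<in>V. \<alpha> v z = 0"
    and X2: "X2 \<in> PP"
  shows "\<exists>bs ps. canonical_basis \<alpha> \<beta> V bs ps"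
proof -
  obtain n where n: "n \<ge> 1"
    and ex: "\<exists>y. (\<forall>i. y i \<in> V) \<and> y 0 = v \<and> (\<forall>i. Suc i < n --> (\<forall>z\<in>V. \<alpha> (y (Suc i)) z = \<beta> (y i) z))"
    and no: "\<not> (\<exists>y. (\<forall>i. y i \<in> V) \<and> y 0 = v \<and> (\<forall>i. i < n --> (\<forall>z\<in>V. \<alpha> (y (Suc i)) z = \<beta> (y i) z)))"
    using maximal_chain_start[OF V \<alpha> \<beta> regular v]
  proof (elim exE conjE)
    fix n y assume "1 \<le> n" "\<forall>i. y i \<in> V" "y 0 = v" "\<forall>i. Suc i < n --> (\<forall>z\<in>V. \<alpha> (y (Suc i)) z = \<beta> (y i) z)"
      and *: "\<not> (\<exists>y. (\<forall>i. y i \<in> V) \<and> y 0 = v \<and> (\<forall>i. i < n --> (\<forall>z\<in>V. \<alpha> (y (Suc i)) z = \<beta> (y i) z)))"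
    then show thesis by (intro that[OF _ _ *] exI[of _ y] conjI)
  qed
  obtain y where y: "(\<forall>i. y i \<in> V) \<and> y 0 = v \<and> (\<forall>i. Suc i < n --> (\<forall>z\<in>V. \<alpha> (y (Suc i)) z = \<beta> (y i) z))"
    using ex by (rule exE)
  have yV: "y i \<in> V" and y0: "y 0 = v"
    and yc: "Suc i < n ==> z \<in> V ==> \<alpha> (y (Suc i)) z = \<beta> (y i) z" for i z
    using y by blast+
  have "\<nexists>y. (\<forall>i. y i \<in> V) \<and> y 0 = v \<and> (\<forall>i<n. \<forall>z\<in>V. \<alpha> (y (Suc i)) z = \<beta> (y i) z) \<and> (\<forall>i>n. y i = 0)"
    by (rule notI, rule notE[OF no], erule exE, rule exI, (erule conjE)+, intro conjI; assumption)
  from chain_alternative[OF V \<beta> \<alpha> v(1) _ _ this]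
  have "\<exists>w. (\<forall>i. w i \<in> V) \<and> (\<forall>i\<ge>n. w i = 0) \<and> \<beta> v (w 0) = 1 \<and>
      (\<forall>j<n. \<forall>z\<in>V. \<beta> (w (Suc j)) z = \<alpha> (w j) z)"
    using n by simp
  then obtain w where w: "(\<forall>i. w i \<in> V) \<and> (\<forall>i\<ge>n. w i = 0) \<and> \<beta> v (w 0) = 1 \<and>
      (\<forall>j<n. \<forall>z\<in>V. \<beta> (w (Suc j)) z = \<alpha> (w j) z)"
    by (rule exE)
  have wV: "w i \<in> V" for i using w by blast
  have w0: "\<beta> v (w 0) = 1" using w by blast
  have wn: "w n = 0" using w by blast
  have wc: "\<beta> (w (Suc j)) z = \<alpha> (w j) z" if "j < n" "z \<in> V" for j z
    using w that by blast
  have step: "\<beta> (y (Suc i)) (w (Suc j)) = \<beta> (y i) (w j)" if "Suc i < n" "j < n" for i j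
  proof -
    have "\<beta> (y (Suc i)) (w (Suc j)) = \<alpha> (y (Suc i)) (w j)"
      using wc[of j "y (Suc i)"] that yV by (simp add: alt_sym[OF \<alpha>, of "y _"] alt_sym[OF \<beta>, of "y _"])
    then show ?thesis using yc[of i "w j"] that wV by simp
  qed
  have pair: "i \<le> j ==> \<beta> (y i) (w j) = (if i = j then 1 else 0)" if "j < n" for i j
    using that
  proof (induction j arbitrary: i)
    case 0
    then show ?case using w0 y0 by simp
  next
    case (Suc j)
    show ?case
    proof (cases i)
      case 0
      then show ?thesis using wc[of j v] Suc.prems v y0 wV
        by (simp add: alt_sym[OF \<beta>, of v] alt_sym[OF \<alpha>, of _ v])
    next
      case (Suc i')
      then show ?thesis using step[of i' j] Suc.IH[of i'] Suc.prems by simp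
    qed
  qed
  define cs where "cs = map y [0..<n]"
  define ws where "ws = map w [0..<n]"
  have len: "length cs = n" "length ws = n" by (simp_all add: cs_def ws_def)
  have nd: "\<exists>x\<in>range (comb ws). \<beta> x (comb cs p) ~= 0" if p: "p \<in> vecs (length cs)" "p ~= 0" for p
  proof -
    have d: "degree p < n" using p by (simp add: vecs_degree len)
    have lc: "coeff p (degree p) = 1"
      using p(2) leading_coeff_0_iff[of p] by (cases "coeff p (degree p)") auto
    have "\<beta> (comb cs p) (w (degree p)) = (\<Sum>i<n. coeff p i * \<beta> (y i) (w (degree p)))"
      by (simp add: alt_comb[OF \<beta>] len) (simp add: cs_def)
    also have "... = (\<Sum>i<n. if i = degree p then 1 else 0)"
    proof (rule sum.cong)
      fix i assume "i \<in> {..<n}"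
      show "coeff p i * \<beta> (y i) (w (degree p)) = (if i = degree p then 1 else 0)"
        using pair[OF d, of i] lc coeff_eq_0[of p i]
        by (cases i "degree p" rule: linorder_cases) auto
    qed simp
    also have "... = 1" using d by simp
    finally have "\<beta> (w (degree p)) (comb cs p) ~= 0" by (simp add: alt_sym[OF \<beta>, of "w _"])
    moreover have "w (degree p) \<in> range (comb ws)" using d by (intro nth_in_range_comb) (simp add: ws_def)
    ultimately show ?thesis by blast
  qed
  obtain bs where bs: "length bs = n" "set bs \<subseteq> range (comb ws)"
    and dual: "!!i j. i < n ==> j < n ==> \<beta> (bs ! i) (cs ! j) = (if i = j then 1 else 0)"
    using dual_family[OF \<beta> subgrp_range_comb nd] len by auto
  have span: "range (comb bs) = range (comb ws)"
    by (rule dual_family_span[of \<beta> bs cs ws]) (simp_all add: bs dual len \<beta>)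
  have wsV: "set ws \<subseteq> V" "set cs \<subseteq> V" using wV yV by (auto simp: ws_def cs_def)
  have isow: "\<beta> (w i) (w j) = 0 \<and> \<alpha> (w i) (w j) = 0" if "i < n" "j < n" for i j
    by (rule chain_isotropic[OF \<beta> \<alpha>, where L = n and V = V]) (use wV wc that in auto)
  have isoy: "\<alpha> (y i) (y j) = 0 \<and> \<beta> (y i) (y j) = 0" if "i < n" "j < n" for i j
    by (rule chain_isotropic[OF \<alpha> \<beta>, where L = n and V = V]) (use yV yc that in auto)
  show ?thesis
  proof (rule split_block_perfect[of V \<alpha> \<beta> \<beta> "(Some X2, n)" "jordan_block n 0" "1\<^sub>m n" n bs cs, OF V(1) \<alpha> \<beta> _ IH])
    show "(Some X2, n) \<in> indices" using X2 n by (simp add: indices_def PPe_def)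
    show "set bs \<subseteq> V" using bs(2) comb_in[OF V(1) wsV(1)] by auto
    show "\<alpha> b b' = 0 \<and> \<beta> b b' = 0" if "b \<in> set bs" "b' \<in> set bs" for b b'
    proof -
      have "b \<in> range (comb ws)" "b' \<in> range (comb ws)" using that bs(2) by (simp_all add: subsetD)
      then obtain p q where "b = comb ws p" "b' = comb ws q" by (elim rangeE) (rule that)
      moreover have "\<alpha> (comb ws p) (comb ws q) = 0"
        by (rule alt_comb_comb_0[OF \<alpha>]) (use isow in \<open>auto simp: ws_def\<close>)
      moreover have "\<beta> (comb ws p) (comb ws q) = 0"
        by (rule alt_comb_comb_0[OF \<beta>]) (use isow in \<open>auto simp: ws_def\<close>)
      ultimately show ?thesis by simp
    qed
    show "\<alpha> x x' = 0 \<and> \<beta> x x' = 0" if "x \<in> set cs" "x' \<in> set cs" for x x'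
      using isoy that by (auto simp: cs_def)
    show "\<alpha> (bs ! i) (cs ! j) = jordan_block n 0 $$ (i, j) \<and> \<beta> (bs ! i) (cs ! j) = 1\<^sub>m n $$ (i, j)"
      if ij: "i < n" "j < n" for i j
    proof -
      have "bs ! i \<in> range (comb ws)" using ij bs by (simp add: subsetD)
      then have bV: "bs ! i \<in> V" using comb_in[OF V(1) wsV(1)] by (elim rangeE) simp
      have "\<alpha> (bs ! i) (cs ! j) = (if j = Suc i then 1 else 0)"
      proof (cases j)
        case 0
        then show ?thesis using v(3)[rule_format, OF bV] y0 ij by (simp add: cs_def alt_sym[OF \<alpha>, of "bs ! i"])
      next
        case (Suc j')
        have "\<alpha> (bs ! i) (cs ! j) = \<beta> (bs ! i) (cs ! j')"
          using yc[of j' "bs ! i"] bV ij Suc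
          by (simp add: cs_def alt_sym[OF \<alpha>, of "bs ! i"] alt_sym[OF \<beta>, of "bs ! i"])
        then show ?thesis using dual[of i j'] ij Suc by simp
      qed
      then show ?thesis using dual ij by (auto simp: jordan_block_index)
    qed
    show "\<alpha> b x = 0 \<and> \<beta> b x = 0" if x: "x \<in> V" "!!z. z \<in> set bs \<union> set cs ==> \<beta> z x = 0"
        "b \<in> set bs \<union> set cs" for x b
    proof -
      have bw: "\<beta> (w i) x = 0" if "i < n" for i
      proof -
        have "w i \<in> range (comb bs)" unfolding span using that by (intro nth_in_range_comb) (simp add: ws_def)
        then obtain p where p: "w i = comb bs p" by (rule rangeE)
        show ?thesis unfolding p by (rule alt_comb_0[OF \<beta>]) (use x(2) in simp)
      qed
      have aw: "\<alpha> (w i) x = 0" if "i < n" for i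
        using wc[OF that x(1)] bw[of "Suc i"] wn that by (cases "Suc i = n") (auto simp: alt_0[OF \<beta>])
      have ab: "\<alpha> b x = 0" if "b \<in> set bs" for b
      proof -
        have "b \<in> range (comb ws)" using bs(2) that by (simp add: subsetD)
        then obtain p where p: "b = comb ws p" by (rule rangeE)
        show ?thesis unfolding p by (rule alt_comb_0[OF \<alpha>]) (use aw in \<open>auto simp: ws_def\<close>)
      qed
      have ac: "\<alpha> (y i) x = 0" if "i < n" for i
      proof (cases i)
        case 0
        then show ?thesis using v(3)[rule_format, OF x(1)] y0 by simp
      next
        case (Suc i')
        then show ?thesis using yc[of i' x] x that by (auto simp: cs_def)
      qed
      show ?thesis using x ab ac by (auto simp: cs_def)
    qed
  qed (use n bs wsV dual len in \<open>auto simp: canonical_pair_X2\<close>)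
qed


section \<open>Homogeneous polynomials in two variables\<close>

text \<open>Forms of degree \<open>D\<close>; the condition on the coefficients includes the zero polynomial,
  so this is a group.\<close>

definition hpolys :: "nat => bipoly set" where
  "hpolys D = {g. \<forall>i j. i + j ~= D --> coeff (coeff g i) j = 0}"

definition homogenize :: "nat => bit poly => bipoly" where
  "homogenize D f = (\<Sum>i\<le>D. monom (monom (coeff f i) (D - i)) i)"

lemma homogeneous_iff: "homogeneous g \<longleftrightarrow> (\<exists>D. g \<in> hpolys D)"
  unfolding homogeneous_def hpolys_def mem_Collect_eq by blast

lemma hpolysD: "g \<in> hpolys D ==> i + j ~= D ==> coeff (coeff g i) j = 0"
  by (auto simp: hpolys_def)

lemma coeff_homogenize:
  "coeff (homogenize D f) i = (if i \<le> D then monom (coeff f i) (D - i) else 0)"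
proof -
  have "coeff (homogenize D f) i = (\<Sum>k\<le>D. if k = i then monom (coeff f k) (D - k) else 0)"
    unfolding homogenize_def coeff_sum by (intro sum.cong) auto
  then show ?thesis by simp
qed

lemma homogenize_hpolys: "homogenize D f \<in> hpolys D"
  by (auto simp: hpolys_def coeff_homogenize split: if_splits)

lemma coeff_hpolys:
  assumes "g \<in> hpolys D"
  shows "coeff g i = (if i \<le> D then monom (coeff (coeff g i) (D - i)) (D - i) else 0)"
  by (rule poly_eqI) (use assms in \<open>auto simp: hpolys_def\<close>)

lemma coeff_dehomogenize: "coeff (dehomogenize g) i = poly (coeff g i) 1"
  by (simp add: dehomogenize_def coeff_map_poly)

lemma coeff_dehomogenize_hpolys:
  assumes "g \<in> hpolys D"
  shows "coeff (dehomogenize g) i = (if i \<le> D then coeff (coeff g i) (D - i) else 0)"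
  unfolding coeff_dehomogenize by (subst coeff_hpolys[OF assms]) (simp add: poly_monom)

lemma dehomogenize_vecs: "g \<in> hpolys D ==> dehomogenize g \<in> vecs (Suc D)"
  by (auto simp: vecs_def coeff_dehomogenize_hpolys)

lemma homogenize_dehomogenize: "g \<in> hpolys D ==> homogenize D (dehomogenize g) = g"
  by (intro poly_eqI) (auto simp: coeff_homogenize coeff_dehomogenize_hpolys hpolysD)

lemma dehomogenize_homogenize: "f \<in> vecs (Suc D) ==> dehomogenize (homogenize D f) = f"
  by (rule poly_eqI) (auto simp: coeff_dehomogenize coeff_homogenize poly_monom vecs_def)

interpretation dehom: comm_ring_hom dehomogenize
proof -
  interpret map_poly_comm_ring_hom "\<lambda>c::bit poly. poly c 1" ..
  show "comm_ring_hom dehomogenize"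
    unfolding dehomogenize_def by unfold_locales
qed

lemma dehomogenize_X [simp]: "dehomogenize X1 = [:0, 1:]" "dehomogenize X2 = 1"
  by (simp_all add: X1_def X2_def dehomogenize_def)

lemma subgrp_hpolys: "subgrp (hpolys D)"
  by (auto simp: subgrp_def hpolys_def)

lemma hpolys_mult:
  assumes "g \<in> hpolys D" "h \<in> hpolys E"
  shows "g * h \<in> hpolys (D + E)"
proof -
  have "coeff (coeff (g * h) i) j = 0" if "i + j ~= D + E" for i j
    unfolding coeff_mult coeff_sum
  proof (intro sum.neutral ballI)
    fix k l assume "k \<in> {..i}" "l \<in> {..j}"
    then have "k + l ~= D \<or> (i - k) + (j - l) ~= E" using that by auto
    then show "coeff (coeff g k) l * coeff (coeff h (i - k)) (j - l) = 0"
      using hpolysD[OF assms(1)] hpolysD[OF assms(2)] by auto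
  qed
  then show ?thesis unfolding hpolys_def by blast
qed

lemma hpolys_scal: "scal c \<in> hpolys 0"
  by (auto simp: hpolys_def coeff_pCons split: nat.splits)

lemma hpolys_1: "1 \<in> hpolys 0"
  using hpolys_scal[of 1] by (simp add: pCons_one)

lemma hpolys_power: "g \<in> hpolys D ==> g ^ n \<in> hpolys (n * D)"
  by (induction n) (auto simp: hpolys_1 dest: hpolys_mult)

lemma hpolys_X: "X1 \<in> hpolys 1" "X2 \<in> hpolys 1"
  by (auto simp: hpolys_def X1_def X2_def coeff_pCons split: nat.splits)

lemma homogenize_mult:
  assumes "f \<in> vecs (Suc D)" "g \<in> vecs (Suc E)"
  shows "homogenize D f * homogenize E g = homogenize (D + E) (f * g)"
proof -
  have "homogenize D f * homogenize E g
      = homogenize (D + E) (dehomogenize (homogenize D f * homogenize E g))"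
    by (intro homogenize_dehomogenize[symmetric] hpolys_mult homogenize_hpolys)
  then show ?thesis using assms by (simp add: dehom.hom_mult dehomogenize_homogenize)
qed

lemma degree_0_bit_poly:
  assumes "degree (p :: bit poly) = 0" "p ~= 0"
  shows "p = 1"
proof -
  obtain c where "p = [:c:]" using assms(1) by (rule degree_eq_zeroE)
  then show ?thesis using assms(2) by (cases c) (auto simp: pCons_one)
qed

lemma unit_bit_poly: "(p :: bit poly) dvd 1 \<longleftrightarrow> p = 1"
  by (auto dest: degree_0_bit_poly)

lemma unit_bipoly: "(p :: bipoly) dvd 1 \<longleftrightarrow> p = 1"
  unfolding is_unit_poly_iff[of p] unit_bit_poly by (auto simp: pCons_one)

lemma irreducible_bipoly:
  "Factorial_Ring.irreducible (g :: bipoly) \<longleftrightarrow> g ~= 0 \<and> g ~= 1 \<and> (\<forall>a b. g = a * b --> a = 1 \<or> b = 1)"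
  unfolding Factorial_Ring.irreducible_def unit_bipoly by blast

lemma irreducible_bit_poly:
  "Factorial_Ring.irreducible (g :: bit poly) \<longleftrightarrow> g ~= 0 \<and> g ~= 1 \<and> (\<forall>a b. g = a * b --> a = 1 \<or> b = 1)"
  unfolding Factorial_Ring.irreducible_def unit_bit_poly by blast

text \<open>Over \<open>F\<^sub>2\<close> every nonzero scalar is one, so an irreducible form other than
  \<open>x\<^sub>2\<close> has leading coefficient one because \<open>x\<^sub>2\<close> does not
  divide it.\<close>

lemma PP_iff: "g \<in> PP \<longleftrightarrow> homogeneous g \<and> Factorial_Ring.irreducible g"
proof
  assume g: "homogeneous g \<and> Factorial_Ring.irreducible g"
  then obtain D where D: "g \<in> hpolys D" by (auto simp: homogeneous_iff)
  have g0: "g ~= 0" using g by (simp add: irreducible_bipoly)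
  have "g = X2 \<or> lead_coeff g = 1"
  proof (cases "degree g = D")
    case True
    have "coeff g (degree g) = monom (coeff (coeff g D) 0) 0"
      using coeff_hpolys[OF D, of D] True by simp
    then show ?thesis using g0 leading_coeff_0_iff[of g]
      by (cases "coeff (coeff g D) 0") (auto simp: monom_0 pCons_one)
  next
    case False
    have le: "degree g < D"
      using coeff_hpolys[OF D, of "degree g"] g0 leading_coeff_0_iff[of g] False by (cases "degree g \<le> D") auto
    have "g = X2 * homogenize (D - 1) (dehomogenize g)"
    proof -
      have f: "dehomogenize g \<in> vecs (Suc (D - 1))"
        using coeff_dehomogenize[of g] le by (auto simp: vecs_def coeff_eq_0)
      have x: "X2 * homogenize (D - 1) (dehomogenize g) \<in> hpolys D"
        using hpolys_mult[OF hpolys_X(2) homogenize_hpolys[of "D - 1" "dehomogenize g"]] le by simp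
      have "dehomogenize (X2 * homogenize (D - 1) (dehomogenize g)) = dehomogenize g"
        using f by (simp add: dehom.hom_mult dehomogenize_homogenize)
      then show ?thesis using homogenize_dehomogenize[OF D] homogenize_dehomogenize[OF x] by simp
    qed
    moreover have "X2 ~= 1" by (simp add: X2_def flip: pCons_one)
    ultimately have "homogenize (D - 1) (dehomogenize g) = 1" using g unfolding irreducible_bipoly by blast
    then show ?thesis using \<open>g = X2 * homogenize (D - 1) (dehomogenize g)\<close> by simp
  qed
  then show "g \<in> PP" using g by (simp add: PP_def)
qed (auto simp: PP_def)

lemma X2_PP: "X2 \<in> PP"
proof -
  have d: "degree X2 = 0" "X2 ~= 0" by (simp_all add: X2_def)
  have "Factorial_Ring.irreducible X2"
    unfolding irreducible_bipoly
  proof (intro conjI allI impI)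
    show "X2 ~= 0" by (rule d)
    show "X2 ~= 1" by (simp add: X2_def flip: pCons_one)
    fix a b assume ab: "X2 = a * b"
    then have "a ~= 0" "b ~= 0" using d by auto
    then have "degree a + degree b = 0" using d(1) unfolding ab by (simp add: degree_mult_eq)
    then have "degree a = 0" "degree b = 0" by simp_all
    then obtain a' b' where ab': "a = [:a':]" "b = [:b':]" by (elim degree_eq_zeroE) (rule that)
    then have e: "[:0, 1:] = a' * b'" using ab by (simp add: X2_def)
    then have nz: "a' ~= 0" "b' ~= 0" by auto
    have "degree a' + degree b' = 1" using nz arg_cong[OF e, of degree] by (simp add: degree_mult_eq)
    then consider "degree a' = 0" | "degree b' = 0" by linarith
    then have "a' = 1 \<or> b' = 1" using nz degree_0_bit_poly by cases blast+
    then show "a = 1 \<or> b = 1" using ab' by (auto simp: pCons_one)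
  qed
  then show ?thesis using hpolys_X by (auto simp: PP_def homogeneous_iff)
qed

lemma PP_hpolys:
  assumes "g \<in> PP" "g ~= X2"
  shows "g \<in> hpolys (degree g)" "lead_coeff g = 1" "degree (dehomogenize g) = degree g"
    "homogenize (degree g) (dehomogenize g) = g"
proof -
  show l: "lead_coeff g = 1" using assms by (simp add: PP_def)
  obtain D where D: "g \<in> hpolys D" using assms by (auto simp: PP_def homogeneous_iff)
  have "degree g = D" using hpolysD[OF D, of "degree g" 0] l by auto
  with D show g: "g \<in> hpolys (degree g)" by simp
  have "degree (dehomogenize g) \<le> degree g"
    by (intro degree_le) (auto simp: coeff_dehomogenize_hpolys[OF g])
  moreover have "coeff (dehomogenize g) (degree g) ~= 0"
    using l by (simp add: coeff_dehomogenize)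
  ultimately show "degree (dehomogenize g) = degree g" by (simp add: le_antisym le_degree)
  show "homogenize (degree g) (dehomogenize g) = g" using homogenize_dehomogenize[OF g] .
qed

lemma irreducible_degree_pos: "Factorial_Ring.irreducible (f :: bit poly) ==> degree f > 0"
  using degree_0_bit_poly[of f] unfolding irreducible_bit_poly by blast

lemma dehomogenize_irreducible:
  assumes "g \<in> PP" "g ~= X2"
  shows "Factorial_Ring.irreducible (dehomogenize g)"
proof -
  let ?f = "dehomogenize g"
  note h = PP_hpolys[OF assms]
  have irr: "Factorial_Ring.irreducible g" using assms by (simp add: PP_def)
  have f0: "?f ~= 0" using h(4) irr by (auto simp: irreducible_bipoly homogenize_def)
  have f1: "?f ~= 1"
  proof
    assume f1: "?f = 1"
    then have "degree g = 0" using h(3) by simp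
    then have "g = 1" using h(4) f1 by (simp add: homogenize_def monom_0 pCons_one)
    then show False using irr by (simp add: irreducible_bipoly)
  qed
  have "a = 1 \<or> b = 1" if ab: "?f = a * b" for a b
  proof -
    have nz: "a ~= 0" "b ~= 0" using ab f0 by auto
    then have d: "degree g = degree a + degree b" using h(3) ab by (simp add: degree_mult_eq)
    have v: "a \<in> vecs (Suc (degree a))" "b \<in> vecs (Suc (degree b))" by (simp_all add: vecs_degree)
    have "g = homogenize (degree a) a * homogenize (degree b) b"
      using h(4) v by (simp add: homogenize_mult d ab)
    then consider "homogenize (degree a) a = 1" | "homogenize (degree b) b = 1"
      using irr unfolding irreducible_bipoly by blast
    then show ?thesis
      using dehomogenize_homogenize[OF v(1)] dehomogenize_homogenize[OF v(2)] by cases simp_all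
  qed
  then show ?thesis using f0 f1 by (simp add: irreducible_bit_poly)
qed

lemma lead_coeff_1_mult:
  assumes "lead_coeff (a * b :: bipoly) = 1"
  shows "lead_coeff a = 1" "lead_coeff b = 1"
proof -
  have "lead_coeff a * lead_coeff b = 1" using assms by (simp add: lead_coeff_mult)
  then have "lead_coeff a dvd 1" "lead_coeff b dvd 1"
    using dvd_triv_left[of "lead_coeff a" "lead_coeff b"] dvd_triv_right[of "lead_coeff b" "lead_coeff a"] by simp_all
  then show "lead_coeff a = 1" "lead_coeff b = 1" unfolding unit_bit_poly .
qed

text \<open>Factors of a form are forms, and dehomogenization is multiplicative, so a factorization of the
  homogenization comes from one of \<open>f\<close>.\<close>

lemma homogenize_PP:
  assumes f: "Factorial_Ring.irreducible f"
  shows "homogenize (degree f) f \<in> PP" "homogenize (degree f) f ~= X2"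
    "dehomogenize (homogenize (degree f) f) = f"
proof -
  let ?g = "homogenize (degree f) f"
  show dg: "dehomogenize ?g = f" by (rule dehomogenize_homogenize) (simp add: vecs_degree)
  have f01: "f ~= 0" "f ~= 1" using f by (auto simp: irreducible_bit_poly)
  show "?g ~= X2" using dg f01 by auto
  have "coeff f (degree f) = 1" using f01 leading_coeff_0_iff[of f] by (cases "coeff f (degree f)") auto
  then have c: "coeff ?g (degree f) = 1" by (simp add: coeff_homogenize monom_0 pCons_one)
  then have "degree ?g = degree f"
    by (intro antisym degree_le le_degree) (auto simp: coeff_homogenize)
  then have lc: "lead_coeff ?g = 1" using c by simp
  have "a = 1 \<or> b = 1" if ab: "?g = a * b" for a b
  proof -
    have l: "lead_coeff a = 1" "lead_coeff b = 1" using lead_coeff_1_mult[of a b] lc ab by auto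
    have dd: "a = 1" if "dehomogenize a = 1" "lead_coeff a = 1" for a
    proof -
      have "coeff (dehomogenize a) (degree a) = 1" using that(2) by (simp add: coeff_dehomogenize)
      then have "degree a = 0" using that(1) coeff_eq_0[of "1 :: bit poly" "degree a"] by (cases "degree a") auto
      then obtain c where "a = [:c:]" by (rule degree_eq_zeroE)
      then show ?thesis using that(2) by (simp add: pCons_one)
    qed
    have "f = dehomogenize a * dehomogenize b" using dg ab by (simp add: dehom.hom_mult)
    then consider "dehomogenize a = 1" | "dehomogenize b = 1" using f unfolding irreducible_bit_poly by blast
    then show ?thesis using dd l by cases blast+
  qed
  moreover have "?g ~= 0" "?g ~= 1" using dg f01 by auto
  ultimately have "Factorial_Ring.irreducible ?g" unfolding irreducible_bipoly by blast
  moreover have "homogeneous ?g" unfolding homogeneous_iff by (rule exI, rule homogenize_hpolys)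
  ultimately show "?g \<in> PP" by (simp add: PP_iff)
qed

lemma dehomogenize_inj_PP:
  assumes "g \<in> PP" "g ~= X2" "h \<in> PP" "h ~= X2" "dehomogenize g = dehomogenize h"
  shows "g = h"
  using PP_hpolys(3,4)[OF assms(1,2)] PP_hpolys(3,4)[OF assms(3,4)] unfolding assms(5) by simp

text \<open>An element of least degree generates, by division with remainder.\<close>

lemma ideal_principal:
  fixes I :: "bit poly set"
  assumes "a \<in> I" "a ~= 0" and sub: "!!p q. p \<in> I ==> q \<in> I ==> p + q \<in> I"
    and mul: "!!p q. p \<in> I ==> q * p \<in> I"
  shows "\<exists>g\<in>I. g ~= 0 \<and> (\<forall>p\<in>I. g dvd p)"
proof -
  define D where "D = (LEAST d. \<exists>g\<in>I. g ~= 0 \<and> degree g = d)"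
  have "\<exists>g\<in>I. g ~= 0 \<and> degree g = D"
    unfolding D_def by (rule LeastI[of _ "degree a"]) (use assms in blast)
  then obtain g where g: "g \<in> I" "g ~= 0" "degree g = D" by blast
  have min: "D \<le> degree p" if "p \<in> I" "p ~= 0" for p
    unfolding D_def by (rule Least_le) (use that in blast)
  have "g dvd p" if p: "p \<in> I" for p
  proof -
    have "p mod g = p + (p div g) * g"
      using minus_div_mult_eq_mod[of p g] by simp
    then have "p mod g \<in> I" using sub[OF p mul[OF g(1)]] by simp
    moreover have "p mod g = 0 \<or> degree (p mod g) < degree g" using g(2) by (rule degree_mod_less)
    ultimately have "p mod g = 0" using min[of "p mod g"] g(3) by linarith
    then show ?thesis by (simp add: dvd_eq_mod_eq_0)
  qed
  with g show ?thesis by blast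
qed

lemma irreducible_imp_prime:
  fixes f :: "bit poly"
  assumes f: "Factorial_Ring.irreducible f" and dv: "f dvd a * b"
  shows "f dvd a \<or> f dvd b"
proof -
  let ?I = "{x * f + y * a | x y. True}"
  have f0: "f ~= 0" using f by (simp add: irreducible_bit_poly)
  have "\<exists>g\<in>?I. g ~= 0 \<and> (\<forall>p\<in>?I. g dvd p)"
  proof (rule ideal_principal[of f])
    have "f = 1 * f + 0 * a" by simp
    then show "f \<in> ?I" by blast
    show "f ~= 0" by (rule f0)
    fix p q assume "p \<in> ?I"
    then obtain x y where p: "p = x * f + y * a" by blast
    have "q * p = (q * x) * f + (q * y) * a" by (simp add: p algebra_simps)
    then show "q * p \<in> ?I" by blast
    assume "q \<in> ?I"
    then obtain x' y' where q: "q = x' * f + y' * a" by blast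
    have "p + q = (x + x') * f + (y + y') * a" by (simp add: p q algebra_simps)
    then show "p + q \<in> ?I" by blast
  qed
  then obtain g where g: "g \<in> ?I" "!!p. p \<in> ?I ==> g dvd p" by blast
  have "f = 1 * f + 0 * a" "a = 0 * f + 1 * a" by simp_all
  then have "f \<in> ?I" "a \<in> ?I" by blast+
  then have "g dvd f" "g dvd a" using g(2) by blast+
  then obtain h where h: "f = g * h" by (auto simp: dvd_def)
  then consider "g = 1" | "h = 1" using f unfolding irreducible_bit_poly by blast
  then show ?thesis
  proof cases
    case 1
    then obtain x y where "1 = x * f + y * a" using g(1) by auto
    then have "b * 1 = b * (x * f + y * a)" by (rule arg_cong)
    then have "b = (x * b) * f + y * (a * b)" by (simp add: algebra_simps)
    moreover have "f dvd (x * b) * f + y * (a * b)" by (intro dvd_add dvd_mult dvd_triv_right dv)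
    ultimately show ?thesis by simp
  next
    case 2
    then show ?thesis using h \<open>g dvd a\<close> by simp
  qed
qed

lemma irreducible_power_dvd_cancel:
  fixes f :: "bit poly"
  assumes f: "Factorial_Ring.irreducible f" and s: "\<not> f dvd s" and dv: "f ^ n dvd s * g"
  shows "f ^ n dvd g"
  using dv
proof (induction n arbitrary: g)
  case (Suc n)
  have "f dvd s * g" using Suc.prems dvd_mult_left[of f "f ^ n" "s * g"] by simp
  then have "f dvd g" using irreducible_imp_prime[OF f] s by blast
  then obtain g' where g': "g = f * g'" by (auto simp: dvd_def)
  then have "f * f ^ n dvd f * (s * g')" using Suc.prems by (simp add: ac_simps)
  then have "f ^ n dvd s * g'" using f by (subst (asm) dvd_mult_cancel_left) (simp add: irreducible_bit_poly)
  then show ?case using Suc.IH[of g'] g' by (simp add: mult_dvd_mono)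
qed simp


section \<open>Blocks of the other irreducible polynomials\<close>

text \<open>The module structure over \<open>F\<^sub>2[x]\<close> defined by an additive operator
  \<open>T\<close>.\<close>

definition poly_act :: "('v::boolean_group => 'v) => bit poly => 'v => 'v" where
  "poly_act T p v = fold_coeffs (\<lambda>a x. scl a v + T x) p 0"

locale additive_endo =
  fixes V :: "'v::boolean_group set" and T :: "'v => 'v"
  assumes subV: "subgrp V" and T_in: "!!x. x \<in> V ==> T x \<in> V"
    and T_add: "!!x y. x \<in> V ==> y \<in> V ==> T (x + y) = T x + T y"
begin

lemma V0: "0 \<in> V" and V_add: "x \<in> V ==> y \<in> V ==> x + y \<in> V"
  using subV by (auto simp: subgrp_def)

lemma T_0: "T 0 = 0"
  using T_add[OF V0 V0] by simp

lemma T_scl: "x \<in> V ==> T (scl c x) = scl c (T x)"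
  by (cases c) (auto simp: T_0)

lemma act_pCons: "poly_act T (pCons a p) v = scl a v + T (poly_act T p v)"
  by (cases "a = 0 \<and> p = 0")
    (auto simp: poly_act_def T_0 fold_coeffs_pCons_coeff_not_0_eq fold_coeffs_pCons_not_0_0_eq)

lemma act_0 [simp]: "poly_act T 0 v = 0"
  by (simp add: poly_act_def)

lemma act_1 [simp]: "poly_act T 1 v = v"
  using act_pCons[of 1 0 v] by (simp add: T_0 pCons_one)

lemma act_in: "v \<in> V ==> poly_act T p v \<in> V"
  by (induction p) (auto simp: act_pCons V0 intro!: V_add T_in scl_in[OF subV])

lemma act_vec_0: "poly_act T p 0 = 0"
  by (induction p) (auto simp: act_pCons T_0)

lemma act_add: "v \<in> V ==> poly_act T (p + q) v = poly_act T p v + poly_act T q v"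
proof (induction p q rule: poly_induct2)
  case (pCons a p b q)
  then show ?case by (simp add: act_pCons scl_add T_add act_in ac_simps)
qed simp

lemma act_vec_add: "u \<in> V ==> v \<in> V ==> poly_act T p (u + v) = poly_act T p u + poly_act T p v"
  by (induction p) (simp_all add: act_pCons scl_add_right T_add act_in ac_simps)

lemma act_smult: "v \<in> V ==> poly_act T (smult a p) v = scl a (poly_act T p v)"
  by (cases a) auto

lemma act_mult: "v \<in> V ==> poly_act T (p * q) v = poly_act T p (poly_act T q v)"
proof (induction p)
  case (pCons a p)
  then show ?case by (simp add: act_add act_smult act_pCons[of 0] act_pCons[of a])
qed simp

lemma act_T: "v \<in> V ==> poly_act T p (T v) = T (poly_act T p v)"
  by (induction p) (simp_all add: act_pCons T_0 T_add T_scl scl_in[OF subV] T_in act_in)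

lemma power_in: "v \<in> V ==> (T ^^ i) v \<in> V"
  by (induction i) (auto intro: T_in)

lemma act_monom: "v \<in> V ==> poly_act T (monom 1 i) v = (T ^^ i) v"
  by (induction i) (auto simp: monom_0 monom_Suc act_pCons pCons_one T_0)

lemma comb_powers:
  assumes "v \<in> V" "p \<in> vecs d"
  shows "comb (map (\<lambda>i. (T ^^ i) v) [0..<d]) p = poly_act T p v"
  using assms
proof (induction d arbitrary: p v)
  case 0
  then show ?case by (simp add: vecs_0)
next
  case (Suc d)
  obtain a q where p: "p = pCons a q" "q \<in> vecs d" using Suc.prems(2) by (auto simp: vecs_Suc)
  have m: "map (\<lambda>i. (T ^^ i) v) [0..<Suc d] = v # map (\<lambda>i. (T ^^ i) (T v)) [0..<d]"
    by (simp add: map_upt_Suc funpow_swap1 del: upt_Suc)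
  show ?case
    unfolding m p(1) comb_pCons act_pCons using Suc.IH[OF T_in[OF Suc.prems(1)] p(2)] Suc.prems(1)
    by (simp add: act_T)
qed

text \<open>The powers of \<open>T\<close> applied to \<open>u\<^sub>0\<close> repeat, so some polynomial
  kills \<open>u\<^sub>0\<close>; one of least degree killing a nonzero vector is irreducible.\<close>

lemma exists_irreducible_annihilator:
  assumes fin: "finite V" and u0: "u0 \<in> V" "u0 ~= 0"
  shows "\<exists>u f. u \<in> V \<and> u ~= 0 \<and> Factorial_Ring.irreducible f \<and> poly_act T f u = 0"
proof -
  let ?P = "\<lambda>d. \<exists>u p. u \<in> V \<and> u ~= 0 \<and> p ~= 0 \<and> poly_act T p u = 0 \<and> degree p = d"
  have "\<exists>d. ?P d"
  proof -
    have "\<not> inj_on (\<lambda>i. (T ^^ i) u0) {..card V}"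
    proof
      assume "inj_on (\<lambda>i. (T ^^ i) u0) {..card V}"
      then have "card {..card V} \<le> card V"
        using power_in[OF u0(1)] fin by (intro card_inj_on_le[of "\<lambda>i. (T ^^ i) u0"]) auto
      then show False by simp
    qed
    then obtain i j where ij: "(T ^^ i) u0 = (T ^^ j) u0" "i ~= j" by (auto simp: inj_on_def)
    let ?p = "monom 1 i + monom 1 j :: bit poly"
    have "coeff ?p i = 1" using ij(2) by simp
    then have "?p ~= 0" by (intro notI) simp
    moreover have "poly_act T ?p u0 = 0" using u0 ij by (simp add: act_add act_monom)
    ultimately show ?thesis using u0 by (intro exI[of _ "degree ?p"] exI[of _ u0] exI[of _ ?p]) simp
  qed
  then have "?P (LEAST d. ?P d)" by (rule LeastI_ex)
  then obtain u f where u: "u \<in> V" "u ~= 0" and f: "f ~= 0" "poly_act T f u = 0" "degree f = (LEAST d. ?P d)"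
    by (elim exE conjE) (rule that)
  have min: "degree f \<le> degree p" if "w \<in> V" "w ~= 0" "p ~= 0" "poly_act T p w = 0" for w p
    unfolding f(3) by (rule Least_le) (intro exI[of _ w] exI[of _ p] conjI that refl)
  have "a = 1 \<or> b = 1" if ab: "f = a * b" for a b
  proof -
    have nz: "a ~= 0" "b ~= 0" using f(1) ab by auto
    have d: "degree f = degree a + degree b" using nz by (simp add: ab degree_mult_eq)
    show ?thesis
    proof (cases "poly_act T b u = 0")
      case True
      then have "degree f \<le> degree b" using u nz by (intro min)
      then show ?thesis using d nz degree_0_bit_poly[of a] by simp
    next
      case False
      have "poly_act T a (poly_act T b u) = 0" using f(2) u by (simp add: ab act_mult)
      then have "degree f \<le> degree a" using u nz False by (intro min) (auto intro: act_in)
      then show ?thesis using d nz degree_0_bit_poly[of b] by simp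
    qed
  qed
  moreover have "f ~= 1" using f(2) u by auto
  ultimately have "Factorial_Ring.irreducible f" unfolding irreducible_bit_poly using f(1) by blast
  with u f(2) show ?thesis by blast
qed

text \<open>Otherwise \<open>f\<close> would be onto, hence injective, on the stable image, which contains
  \<open>u\<close>.\<close>

lemma not_in_all_images:
  assumes fin: "finite V" and u: "u \<in> V" "u ~= 0" "poly_act T f u = 0"
  shows "\<exists>n. u \<notin> (\<lambda>v. poly_act T (f ^ n) v) ` V"
proof (rule ccontr)
  assume "\<not> ?thesis"
  then have all: "u \<in> (\<lambda>v. poly_act T (f ^ n) v) ` V" for n by blast
  let ?c = "\<lambda>n. card ((\<lambda>v. poly_act T (f ^ n) v) ` V)"
  let ?I = "\<lambda>n. (\<lambda>v. poly_act T (f ^ n) v) ` V"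
  have dec: "?I (Suc n) = poly_act T f ` ?I n" for n
    unfolding image_image by (intro image_cong refl) (simp add: act_mult)
  have strict: "?c (Suc n) < ?c n" for n
  proof -
    have "\<not> inj_on (poly_act T f) (?I n)"
    proof
      assume inj: "inj_on (poly_act T f) (?I n)"
      have "0 \<in> ?I n" using V0 act_vec_0 by (intro image_eqI[of _ _ 0]) simp_all
      from inj_onD[OF inj _ all this] u(3) act_vec_0 show False using u(2) by simp
    qed
    then have "?c (Suc n) ~= ?c n" unfolding dec using fin eq_card_imp_inj_on[of "?I n" "poly_act T f"] by auto
    moreover have "?c (Suc n) \<le> ?c n" unfolding dec using fin by (intro card_image_le) simp
    ultimately show ?thesis by simp
  qed
  have "?c n + n \<le> ?c 0" for n
  proof (induction n)
    case (Suc n)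
    then show ?case using strict[of n] by simp
  qed simp
  from this[of "Suc (?c 0)"] show False by simp
qed

end

lemma canonical_pair_Some:
  assumes "g ~= X2"
  shows "canonical_pair (Some g, n) = (off_diag (1\<^sub>m (n * degree (dehomogenize g))),
    off_diag (frobenius_mat (dehomogenize g ^ n)))"
  using assms by (simp add: canonical_pair_def Let_def)

lemma degree_power_bit: "(f :: bit poly) ~= 0 ==> degree (f ^ n) = n * degree f"
  by (induction n) (auto simp: degree_mult_eq)

text \<open>If \<open>\<alpha>\<close> is nondegenerate, then \<open>\<beta>\<close> is
  \<open>\<alpha>\<close> composed with an operator \<open>T\<close>, and the classification of
  pairs becomes that of the \<open>F\<^sub>2[T]\<close>-module structure.\<close>

lemma exists_form_operator:
  fixes \<alpha> \<beta> :: "'v::boolean_group => 'v => bit"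
  assumes V: "subgrp V" "finite V" and \<alpha>: "alt_form \<alpha>" and \<beta>: "alt_form \<beta>"
    and nd: "!!x. x \<in> V ==> (!!y. y \<in> V ==> \<alpha> x y = 0) ==> x = 0"
  shows "\<exists>T. additive_endo V T \<and> (\<forall>x\<in>V. \<forall>y\<in>V. \<alpha> (T x) y = \<beta> x y)"
proof -
  have ex: "\<exists>t\<in>V. \<forall>y\<in>V. \<beta> x y = \<alpha> y t" for x
  proof (rule functional_representation[OF V(1) V])
    show "additive_on V (\<lambda>x. \<alpha> x y)" "additive_on V (\<alpha> z)" "additive_on V (\<beta> x)" for y z
      using \<alpha> \<beta> by (simp_all add: alt_additive alt_additive_left)
    show "\<beta> x y = 0" if "y \<in> V" "!!z. z \<in> V ==> \<alpha> y z = 0" for y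
      using nd[OF that] by (simp add: alt_0_right[OF \<beta>])
  qed
  define T where "T x = (SOME t. t \<in> V \<and> (\<forall>y\<in>V. \<beta> x y = \<alpha> y t))" for x
  have "T x \<in> V \<and> (\<forall>y\<in>V. \<beta> x y = \<alpha> y (T x))" for x
    unfolding T_def by (rule someI_ex) (use ex[of x] in blast)
  then have TV: "T x \<in> V" and T: "y \<in> V ==> \<alpha> (T x) y = \<beta> x y" for x y
    by (simp_all add: alt_sym[OF \<alpha>, of "T x"])
  have "T (x + y) = T x + T y" for x y
  proof -
    have "T (x + y) + (T x + T y) = 0"
      using V(1) TV by (intro nd) (auto simp: subgrpD alt_add[OF \<alpha>] alt_add[OF \<beta>] T)
    then show ?thesis by (simp add: add_eq_0_iff_eq)
  qed
  then have "additive_endo V T" using V(1) TV by unfold_locales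
  with T show ?thesis by blast
qed

text \<open>Choose \<open>u = f\<^sup>n\<^sup>-\<^sup>1(T) v\<close> killed by \<open>f(T)\<close> with
  \<open>n\<close> maximal, so that \<open>u\<close> is not in the image of
  \<open>f\<^sup>n(T)\<close>. The alternative gives \<open>w\<close> killed by
  \<open>f\<^sup>n(T)\<close> with \<open>\<alpha>(u, w) = 1\<close>. The cyclic modules of
  \<open>v\<close> and \<open>w\<close> then pair perfectly: a nonzero annihilator would contain the
  socle element \<open>u\<close>.\<close>

lemma split_finite_block:
  fixes \<alpha> \<beta> :: "'v::boolean_group => 'v => bit"
  assumes V: "subgrp V" "finite V" and \<alpha>: "alt_form \<alpha>" and \<beta>: "alt_form \<beta>"
    and IH: "!!W. subgrp W ==> W \<subset> V ==> \<exists>bs ps. canonical_basis \<alpha> \<beta> W bs ps"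
    and nd: "!!x. x \<in> V ==> (!!y. y \<in> V ==> \<alpha> x y = 0) ==> x = 0"
    and ne: "u0 \<in> V" "u0 ~= 0"
  shows "\<exists>bs ps. canonical_basis \<alpha> \<beta> V bs ps"
proof -
  obtain T where T: "additive_endo V T" and Tab': "\<forall>x\<in>V. \<forall>y\<in>V. \<alpha> (T x) y = \<beta> x y"
    using exists_form_operator[OF V \<alpha> \<beta> nd] by blast
  then have Tab: "\<alpha> (T x) y = \<beta> x y" if "x \<in> V" "y \<in> V" for x y using that by blast
  interpret additive_endo V T by (rule T)
  have adjT: "\<alpha> (T x) y = \<alpha> x (T y)" if "x \<in> V" "y \<in> V" for x y
    using that Tab[of x y] Tab[of y x] by (simp add: alt_sym[OF \<beta>, of x] alt_sym[OF \<alpha>, of x])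
  have adj: "\<alpha> (poly_act T p x) y = \<alpha> x (poly_act T p y)" if "x \<in> V" "y \<in> V" for p x y
    using that
  proof (induction p arbitrary: x y)
    case (pCons a p)
    have "\<alpha> (T (poly_act T p x)) y = \<alpha> (poly_act T p x) (T y)"
      using pCons.prems by (intro adjT act_in)
    also have "... = \<alpha> x (poly_act T p (T y))" using pCons.prems by (intro pCons.IH T_in)
    also have "... = \<alpha> x (T (poly_act T p y))" using pCons.prems by (simp add: act_T)
    finally show ?case
      by (simp add: act_pCons alt_add[OF \<alpha>] alt_add_right[OF \<alpha>] alt_scl[OF \<alpha>]
        alt_sym[OF \<alpha>, of x "scl a y"] alt_sym[OF \<alpha>, of y x])
  qed (simp add: alt_0[OF \<alpha>] alt_0_right[OF \<alpha>])
  obtain u f where u: "u \<in> V" "u ~= 0" and f: "Factorial_Ring.irreducible f" and fu: "poly_act T f u = 0"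
    using exists_irreducible_annihilator[OF V(2) ne] by blast
  let ?I = "\<lambda>n. (\<lambda>v. poly_act T (f ^ n) v) ` V"
  have "\<exists>n. u \<notin> ?I n" by (rule not_in_all_images[OF V(2) u fu])
  define m where "m = (LEAST n. u \<notin> ?I n)"
  have um: "u \<notin> ?I m" unfolding m_def by (rule LeastI_ex) fact
  have "m ~= 0"
  proof
    assume "m = 0"
    then have "u = poly_act T (f ^ m) u" by simp
    then show False using um u(1) by blast
  qed
  then obtain k where k: "m = Suc k" by (cases m) auto
  have "u \<in> ?I k" using not_less_Least[of k "\<lambda>n. u \<notin> ?I n"] k unfolding m_def by auto
  then obtain v where v: "v \<in> V" "u = poly_act T (f ^ k) v" by blast
  have fv: "poly_act T (f ^ m) v = 0" using fu v by (simp add: k act_mult)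
  have "\<exists>w\<in>V. (\<forall>x\<in>?I m. \<alpha> w x = 0) \<and> \<alpha> w u ~= 0"
  proof (rule ccontr)
    assume n: "\<not> ?thesis"
    have "\<exists>x\<in>?I m. \<forall>w\<in>V. \<alpha> w u = \<alpha> w x"
    proof (rule functional_representation[OF V(1)])
      show "subgrp (?I m)"
        unfolding subgrp_def
      proof (intro conjI ballI)
        show "0 \<in> ?I m" using V0 act_vec_0 by (intro image_eqI[of _ _ 0]) simp_all
        fix x y assume "x \<in> ?I m" "y \<in> ?I m"
        then obtain x' y' where xy: "x' \<in> V" "y' \<in> V" "x = poly_act T (f ^ m) x'" "y = poly_act T (f ^ m) y'"
          by blast
        show "x + y \<in> ?I m"
          by (rule image_eqI[of _ _ "x' + y'"]) (simp_all add: xy act_vec_add V_add)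
      qed
      show "finite (?I m)" using V(2) by simp
      show "additive_on V (\<lambda>w. \<alpha> w x)" "additive_on V (\<lambda>w. \<alpha> w u)" "additive_on (?I m) (\<alpha> w)" for x w
        using \<alpha> by (simp_all add: alt_additive alt_additive_left)
      show "\<alpha> w u = 0" if "w \<in> V" "!!x. x \<in> ?I m ==> \<alpha> w x = 0" for w
        using n that by blast
    qed
    then obtain x where x: "x \<in> ?I m" "!!w. w \<in> V ==> \<alpha> w u = \<alpha> w x" by blast
    have xV: "x \<in> V" using x(1) act_in by auto
    have "u + x = 0"
    proof (rule nd)
      fix w assume "w \<in> V"
      then show "\<alpha> (u + x) w = 0"
        using x(2)[of w] by (simp add: alt_sym[OF \<alpha>, of _ w] alt_add_right[OF \<alpha>])
    qed (use u xV V_add in blast)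
    then show False using x(1) um by (simp add: add_eq_0_iff_eq)
  qed
  then obtain w where w: "w \<in> V" "!!x. x \<in> V ==> \<alpha> w (poly_act T (f ^ m) x) = 0" "\<alpha> w u ~= 0" by blast
  have fw: "poly_act T (f ^ m) w = 0"
    using w adj by (intro nd act_in) auto
  define d where "d = degree (f ^ m)"
  have f0: "f ~= 0" using f by (simp add: irreducible_bit_poly)
  have dm: "d = m * degree f" using f0 by (simp add: d_def degree_power_bit)
  have dpos: "d > 0" using irreducible_degree_pos[OF f] k unfolding dm by simp
  define vs where "vs = map (\<lambda>i. (T ^^ i) v) [0..<d]"
  define cs where "cs = map (\<lambda>i. (T ^^ i) w) [0..<d]"
  have len: "length vs = d" "length cs = d" by (simp_all add: vs_def cs_def)
  have vact: "comb vs p = poly_act T p v" if "p \<in> vecs d" for p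
    unfolding vs_def by (rule comb_powers[OF v(1) that])
  have cact: "comb cs p = poly_act T p w" if "p \<in> vecs d" for p
    unfolding cs_def by (rule comb_powers[OF w(1) that])
  have mod: "poly_act T p x = poly_act T (p mod f ^ m) x" "p mod f ^ m \<in> vecs d"
    if "x \<in> V" "poly_act T (f ^ m) x = 0" for p x
  proof -
    have "p = p mod f ^ m + (p div f ^ m) * f ^ m" by (rule mod_div_mult_eq[symmetric])
    then have "poly_act T p x = poly_act T (p mod f ^ m + (p div f ^ m) * f ^ m) x" by (rule arg_cong)
    also have "... = poly_act T (p mod f ^ m) x" using that by (simp add: act_add act_mult act_vec_0)
    finally show "poly_act T p x = poly_act T (p mod f ^ m) x" .
    have "f ^ m ~= 0" using f0 by simp
    from degree_mod_less[OF this, of p] show "p mod f ^ m \<in> vecs d" by (simp add: vecs_degree d_def)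
  qed
  have vspan: "poly_act T p v \<in> range (comb vs)" for p
    using mod[OF v(1) fv, of p] vact by (metis rangeI)
  have cspan: "poly_act T p w \<in> range (comb cs)" for p
    using mod[OF w(1) fw, of p] cact by (metis rangeI)
  have nondeg: "\<exists>y\<in>range (comb vs). \<alpha> y (comb cs q) ~= 0" if q: "q \<in> vecs (length cs)" "q ~= 0" for q
  proof (rule ccontr)
    assume n: "\<not> ?thesis"
    define I where "I = {r. \<forall>p. \<alpha> v (poly_act T (p * r) w) = 0}"
    have "\<exists>g\<in>I. g ~= 0 \<and> (\<forall>p\<in>I. g dvd p)"
    proof (rule ideal_principal[of "f ^ m"])
      show "f ^ m \<in> I" using fw w by (simp add: I_def act_mult act_vec_0 alt_0_right[OF \<alpha>])
      show "f ^ m ~= 0" using f0 by simp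
      show "p + q \<in> I" if "p \<in> I" "q \<in> I" for p q
        using that w by (simp add: I_def distrib_left act_add alt_add_right[OF \<alpha>])
      show "q * p \<in> I" if "p \<in> I" for p q
        using that by (simp add: I_def mult.assoc[symmetric])
    qed
    then obtain g where g: "g \<in> I" "!!p. p \<in> I ==> g dvd p" by blast
    have "f ^ m \<in> I" using fw w by (simp add: I_def act_mult act_vec_0 alt_0_right[OF \<alpha>])
    then have "g dvd f ^ m" by (rule g(2))
    then obtain s where s: "f ^ m = g * s" by (auto simp: dvd_def)
    have "f ^ k \<notin> I"
    proof
      assume "f ^ k \<in> I"
      then have "\<alpha> v (poly_act T (1 * f ^ k) w) = 0" unfolding I_def by blast
      then have "\<alpha> u w = 0" using adj[OF v(1) w(1), of "f ^ k"] v(2) by simp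
      then show False using w(3) by (simp add: alt_sym[OF \<alpha>, of w])
    qed
    have "\<not> f dvd s"
    proof
      assume "f dvd s"
      then obtain s' where "s = f * s'" by (auto simp: dvd_def)
      then have "f * f ^ k = f * (s' * g)" using s k by (simp add: ac_simps)
      then have "f ^ k = s' * g" using f0 by simp
      moreover have "s' * g \<in> I" using g(1) by (simp add: I_def mult.assoc[symmetric])
      ultimately show False using \<open>f ^ k \<notin> I\<close> by simp
    qed
    then have "f ^ m dvd g" by (rule irreducible_power_dvd_cancel[OF f]) (simp add: s mult.commute)
    moreover have "q \<in> I"
    proof -
      have "\<alpha> v (poly_act T (p * q) w) = 0" for p
      proof -
        have "\<alpha> (poly_act T p v) (poly_act T q w) = 0"
          using n vspan[of p] cact[of q] q len by auto
        then show ?thesis using adj[OF v(1) act_in[OF w(1)], of p] w by (simp add: act_mult)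
      qed
      then show ?thesis by (simp add: I_def)
    qed
    then have "g dvd q" by (rule g(2))
    ultimately have "f ^ m dvd q" by (rule dvd_trans)
    then have "degree (f ^ m) \<le> degree q" using q(2) by (rule dvd_imp_degree_le)
    then show False using q len by (auto simp: vecs_degree d_def)
  qed
  obtain bs where bs: "length bs = d" "set bs \<subseteq> range (comb vs)"
    and dual: "!!i j. i < d ==> j < d ==> \<alpha> (bs ! i) (cs ! j) = (if i = j then 1 else 0)"
    using dual_family[OF \<alpha> subgrp_range_comb nondeg] len by auto
  have span: "range (comb bs) = range (comb vs)"
    by (rule dual_family_span[of \<alpha> bs cs vs]) (simp_all add: bs dual len \<alpha>)
  have vV: "set vs \<subseteq> V" "set cs \<subseteq> V" using power_in v w by (auto simp: vs_def cs_def)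
  have iso: "\<alpha> ((T ^^ i) x) ((T ^^ j) x) = 0 \<and> \<beta> ((T ^^ i) x) ((T ^^ j) x) = 0" if "x \<in> V" for i j x
    by (rule chain_isotropic[OF \<alpha> \<beta>, where L = "Suc (i + j)" and V = V and s = "\<lambda>i. (T ^^ i) x"])
      (use that power_in Tab in auto)
  define g where "g = homogenize (degree f) f"
  have g: "g \<in> PP" "g ~= X2" "dehomogenize g = f" using homogenize_PP[OF f] by (simp_all add: g_def)
  show ?thesis
  proof (rule split_block_perfect[of V \<alpha> \<beta> \<alpha> "(Some g, m)" "1\<^sub>m d" "frobenius_mat (f ^ m)" d bs cs, OF V(1) \<alpha> \<beta> _ IH])
    show "(Some g, m) \<in> indices" using g k by (simp add: indices_def PPe_def)
    show "canonical_pair (Some g, m) = (off_diag (1\<^sub>m d), off_diag (frobenius_mat (f ^ m)))"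
      using g by (simp add: canonical_pair_Some dm)
    show "frobenius_mat (f ^ m) \<in> carrier_mat d d" by (simp add: frobenius_mat_def d_def)
    show bV: "set bs \<subseteq> V" using bs(2) comb_in[OF V(1) vV(1)] by auto
    show "\<alpha> b b' = 0 \<and> \<beta> b b' = 0" if "b \<in> set bs" "b' \<in> set bs" for b b'
    proof -
      have "b \<in> range (comb vs)" "b' \<in> range (comb vs)" using that bs(2) by (simp_all add: subsetD)
      then obtain p q where "b = comb vs p" "b' = comb vs q" by (elim rangeE) (rule that)
      moreover have "\<alpha> (comb vs p) (comb vs q) = 0"
        by (rule alt_comb_comb_0[OF \<alpha>]) (use iso v in \<open>auto simp: vs_def\<close>)
      moreover have "\<beta> (comb vs p) (comb vs q) = 0"
        by (rule alt_comb_comb_0[OF \<beta>]) (use iso v in \<open>auto simp: vs_def\<close>)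
      ultimately show ?thesis by simp
    qed
    show "\<alpha> x x' = 0 \<and> \<beta> x x' = 0" if "x \<in> set cs" "x' \<in> set cs" for x x'
      using iso w that by (auto simp: cs_def)
    show "\<alpha> (bs ! i) (cs ! j) = 1\<^sub>m d $$ (i, j) \<and> \<beta> (bs ! i) (cs ! j) = frobenius_mat (f ^ m) $$ (i, j)"
      if ij: "i < d" "j < d" for i j
    proof -
      have biV: "bs ! i \<in> V" using ij bs(1) bV by (simp add: subsetD)
      have csj: "cs ! j = (T ^^ j) w" using ij by (simp add: cs_def)
      have "\<beta> (bs ! i) (cs ! j) = \<alpha> (bs ! i) (T (cs ! j))"
        using Tab[of "cs ! j" "bs ! i"] biV power_in[OF w(1)] unfolding csj
        by (simp add: alt_sym[OF \<alpha>, of "bs ! i"] alt_sym[OF \<beta>, of "bs ! i"])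
      also have "... = frobenius_mat (f ^ m) $$ (i, j)"
      proof (cases "Suc j = d")
        case False
        then have "T (cs ! j) = cs ! Suc j" using ij by (simp add: cs_def)
        then show ?thesis using dual[of i "Suc j"] ij False by (auto simp: frobenius_mat_def d_def[symmetric])
      next
        case True
        define r where "r = f ^ m + monom 1 d"
        have "coeff (f ^ m) d = 1"
          using f0 leading_coeff_0_iff[of "f ^ m"] unfolding d_def by (cases "coeff (f ^ m) (degree (f ^ m))") auto
        then have r: "r \<in> vecs d"
          unfolding r_def vecs_def using coeff_eq_0[of "f ^ m"] by (auto simp: d_def[symmetric] le_less)
        have "poly_act T r w = (T ^^ d) w" using w fw by (simp add: r_def act_add act_monom)
        then have "T (cs ! j) = comb cs r" using cact[OF r] True unfolding csj by (metis funpow.simps(2) o_apply)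
        then have "\<alpha> (bs ! i) (T (cs ! j)) = \<alpha> (comb cs r) (bs ! i)" by (simp add: alt_sym[OF \<alpha>, of "bs ! i"])
        also have "... = (\<Sum>l<d. coeff r l * \<alpha> (bs ! i) (cs ! l))"
          by (simp add: alt_comb[OF \<alpha>] len alt_sym[OF \<alpha>, of "bs ! i"])
        also have "... = (\<Sum>l<d. if l = i then coeff r l else 0)"
          using dual[OF ij(1)] by (intro sum.cong) auto
        also have "... = coeff (f ^ m) i" using ij by (simp add: r_def)
        finally show ?thesis using ij True by (auto simp: frobenius_mat_def d_def[symmetric])
      qed
      finally show ?thesis using dual ij by auto
    qed
    show "\<alpha> b x = 0 \<and> \<beta> b x = 0" if x: "x \<in> V" "!!z. z \<in> set bs \<union> set cs ==> \<alpha> z x = 0"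
        "b \<in> set bs \<union> set cs" for x b
    proof -
      have av: "\<alpha> y x = 0" if "y \<in> range (comb vs)" for y
      proof -
        have "y \<in> range (comb bs)" using that span by simp
        then obtain p where p: "y = comb bs p" by (rule rangeE)
        show ?thesis unfolding p by (rule alt_comb_0[OF \<alpha>]) (use x(2) in simp)
      qed
      have ac: "\<alpha> y x = 0" if "y \<in> range (comb cs)" for y
      proof -
        from that obtain p where p: "y = comb cs p" by (rule rangeE)
        show ?thesis unfolding p by (rule alt_comb_0[OF \<alpha>]) (use x(2) in simp)
      qed
      have "\<beta> ((T ^^ i) v) x = 0" for i
        using Tab[OF power_in[OF v(1)] x(1), of i] av[OF vspan[of "monom 1 (Suc i)"]] v(1) by (simp add: act_monom)
      then have "\<beta> b x = 0" if "b \<in> set bs" for b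
      proof -
        have "b \<in> range (comb vs)" using that bs(2) by (simp add: subsetD)
        then obtain p where p: "b = comb vs p" by (rule rangeE)
        show ?thesis unfolding p
          by (rule alt_comb_0[OF \<beta>]) (use \<open>!!i. \<beta> ((T ^^ i) v) x = 0\<close> in \<open>auto simp: vs_def\<close>)
      qed
      moreover have "\<beta> ((T ^^ i) w) x = 0" for i
        using Tab[OF power_in[OF w(1)] x(1), of i] ac[OF cspan[of "monom 1 (Suc i)"]] w(1) by (simp add: act_monom)
      then have "\<beta> b x = 0" if "b \<in> set cs" for b using that by (auto simp: cs_def)
      ultimately show ?thesis using x by blast
    qed
  qed (use bs vV dual len dpos in simp_all)
qed

text \<open>Existence half of the classification of pairs. Split off a block in each of the three cases: there
  is a kernel chain, or \<open>\<alpha>\<close> is degenerate without one, or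
  \<open>\<alpha>\<close> is nondegenerate.\<close>

theorem exists_canonical_basis:
  fixes \<alpha> \<beta> :: "'v::boolean_group => 'v => bit"
  assumes \<alpha>: "alt_form \<alpha>" and \<beta>: "alt_form \<beta>" and "finite V" "subgrp V"
  shows "\<exists>bs ps. canonical_basis \<alpha> \<beta> V bs ps"
  using assms(3,4)
proof (induction V rule: finite_psubset_induct)
  case (psubset V)
  have IH: "\<exists>bs ps. canonical_basis \<alpha> \<beta> W bs ps" if "subgrp W" "W \<subset> V" for W
    using psubset.IH[OF that(2,1)] .
  note V = psubset.prems psubset.hyps
  show ?case
  proof (cases "V = {0}")
    case True
    have "canonical_basis \<alpha> \<beta> V [] []"
      unfolding canonical_basis_def True basis_def by (auto simp: vecs_0 bij_betw_def gram_def)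
    then show ?thesis by (intro exI)
  next
    case nz: False
    show ?thesis
    proof (cases "\<exists>n v. kernel_chain \<alpha> \<beta> V n v")
      case True
      show ?thesis by (rule split_kernel_chain[OF V \<alpha> \<beta> IH True])
    next
      case False
      then have regular: "\<not> kernel_chain \<alpha> \<beta> V n v" for n v by simp
      show ?thesis
      proof (cases "\<exists>v\<in>V. v ~= 0 \<and> (\<forall>z\<in>V. \<alpha> v z = 0)")
        case True
        then obtain v where v: "v \<in> V" "v ~= 0" "\<forall>z\<in>V. \<alpha> v z = 0" by blast
        show ?thesis by (rule split_infinite_block[OF V \<alpha> \<beta> IH regular v X2_PP])
      next
        case False
        obtain u where u: "u \<in> V" "u ~= 0" using nz psubset.prems by (auto simp: subgrp_def)
        have nd: "x = 0" if "x \<in> V" "!!y. y \<in> V ==> \<alpha> x y = 0" for x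
        proof (rule ccontr)
          assume "x ~= 0"
          with that have "\<exists>v\<in>V. v ~= 0 \<and> (\<forall>z\<in>V. \<alpha> v z = 0)" by (intro bexI[of _ x]) simp_all
          with False show False by contradiction
        qed
        show ?thesis by (rule split_finite_block[OF V \<alpha> \<beta> IH nd u])
      qed
    qed
  qed
qed


section \<open>Linear substitutions\<close>

lemma poly_map_poly_sum:
  fixes h :: "'a::comm_ring_1 => 'b::comm_ring_1"
  assumes "h 0 = 0"
  shows "poly (map_poly h p) x = (\<Sum>i\<le>degree p. h (coeff p i) * x ^ i)"
proof -
  have "poly (map_poly h p) x = (\<Sum>i\<le>degree (map_poly h p). h (coeff p i) * x ^ i)"
    by (simp add: poly_altdef coeff_map_poly assms)
  also have "... = (\<Sum>i\<le>degree p. h (coeff p i) * x ^ i)"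
    by (rule sum.mono_neutral_left)
      (use coeff_map_poly[of h, OF assms, of p] in \<open>auto simp: degree_map_poly_le intro!: le_degree\<close>)
  finally show ?thesis .
qed

definition scal_eval :: "bipoly => bit poly => bipoly" where
  "scal_eval y c = poly (map_poly (\<lambda>a. [:[:a:]:]) c) y"

lemma comm_ring_hom_scal: "comm_ring_hom (\<lambda>a::bit. [:[:a:]:])"
  by unfold_locales (simp_all add: pCons_one)

lemma comm_ring_hom_scal_eval: "comm_ring_hom (scal_eval y)"
proof -
  interpret s: comm_ring_hom "\<lambda>a::bit. [:[:a:]:]" by (rule comm_ring_hom_scal)
  interpret m: map_poly_comm_ring_hom "\<lambda>a::bit. [:[:a:]:]" ..
  show ?thesis unfolding scal_eval_def
    by unfold_locales (simp_all add: m.hom_add m.hom_mult)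
qed

lemma subst2_eq_poly: "subst2 g y1 y2 = poly (map_poly (scal_eval y2) g) y1"
proof -
  interpret comm_ring_hom "scal_eval y2" by (rule comm_ring_hom_scal_eval)
  have "poly (map_poly (scal_eval y2) g) y1 = (\<Sum>i\<le>degree g. scal_eval y2 (coeff g i) * y1 ^ i)"
    by (rule poly_map_poly_sum) simp
  also have "... = subst2 g y1 y2"
    unfolding subst2_def scal_eval_def
    by (intro sum.cong refl, subst poly_map_poly_sum)
      (simp_all add: sum_distrib_left mult.commute[of _ "y1 ^ _"])
  finally show ?thesis by simp
qed

lemma comm_ring_hom_subst2: "comm_ring_hom (\<lambda>g. subst2 g y1 y2)"
proof -
  interpret s: comm_ring_hom "scal_eval y2" by (rule comm_ring_hom_scal_eval)
  interpret m: map_poly_comm_ring_hom "scal_eval y2" ..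
  show ?thesis unfolding subst2_eq_poly
    by unfold_locales (simp_all add: m.hom_add m.hom_mult)
qed

lemma subst2_X: "subst2 X1 y1 y2 = y1" "subst2 X2 y1 y2 = y2" "subst2 (scal c) y1 y2 = scal c"
  by (simp_all add: subst2_def X1_def X2_def numeral_2_eq_2 pCons_one)

lemma subst2_hom:
  assumes "comm_ring_hom \<psi>" "!!c. \<psi> (scal c) = scal c"
  shows "\<psi> (subst2 g y1 y2) = subst2 g (\<psi> y1) (\<psi> y2)"
proof -
  interpret comm_ring_hom \<psi> by fact
  show ?thesis unfolding subst2_def by (simp only: hom_sum hom_mult hom_power assms(2))
qed

lemma monomial_bipoly: "scal c * X1 ^ i * X2 ^ j = monom (monom c j) i"
proof -
  have "X1 ^ i = monom 1 i" by (simp add: X1_def monom_altdef)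
  moreover have "X2 ^ j = [:monom 1 j:]"
    by (induction j) (simp_all add: X2_def monom_altdef pCons_one)
  ultimately show ?thesis by (simp add: smult_monom)
qed

lemma subst2_id: "subst2 g X1 X2 = g"
proof -
  have "subst2 g X1 X2 = (\<Sum>i\<le>degree g. \<Sum>j\<le>degree (coeff g i). monom (monom (coeff (coeff g i) j) j) i)"
    unfolding subst2_def monomial_bipoly ..
  also have "... = (\<Sum>i\<le>degree g. monom (\<Sum>j\<le>degree (coeff g i). monom (coeff (coeff g i) j) j) i)"
    by (simp add: monom_sum)
  also have "... = g" by (simp add: poly_as_sum_of_monoms)
  finally show ?thesis .
qed

interpretation subst_row: comm_ring_hom "subst_row Q" for Q
  unfolding subst_row_def by (rule comm_ring_hom_subst2)

lemma subst_row_scal: "subst_row Q (scal c) = scal c"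
  by (simp add: subst_row_def subst2_X)

lemma subst_row_X:
  "subst_row Q X1 = scal (Q $$ (0, 0)) * X1 + scal (Q $$ (1, 0)) * X2"
  "subst_row Q X2 = scal (Q $$ (0, 1)) * X1 + scal (Q $$ (1, 1)) * X2"
  by (simp_all only: subst_row_def subst2_X)

text \<open>Entrywise form of \<open>QR = 1\<close> for two by two matrices.\<close>

definition inverse2 :: "bit mat => bit mat => bool" where
  "inverse2 Q R \<longleftrightarrow> (\<forall>i<2. \<forall>j<2. Q $$ (i, 0) * R $$ (0, j) + Q $$ (i, 1) * R $$ (1, j) = (if i = j then 1 else 0))"

lemma scal_mult_add: "scal a * scal b = scal (a * b)" "scal a + scal b = scal (a + b)"
  by simp_all

lemma subst_row_inverse:
  assumes "inverse2 Q R"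
  shows "subst_row Q (subst_row R g) = g"
proof -
  have e: "Q $$ (0, 0) * R $$ (0, 0) + Q $$ (0, 1) * R $$ (1, 0) = 1"
    "Q $$ (0, 0) * R $$ (0, 1) + Q $$ (0, 1) * R $$ (1, 1) = 0"
    "Q $$ (1, 0) * R $$ (0, 0) + Q $$ (1, 1) * R $$ (1, 0) = 0"
    "Q $$ (1, 0) * R $$ (0, 1) + Q $$ (1, 1) * R $$ (1, 1) = 1"
    using assms unfolding inverse2_def by (simp_all only: less_2_cases_iff) auto
  have x: "scal a * (scal b * X1 + scal c * X2) + scal a' * (scal b' * X1 + scal c' * X2)
      = scal (b * a + b' * a') * X1 + scal (c * a + c' * a') * X2" for a b c a' b' c'
    unfolding scal_mult_add[symmetric] by (simp only: algebra_simps)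
  have 1: "subst_row Q (subst_row R X1) = X1" "subst_row Q (subst_row R X2) = X2"
    unfolding subst_row_X subst_row.hom_add subst_row.hom_mult subst_row_scal x
    unfolding e by (simp_all add: pCons_one)
  have "subst_row Q (subst_row R g) = subst_row Q (subst2 g (subst_row R X1) (subst_row R X2))"
    unfolding subst_row_X by (simp only: subst_row_def[of R])
  also have "... = subst2 g X1 X2"
    by (subst subst2_hom[OF subst_row.comm_ring_hom_axioms subst_row_scal]) (simp only: 1)
  finally show ?thesis by (simp add: subst2_id)
qed

lemma subst_row_hpolys:
  assumes "g \<in> hpolys D"
  shows "subst_row Q g \<in> hpolys D"
proof -
  have y: "scal a * X1 + scal b * X2 \<in> hpolys 1" for a b
    using hpolys_mult[OF hpolys_scal hpolys_X(1), of a] hpolys_mult[OF hpolys_scal hpolys_X(2), of b]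
    by (intro subgrpD(2)[OF subgrp_hpolys]) simp_all
  have "scal (coeff (coeff g i) j) * (scal a * X1 + scal b * X2) ^ i * (scal c * X1 + scal d * X2) ^ j \<in> hpolys D"
    for i j a b c d
  proof (cases "i + j = D")
    case True
    have "scal (coeff (coeff g i) j) * (scal a * X1 + scal b * X2) ^ i * (scal c * X1 + scal d * X2) ^ j
        \<in> hpolys (0 + i * 1 + j * 1)"
      by (intro hpolys_mult hpolys_scal hpolys_power y)
    then show ?thesis using True by (simp only: mult_1_right add_0)
  next
    case False
    then show ?thesis using assms subgrpD(1)[OF subgrp_hpolys] by (simp add: hpolysD)
  qed
  then show ?thesis unfolding subst_row_def subst2_def by (intro subgrp_sum subgrp_hpolys)
qed

lemma subst_row_PP:
  assumes QR: "inverse2 Q R" "inverse2 R Q" and g: "g \<in> PP"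
  shows "subst_row Q g \<in> PP"
proof -
  have irr: "Factorial_Ring.irreducible g" using g by (simp add: PP_def)
  have "a = 1 \<or> b = 1" if ab: "subst_row Q g = a * b" for a b
  proof -
    have "g = subst_row R a * subst_row R b"
      using subst_row_inverse[OF QR(2), of g] by (simp only: ab subst_row.hom_mult)
    then consider "subst_row R a = 1" | "subst_row R b = 1" using irr unfolding irreducible_bipoly by blast
    then show ?thesis
      using subst_row_inverse[OF QR(1), of a] subst_row_inverse[OF QR(1), of b] by cases auto
  qed
  moreover have "subst_row Q g ~= 0" "subst_row Q g ~= 1"
    using subst_row_inverse[OF QR(2), of g] irr unfolding irreducible_bipoly by auto
  ultimately have "Factorial_Ring.irreducible (subst_row Q g)" unfolding irreducible_bipoly by blast
  moreover have "homogeneous (subst_row Q g)"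
    using g subst_row_hpolys by (auto simp: PP_iff homogeneous_iff)
  ultimately show ?thesis by (simp add: PP_iff)
qed

lemma star_eq_subst_row:
  assumes "inverse2 Q R" "inverse2 R Q" "g \<in> PP"
  shows "star Q g = subst_row Q g"
  unfolding star_def
proof (rule the_equality)
  show "subst_row Q g \<in> PP \<and> (\<exists>c. c ~= 0 \<and> subst_row Q g = scal c * subst_row Q g)"
    using subst_row_PP[OF assms] by (auto intro!: exI[of _ 1] simp: pCons_one)
  show "g' = subst_row Q g" if "g' \<in> PP \<and> (\<exists>c. c ~= 0 \<and> subst_row Q g = scal c * g')" for g'
    using that by (auto simp: pCons_one)
qed

lemma Units_ring_mat_2:
  assumes "Q \<in> carrier GL2"
  shows "\<exists>R. inverse2 Q R \<and> inverse2 R Q"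
proof -
  obtain R where Q: "Q \<in> carrier_mat 2 2" and R: "R \<in> carrier_mat 2 2" and e: "R * Q = 1\<^sub>m 2" "Q * R = 1\<^sub>m 2"
    using assms by (auto simp: GL2_def units_of_def Units_def ring_mat_def)
  have m: "(A * B) $$ (i, j) = A $$ (i, 0) * B $$ (0, j) + A $$ (i, 1) * B $$ (1, j)"
    if "A \<in> carrier_mat 2 2" "B \<in> carrier_mat 2 2" "i < 2" "j < 2" for A B :: "bit mat" and i j
    using that by (simp add: scalar_prod_def numeral_2_eq_2)
  have "inverse2 Q R" "inverse2 R Q"
    unfolding inverse2_def using m[OF Q R] m[OF R Q] e by auto
  then show ?thesis by blast
qed

lemma GL2I:
  assumes Q: "Q \<in> carrier_mat 2 2" and R: "R \<in> carrier_mat 2 2" and QR: "inverse2 Q R" "inverse2 R Q"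
  shows "Q \<in> carrier GL2"
proof -
  have m: "(A * B) $$ (i, j) = A $$ (i, 0) * B $$ (0, j) + A $$ (i, 1) * B $$ (1, j)"
    if "A \<in> carrier_mat 2 2" "B \<in> carrier_mat 2 2" "i < 2" "j < 2" for A B :: "bit mat" and i j
    using that by (simp add: scalar_prod_def numeral_2_eq_2)
  have "Q * R = 1\<^sub>m 2"
    by (rule eq_matI) (use QR(1) Q R in \<open>auto simp: m inverse2_def simp del: index_mult_mat(1)\<close>)
  moreover have "R * Q = 1\<^sub>m 2"
    by (rule eq_matI) (use QR(2) Q R in \<open>auto simp: m inverse2_def simp del: index_mult_mat(1)\<close>)
  ultimately show ?thesis
    using Q R by (auto simp: GL2_def units_of_def Units_def ring_mat_def)
qed


section \<open>Counting invariants of a pair of forms\<close>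

text \<open>For a form \<open>h\<close> of degree \<open>D\<close> with dehomogenization \<open>r\<close>,
  these sequences are the additive maps \<open>\<phi>\<close> from the forms of degree \<open>D -
  1\<close> to \<open>V\<close> such that \<open>\<alpha>(\<phi> p, y) + \<beta>(\<phi> q, y) =
  0\<close> whenever \<open>x\<^sub>2 p + x\<^sub>1 q\<close> is \<open>0\<close> or
  \<open>h\<close>: maps of Kronecker modules, given by the images of the monomials. Their numbers
  are the invariants that detect the multiplicities of the blocks.\<close>

definition hom_space ::
  "('v::boolean_group => 'v => bit) => ('v => 'v => bit) => 'v set => nat => bit poly => (nat => 'v) set" where
  "hom_space \<alpha> \<beta> V D r = {v. (\<forall>i. v i \<in> V) \<and> (\<forall>i\<ge>D. v i = 0) \<and>
     (\<forall>i. Suc i < D --> (\<forall>y\<in>V. \<alpha> (v (Suc i)) y = \<beta> (v i) y)) \<and>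
     (\<forall>y\<in>V. (\<Sum>i<D. coeff r i * \<alpha> (v i) y) + coeff r D * \<beta> (v (D - 1)) y = 0)}"

definition seq_eval :: "nat => (nat => 'v::boolean_group) => bipoly => 'v" where
  "seq_eval D v p = (\<Sum>i<D. scl (coeff (dehomogenize p) i) (v i))"

lemma seq_eval_add: "seq_eval D v (p + q) = seq_eval D v p + seq_eval D v q"
  by (simp add: seq_eval_def dehom.hom_add scl_add sum.distrib)

lemma seq_eval_0 [simp]: "seq_eval D v 0 = 0"
  by (simp add: seq_eval_def)

lemma seq_eval_sum: "seq_eval D v (sum f I) = (\<Sum>i\<in>I. seq_eval D v (f i))"
  by (induction I rule: infinite_finite_induct) (simp_all add: seq_eval_add)

lemma seq_eval_scal: "seq_eval D v (scal c * p) = scl c (seq_eval D v p)"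
  by (cases c) (simp_all add: pCons_one)

lemma seq_eval_homogenize:
  assumes "f \<in> vecs D" "D \<ge> 1"
  shows "seq_eval D v (homogenize (D - 1) f) = (\<Sum>i<D. scl (coeff f i) (v i))"
  using assms dehomogenize_homogenize[of f "D - 1"] by (simp add: seq_eval_def)

lemma seq_eval_monom:
  assumes "i < D"
  shows "seq_eval D v (homogenize (D - 1) (monom 1 i)) = v i"
proof -
  have "seq_eval D v (homogenize (D - 1) (monom 1 i)) = (\<Sum>j<D. scl (coeff (monom 1 i) j) (v j))"
    using assms by (intro seq_eval_homogenize) (auto simp: vecs_def)
  also have "... = (\<Sum>j<D. if j = i then v j else 0)" by (intro sum.cong) auto
  finally show ?thesis using assms by simp
qed

lemma seq_eval_in: "subgrp V ==> (!!i. v i \<in> V) ==> seq_eval D v p \<in> V"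
  unfolding seq_eval_def by (intro subgrp_sum scl_in)

lemma alt_seq_eval:
  "alt_form \<alpha> ==> \<alpha> (seq_eval D v p) y = (\<Sum>i<D. coeff (dehomogenize p) i * \<alpha> (v i) y)"
  by (simp add: seq_eval_def alt_sum alt_scl)

lemma shifted_sum:
  fixes a b :: "nat => bit"
  assumes p: "p \<in> vecs D" and q: "q \<in> vecs D" and D: "D \<ge> 1"
    and ab: "!!i. Suc i < D ==> a (Suc i) = b i"
  shows "(\<Sum>i<D. coeff p i * a i) + (\<Sum>i<D. coeff q i * b i)
    = (\<Sum>i<D. coeff (p + pCons 0 q) i * a i) + coeff (p + pCons 0 q) D * b (D - 1)"
proof -
  obtain E where E: "D = Suc E" using D by (cases D) auto
  have "(\<Sum>i<D. coeff q i * b i) = (\<Sum>i<E. coeff q i * a (Suc i)) + coeff q E * b E"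
    using ab E by (simp add: sum.lessThan_Suc)
  also have "(\<Sum>i<E. coeff q i * a (Suc i)) = (\<Sum>i<D. coeff (pCons 0 q) i * a i)"
    unfolding E sum.lessThan_Suc_shift by simp
  also have "coeff q E = coeff (p + pCons 0 q) D"
    using p by (simp add: E vecs_def)
  finally show ?thesis using E by (simp add: sum.distrib distrib_right add.assoc)
qed

text \<open>The description without coordinates. It shows that the count for \<open>h\<close> only depends on
  \<open>h\<close> up to a simultaneous substitution in \<open>h\<close> and in the pair.\<close>

lemma hom_space_iff:
  assumes V: "subgrp V" and \<alpha>: "alt_form \<alpha>" and \<beta>: "alt_form \<beta>" and D: "D \<ge> 1" and h: "h \<in> hpolys D"
    and v: "!!i. v i \<in> V" "!!i. i \<ge> D ==> v i = 0"
  shows "v \<in> hom_space \<alpha> \<beta> V D (dehomogenize h) \<longleftrightarrow>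
    (\<forall>p\<in>hpolys (D - 1). \<forall>q\<in>hpolys (D - 1). X2 * p + X1 * q \<in> {0, h} -->
      (\<forall>y\<in>V. \<alpha> (seq_eval D v p) y + \<beta> (seq_eval D v q) y = 0))" (is "_ \<longleftrightarrow> ?R")
proof
  have SD: "Suc (D - 1) = D" using D by simp
  have X: "X2 * p + X1 * q \<in> hpolys D" if "p \<in> hpolys (D - 1)" "q \<in> hpolys (D - 1)" for p q
    using hpolys_mult[OF hpolys_X(2) that(1)] hpolys_mult[OF hpolys_X(1) that(2)] SD
    by (intro subgrpD(2)[OF subgrp_hpolys]) simp_all
  have deh: "dehomogenize (X2 * p + X1 * q) = dehomogenize p + pCons 0 (dehomogenize q)" for p q
    by (simp add: dehom.hom_add dehom.hom_mult)
  {
    assume Z: "v \<in> hom_space \<alpha> \<beta> V D (dehomogenize h)"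
    show ?R
    proof (intro ballI impI)
      fix p q y assume p: "p \<in> hpolys (D - 1)" and q: "q \<in> hpolys (D - 1)"
        and pq: "X2 * p + X1 * q \<in> {0, h}" and y: "y \<in> V"
      let ?s = "dehomogenize p + pCons 0 (dehomogenize q)"
      have "\<alpha> (seq_eval D v p) y + \<beta> (seq_eval D v q) y
        = (\<Sum>i<D. coeff ?s i * \<alpha> (v i) y) + coeff ?s D * \<beta> (v (D - 1)) y"
        unfolding alt_seq_eval[OF \<alpha>] alt_seq_eval[OF \<beta>]
        by (rule shifted_sum) (use Z y dehomogenize_vecs[OF p] dehomogenize_vecs[OF q] SD D in
            \<open>simp_all add: hom_space_def\<close>)
      also have "... = 0"
      proof -
        have "?s = 0 \<or> ?s = dehomogenize h" using pq deh[of p q] by auto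
        then show ?thesis
        proof
          assume s: "?s = 0"
          show ?thesis unfolding s by simp
        next
          assume s: "?s = dehomogenize h"
          show ?thesis unfolding s using Z y by (simp add: hom_space_def)
        qed
      qed
      finally show "\<alpha> (seq_eval D v p) y + \<beta> (seq_eval D v q) y = 0" .
    qed
  }
  assume R: ?R
  have "\<alpha> (v (Suc i)) y = \<beta> (v i) y" if i: "Suc i < D" "y \<in> V" for i y
  proof -
    let ?p = "homogenize (D - 1) (monom 1 (Suc i))" and ?q = "homogenize (D - 1) (monom 1 i)"
    have d: "dehomogenize ?p = monom 1 (Suc i)" "dehomogenize ?q = monom 1 i"
      using i by (auto intro!: dehomogenize_homogenize simp: vecs_def)
    have "dehomogenize (X2 * ?p + X1 * ?q) = 0" unfolding deh d by (simp add: monom_Suc)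
    then have "X2 * ?p + X1 * ?q = 0"
      using homogenize_dehomogenize[OF X[OF homogenize_hpolys homogenize_hpolys], of "monom 1 (Suc i)" "monom 1 i"]
      by (simp add: homogenize_def)
    then have "\<alpha> (seq_eval D v ?p) y + \<beta> (seq_eval D v ?q) y = 0"
      using R i homogenize_hpolys by auto
    then show ?thesis using i unfolding seq_eval_monom[OF i(1)] seq_eval_monom[OF Suc_lessD[OF i(1)]]
      by (simp add: add_eq_0_iff_eq)
  qed
  moreover have "(\<Sum>i<D. coeff (dehomogenize h) i * \<alpha> (v i) y) + coeff (dehomogenize h) D * \<beta> (v (D - 1)) y = 0"
    if y: "y \<in> V" for y
  proof -
    let ?r = "dehomogenize h"
    have r: "?r \<in> vecs (Suc D)" by (rule dehomogenize_vecs[OF h])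
    let ?a = "poly_cutoff D ?r" and ?b = "monom (coeff ?r D) (D - 1)"
    let ?p = "homogenize (D - 1) ?a" and ?q = "homogenize (D - 1) ?b"
    have ab: "?a \<in> vecs D" "?b \<in> vecs D" using D by (auto simp: vecs_def coeff_poly_cutoff)
    have d: "dehomogenize ?p = ?a" "dehomogenize ?q = ?b"
      using ab SD by (auto intro!: dehomogenize_homogenize)
    have "?a + pCons 0 ?b = ?r"
      using r SD by (intro poly_eqI) (auto simp: coeff_poly_cutoff vecs_def monom_Suc[symmetric])
    then have "dehomogenize (X2 * ?p + X1 * ?q) = ?r" unfolding deh d .
    then have "X2 * ?p + X1 * ?q = h"
      using homogenize_dehomogenize[OF X[OF homogenize_hpolys homogenize_hpolys], of ?a ?b]
        homogenize_dehomogenize[OF h] by simp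
    then have "\<alpha> (seq_eval D v ?p) y + \<beta> (seq_eval D v ?q) y = 0"
      using R y homogenize_hpolys by auto
    moreover have "\<alpha> (seq_eval D v ?p) y = (\<Sum>i<D. coeff ?r i * \<alpha> (v i) y)"
      unfolding alt_seq_eval[OF \<alpha>] d by (intro sum.cong) (auto simp: coeff_poly_cutoff)
    moreover have "\<beta> (seq_eval D v ?q) y = (\<Sum>i<D. if i = D - 1 then coeff ?r D * \<beta> (v i) y else 0)"
      unfolding alt_seq_eval[OF \<beta>] d by (intro sum.cong) auto
    ultimately show ?thesis using D by simp
  qed
  ultimately show "v \<in> hom_space \<alpha> \<beta> V D (dehomogenize h)"
    using v by (simp add: hom_space_def)
qed

text \<open>The action of \<open>GL(2,F\<^sub>2)\<close> on pairs of forms that corresponds to the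
  substitution \<open>subst_row\<close> in polynomials.\<close>

definition twist_fst :: "bit mat => ('v => 'v => bit) => ('v => 'v => bit) => 'v => 'v => bit" where
  "twist_fst Q \<alpha> \<beta> x y = Q $$ (1, 1) * \<alpha> x y + Q $$ (0, 1) * \<beta> x y"

definition twist_snd :: "bit mat => ('v => 'v => bit) => ('v => 'v => bit) => 'v => 'v => bit" where
  "twist_snd Q \<alpha> \<beta> x y = Q $$ (1, 0) * \<alpha> x y + Q $$ (0, 0) * \<beta> x y"

lemma alt_form_twist:
  assumes "alt_form \<alpha>" "alt_form \<beta>"
  shows "alt_form (twist_fst Q \<alpha> \<beta>)" "alt_form (twist_snd Q \<alpha> \<beta>)"
  using assms by (simp_all add: alt_form_def twist_fst_def twist_snd_def algebra_simps)

lemma twist_inverse: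
  assumes "inverse2 Q R"
  shows "twist_fst R (twist_fst Q \<alpha> \<beta>) (twist_snd Q \<alpha> \<beta>) = \<alpha>"
    "twist_snd R (twist_fst Q \<alpha> \<beta>) (twist_snd Q \<alpha> \<beta>) = \<beta>"
proof -
  have e: "Q $$ (0, 0) * R $$ (0, 0) + Q $$ (0, 1) * R $$ (1, 0) = 1"
    "Q $$ (0, 0) * R $$ (0, 1) + Q $$ (0, 1) * R $$ (1, 1) = 0"
    "Q $$ (1, 0) * R $$ (0, 0) + Q $$ (1, 1) * R $$ (1, 0) = 0"
    "Q $$ (1, 0) * R $$ (0, 1) + Q $$ (1, 1) * R $$ (1, 1) = 1"
    using assms unfolding inverse2_def by (simp_all only: less_2_cases_iff) auto
  have 1: "R11 * (Q11 * a + Q01 * b) + R01 * (Q10 * a + Q00 * b)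
      = (Q10 * R01 + Q11 * R11) * a + (Q00 * R01 + Q01 * R11) * (b :: bit)" for R11 Q11 a Q01 b R01 Q10 Q00
    by (simp add: algebra_simps)
  show "twist_fst R (twist_fst Q \<alpha> \<beta>) (twist_snd Q \<alpha> \<beta>) = \<alpha>"
    "twist_snd R (twist_fst Q \<alpha> \<beta>) (twist_snd Q \<alpha> \<beta>) = \<beta>"
    unfolding fun_eq_iff twist_fst_def twist_snd_def 1 e by simp_all
qed

definition seq_subst :: "nat => bit mat => (nat => 'v::boolean_group) => nat => 'v" where
  "seq_subst D Q v i = (if i < D then seq_eval D v (subst_row Q (homogenize (D - 1) (monom 1 i))) else 0)"

lemma hpolys_monomials:
  assumes "p \<in> hpolys (D - 1)" "D \<ge> 1"
  shows "p = (\<Sum>i<D. scal (coeff (dehomogenize p) i) * homogenize (D - 1) (monom 1 i))"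
proof -
  let ?s = "\<Sum>i<D. scal (coeff (dehomogenize p) i) * homogenize (D - 1) (monom 1 i)"
  have s: "?s \<in> hpolys (D - 1)"
    using hpolys_mult[OF hpolys_scal homogenize_hpolys] by (intro subgrp_sum subgrp_hpolys) (metis add_0)
  have "coeff (dehomogenize ?s) j = coeff (dehomogenize p) j" for j
  proof -
    have "coeff (dehomogenize ?s) j = (\<Sum>i<D. coeff (dehomogenize p) i * coeff (monom 1 i) j)"
      unfolding dehom.hom_sum dehom.hom_mult coeff_sum
    proof (intro sum.cong refl)
      fix i assume "i \<in> {..<D}"
      then have "dehomogenize (homogenize (D - 1) (monom 1 i)) = monom 1 i"
        by (intro dehomogenize_homogenize) (auto simp: vecs_def)
      moreover have "dehomogenize (scal c) = [:c:]" for c by (cases c) (simp_all add: pCons_one)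
      ultimately show "coeff (dehomogenize (scal (coeff (dehomogenize p) i)) *
          dehomogenize (homogenize (D - 1) (monom 1 i))) j
          = coeff (dehomogenize p) i * coeff (monom 1 i) j"
        by simp
    qed
    also have "... = (\<Sum>i<D. if i = j then coeff (dehomogenize p) i else 0)"
      by (intro sum.cong) auto
    also have "... = coeff (dehomogenize p) j"
      using dehomogenize_vecs[OF assms(1)] assms(2) by (auto simp: vecs_def)
    finally show ?thesis .
  qed
  then have "dehomogenize ?s = dehomogenize p" by (intro poly_eqI)
  then show ?thesis using homogenize_dehomogenize[OF s] homogenize_dehomogenize[OF assms(1)] by simp
qed

lemma seq_eval_subst:
  assumes "p \<in> hpolys (D - 1)" "D \<ge> 1"
  shows "seq_eval D (seq_subst D Q v) p = seq_eval D v (subst_row Q p)"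
proof -
  have "seq_eval D v (subst_row Q p) = seq_eval D v (subst_row Q
      (\<Sum>i<D. scal (coeff (dehomogenize p) i) * homogenize (D - 1) (monom 1 i)))"
    using hpolys_monomials[OF assms] by simp
  also have "... = (\<Sum>i<D. scl (coeff (dehomogenize p) i)
      (seq_eval D v (subst_row Q (homogenize (D - 1) (monom 1 i)))))"
    by (simp only: subst_row.hom_sum subst_row.hom_mult subst_row_scal seq_eval_sum seq_eval_scal)
  also have "... = seq_eval D (seq_subst D Q v) p"
    unfolding seq_eval_def[of D "seq_subst D Q v"] by (intro sum.cong) (auto simp: seq_subst_def)
  finally show ?thesis by simp
qed

lemma seq_subst_inverse:
  assumes "inverse2 Q R" "D \<ge> 1" "!!i. i \<ge> D ==> v i = 0"
  shows "seq_subst D R (seq_subst D Q v) = v"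
proof
  fix i show "seq_subst D R (seq_subst D Q v) i = v i"
  proof (cases "i < D")
    case True
    then have "seq_subst D R (seq_subst D Q v) i
        = seq_eval D (seq_subst D Q v) (subst_row R (homogenize (D - 1) (monom 1 i)))"
      by (simp add: seq_subst_def)
    also have "... = seq_eval D v (homogenize (D - 1) (monom 1 i))"
      unfolding seq_eval_subst[OF subst_row_hpolys[OF homogenize_hpolys] assms(2)] subst_row_inverse[OF assms(1)] ..
    finally show ?thesis unfolding seq_eval_monom[OF True] .
  qed (use assms(3) in \<open>simp add: seq_subst_def\<close>)
qed

lemma finite_hom_space: "finite V ==> finite (hom_space \<alpha> \<beta> V D r)"
  by (rule finite_subset[OF _ finite_sequences[of V D 0]]) (auto simp: hom_space_def)

lemma seq_subst_hom_space:
  assumes V: "subgrp V" and \<alpha>: "alt_form \<alpha>" and \<beta>: "alt_form \<beta>" and D: "D \<ge> 1" and h: "h \<in> hpolys D"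
    and v: "v \<in> hom_space \<alpha> \<beta> V D (dehomogenize (subst_row Q h))"
  shows "seq_subst D Q v \<in> hom_space (twist_fst Q \<alpha> \<beta>) (twist_snd Q \<alpha> \<beta>) V D (dehomogenize h)"
proof -
  have vV: "v i \<in> V" "i \<ge> D ==> v i = 0" for i using v by (auto simp: hom_space_def)
  have sV: "seq_subst D Q v i \<in> V" "i \<ge> D ==> seq_subst D Q v i = 0" for i
    using seq_eval_in[OF V vV(1)] subgrpD(1)[OF V] by (auto simp: seq_subst_def)
  show ?thesis
  proof (subst hom_space_iff[OF V alt_form_twist(1)[OF \<alpha> \<beta>] alt_form_twist(2)[OF \<alpha> \<beta>] D h sV],
      assumption, intro ballI impI)
    fix p q y assume pq: "p \<in> hpolys (D - 1)" "q \<in> hpolys (D - 1)" "X2 * p + X1 * q \<in> {0, h}" and y: "y \<in> V"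
    let ?p = "subst_row Q p" and ?q = "subst_row Q q"
    let ?p' = "scal (Q $$ (1, 1)) * ?p + scal (Q $$ (1, 0)) * ?q"
    let ?q' = "scal (Q $$ (0, 1)) * ?p + scal (Q $$ (0, 0)) * ?q"
    have "X2 * ?p' + X1 * ?q' = subst_row Q (X2 * p + X1 * q)"
      unfolding subst_row.hom_add subst_row.hom_mult subst_row_X by (simp only: algebra_simps)
    also have "... \<in> {0, subst_row Q h}" using pq(3) by auto
    finally have "X2 * ?p' + X1 * ?q' \<in> {0, subst_row Q h}" .
    moreover have in': "scal a * ?p + scal b * ?q \<in> hpolys (D - 1)" for a b
      using hpolys_mult[OF hpolys_scal subst_row_hpolys[OF pq(1)], of a]
        hpolys_mult[OF hpolys_scal subst_row_hpolys[OF pq(2)], of b]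
      by (intro subgrpD(2)[OF subgrp_hpolys]) simp_all
    moreover have "\<forall>p\<in>hpolys (D - 1). \<forall>q\<in>hpolys (D - 1). X2 * p + X1 * q \<in> {0, subst_row Q h} -->
        (\<forall>y\<in>V. \<alpha> (seq_eval D v p) y + \<beta> (seq_eval D v q) y = 0)"
      using hom_space_iff[OF V \<alpha> \<beta> D subst_row_hpolys[OF h] vV] v by (rule iffD1)
    ultimately have "\<alpha> (seq_eval D v ?p') y + \<beta> (seq_eval D v ?q') y = 0"
      using y by blast
    then show "twist_fst Q \<alpha> \<beta> (seq_eval D (seq_subst D Q v) p) y
        + twist_snd Q \<alpha> \<beta> (seq_eval D (seq_subst D Q v) q) y = 0"
      unfolding seq_eval_subst[OF pq(1) D] seq_eval_subst[OF pq(2) D] seq_eval_add seq_eval_scal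
        twist_fst_def twist_snd_def alt_add[OF \<alpha>] alt_add[OF \<beta>] alt_scl[OF \<alpha>] alt_scl[OF \<beta>]
      by (simp only: ac_simps)
  qed
qed

text \<open>Composition with the substitution is a bijection between the two spaces, with inverse given by
  \<open>R\<close>.\<close>

theorem card_hom_space_twist:
  assumes V: "subgrp V" "finite V" and \<alpha>: "alt_form \<alpha>" and \<beta>: "alt_form \<beta>" and D: "D \<ge> 1" and h: "h \<in> hpolys D"
    and QR: "inverse2 Q R" "inverse2 R Q"
  shows "card (hom_space (twist_fst Q \<alpha> \<beta>) (twist_snd Q \<alpha> \<beta>) V D (dehomogenize h))
    = card (hom_space \<alpha> \<beta> V D (dehomogenize (subst_row Q h)))"
proof (rule antisym)
  have le: "card (hom_space \<alpha> \<beta> V D (dehomogenize (subst_row Q h)))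
      \<le> card (hom_space (twist_fst Q \<alpha> \<beta>) (twist_snd Q \<alpha> \<beta>) V D (dehomogenize h))"
    if "alt_form \<alpha>" "alt_form \<beta>" "h \<in> hpolys D" "inverse2 Q R" "inverse2 R Q" for \<alpha> \<beta> :: "'a => 'a => bit" and h Q R
  proof (rule card_inj_on_le[of "seq_subst D Q"])
    show "seq_subst D Q ` hom_space \<alpha> \<beta> V D (dehomogenize (subst_row Q h))
        \<subseteq> hom_space (twist_fst Q \<alpha> \<beta>) (twist_snd Q \<alpha> \<beta>) V D (dehomogenize h)"
      using seq_subst_hom_space[OF V(1) that(1,2) D that(3)] by blast
    show "inj_on (seq_subst D Q) (hom_space \<alpha> \<beta> V D (dehomogenize (subst_row Q h)))"
      by (rule inj_on_inverseI[of _ "seq_subst D R"])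
        (rule seq_subst_inverse[OF that(4) D], simp add: hom_space_def)
  qed (rule finite_hom_space[OF V(2)])
  show "card (hom_space \<alpha> \<beta> V D (dehomogenize (subst_row Q h)))
      \<le> card (hom_space (twist_fst Q \<alpha> \<beta>) (twist_snd Q \<alpha> \<beta>) V D (dehomogenize h))"
    by (rule le[OF \<alpha> \<beta> h QR])
  show "card (hom_space (twist_fst Q \<alpha> \<beta>) (twist_snd Q \<alpha> \<beta>) V D (dehomogenize h))
      \<le> card (hom_space \<alpha> \<beta> V D (dehomogenize (subst_row Q h)))"
    using le[OF alt_form_twist(1)[OF \<alpha> \<beta>, of Q] alt_form_twist(2)[OF \<alpha> \<beta>, of Q] subst_row_hpolys[OF h, of Q] QR(2) QR(1)]
    unfolding subst_row_inverse[OF QR(2)] twist_inverse[OF QR(1)] .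
qed


section \<open>The counts in coordinates\<close>

text \<open>The coordinate version of \<open>hom_space\<close> for rectangular matrices; \<open>K\<close> is
  the set of rows, so that the two halves of a block can be treated separately.\<close>

definition sol_space ::
  "nat => nat set => (nat => nat => bit) => (nat => nat => bit) => nat => bit poly => (nat => bit poly) set" where
  "sol_space n K A B D r = {q. (\<forall>i. q i \<in> vecs n) \<and> (\<forall>i\<ge>D. q i = 0) \<and>
     (\<forall>i. Suc i < D --> (\<forall>k\<in>K. (\<Sum>j<n. A k j * coeff (q (Suc i)) j) = (\<Sum>j<n. B k j * coeff (q i) j))) \<and>
     (\<forall>k\<in>K. (\<Sum>i<D. coeff r i * (\<Sum>j<n. A k j * coeff (q i) j))
        + coeff r D * (\<Sum>j<n. B k j * coeff (q (D - 1)) j) = 0)}"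

lemma sol_space_cong:
  assumes "!!k j. k \<in> K ==> j < n ==> A k j = A' k j" "!!k j. k \<in> K ==> j < n ==> B k j = B' k j"
  shows "sol_space n K A B D r = sol_space n K A' B' D r"
proof -
  have "(\<Sum>j<n. A k j * c j) = (\<Sum>j<n. A' k j * c j)" "(\<Sum>j<n. B k j * c j) = (\<Sum>j<n. B' k j * c j)"
    if "k \<in> K" for k and c :: "nat => bit"
    using assms that by (auto intro!: sum.cong)
  then show ?thesis unfolding sol_space_def by (simp cong: conj_cong)
qed

lemma sol_space_reindex:
  "sol_space n (f ` K) A B D r = sol_space n K (\<lambda>k. A (f k)) (\<lambda>k. B (f k)) D r"
  by (simp add: sol_space_def)

lemma card_hom_space_basis:
  assumes bs: "basis bs V" and \<alpha>: "alt_form \<alpha>" and \<beta>: "alt_form \<beta>" and D: "D \<ge> 1"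
  shows "card (hom_space \<alpha> \<beta> V D r) = card (sol_space (length bs) {..<length bs}
    (\<lambda>k j. \<alpha> (bs ! k) (bs ! j)) (\<lambda>k j. \<beta> (bs ! k) (bs ! j)) D r)"
proof -
  let ?n = "length bs"
  let ?S = "sol_space ?n {..<?n} (\<lambda>k j. \<alpha> (bs ! k) (bs ! j)) (\<lambda>k j. \<beta> (bs ! k) (bs ! j)) D r"
  have bij: "bij_betw (comb bs) (vecs ?n) V" using bs by (simp add: basis_def)
  have V: "V = range (comb bs)" using bs by (rule basis_range)
  have e: "\<gamma> (comb bs p) (bs ! k) = (\<Sum>j<?n. \<gamma> (bs ! k) (bs ! j) * coeff p j)" if "alt_form \<gamma>" for \<gamma> p k
    unfolding alt_comb[OF that] by (intro sum.cong refl) (simp add: alt_sym[OF that, of "bs ! k"] mult.commute)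
  have all: "(\<forall>y\<in>V. f y = 0) \<longleftrightarrow> (\<forall>k<?n. f (bs ! k) = 0)" if f: "additive_on UNIV f" for f
  proof
    assume "\<forall>y\<in>V. f y = 0"
    then show "\<forall>k<?n. f (bs ! k) = 0" using nth_in_range_comb[OF nth_mem] unfolding V by blast
  next
    assume z: "\<forall>k<?n. f (bs ! k) = 0"
    show "\<forall>y\<in>V. f y = 0"
    proof
      fix y assume "y \<in> V"
      then obtain p where "y = comb bs p" using V by blast
      then show "f y = 0" using functional_comb[OF f, of bs p] z by simp
    qed
  qed
  have eq: "(\<forall>y\<in>V. \<alpha> x y = \<beta> x' y) \<longleftrightarrow> (\<forall>k<?n. \<alpha> x (bs ! k) = \<beta> x' (bs ! k))" for x x'
    using all[of "\<lambda>y. \<alpha> x y + \<beta> x' y"] by (simp add: add_eq_0_iff_eq additive_on_add alt_additive \<alpha> \<beta>)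
  have ad: "additive_on UNIV (\<lambda>y. (\<Sum>i<D. coeff r i * \<alpha> (v i) y) + coeff r D * \<beta> (v (D - 1)) y)" for v
    by (auto simp: additive_on_def alt_add_right[OF \<alpha>] alt_add_right[OF \<beta>] algebra_simps sum.distrib)
  have mem: "(\<lambda>i. comb bs (q i)) \<in> hom_space \<alpha> \<beta> V D r \<longleftrightarrow> q \<in> ?S"
    if q: "\<forall>i. q i \<in> vecs ?n" "\<forall>i\<ge>D. q i = 0" for q
    unfolding hom_space_def sol_space_def mem_Collect_eq eq all[OF ad] e[OF \<alpha>] e[OF \<beta>]
    using q V by auto
  have "bij_betw (\<lambda>q i. comb bs (q i)) ?S (hom_space \<alpha> \<beta> V D r)"
  proof (rule bij_betwI')
    fix q q' assume q: "q \<in> ?S" "q' \<in> ?S"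
    have "comb bs (q i) = comb bs (q' i) \<longleftrightarrow> q i = q' i" for i
      using q bij by (auto simp: sol_space_def bij_betw_def inj_on_eq_iff)
    then show "((\<lambda>i. comb bs (q i)) = (\<lambda>i. comb bs (q' i))) = (q = q')" by (simp add: fun_eq_iff)
  next
    fix q assume q: "q \<in> ?S"
    then show "(\<lambda>i. comb bs (q i)) \<in> hom_space \<alpha> \<beta> V D r"
      using mem[of q] by (auto simp: sol_space_def)
  next
    fix v assume v: "v \<in> hom_space \<alpha> \<beta> V D r"
    define q where "q i = the_inv_into (vecs ?n) (comb bs) (v i)" for i
    have vV: "v i \<in> comb bs ` vecs ?n" for i using v bij by (auto simp: hom_space_def bij_betw_def)
    have inj: "inj_on (comb bs) (vecs ?n)" using bij by (simp add: bij_betw_def)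
    have q: "q i \<in> vecs ?n" "comb bs (q i) = v i" for i
      unfolding q_def using the_inv_into_into[OF inj vV order_refl] f_the_inv_into_f[OF inj vV] by auto
    have "q i = 0" if "i \<ge> D" for i
      using basis_indep[OF bs q(1)] q(2)[of i] v that by (simp add: hom_space_def)
    then have "q \<in> ?S" using mem[of q] q v by simp
    then show "\<exists>q\<in>?S. v = (\<lambda>i. comb bs (q i))" using q(2) by (intro bexI[of _ q]) auto
  qed
  from bij_betw_same_card[OF this] show ?thesis by simp
qed

lemma sum_split_at: "(\<Sum>j<n + m. f j) = (\<Sum>j<n. f j) + (\<Sum>j<(m::nat). f (n + j) :: 'a::comm_monoid_add)"
  by (induction m) (simp_all add: ac_simps)

text \<open>For block matrices the equations separate.\<close>

lemma card_sol_space_split: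
  assumes A1: "!!k j. k \<in> K1 ==> j \<ge> n ==> j < n + m ==> A k j = 0 \<and> B k j = 0"
    and A2: "!!k j. k \<in> K2 ==> j < n ==> A k j = 0 \<and> B k j = 0"
  shows "card (sol_space (n + m) (K1 \<union> K2) A B D r) =
    card (sol_space n K1 A B D r) * card (sol_space m K2 (\<lambda>k j. A k (n + j)) (\<lambda>k j. B k (n + j)) D r)"
proof -
  let ?S = "sol_space (n + m) (K1 \<union> K2) A B D r"
  let ?S1 = "sol_space n K1 A B D r" and ?S2 = "sol_space m K2 (\<lambda>k j. A k (n + j)) (\<lambda>k j. B k (n + j)) D r"
  define glue :: "bit poly => bit poly => bit poly" where "glue p q = p + monom 1 n * q" for p q
  have cg: "coeff (glue p q) j = (if j < n then coeff p j else coeff q (j - n))" if "p \<in> vecs n" for p q j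
    using that by (auto simp: glue_def coeff_monom_mult vecs_def)
  have gv: "glue p q \<in> vecs (n + m)" if "p \<in> vecs n" "q \<in> vecs m" for p q
    using that unfolding vecs_def[of "n + m"] mem_Collect_eq by (subst cg) (auto simp: vecs_def)
  have s1: "(\<Sum>j<n + m. C k j * coeff (glue p q) j) = (\<Sum>j<n. C k j * coeff p j)"
    if "p \<in> vecs n" "!!j. j \<ge> n ==> j < n + m ==> C k j = 0" for C :: "nat => nat => bit" and k p q
    unfolding sum_split_at using that by (simp add: cg)
  have s2: "(\<Sum>j<n + m. C k j * coeff (glue p q) j) = (\<Sum>j<m. C k (n + j) * coeff q j)"
    if "p \<in> vecs n" "!!j. j < n ==> C k j = 0" for C :: "nat => nat => bit" and k p q
    unfolding sum_split_at using that by (simp add: cg)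
  have mem: "(\<lambda>i. glue (p i) (q i)) \<in> ?S \<longleftrightarrow> p \<in> ?S1 \<and> q \<in> ?S2"
    if pq: "!!i. p i \<in> vecs n" "!!i. q i \<in> vecs m" "!!i. i \<ge> D ==> p i = 0 \<and> q i = 0" for p q
  proof -
    define a where "a k i = (\<Sum>j<n + m. A k j * coeff (glue (p i) (q i)) j)" for k i
    define b where "b k i = (\<Sum>j<n + m. B k j * coeff (glue (p i) (q i)) j)" for k i
    define a1 where "a1 k i = (\<Sum>j<n. A k j * coeff (p i) j)" for k i
    define b1 where "b1 k i = (\<Sum>j<n. B k j * coeff (p i) j)" for k i
    define a2 where "a2 k i = (\<Sum>j<m. A k (n + j) * coeff (q i) j)" for k i
    define b2 where "b2 k i = (\<Sum>j<m. B k (n + j) * coeff (q i) j)" for k i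
    have e1: "a k i = a1 k i" "b k i = b1 k i" if "k \<in> K1" for i k
      unfolding a_def b_def a1_def b1_def using A1[OF that] by (intro s1 pq(1); blast)+
    have e2: "a k i = a2 k i" "b k i = b2 k i" if "k \<in> K2" for i k
      unfolding a_def b_def a2_def b2_def using A2[OF that] by (intro s2 pq(1); blast)+
    have g: "\<forall>i. glue (p i) (q i) \<in> vecs (n + m)" "\<forall>i\<ge>D. glue (p i) (q i) = 0"
      using gv[OF pq(1,2)] pq(3) by (simp_all add: glue_def)
    have pq': "\<forall>i. p i \<in> vecs n" "\<forall>i. q i \<in> vecs m" "\<forall>i\<ge>D. p i = 0" "\<forall>i\<ge>D. q i = 0"
      using pq by simp_all
    have "(\<lambda>i. glue (p i) (q i)) \<in> ?S \<longleftrightarrow>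
       (\<forall>i. Suc i < D --> (\<forall>k\<in>K1 \<union> K2. a k (Suc i) = b k i)) \<and>
       (\<forall>k\<in>K1 \<union> K2. (\<Sum>i<D. coeff r i * a k i) + coeff r D * b k (D - 1) = 0)"
      unfolding sol_space_def mem_Collect_eq a_def b_def using g by simp
    also have "... \<longleftrightarrow> ((\<forall>i. Suc i < D --> (\<forall>k\<in>K1. a1 k (Suc i) = b1 k i)) \<and>
        (\<forall>k\<in>K1. (\<Sum>i<D. coeff r i * a1 k i) + coeff r D * b1 k (D - 1) = 0)) \<and>
       ((\<forall>i. Suc i < D --> (\<forall>k\<in>K2. a2 k (Suc i) = b2 k i)) \<and>
        (\<forall>k\<in>K2. (\<Sum>i<D. coeff r i * a2 k i) + coeff r D * b2 k (D - 1) = 0))"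
      by (simp only: ball_Un e1 e2 cong: ball_cong) blast
    also have "... \<longleftrightarrow> p \<in> ?S1 \<and> q \<in> ?S2"
      unfolding sol_space_def mem_Collect_eq a1_def b1_def a2_def b2_def using pq' by simp
    finally show ?thesis .
  qed
  have "bij_betw (\<lambda>(p, q) i. glue (p i) (q i)) (?S1 \<times> ?S2) ?S"
  proof (rule bij_betwI')
    fix x y assume x: "x \<in> ?S1 \<times> ?S2" and y: "y \<in> ?S1 \<times> ?S2"
    obtain p q p' q' where xy: "x = (p, q)" "y = (p', q')" by (cases x, cases y)
    have v: "p i \<in> vecs n" "p' i \<in> vecs n" "q i \<in> vecs m" "q' i \<in> vecs m" for i
      using x y xy by (auto simp: sol_space_def)
    have "p i = p' i \<and> q i = q' i" if "glue (p i) (q i) = glue (p' i) (q' i)" for i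
    proof -
      have c: "(if j < n then coeff (p i) j else coeff (q i) (j - n))
        = (if j < n then coeff (p' i) j else coeff (q' i) (j - n))" for j
        using arg_cong[OF that, of "\<lambda>s. coeff s j"] v by (simp add: cg)
      have "coeff (p i) j = coeff (p' i) j" for j
        using c[of j] v(1,2)[of i] by (cases "j < n") (auto simp: vecs_def)
      moreover have "coeff (q i) j = coeff (q' i) j" for j using c[of "n + j"] by simp
      ultimately show ?thesis by (simp add: poly_eq_iff)
    qed
    then show "((\<lambda>(p, q) i. glue (p i) (q i)) x = (\<lambda>(p, q) i. glue (p i) (q i)) y) = (x = y)"
      unfolding xy by (auto simp: fun_eq_iff)
  next
    fix x assume "x \<in> ?S1 \<times> ?S2"
    then show "(\<lambda>(p, q) i. glue (p i) (q i)) x \<in> ?S"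
      using mem[of "fst x" "snd x"] by (auto simp: sol_space_def[of n] sol_space_def[of m] split: prod.splits)
  next
    fix s assume s: "s \<in> ?S"
    define p where "p i = poly_cutoff n (s i)" for i
    define q where "q i = poly_shift n (s i)" for i
    have sv: "s i \<in> vecs (n + m)" "i \<ge> D ==> s i = 0" for i using s by (auto simp: sol_space_def)
    have pv: "p i \<in> vecs n" "q i \<in> vecs m" for i
      using sv(1)[of i] by (auto simp: p_def q_def vecs_def coeff_poly_cutoff coeff_poly_shift)
    have g: "glue (p i) (q i) = s i" for i
      by (rule poly_eqI) (simp add: cg[OF pv(1)], simp add: p_def q_def coeff_poly_cutoff coeff_poly_shift)
    have "p i = 0 \<and> q i = 0" if "i \<ge> D" for i
      using sv(2)[OF that] by (simp add: p_def q_def poly_eq_iff coeff_poly_cutoff coeff_poly_shift)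
    then have "(\<lambda>i. glue (p i) (q i)) \<in> ?S \<longleftrightarrow> p \<in> ?S1 \<and> q \<in> ?S2" by (intro mem pv)
    then have "p \<in> ?S1 \<and> q \<in> ?S2" using s by (simp add: g)
    then show "\<exists>x\<in>?S1 \<times> ?S2. s = (\<lambda>(p, q) i. glue (p i) (q i)) x"
      using g by (intro bexI[of _ "(p, q)"]) auto
  qed
  from bij_betw_same_card[OF this] show ?thesis by (simp add: card_cartesian_product)
qed

lemma sol_space_0: "sol_space 0 {} A B D r = {\<lambda>_. 0}"
  by (auto simp: sol_space_def vecs_0 fun_eq_iff)

abbreviation mat_fun :: "'a mat => nat => nat => 'a" where
  "mat_fun A \<equiv> \<lambda>i j. A $$ (i, j)"

lemma card_sol_space_four_block:
  assumes A: "A1 \<in> carrier_mat n n" "B1 \<in> carrier_mat n n" and B: "A2 \<in> carrier_mat m m" "B2 \<in> carrier_mat m m"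
  shows "card (sol_space (n + m) {..<n + m} (mat_fun (four_block_mat A1 (0\<^sub>m n m) (0\<^sub>m m n) A2))
      (mat_fun (four_block_mat B1 (0\<^sub>m n m) (0\<^sub>m m n) B2)) D r) =
    card (sol_space n {..<n} (mat_fun A1) (mat_fun B1) D r) * card (sol_space m {..<m} (mat_fun A2) (mat_fun B2) D r)"
proof -
  let ?A = "four_block_mat A1 (0\<^sub>m n m) (0\<^sub>m m n) A2" and ?B = "four_block_mat B1 (0\<^sub>m n m) (0\<^sub>m m n) B2"
  have K: "{..<n + m} = {..<n} \<union> (+) n ` {..<m}"
    using lessThan_atLeast0 by (auto simp: image_iff)
  have "card (sol_space (n + m) {..<n + m} (mat_fun ?A) (mat_fun ?B) D r)
    = card (sol_space n {..<n} (mat_fun ?A) (mat_fun ?B) D r) *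
      card (sol_space m ((+) n ` {..<m}) (\<lambda>k j. ?A $$ (k, n + j)) (\<lambda>k j. ?B $$ (k, n + j)) D r)"
    unfolding K by (rule card_sol_space_split) (use A B in auto)
  also have "sol_space n {..<n} (mat_fun ?A) (mat_fun ?B) D r = sol_space n {..<n} (mat_fun A1) (mat_fun B1) D r"
    by (rule sol_space_cong) (use A B in auto)
  also have "sol_space m ((+) n ` {..<m}) (\<lambda>k j. ?A $$ (k, n + j)) (\<lambda>k j. ?B $$ (k, n + j)) D r
      = sol_space m {..<m} (mat_fun A2) (mat_fun B2) D r"
    unfolding sol_space_reindex by (rule sol_space_cong) (use A B in auto)
  finally show ?thesis .
qed

lemma card_sol_space_off_diag:
  assumes A: "A \<in> carrier_mat a b" "B \<in> carrier_mat a b"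
  shows "card (sol_space (a + b) {..<a + b} (mat_fun (off_diag A)) (mat_fun (off_diag B)) D r) =
    card (sol_space b {..<a} (mat_fun A) (mat_fun B) D r) *
    card (sol_space a {..<b} (\<lambda>k j. A $$ (j, k)) (\<lambda>k j. B $$ (j, k)) D r)"
proof -
  have d: "dim_row A = a" "dim_col A = b" "dim_row B = a" "dim_col B = b" using A by auto
  have K: "{..<a + b} = (+) a ` {..<b} \<union> {..<a}"
    using lessThan_atLeast0 by (auto simp: image_iff)
  have "card (sol_space (a + b) {..<a + b} (mat_fun (off_diag A)) (mat_fun (off_diag B)) D r)
    = card (sol_space a ((+) a ` {..<b}) (mat_fun (off_diag A)) (mat_fun (off_diag B)) D r) *
      card (sol_space b {..<a} (\<lambda>k j. off_diag A $$ (k, a + j)) (\<lambda>k j. off_diag B $$ (k, a + j)) D r)"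
    unfolding K by (rule card_sol_space_split) (auto simp: off_diag_def d)
  also have "sol_space b {..<a} (\<lambda>k j. off_diag A $$ (k, a + j)) (\<lambda>k j. off_diag B $$ (k, a + j)) D r
      = sol_space b {..<a} (mat_fun A) (mat_fun B) D r"
    by (rule sol_space_cong) (auto simp: off_diag_def d)
  also have "sol_space a ((+) a ` {..<b}) (mat_fun (off_diag A)) (mat_fun (off_diag B)) D r
      = sol_space a {..<b} (\<lambda>k j. A $$ (j, k)) (\<lambda>k j. B $$ (j, k)) D r"
    unfolding sol_space_reindex by (rule sol_space_cong) (auto simp: off_diag_def d)
  finally show ?thesis by (simp add: mult.commute)
qed

lemma card_sol_space_diag_block:
  assumes "!!A B. (A, B) \<in> set Ms ==> square_mat A \<and> square_mat B \<and> dim_row A = dim_row B"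
  shows "card (sol_space (sum_list (map (dim_row \<circ> fst) Ms)) {..<sum_list (map (dim_row \<circ> fst) Ms)}
      (mat_fun (diag_block_mat (map fst Ms))) (mat_fun (diag_block_mat (map snd Ms))) D r) =
    prod_list (map (\<lambda>(A, B). card (sol_space (dim_row A) {..<dim_row A} (mat_fun A) (mat_fun B) D r)) Ms)"
  using assms
proof (induction Ms)
  case Nil
  then show ?case by (simp add: sol_space_0)
next
  case (Cons M Ms)
  obtain A B where M: "M = (A, B)" by (cases M)
  let ?n = "dim_row A" and ?m = "sum_list (map (dim_row \<circ> fst) Ms)"
  have dims: "dim_col (fst N) = dim_row (fst N)" "dim_row (snd N) = dim_row (fst N)"
    "dim_col (snd N) = dim_row (fst N)" if "N \<in> set (M # Ms)" for N
  proof -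
    have "square_mat (fst N) \<and> square_mat (snd N) \<and> dim_row (fst N) = dim_row (snd N)"
      by (rule Cons.prems) (use that in simp)
    then show "dim_col (fst N) = dim_row (fst N)" "dim_row (snd N) = dim_row (fst N)"
      "dim_col (snd N) = dim_row (fst N)"
      by (simp_all only: square_mat.simps)
  qed
  have "dim_col A = dim_row A" "dim_row B = dim_row A" "dim_col B = dim_row A"
    using dims[OF list.set_intros(1)] by (simp_all only: M fst_conv snd_conv)
  then have sq: "A \<in> carrier_mat ?n ?n" "B \<in> carrier_mat ?n ?n"
    by (intro carrier_matI, simp_all only:)+
  have e: "map (dim_row \<circ> fst) Ms = map dim_row (map fst Ms)" "map (dim_row \<circ> fst) Ms = map dim_col (map fst Ms)"
    "map (dim_row \<circ> fst) Ms = map dim_row (map snd Ms)" "map (dim_row \<circ> fst) Ms = map dim_col (map snd Ms)"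
    by (simp_all add: dims[OF list.set_intros(2)])
  have D1: "diag_block_mat (map fst Ms) \<in> carrier_mat ?m ?m"
    by (intro carrier_matI) (simp_all only: dim_diag_block_mat e(1)[symmetric] e(2)[symmetric])
  have D2: "diag_block_mat (map snd Ms) \<in> carrier_mat ?m ?m"
    by (intro carrier_matI) (simp_all only: dim_diag_block_mat e(3)[symmetric] e(4)[symmetric])
  have d: "dim_row (diag_block_mat (map fst Ms)) = ?m" "dim_col (diag_block_mat (map fst Ms)) = ?m"
    "dim_row (diag_block_mat (map snd Ms)) = ?m" "dim_col (diag_block_mat (map snd Ms)) = ?m"
    "dim_row B = ?n" "dim_col B = ?n" "dim_col A = ?n"
    using carrier_matD[OF D1] carrier_matD[OF D2] carrier_matD[OF sq(2)] carrier_matD[OF sq(1)] by (simp_all only:)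
  have "card (sol_space ?m {..<?m} (mat_fun (diag_block_mat (map fst Ms))) (mat_fun (diag_block_mat (map snd Ms))) D r) =
      prod_list (map (\<lambda>(A, B). card (sol_space (dim_row A) {..<dim_row A} (mat_fun A) (mat_fun B) D r)) Ms)"
    by (rule Cons.IH) (rule Cons.prems, simp)
  moreover have "sum_list (map (dim_row \<circ> fst) (M # Ms)) = ?n + ?m" by (simp add: M)
  moreover have "diag_block_mat (map fst (M # Ms))
      = four_block_mat A (0\<^sub>m ?n ?m) (0\<^sub>m ?m ?n) (diag_block_mat (map fst Ms))"
    "diag_block_mat (map snd (M # Ms))
      = four_block_mat B (0\<^sub>m ?n ?m) (0\<^sub>m ?m ?n) (diag_block_mat (map snd Ms))"
    by (simp_all only: M fst_conv snd_conv list.map diag_block_mat.simps Let_def d)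
  ultimately show ?case
    by (simp only: card_sol_space_four_block[OF sq D1 D2]) (simp add: M)
qed


section \<open>Counts on Frobenius blocks\<close>

lemma sum_monomials:
  assumes "r \<in> vecs n"
  shows "(\<Sum>i<n. monom (coeff r i) i) = r"
proof (rule poly_eqI)
  fix j
  have "coeff (\<Sum>i<n. monom (coeff r i) i) j = (\<Sum>i<n. if i = j then coeff r i else 0)"
    unfolding coeff_sum by (intro sum.cong) auto
  then show "coeff (\<Sum>i<n. monom (coeff r i) i) j = coeff r j" using assms by (auto simp: vecs_def)
qed

lemma sum_smult_monomials:
  assumes "r \<in> vecs n"
  shows "(\<Sum>i<n. smult (coeff r i) (monom 1 i * y)) = r * y"
proof -
  have "(\<Sum>i<n. smult (coeff r i) (monom 1 i * y)) = (\<Sum>i<n. monom (coeff r i) i) * y"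
    by (simp add: sum_distrib_right mult_smult_left[symmetric] smult_monom)
  then show ?thesis by (simp add: sum_monomials[OF assms])
qed

lemma mod_sum_smult: "(\<Sum>i\<in>I. smult (c i) (f i mod P)) = (\<Sum>i\<in>I. smult (c i) (f i)) mod (P :: bit poly)"
  by (induction I rule: infinite_finite_induct) (simp_all add: poly_mod_add_left mod_smult_left)

lemma vecs_eqI: "p \<in> vecs n ==> q \<in> vecs n ==> (!!k. k < n ==> coeff p k = coeff q k) ==> p = q"
proof (rule poly_eqI)
  fix k assume "p \<in> vecs n" "q \<in> vecs n" "!!k. k < n ==> coeff p k = coeff q k"
  then show "coeff p k = coeff q k" by (cases "k < n") (simp_all add: vecs_def)
qed

lemma vecs_eq_iff: "p \<in> vecs n ==> q \<in> vecs n ==> p = q \<longleftrightarrow> (\<forall>k<n. coeff p k = coeff q k)"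
  using vecs_eqI[of p n q] by blast

lemma sol_space_iff:
  assumes A: "!!q k. q \<in> vecs n ==> k \<in> K ==> (\<Sum>j<n. A k j * coeff q j) = a q k"
    and B: "!!q k. q \<in> vecs n ==> k \<in> K ==> (\<Sum>j<n. B k j * coeff q j) = b q k"
    and q: "\<forall>i. q i \<in> vecs n" "\<forall>i\<ge>D. q i = 0"
  shows "q \<in> sol_space n K A B D r \<longleftrightarrow> (\<forall>i. Suc i < D --> (\<forall>k\<in>K. a (q (Suc i)) k = b (q i) k)) \<and>
      (\<forall>k\<in>K. (\<Sum>i<D. coeff r i * a (q i) k) + coeff r D * b (q (D - 1)) k = 0)"
proof -
  have e: "(\<Sum>j<n. A k j * coeff (q i) j) = a (q i) k" "(\<Sum>j<n. B k j * coeff (q i) j) = b (q i) k"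
    if "k \<in> K" for i k
    using A B q that by simp_all
  show ?thesis unfolding sol_space_def mem_Collect_eq using q by (simp add: e cong: ball_cong)
qed

lemma vecs_mod: "(P :: bit poly) ~= 0 ==> p mod P \<in> vecs (degree P)"
  using degree_mod_less[of P p] by (auto simp: vecs_degree)

lemma mod_vecs: "p \<in> vecs (degree P) ==> p mod (P :: bit poly) = p"
  by (auto simp: vecs_degree mod_poly_less)

lemma pCons_mod:
  fixes P :: "bit poly"
  assumes d: "degree P > 0" and q: "q \<in> vecs (degree P)"
  shows "pCons 0 q mod P = pCons 0 q + smult (coeff q (degree P - 1)) P"
proof -
  let ?c = "coeff q (degree P - 1)" and ?r = "pCons 0 q + smult (coeff q (degree P - 1)) P"
  have lc: "coeff P (degree P) = 1"
    using d leading_coeff_0_iff[of P] by (cases "coeff P (degree P)") auto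
  have r: "?r \<in> vecs (degree P)"
    unfolding vecs_def mem_Collect_eq
  proof (intro allI impI)
    fix i assume i: "degree P \<le> i"
    then obtain i' where i': "i = Suc i'" using d by (cases i) auto
    show "coeff ?r i = 0"
    proof (cases "i = degree P")
      case True
      then have e: "degree P - 1 = i'" "coeff P (Suc i') = 1" using i' lc by simp_all
      show ?thesis
        unfolding i' coeff_add coeff_smult coeff_pCons_Suc e mult_1_right by (rule add_self)
    next
      case False
      then have "coeff P i = 0" "coeff q i' = 0" using i i' q by (auto simp: coeff_eq_0 vecs_def)
      then show ?thesis by (simp add: i')
    qed
  qed
  have "pCons 0 q = ?r + [:?c:] * P" by (simp add: ac_simps)
  then have "pCons 0 q mod P = (?r + [:?c:] * P) mod P" by (rule arg_cong)
  also have "... = ?r mod P" by (rule mod_mult_self1)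
  also have "... = ?r" by (rule mod_vecs[OF r])
  finally show ?thesis .
qed

lemma frobenius_apply:
  assumes d: "degree P > 0" and q: "q \<in> vecs (degree P)" and k: "k < degree P"
  shows "(\<Sum>j<degree P. frobenius_mat P $$ (k, j) * coeff q j) = coeff (pCons 0 q mod P) k"
proof -
  let ?d = "degree P"
  have "(\<Sum>j<?d. frobenius_mat P $$ (k, j) * coeff q j)
    = (\<Sum>j<?d. if j = ?d - 1 then coeff P k * coeff q j else 0) + (\<Sum>j<?d. if Suc j = k then coeff q j else 0)"
    unfolding sum.distrib[symmetric]
    by (intro sum.cong) (use k in \<open>auto simp: frobenius_mat_def\<close>)
  also have "(\<Sum>j<?d. if Suc j = k then coeff q j else 0) = coeff (pCons 0 q) k"
    using k by (cases k) auto
  finally show ?thesis using d by (simp add: pCons_mod[OF d q] ac_simps)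
qed

lemma unit_mat_apply: "q \<in> vecs d ==> k < d ==> (\<Sum>j<d. 1\<^sub>m d $$ (k, j) * coeff q j) = (coeff q k :: bit)"
  and unit_mat_apply': "q \<in> vecs d ==> k < d ==> (\<Sum>j<d. 1\<^sub>m d $$ (j, k) * coeff q j) = (coeff q k :: bit)"
proof -
  assume k: "k < d"
  have "(\<Sum>j<d. 1\<^sub>m d $$ (k, j) * coeff q j) = (\<Sum>j<d. if k = j then coeff q j else 0)"
    "(\<Sum>j<d. 1\<^sub>m d $$ (j, k) * coeff q j) = (\<Sum>j<d. if k = j then coeff q j else 0)"
    using k by (intro sum.cong refl; simp)+
  then show "(\<Sum>j<d. 1\<^sub>m d $$ (k, j) * coeff q j) = coeff q k" "(\<Sum>j<d. 1\<^sub>m d $$ (j, k) * coeff q j) = coeff q k"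
    using k by (simp_all only: sum.delta' finite_lessThan lessThan_iff if_True)
qed

text \<open>The kernel of multiplication by \<open>r\<close> on \<open>F\<^sub>2[x]/(P)\<close>.\<close>

definition cyclic_kernel :: "bit poly => bit poly => bit poly set" where
  "cyclic_kernel P r = {y \<in> vecs (degree P). P dvd r * y}"

text \<open>The Frobenius matrix is multiplication by \<open>x\<close> modulo \<open>P\<close>, so a solution
  is determined by \<open>q\<^sub>0\<close>, and the last equation says that \<open>r
  q\<^sub>0\<close> vanishes modulo \<open>P\<close>.\<close>

lemma card_sol_space_frobenius:
  assumes d: "degree P > 0" and D: "D \<ge> 1" and r: "r \<in> vecs (Suc D)"
  shows "card (sol_space (degree P) {..<degree P} (mat_fun (1\<^sub>m (degree P))) (mat_fun (frobenius_mat P)) D r)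
    = card (cyclic_kernel P r)"
proof -
  let ?d = "degree P"
  let ?S = "sol_space ?d {..<?d} (mat_fun (1\<^sub>m ?d)) (mat_fun (frobenius_mat P)) D r"
  have P0: "P ~= 0" using d by auto
  have iter: "pCons 0 ((monom 1 i * y) mod P) mod P = (monom 1 (Suc i) * y) mod P" for i y
  proof -
    have "pCons 0 ((monom 1 i * y) mod P) mod P = ([:0, 1:] * ((monom 1 i * y) mod P)) mod P" by simp
    also have "... = ([:0, 1:] * (monom 1 i * y)) mod P" by (rule mod_mult_right_eq)
    finally show ?thesis by (simp add: monom_Suc)
  qed
  have mem: "q \<in> ?S \<longleftrightarrow> (\<forall>i. Suc i < D --> q (Suc i) = pCons 0 (q i) mod P) \<and>
      (\<Sum>i<D. smult (coeff r i) (q i)) + smult (coeff r D) (pCons 0 (q (D - 1)) mod P) = 0"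
    if q: "\<forall>i. q i \<in> vecs ?d" "\<forall>i\<ge>D. q i = 0" for q
  proof -
    have qi: "q i \<in> vecs ?d" for i using q by blast
    have v: "(\<Sum>i<D. smult (coeff r i) (q i)) + smult (coeff r D) (pCons 0 (q (D - 1)) mod P) \<in> vecs ?d"
      using qi vecs_mod[OF P0] by (auto simp: vecs_def coeff_sum)
    have 1: "(q (Suc i) = pCons 0 (q i) mod P) \<longleftrightarrow> (\<forall>k<?d. coeff (q (Suc i)) k = coeff (pCons 0 (q i) mod P) k)" for i
      by (rule vecs_eq_iff[OF qi vecs_mod[OF P0]])
    have 2: "((\<Sum>i<D. smult (coeff r i) (q i)) + smult (coeff r D) (pCons 0 (q (D - 1)) mod P) = 0)
      \<longleftrightarrow> (\<forall>k<?d. (\<Sum>i<D. coeff r i * coeff (q i) k) + coeff r D * coeff (pCons 0 (q (D - 1)) mod P) k = 0)"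
      unfolding vecs_eq_iff[OF v subgrpD(1)[OF subgrp_vecs]] by (simp add: coeff_sum)
    have "q \<in> ?S \<longleftrightarrow> (\<forall>i. Suc i < D --> (\<forall>k\<in>{..<?d}. coeff (q (Suc i)) k = coeff (pCons 0 (q i) mod P) k)) \<and>
      (\<forall>k\<in>{..<?d}. (\<Sum>i<D. coeff r i * coeff (q i) k) + coeff r D * coeff (pCons 0 (q (D - 1)) mod P) k = 0)"
      by (rule sol_space_iff[OF _ _ q]) (simp_all only: unit_mat_apply frobenius_apply[OF d] lessThan_iff)
    then show ?thesis unfolding 1 2 by (simp only: Ball_def lessThan_iff)
  qed
  have pow: "q i = (monom 1 i * q 0) mod P" if q: "q \<in> ?S" and i: "i < D" for q i
    using i
  proof (induction i)
    case 0
    have "q 0 \<in> vecs ?d" using q by (simp add: sol_space_def)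
    then show ?case by (simp add: mod_vecs)
  next
    case (Suc i)
    have "q (Suc i) = pCons 0 (q i) mod P" using mem[of q] q Suc.prems by (auto simp: sol_space_def)
    then show ?case using Suc iter by simp
  qed
  have total: "(\<Sum>i<D. smult (coeff r i) ((monom 1 i * y) mod P))
      + smult (coeff r D) (pCons 0 ((monom 1 (D - 1) * y) mod P) mod P) = (r * y) mod P" for y
  proof -
    have "(\<Sum>i<D. smult (coeff r i) ((monom 1 i * y) mod P))
      + smult (coeff r D) (pCons 0 ((monom 1 (D - 1) * y) mod P) mod P)
      = (\<Sum>i<Suc D. smult (coeff r i) ((monom 1 i * y) mod P))"
      using D by (simp add: iter)
    also have "... = (r * y) mod P" unfolding mod_sum_smult sum_smult_monomials[OF r] ..
    finally show ?thesis .
  qed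
  have "bij_betw (\<lambda>q. q 0) ?S (cyclic_kernel P r)"
  proof (rule bij_betwI')
    fix q q' assume q: "q \<in> ?S" "q' \<in> ?S"
    have "q = q'" if "q 0 = q' 0"
    proof
      fix i show "q i = q' i"
        using pow[OF q(1), of i] pow[OF q(2), of i] that q by (cases "i < D") (auto simp: sol_space_def)
    qed
    then show "(q 0 = q' 0) = (q = q')" by auto
  next
    fix q assume q: "q \<in> ?S"
    have v: "\<forall>i. q i \<in> vecs ?d" "\<forall>i\<ge>D. q i = 0" using q by (auto simp: sol_space_def)
    have "(\<Sum>i<D. smult (coeff r i) (q i)) + smult (coeff r D) (pCons 0 (q (D - 1)) mod P) = 0"
      using mem[OF v] q by blast
    moreover have "(\<Sum>i<D. smult (coeff r i) (q i)) = (\<Sum>i<D. smult (coeff r i) ((monom 1 i * q 0) mod P))"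
      by (intro sum.cong refl) (simp flip: pow[OF q])
    moreover have "q (D - 1) = (monom 1 (D - 1) * q 0) mod P" using D by (intro pow[OF q]) simp
    ultimately have "(r * q 0) mod P = 0" using total[of "q 0"] by simp
    then show "q 0 \<in> cyclic_kernel P r" using v by (simp add: cyclic_kernel_def dvd_eq_mod_eq_0)
  next
    fix y assume y: "y \<in> cyclic_kernel P r"
    define q where "q i = (if i < D then (monom 1 i * y) mod P else 0)" for i
    have v: "\<forall>i. q i \<in> vecs ?d" "\<forall>i\<ge>D. q i = 0"
      using vecs_mod[OF P0] subgrpD(1)[OF subgrp_vecs] by (auto simp: q_def)
    have "(\<Sum>i<D. smult (coeff r i) (q i)) + smult (coeff r D) (pCons 0 (q (D - 1)) mod P) = (r * y) mod P"
      using total[of y] D by (simp add: q_def)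
    also have "... = 0" using y by (simp add: cyclic_kernel_def)
    finally have "q \<in> ?S" unfolding mem[OF v] by (simp add: q_def iter)
    moreover have "q 0 = y" using y D by (simp add: q_def cyclic_kernel_def mod_vecs)
    ultimately show "\<exists>q\<in>?S. y = q 0" by blast
  qed
  from bij_betw_same_card[OF this] show ?thesis .
qed

text \<open>All functionals on \<open>F\<^sub>2[x]/(P)\<close>, indexed by coefficient vectors.\<close>

definition residue_functional :: "bit poly => bit poly => bit poly => bit" where
  "residue_functional P s p = (\<Sum>j<degree P. coeff (p mod P) j * coeff s j)"

lemma residue_functional_add:
  "residue_functional P s (p + q) = residue_functional P s p + residue_functional P s q"
  "residue_functional P (s + t) p = residue_functional P s p + residue_functional P t p"
  by (simp_all add: residue_functional_def poly_mod_add_left algebra_simps sum.distrib)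

lemma residue_functional_mod_mult: "residue_functional P s (x * (p mod P)) = residue_functional P s (x * p)"
  unfolding residue_functional_def by (simp add: mod_mult_right_eq)

lemma residue_functional_0 [simp]: "residue_functional P s 0 = 0"
  by (simp add: residue_functional_def)

lemma residue_functional_sum:
  "residue_functional P s (sum f I) = (\<Sum>i\<in>I. residue_functional P s (f i))"
  by (induction I rule: infinite_finite_induct) (simp_all add: residue_functional_add)

lemma residue_functional_smult: "residue_functional P s (smult c p) = c * residue_functional P s p"
  by (cases c) simp_all

lemma residue_functional_monom:
  assumes "k < degree P"
  shows "residue_functional P s (monom 1 k) = coeff s k"
proof -
  have "monom 1 k mod P = monom 1 k" using assms by (intro mod_vecs) (simp add: vecs_def)
  then have "residue_functional P s (monom 1 k) = (\<Sum>j<degree P. if k = j then coeff s j else 0)"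
    unfolding residue_functional_def by (intro sum.cong) auto
  then show ?thesis using assms by simp
qed

lemma residue_functional_expand:
  assumes "P ~= 0"
  shows "residue_functional P s (x * p) = (\<Sum>k<degree P. coeff (p mod P) k * residue_functional P s (x * monom 1 k))"
proof -
  have "x * (p mod P) = (\<Sum>k<degree P. smult (coeff (p mod P) k) (x * monom 1 k))"
    using sum_smult_monomials[OF vecs_mod[OF assms, of p], of x] by (simp add: mult.commute)
  then have "residue_functional P s (x * (p mod P))
    = (\<Sum>k<degree P. coeff (p mod P) k * residue_functional P s (x * monom 1 k))"
    by (simp add: residue_functional_sum residue_functional_smult)
  then show ?thesis by (simp add: residue_functional_mod_mult)
qed

lemma residue_functional_nondegenerate:
  assumes "P ~= 0"
  shows "(\<forall>s\<in>vecs (degree P). residue_functional P s p = 0) \<longleftrightarrow> P dvd p"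
proof
  assume z: "\<forall>s\<in>vecs (degree P). residue_functional P s p = 0"
  have "coeff (p mod P) k = 0" if k: "k < degree P" for k
  proof -
    have "residue_functional P (monom 1 k) p = (\<Sum>j<degree P. if j = k then coeff (p mod P) j else 0)"
      unfolding residue_functional_def by (intro sum.cong) auto
    then show ?thesis using z k by (auto simp: vecs_def)
  qed
  then have "p mod P = 0" by (intro vecs_eqI[OF vecs_mod[OF assms] subgrpD(1)[OF subgrp_vecs]]) simp
  then show "P dvd p" by (simp add: dvd_eq_mod_eq_0)
qed (simp add: residue_functional_def)

lemma card_annihilated_functionals:
  assumes P0: "P ~= 0"
  shows "card {s \<in> vecs (degree P). \<forall>y\<in>vecs (degree P). residue_functional P s (r * y) = 0}
    = card (cyclic_kernel P r)"
proof -
  let ?V = "vecs (degree P)"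
  have "card {s \<in> ?V. \<forall>y\<in>?V. residue_functional P s (r * y) = 0} * card ?V
    = card {y \<in> ?V. \<forall>s\<in>?V. residue_functional P s (r * y) = 0} * card ?V"
    by (rule card_left_right_kernel)
      (simp_all add: subgrp_vecs additive_on_def residue_functional_add distrib_left)
  moreover have "{y \<in> ?V. \<forall>s\<in>?V. residue_functional P s (r * y) = 0} = cyclic_kernel P r"
    by (simp add: residue_functional_nondegenerate[OF P0] cyclic_kernel_def)
  ultimately show ?thesis by (simp add: card_vecs)
qed

text \<open>The transposed block acts on functionals, and multiplication by \<open>r\<close> and its transpose
  have kernels of the same size.\<close>

lemma card_sol_space_frobenius_transpose:
  assumes d: "degree P > 0" and D: "D \<ge> 1" and r: "r \<in> vecs (Suc D)"
  shows "card (sol_space (degree P) {..<degree P} (\<lambda>k j. 1\<^sub>m (degree P) $$ (j, k))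
      (\<lambda>k j. frobenius_mat P $$ (j, k)) D r) = card (cyclic_kernel P r)"
proof -
  let ?d = "degree P"
  let ?S = "sol_space ?d {..<?d} (\<lambda>k j. 1\<^sub>m ?d $$ (j, k)) (\<lambda>k j. frobenius_mat P $$ (j, k)) D r"
  let ?L = "residue_functional P"
  let ?A = "{s \<in> vecs ?d. \<forall>y\<in>vecs ?d. ?L s (r * y) = 0}"
  have P0: "P ~= 0" using d by auto
  have frob: "(\<Sum>j<?d. frobenius_mat P $$ (j, k) * coeff q j) = ?L q (monom 1 (Suc k))" if k: "k < ?d" for k q
  proof -
    have "frobenius_mat P $$ (j, k) = coeff (monom 1 (Suc k) mod P) j" if j: "j < ?d" for j
    proof -
      have "(\<Sum>l<?d. frobenius_mat P $$ (j, l) * coeff (monom 1 k) l) = coeff (pCons 0 (monom 1 k) mod P) j"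
        using k j by (intro frobenius_apply d) (auto simp: vecs_def)
      moreover have "(\<Sum>l<?d. frobenius_mat P $$ (j, l) * coeff (monom 1 k) l)
        = (\<Sum>l<?d. if k = l then frobenius_mat P $$ (j, l) else 0)" by (intro sum.cong) auto
      ultimately show ?thesis using k by (simp add: monom_Suc)
    qed
    then show ?thesis by (simp add: residue_functional_def)
  qed
  have mem: "q \<in> ?S \<longleftrightarrow> (\<forall>i. Suc i < D --> (\<forall>k<?d. coeff (q (Suc i)) k = ?L (q i) (monom 1 (Suc k)))) \<and>
      (\<forall>k<?d. (\<Sum>i<D. coeff r i * coeff (q i) k) + coeff r D * ?L (q (D - 1)) (monom 1 (Suc k)) = 0)"
    if q: "\<forall>i. q i \<in> vecs ?d" "\<forall>i\<ge>D. q i = 0" for q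
  proof -
    have "q \<in> ?S \<longleftrightarrow> (\<forall>i. Suc i < D --> (\<forall>k\<in>{..<?d}. coeff (q (Suc i)) k = ?L (q i) (monom 1 (Suc k)))) \<and>
      (\<forall>k\<in>{..<?d}. (\<Sum>i<D. coeff r i * coeff (q i) k) + coeff r D * ?L (q (D - 1)) (monom 1 (Suc k)) = 0)"
      by (rule sol_space_iff[OF _ _ q]) (simp_all only: unit_mat_apply' frob lessThan_iff)
    then show ?thesis by (simp only: Ball_def lessThan_iff)
  qed
  have power: "?L (q i) p = ?L (q 0) (monom 1 i * p)"
    if i: "i < D" and step: "!!i k. Suc i < D ==> k < ?d ==> coeff (q (Suc i)) k = ?L (q i) (monom 1 (Suc k))" for q i p
    using i
  proof (induction i arbitrary: p)
    case (Suc i)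
    have "?L (q (Suc i)) (1 * p) = (\<Sum>k<?d. coeff (p mod P) k * ?L (q (Suc i)) (1 * monom 1 k))"
      by (rule residue_functional_expand[OF P0])
    also have "... = (\<Sum>k<?d. coeff (p mod P) k * ?L (q i) ([:0, 1:] * monom 1 k))"
      using step[OF Suc.prems] by (intro sum.cong refl) (simp add: residue_functional_monom monom_Suc)
    also have "... = ?L (q i) ([:0, 1:] * p)" by (rule residue_functional_expand[OF P0, symmetric])
    also have "... = ?L (q 0) (monom 1 (Suc i) * p)"
      using Suc.IH[of "[:0, 1:] * p"] Suc.prems by (simp add: monom_Suc)
    finally show ?case by simp
  qed simp
  have total: "(\<Sum>i<D. coeff r i * ?L s (monom 1 i * y)) + coeff r D * ?L s (monom 1 D * y) = ?L s (r * y)" for s y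
  proof -
    have "(\<Sum>i<D. coeff r i * ?L s (monom 1 i * y)) + coeff r D * ?L s (monom 1 D * y)
      = ?L s (\<Sum>i<Suc D. smult (coeff r i) (monom 1 i * y))"
      by (simp add: residue_functional_sum residue_functional_smult residue_functional_add)
    then show ?thesis unfolding sum_smult_monomials[OF r] .
  qed
  have D1: "monom 1 (D - 1) * monom 1 (Suc k) = (monom 1 D * monom 1 k :: bit poly)" for k
    using D by (simp add: mult_monom)
  have cond: "(\<forall>k<?d. ?L s (r * monom 1 k) = 0) \<longleftrightarrow> (\<forall>y\<in>vecs ?d. ?L s (r * y) = 0)" for s
  proof
    assume "\<forall>k<?d. ?L s (r * monom 1 k) = 0"
    then have "?L s (r * y) = 0" for y
      by (subst residue_functional_expand[OF P0]) (simp add: sum.neutral)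
    then show "\<forall>y\<in>vecs ?d. ?L s (r * y) = 0" by simp
  qed (simp add: vecs_def)
  have "bij_betw (\<lambda>q. q 0) ?S ?A"
  proof (rule bij_betwI')
    fix q q' assume q: "q \<in> ?S" "q' \<in> ?S"
    have c: "coeff (q i) k = ?L (q 0) (monom 1 i * monom 1 k)" if "q \<in> ?S" "i < D" "k < ?d" for q i k
    proof -
      have "?L (q i) (monom 1 k) = ?L (q 0) (monom 1 i * monom 1 k)"
        by (rule power[OF that(2)]) (use mem[of q] that(1) in \<open>auto simp: sol_space_def\<close>)
      then show ?thesis using that by (simp add: residue_functional_monom)
    qed
    have "q = q'" if e: "q 0 = q' 0"
    proof
      fix i
      have v: "q i \<in> vecs ?d" "q' i \<in> vecs ?d" using q by (auto simp: sol_space_def)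
      show "q i = q' i"
      proof (cases "i < D")
        case True
        then show ?thesis using c[OF q(1) True] c[OF q(2) True] e by (intro vecs_eqI[OF v]) simp
      next
        case False
        then show ?thesis using q by (simp add: sol_space_def)
      qed
    qed
    then show "(q 0 = q' 0) = (q = q')" by auto
  next
    fix q assume q: "q \<in> ?S"
    have v: "\<forall>i. q i \<in> vecs ?d" "\<forall>i\<ge>D. q i = 0" using q by (auto simp: sol_space_def)
    have st: "coeff (q (Suc i)) k = ?L (q i) (monom 1 (Suc k))" if "Suc i < D" "k < ?d" for i k
      using mem[OF v] q that by blast
    have "?L (q 0) (r * monom 1 k) = 0" if k: "k < ?d" for k
    proof -
      have "(\<Sum>i<D. coeff r i * coeff (q i) k) + coeff r D * ?L (q (D - 1)) (monom 1 (Suc k)) = 0"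
        using mem[OF v] q k by blast
      moreover have "(\<Sum>i<D. coeff r i * coeff (q i) k) = (\<Sum>i<D. coeff r i * ?L (q 0) (monom 1 i * monom 1 k))"
      proof (intro sum.cong refl)
        fix i assume "i \<in> {..<D}"
        then have "?L (q i) (monom 1 k) = ?L (q 0) (monom 1 i * monom 1 k)" by (intro power st) auto
        then show "coeff r i * coeff (q i) k = coeff r i * ?L (q 0) (monom 1 i * monom 1 k)"
          using k by (simp add: residue_functional_monom)
      qed
      moreover have "?L (q (D - 1)) (monom 1 (Suc k)) = ?L (q 0) (monom 1 D * monom 1 k)"
        unfolding D1[symmetric] by (rule power) (use D st in auto)
      ultimately show ?thesis using total[of "q 0" "monom 1 k"] by simp
    qed
    then show "q 0 \<in> ?A" using cond v by blast
  next
    fix s assume s: "s \<in> ?A"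
    define q where "q i = (if i < D then (\<Sum>k<?d. monom (?L s (monom 1 i * monom 1 k)) k) else 0)" for i
    have cq: "coeff (q i) k = ?L s (monom 1 i * monom 1 k)" if "i < D" "k < ?d" for i k
    proof -
      have "coeff (q i) k = (\<Sum>l<?d. if l = k then ?L s (monom 1 i * monom 1 l) else 0)"
        using that(1) unfolding q_def by (simp add: coeff_sum)
      then show ?thesis using that by simp
    qed
    have v: "\<forall>i. q i \<in> vecs ?d" "\<forall>i\<ge>D. q i = 0"
      by (auto simp: q_def vecs_def coeff_sum intro!: sum.neutral)
    have L: "?L (q i) p = ?L s (monom 1 i * p)" if i: "i < D" for i p
    proof -
      have "?L (q i) (1 * p) = (\<Sum>k<?d. coeff (p mod P) k * ?L (q i) (1 * monom 1 k))"
        by (rule residue_functional_expand[OF P0])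
      also have "... = (\<Sum>k<?d. coeff (p mod P) k * ?L s (monom 1 i * monom 1 k))"
        using cq[OF i] by (intro sum.cong refl) (simp add: residue_functional_monom)
      also have "... = ?L s (monom 1 i * p)" by (rule residue_functional_expand[OF P0, symmetric])
      finally show ?thesis by simp
    qed
    have z: "?L s (r * monom 1 k) = 0" if "k < ?d" for k using s that by (simp add: vecs_def)
    have "q \<in> ?S"
      unfolding mem[OF v]
    proof (intro conjI allI impI)
      show "coeff (q (Suc i)) k = ?L (q i) (monom 1 (Suc k))" if "Suc i < D" "k < ?d" for i k
        using that cq[of "Suc i" k] L[of i "monom 1 (Suc k)"] by (simp add: mult_monom)
      show "(\<Sum>i<D. coeff r i * coeff (q i) k) + coeff r D * ?L (q (D - 1)) (monom 1 (Suc k)) = 0" if k: "k < ?d" for k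
      proof -
        have "?L (q (D - 1)) (monom 1 (Suc k)) = ?L s (monom 1 D * monom 1 k)"
          using L[of "D - 1" "monom 1 (Suc k)"] D unfolding D1 by simp
        then show ?thesis using total[of s "monom 1 k"] z[OF k] cq k by simp
      qed
    qed
    moreover have "q 0 = s"
      using s v D cq[of 0] by (intro vecs_eqI[of _ ?d]) (auto simp: residue_functional_monom)
    ultimately show "\<exists>q\<in>?S. s = q 0" by blast
  qed
  from bij_betw_same_card[OF this] show ?thesis using card_annihilated_functionals[OF P0] by simp
qed

lemma card_cyclic_kernel_0: "card (cyclic_kernel P 0) = 2 ^ degree P"
  by (simp add: cyclic_kernel_def card_vecs)

lemma card_cyclic_kernel_same:
  assumes f: "Factorial_Ring.irreducible (f :: bit poly)"
  shows "card (cyclic_kernel (f ^ m) (f ^ n)) = 2 ^ (degree f * min n m)"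
proof -
  have f0: "f ~= 0" using f by (simp add: irreducible_bit_poly)
  show ?thesis
  proof (cases "n \<ge> m")
    case True
    then have "f ^ m dvd f ^ n * y" for y by (intro dvd_mult2 le_imp_power_dvd)
    then have "cyclic_kernel (f ^ m) (f ^ n) = vecs (degree (f ^ m))" by (simp add: cyclic_kernel_def)
    then show ?thesis using True f0 by (simp add: card_vecs degree_power_bit min_def mult.commute)
  next
    case False
    then obtain k where k: "m = n + k" using le_Suc_ex[of n m] by auto
    have "bij_betw (\<lambda>z. f ^ k * z) (vecs (n * degree f)) (cyclic_kernel (f ^ m) (f ^ n))"
      unfolding bij_betw_def
    proof
      show "inj_on (\<lambda>z. f ^ k * z) (vecs (n * degree f))" using f0 by (simp add: inj_on_def)
      have c: "f ^ m dvd f ^ n * y \<longleftrightarrow> f ^ k dvd y" for y using f0 by (simp add: k power_add)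
      have dm: "degree (f ^ m) = n * degree f + k * degree f" "degree (f ^ k) = k * degree f"
        using f0 by (simp_all add: degree_power_bit k distrib_right)
      have dz: "f ^ k * z \<in> vecs (degree (f ^ m)) \<longleftrightarrow> z \<in> vecs (n * degree f)" for z
        using f0 by (cases "z = 0") (auto simp: vecs_degree dm degree_mult_eq)
      show "(\<lambda>z. f ^ k * z) ` vecs (n * degree f) = cyclic_kernel (f ^ m) (f ^ n)"
        unfolding cyclic_kernel_def c
      proof (intro equalityI subsetI)
        fix y assume "y \<in> {y \<in> vecs (degree (f ^ m)). f ^ k dvd y}"
        then obtain z where "y = f ^ k * z" "y \<in> vecs (degree (f ^ m))" by (auto simp: dvd_def)
        then show "y \<in> (\<lambda>z. f ^ k * z) ` vecs (n * degree f)" using dz[of z] by blast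
      qed (use dz in auto)
    qed
    from bij_betw_same_card[OF this] show ?thesis using False by (simp add: card_vecs mult.commute)
  qed
qed

lemma card_cyclic_kernel_coprime:
  assumes f: "Factorial_Ring.irreducible (f :: bit poly)" and s: "\<not> f dvd s"
  shows "card (cyclic_kernel (f ^ m) s) = 1"
proof -
  have f0: "f ~= 0" using f by (simp add: irreducible_bit_poly)
  have "cyclic_kernel (f ^ m) s = {0}"
  proof (intro equalityI subsetI)
    fix y assume y: "y \<in> cyclic_kernel (f ^ m) s"
    then have "f ^ m dvd s * y" by (simp add: cyclic_kernel_def)
    then have "f ^ m dvd y" by (rule irreducible_power_dvd_cancel[OF f s])
    then have "y = 0 \<or> degree (f ^ m) \<le> degree y" using dvd_imp_degree_le[of "f ^ m" y] by blast
    then show "y \<in> {0}" using y by (auto simp: cyclic_kernel_def vecs_degree)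
  qed (simp add: cyclic_kernel_def subgrpD(1)[OF subgrp_vecs])
  then show ?thesis by simp
qed


section \<open>Counts on blocks of type \<open>\<epsilon>\<close>, and reversal\<close>

lemma I_plus_apply: "q \<in> vecs (n - 1) ==> k < n ==> (\<Sum>j<n - 1. I_plus n $$ (k, j) * coeff q j) = coeff q k"
proof -
  assume q: "q \<in> vecs (n - 1)" and k: "k < n"
  have "(\<Sum>j<n - 1. I_plus n $$ (k, j) * coeff q j) = (\<Sum>j<n - 1. if j = k then coeff q j else 0)"
    using k by (intro sum.cong refl) (simp add: I_plus_def)
  also have "... = (if k < n - 1 then coeff q k else 0)" by simp
  also have "... = coeff q k" using q by (auto simp: vecs_def)
  finally show ?thesis .
qed

lemma I_minus_apply: "q \<in> vecs (n - 1) ==> k < n ==> (\<Sum>j<n - 1. I_minus n $$ (k, j) * coeff q j) = coeff (pCons 0 q) k"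
proof -
  assume q: "q \<in> vecs (n - 1)" and k: "k < n"
  have "(\<Sum>j<n - 1. I_minus n $$ (k, j) * coeff q j) = (\<Sum>j<n - 1. if Suc j = k then coeff q j else 0)"
    using k by (intro sum.cong refl) (simp add: I_minus_def)
  also have "... = coeff (pCons 0 q) k" using k by (cases k) auto
  finally show ?thesis .
qed

lemma I_plus_apply': "k < n - 1 ==> (\<Sum>j<n. I_plus n $$ (j, k) * coeff q j) = coeff q k"
proof -
  assume k: "k < n - 1"
  have "(\<Sum>j<n. I_plus n $$ (j, k) * coeff q j) = (\<Sum>j<n. if j = k then coeff q j else 0)"
    using k by (intro sum.cong refl) (simp add: I_plus_def)
  then show ?thesis using k by simp
qed

lemma I_minus_apply': "k < n - 1 ==> (\<Sum>j<n. I_minus n $$ (j, k) * coeff q j) = coeff q (Suc k)"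
proof -
  assume k: "k < n - 1"
  have "(\<Sum>j<n. I_minus n $$ (j, k) * coeff q j) = (\<Sum>j<n. if j = Suc k then coeff q j else 0)"
    using k by (intro sum.cong refl) (simp add: I_minus_def)
  then show ?thesis using k by simp
qed

text \<open>The equations shift a vector by one place at each step, so only \<open>D - 1\<close> shifts of a
  vector fit; the last equation is multiplication by \<open>r\<close>, which is injective unless
  \<open>r = 0\<close>.\<close>

lemma card_sol_space_tall:
  assumes n: "n \<ge> 1" and D: "D \<ge> 1" and r: "r \<in> vecs (Suc D)"
  shows "card (sol_space (n - 1) {..<n} (mat_fun (I_plus n)) (mat_fun (I_minus n)) D r)
    = (if r = 0 then 2 ^ (n - D) else 1)"
proof -
  let ?S = "sol_space (n - 1) {..<n} (mat_fun (I_plus n)) (mat_fun (I_minus n)) D r"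
  let ?K = "{y \<in> vecs (n - D). r * y = 0}"
  have mem: "q \<in> ?S \<longleftrightarrow> (\<forall>i. Suc i < D --> q (Suc i) = pCons 0 (q i)) \<and>
      (\<Sum>i<D. smult (coeff r i) (q i)) + smult (coeff r D) (pCons 0 (q (D - 1))) = 0"
    if q: "\<forall>i. q i \<in> vecs (n - 1)" "\<forall>i\<ge>D. q i = 0" for q
  proof -
    have qi: "q i \<in> vecs n" "pCons 0 (q i) \<in> vecs n" for i
      using q(1) n by (auto simp: vecs_def coeff_pCons split: nat.splits)
    have v: "(\<Sum>i<D. smult (coeff r i) (q i)) + smult (coeff r D) (pCons 0 (q (D - 1))) \<in> vecs n"
      using qi by (auto simp: vecs_def coeff_sum simp del: smult_pCons)
    have 1: "q (Suc i) = pCons 0 (q i) \<longleftrightarrow> (\<forall>k<n. coeff (q (Suc i)) k = coeff (pCons 0 (q i)) k)" for i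
      by (rule vecs_eq_iff[OF qi])
    have 2: "((\<Sum>i<D. smult (coeff r i) (q i)) + smult (coeff r D) (pCons 0 (q (D - 1))) = 0)
      \<longleftrightarrow> (\<forall>k<n. (\<Sum>i<D. coeff r i * coeff (q i) k) + coeff r D * coeff (pCons 0 (q (D - 1))) k = 0)"
      unfolding vecs_eq_iff[OF v subgrpD(1)[OF subgrp_vecs]] by (simp add: coeff_sum del: smult_pCons)
    have "q \<in> ?S \<longleftrightarrow> (\<forall>i. Suc i < D --> (\<forall>k\<in>{..<n}. coeff (q (Suc i)) k = coeff (pCons 0 (q i)) k)) \<and>
      (\<forall>k\<in>{..<n}. (\<Sum>i<D. coeff r i * coeff (q i) k) + coeff r D * coeff (pCons 0 (q (D - 1))) k = 0)"
      by (rule sol_space_iff[OF _ _ q]) (simp_all only: I_plus_apply I_minus_apply lessThan_iff)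
    then show ?thesis unfolding 1 2 by (simp only: Ball_def lessThan_iff)
  qed
  have total: "(\<Sum>i<D. smult (coeff r i) (monom 1 i * y)) + smult (coeff r D) (pCons 0 (monom 1 (D - 1) * y)) = r * y" for y
  proof -
    have "pCons 0 (monom 1 (D - 1) * y) = monom 1 (Suc (D - 1)) * y" by (simp only: monom_Suc mult_pCons_left) simp
    then show ?thesis using sum_smult_monomials[OF r, of y] D by simp
  qed
  have "bij_betw (\<lambda>q. q 0) ?S ?K"
  proof (rule bij_betwI')
    have pow: "q i = monom 1 i * q 0" if "q \<in> ?S" "i < D" for q i
      using that(2)
    proof (induction i)
      case (Suc i)
      have v: "\<forall>i. q i \<in> vecs (n - 1)" "\<forall>i\<ge>D. q i = 0" using that(1) by (auto simp: sol_space_def)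
      have "q (Suc i) = pCons 0 (q i)" using mem[OF v] that(1) Suc.prems by blast
      then show ?case using Suc by (simp add: monom_Suc)
    qed (simp add: monom_0)
    fix q q' assume q: "q \<in> ?S" "q' \<in> ?S"
    have "q = q'" if "q 0 = q' 0"
    proof
      fix i show "q i = q' i"
        using pow[OF q(1), of i] pow[OF q(2), of i] that q by (cases "i < D") (auto simp: sol_space_def)
    qed
    then show "(q 0 = q' 0) = (q = q')" by auto
    have v: "\<forall>i. q i \<in> vecs (n - 1)" "\<forall>i\<ge>D. q i = 0" using q(1) by (auto simp: sol_space_def)
    have l: "q (D - 1) = monom 1 (D - 1) * q 0" using D by (intro pow[OF q(1)]) simp
    have "(\<Sum>i<D. smult (coeff r i) (q i)) + smult (coeff r D) (pCons 0 (q (D - 1))) = 0"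
      using mem[OF v] q by blast
    moreover have "(\<Sum>i<D. smult (coeff r i) (q i)) = (\<Sum>i<D. smult (coeff r i) (monom 1 i * q 0))"
      by (intro sum.cong refl) (simp flip: pow[OF q(1)])
    ultimately have "r * q 0 = 0" using total[of "q 0"] unfolding l by simp
    moreover have "coeff (q 0) k = 0" if k: "k \<ge> n - D" for k
    proof -
      have "coeff (q (D - 1)) (k + (D - 1)) = 0" using v(1) k D unfolding vecs_def by auto
      then show ?thesis unfolding l by (simp add: coeff_monom_mult)
    qed
    ultimately show "q 0 \<in> ?K" by (simp add: vecs_def)
  next
    fix y assume y: "y \<in> ?K"
    define q where "q i = (if i < D then monom 1 i * y else 0)" for i
    have v: "\<forall>i. q i \<in> vecs (n - 1)" "\<forall>i\<ge>D. q i = 0"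
      using y by (auto simp: q_def vecs_def coeff_monom_mult)
    have "(\<Sum>i<D. smult (coeff r i) (q i)) + smult (coeff r D) (pCons 0 (q (D - 1))) = 0"
      using total[of y] D y by (simp add: q_def)
    then have "q \<in> ?S" unfolding mem[OF v] by (simp add: q_def monom_Suc)
    moreover have "q 0 = y" using D by (simp add: q_def monom_0)
    ultimately show "\<exists>q\<in>?S. y = q 0" by blast
  qed
  from bij_betw_same_card[OF this] have "card ?S = card ?K" .
  moreover have "?K = (if r = 0 then vecs (n - D) else {0})" using subgrpD(1)[OF subgrp_vecs] by auto
  ultimately show ?thesis by (simp add: card_vecs)
qed

text \<open>The equations are a linear recurrence: with \<open>r \<noteq> 0\<close> each of them determines
  one new coefficient.\<close>

lemma card_toeplitz_kernel:
  assumes n: "n \<ge> 1" and r: "r \<in> vecs (Suc D)"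
  shows "card {s \<in> vecs (n + D - 1). \<forall>k<n - 1. (\<Sum>i<Suc D. coeff r i * coeff s (i + k)) = 0}
    = (if r = 0 then 2 ^ (n + D - 1) else 2 ^ D)"
proof -
  let ?N = "n + D - 1"
  define B where "B s y = (\<Sum>j<?N. coeff (r * y) j * coeff s j)" for s y
  have ry: "r * y \<in> vecs ?N" if "y \<in> vecs (n - 1)" for y
  proof -
    have "degree r \<le> D" using r by (auto simp: vecs_degree)
    then show ?thesis using that degree_mult_le[of r y] n by (auto simp: vecs_degree)
  qed
  have Bk: "B s (monom 1 k) = (\<Sum>i<Suc D. coeff r i * coeff s (i + k))" if k: "k < n - 1" for s k
  proof -
    have "(\<Sum>i<Suc D. coeff r i * coeff s (i + k)) = (\<Sum>j\<in>{k..<Suc D + k}. coeff (r * monom 1 k) j * coeff s j)"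
      by (rule sum.reindex_bij_witness[of _ "\<lambda>j. j - k" "\<lambda>i. i + k"]) (auto simp: coeff_monom_mult mult.commute[of r])
    also have "... = B s (monom 1 k)"
      unfolding B_def using k
      by (intro sum.mono_neutral_left) (use r in \<open>auto simp: coeff_monom_mult mult.commute[of r] vecs_def\<close>)
    finally show ?thesis by simp
  qed
  have Badd: "B (s + t) y = B s y + B t y" "B s (y + z) = B s y + B s z" for s t y z
    by (simp_all add: B_def algebra_simps sum.distrib)
  have ev: "(\<forall>y\<in>vecs (n - 1). B s y = 0) \<longleftrightarrow> (\<forall>k<n - 1. (\<Sum>i<Suc D. coeff r i * coeff s (i + k)) = 0)" for s
  proof
    assume "\<forall>y\<in>vecs (n - 1). B s y = 0"
    then show "\<forall>k<n - 1. (\<Sum>i<Suc D. coeff r i * coeff s (i + k)) = 0"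
      using Bk[of _ s] by (auto simp: vecs_def simp del: sum.lessThan_Suc)
  next
    assume z: "\<forall>k<n - 1. (\<Sum>i<Suc D. coeff r i * coeff s (i + k)) = 0"
    show "\<forall>y\<in>vecs (n - 1). B s y = 0"
    proof
      fix y assume y: "y \<in> vecs (n - 1)"
      have sm: "B s (smult c x) = c * B s x" for c x by (cases c) (simp_all add: B_def)
      have su: "B s (sum f I) = (\<Sum>i\<in>I. B s (f i))" for f and I :: "nat set"
        by (induction I rule: infinite_finite_induct) (simp_all add: Badd, simp_all add: B_def)
      have "B s y = B s (\<Sum>k<n - 1. smult (coeff y k) (monom 1 k))"
        using sum_monomials[OF y] by (simp add: smult_monom)
      also have "... = 0" unfolding su sm using z Bk[of _ s] by (intro sum.neutral) (simp del: sum.lessThan_Suc)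
      finally show "B s y = 0" .
    qed
  qed
  have right: "{y \<in> vecs (n - 1). \<forall>s\<in>vecs ?N. B s y = 0} = (if r = 0 then vecs (n - 1) else {0})"
  proof -
    have "r * y = 0" if y: "y \<in> vecs (n - 1)" "\<forall>s\<in>vecs ?N. B s y = 0" for y
    proof (rule vecs_eqI[OF ry[OF y(1)] subgrpD(1)[OF subgrp_vecs]])
      fix k assume k: "k < ?N"
      have "B (monom 1 k) y = (\<Sum>j<?N. if j = k then coeff (r * y) j else 0)"
        unfolding B_def by (intro sum.cong) auto
      moreover have "B (monom 1 k) y = 0" using k by (intro bspec[OF y(2)]) (simp add: vecs_def)
      ultimately show "coeff (r * y) k = coeff 0 k" using k by simp
    qed
    then show ?thesis using subgrpD(1)[OF subgrp_vecs] by (auto simp: B_def)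
  qed
  have "card {s \<in> vecs ?N. \<forall>y\<in>vecs (n - 1). B s y = 0} * card (vecs (n - 1))
    = card {y \<in> vecs (n - 1). \<forall>s\<in>vecs ?N. B s y = 0} * card (vecs ?N)"
    by (rule card_left_right_kernel) (simp_all add: subgrp_vecs additive_on_def Badd)
  then have e: "card {s \<in> vecs ?N. \<forall>y\<in>vecs (n - 1). B s y = 0} * 2 ^ (n - 1)
    = (if r = 0 then 2 ^ (n - 1) else 1) * 2 ^ ?N"
    unfolding right by (simp add: card_vecs)
  have "?N = D + (n - 1)" using n by simp
  then have "card {s \<in> vecs ?N. \<forall>y\<in>vecs (n - 1). B s y = 0} = (if r = 0 then 2 ^ ?N else 2 ^ D)"
    using e by (simp add: power_add split: if_splits)
  then show ?thesis unfolding ev .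
qed

text \<open>Here the vectors of a solution overlap and are windows of one sequence of length \<open>n + D -
  1\<close>.\<close>

lemma card_sol_space_wide:
  assumes n: "n \<ge> 1" and D: "D \<ge> 1" and r: "r \<in> vecs (Suc D)"
  shows "card (sol_space n {..<n - 1} (\<lambda>k j. I_plus n $$ (j, k)) (\<lambda>k j. I_minus n $$ (j, k)) D r)
    = (if r = 0 then 2 ^ (n + D - 1) else 2 ^ D)"
proof -
  let ?S = "sol_space n {..<n - 1} (\<lambda>k j. I_plus n $$ (j, k)) (\<lambda>k j. I_minus n $$ (j, k)) D r"
  let ?A = "{s \<in> vecs (n + D - 1). \<forall>k<n - 1. (\<Sum>i<Suc D. coeff r i * coeff s (i + k)) = 0}"
  have mem: "q \<in> ?S \<longleftrightarrow> (\<forall>i. Suc i < D --> (\<forall>k<n - 1. coeff (q (Suc i)) k = coeff (q i) (Suc k))) \<and>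
      (\<forall>k<n - 1. (\<Sum>i<D. coeff r i * coeff (q i) k) + coeff r D * coeff (q (D - 1)) (Suc k) = 0)"
    if q: "\<forall>i. q i \<in> vecs n" "\<forall>i\<ge>D. q i = 0" for q
  proof -
    have "q \<in> ?S \<longleftrightarrow> (\<forall>i. Suc i < D --> (\<forall>k\<in>{..<n - 1}. coeff (q (Suc i)) k = coeff (q i) (Suc k))) \<and>
      (\<forall>k\<in>{..<n - 1}. (\<Sum>i<D. coeff r i * coeff (q i) k) + coeff r D * coeff (q (D - 1)) (Suc k) = 0)"
      by (rule sol_space_iff[OF _ _ q]) (simp_all only: I_plus_apply' I_minus_apply' lessThan_iff)
    then show ?thesis by (simp only: Ball_def lessThan_iff)
  qed
  define F where "F s i = (if i < D then poly_cutoff n (poly_shift i s) else 0)" for s :: "bit poly" and i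
  have Fv: "\<forall>i. F s i \<in> vecs n" "\<forall>i\<ge>D. F s i = 0" for s
    by (auto simp: F_def vecs_def coeff_poly_cutoff)
  have Fc: "coeff (F s i) k = coeff s (i + k)" if "i < D" "k < n" for s i k
    using that by (simp add: F_def coeff_poly_cutoff coeff_poly_shift add.commute)
  have memF: "F s \<in> ?S \<longleftrightarrow> (\<forall>k<n - 1. (\<Sum>i<Suc D. coeff r i * coeff s (i + k)) = 0)" for s
  proof -
    have "(\<Sum>i<D. coeff r i * coeff (F s i) k) + coeff r D * coeff (F s (D - 1)) (Suc k)
      = (\<Sum>i<Suc D. coeff r i * coeff s (i + k))" if "k < n - 1" for k
      using that D by (simp add: Fc)
    then show ?thesis unfolding mem[OF Fv] by (simp add: Fc del: sum.lessThan_Suc)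
  qed
  have "bij_betw F ?A ?S"
  proof (rule bij_betwI')
    fix s t assume s: "s \<in> ?A" "t \<in> ?A"
    have sv: "s \<in> vecs (n + D - 1)" "t \<in> vecs (n + D - 1)" using s by blast+
    have "s = t" if e: "F s = F t"
    proof (rule vecs_eqI[OF sv])
      fix j assume j: "j < n + D - 1"
      define i where "i = min j (D - 1)"
      have i: "i < D" "j - i < n" "i + (j - i) = j" using j D n by (auto simp: i_def)
      show "coeff s j = coeff t j"
        using Fc[OF i(1,2), of s] Fc[OF i(1,2), of t] e i(3) by simp
    qed
    then show "(F s = F t) = (s = t)" by auto
  next
    fix s assume "s \<in> ?A"
    then show "F s \<in> ?S" unfolding memF by simp
  next
    fix q assume q: "q \<in> ?S"
    have v: "\<forall>i. q i \<in> vecs n" "\<forall>i\<ge>D. q i = 0" using q by (auto simp: sol_space_def)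
    have st: "coeff (q (Suc i)) k = coeff (q i) (Suc k)" if "Suc i < D" "k < n - 1" for i k
      using mem[OF v] q that by blast
    have sts: "coeff (q (i + t)) k = coeff (q i) (k + t)" if "i + t < D" "k + t < n" for i t k
      using that
    proof (induction t arbitrary: k)
      case (Suc t)
      then show ?case using st[of "i + t" k] Suc.IH[of "Suc k"] by simp
    qed simp
    define s where "s = (\<Sum>j<n + D - 1. monom (coeff (q (min j (D - 1))) (j - min j (D - 1))) j)"
    have cs: "coeff s j = coeff (q (min j (D - 1))) (j - min j (D - 1))" if "j < n + D - 1" for j
    proof -
      have "coeff s j = (\<Sum>l<n + D - 1. if l = j then coeff (q (min l (D - 1))) (l - min l (D - 1)) else 0)"
        unfolding s_def coeff_sum by (intro sum.cong) auto
      then show ?thesis using that by simp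
    qed
    have sv: "s \<in> vecs (n + D - 1)" by (auto simp: s_def vecs_def coeff_sum intro!: sum.neutral)
    have "F s i = q i" for i
    proof (cases "i < D")
      case True
      have "coeff (F s i) k = coeff (q i) k" if k: "k < n" for k
      proof -
        let ?m = "min (i + k) (D - 1)"
        have m: "i \<le> ?m" "?m - i \<le> k" using True by auto
        have "coeff (F s i) k = coeff (q ?m) (i + k - ?m)"
          using Fc[OF True k] cs[of "i + k"] True k by simp
        also have "... = coeff (q (i + (?m - i))) (i + k - ?m)" using m by simp
        also have "... = coeff (q i) (i + k - ?m + (?m - i))" using m k True by (intro sts) auto
        also have "i + k - ?m + (?m - i) = k" using m by simp
        finally show ?thesis .
      qed
      then show ?thesis using Fv(1) v(1) by (intro vecs_eqI[of _ n]) blast+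
    qed (use v Fv in simp)
    then have "F s = q" by (rule ext)
    then show "\<exists>s\<in>?A. q = F s" using memF[of s] q sv by (intro bexI[of _ s]) simp_all
  qed
  from bij_betw_same_card[OF this] show ?thesis using card_toeplitz_kernel[OF n r] by simp
qed

definition reverse_poly :: "nat => bit poly => bit poly" where
  "reverse_poly D r = (\<Sum>i<Suc D. monom (coeff r (D - i)) i)"

lemma coeff_reverse_poly: "coeff (reverse_poly D r) i = (if i \<le> D then coeff r (D - i) else 0)"
proof -
  have "coeff (reverse_poly D r) i = (\<Sum>l<Suc D. if l = i then coeff r (D - l) else 0)"
    unfolding reverse_poly_def coeff_sum by (intro sum.cong) auto
  then show ?thesis by (auto simp del: sum.lessThan_Suc)
qed

lemma reverse_poly_vecs: "reverse_poly D r \<in> vecs (Suc D)"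
  by (simp add: vecs_def coeff_reverse_poly)

lemma reverse_reverse_poly: "r \<in> vecs (Suc D) ==> reverse_poly D (reverse_poly D r) = r"
  by (rule poly_eqI) (simp add: coeff_reverse_poly vecs_def)

lemma reversed_sum:
  fixes a b :: "nat => bit"
  assumes D: "D \<ge> 1" and ab: "!!i. Suc i < D ==> a (Suc i) = b i"
  shows "(\<Sum>i<D. coeff r i * a i) + coeff r D * b (D - 1)
    = (\<Sum>i<D. coeff (reverse_poly D r) i * b (D - 1 - i)) + coeff (reverse_poly D r) D * a 0"
proof -
  define c where "c i = (if i < D then a i else b (D - 1))" for i
  have "(\<Sum>i<D. coeff r i * a i) + coeff r D * b (D - 1) = (\<Sum>i<Suc D. coeff r i * c i)"
    by (simp add: c_def)
  also have "... = (\<Sum>i<Suc D. coeff r (D - i) * c (D - i))"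
    by (rule sum.reindex_bij_witness[of _ "\<lambda>i. D - i" "\<lambda>i. D - i"]) auto
  also have "... = (\<Sum>i<D. coeff r (D - i) * c (D - i)) + coeff r 0 * c 0" by simp
  also have "(\<Sum>i<D. coeff r (D - i) * c (D - i)) = (\<Sum>i<D. coeff (reverse_poly D r) i * b (D - 1 - i))"
  proof (intro sum.cong refl)
    fix i assume i: "i \<in> {..<D}"
    have "c (D - i) = b (D - 1 - i)"
    proof (cases i)
      case 0
      then show ?thesis by (simp add: c_def)
    next
      case (Suc l)
      then have "D - i = Suc (D - 1 - i)" "D - i < D" using i by auto
      then show ?thesis using ab[of "D - 1 - i"] by (simp add: c_def)
    qed
    then show "coeff r (D - i) * c (D - i) = coeff (reverse_poly D r) i * b (D - 1 - i)"
      using i by (simp add: coeff_reverse_poly)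
  qed
  finally show ?thesis using D by (simp add: coeff_reverse_poly c_def)
qed

text \<open>Reading a sequence backwards exchanges the forms. It reduces the blocks of type
  \<open>x\<^sub>2\<close> to the Frobenius blocks of \<open>x\<^sup>m\<close>.\<close>

lemma card_sol_space_reverse:
  assumes D: "D \<ge> 1" and r: "r \<in> vecs (Suc D)"
  shows "card (sol_space n K A B D r) = card (sol_space n K B A D (reverse_poly D r))"
proof -
  define F :: "(nat => bit poly) => nat => bit poly" where "F q i = (if i < D then q (D - 1 - i) else 0)" for q i
  have F: "F q \<in> sol_space n K B A D (reverse_poly D r)" if q: "q \<in> sol_space n K A B D r" for A B r q
  proof -
    define a where "a k i = (\<Sum>j<n. A k j * coeff (q i) j)" for k i
    define b where "b k i = (\<Sum>j<n. B k j * coeff (q i) j)" for k i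
    have st: "a k (Suc i) = b k i" if "Suc i < D" "k \<in> K" for i k
      using q that by (simp add: sol_space_def a_def b_def)
    have fin: "(\<Sum>i<D. coeff r i * a k i) + coeff r D * b k (D - 1) = 0" if "k \<in> K" for k
      using q that by (simp add: sol_space_def a_def b_def)
    have FA: "(\<Sum>j<n. A k j * coeff (F q i) j) = a k (D - 1 - i)" "(\<Sum>j<n. B k j * coeff (F q i) j) = b k (D - 1 - i)"
      if "i < D" for i k using that by (simp_all add: F_def a_def b_def)
    show ?thesis
      unfolding sol_space_def mem_Collect_eq
    proof (intro conjI allI impI ballI)
      show "F q i \<in> vecs n" for i using q subgrpD(1)[OF subgrp_vecs] by (simp add: F_def sol_space_def)
      show "F q i = 0" if "D \<le> i" for i using that by (simp add: F_def)
      show "(\<Sum>j<n. B k j * coeff (F q (Suc i)) j) = (\<Sum>j<n. A k j * coeff (F q i) j)" if "Suc i < D" "k \<in> K" for i k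
      proof -
        have "Suc (D - 1 - Suc i) = D - 1 - i" using that by simp
        then show ?thesis using st[of "D - 1 - Suc i" k] that by (simp add: FA)
      qed
      show "(\<Sum>i<D. coeff (reverse_poly D r) i * (\<Sum>j<n. B k j * coeff (F q i) j))
          + coeff (reverse_poly D r) D * (\<Sum>j<n. A k j * coeff (F q (D - 1)) j) = 0" if k: "k \<in> K" for k
        using reversed_sum[of D "a k" "b k" r, OF D st[OF _ k]] fin[OF k] D by (simp add: FA)
    qed
  qed
  have FF: "F (F q) = q" if "q \<in> sol_space n K A B D r" for A B r q
    using that by (auto simp: F_def sol_space_def fun_eq_iff)
  have "bij_betw F (sol_space n K A B D r) (sol_space n K B A D (reverse_poly D r))"
  proof (rule bij_betw_byWitness[of _ F])
    show "F ` sol_space n K B A D (reverse_poly D r) \<subseteq> sol_space n K A B D r"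
      using F[of _ B A "reverse_poly D r"] reverse_reverse_poly[OF r] by auto
  qed (use F FF in auto)
  from bij_betw_same_card[OF this] show ?thesis .
qed


section \<open>The multiplicities are determined by the counts\<close>

definition total_degree :: "bipoly => nat" where
  "total_degree g = (if g = X2 then 1 else degree g)"

lemma total_degree_hpolys: "g \<in> PP ==> g \<in> hpolys (total_degree g)"
  using PP_hpolys(1)[of g] hpolys_X(2) by (auto simp: total_degree_def)

lemma total_degree_pos: "g \<in> PP ==> total_degree g \<ge> 1"
  using irreducible_degree_pos[OF dehomogenize_irreducible[of g]] PP_hpolys(3)[of g]
  by (auto simp: total_degree_def)

lemma total_degree_unique:
  assumes "g \<in> PP" "g \<in> hpolys D"
  shows "total_degree g = D"
proof (rule ccontr)
  assume ne: "total_degree g ~= D"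
  have "coeff (coeff g i) j = 0" for i j
    using hpolysD[OF assms(2), of i j] hpolysD[OF total_degree_hpolys[OF assms(1)], of i j] ne by fastforce
  then have "g = 0" by (simp add: poly_eq_iff)
  then show False using assms(1) by (simp add: PP_def irreducible_bipoly)
qed

lemma irreducible_linear: "Factorial_Ring.irreducible ([:0, 1:] :: bit poly)"
  unfolding irreducible_bit_poly
proof (intro conjI allI impI)
  fix a b :: "bit poly" assume ab: "[:0, 1:] = a * b"
  then have nz: "a ~= 0" "b ~= 0" by auto
  have "degree a + degree b = 1" using arg_cong[OF ab, of degree] nz by (simp add: degree_mult_eq)
  then consider "degree a = 0" | "degree b = 0" by linarith
  then show "a = 1 \<or> b = 1" using nz degree_0_bit_poly by cases blast+
qed (simp_all add: one_pCons)

lemma monom_power: "monom 1 m = ([:0, 1:] :: bit poly) ^ m"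
  by (simp add: monom_altdef)

lemma frobenius_monom:
  assumes "i < m" "j < m"
  shows "frobenius_mat (monom 1 m) $$ (i, j) = jordan_block m 0 $$ (j, i)"
  using assms by (auto simp: frobenius_mat_def degree_monom_eq)

definition block_dim :: "index => nat" where
  "block_dim p = dim_row (fst (canonical_pair p))"

definition block_card :: "index => nat => bit poly => nat" where
  "block_card p D r = card (sol_space (block_dim p) {..<block_dim p}
     (mat_fun (fst (canonical_pair p))) (mat_fun (snd (canonical_pair p))) D r)"

lemma off_diag_carrier: "B \<in> carrier_mat a b ==> off_diag B \<in> carrier_mat (a + b) (a + b)"
  by (auto simp: off_diag_def)

lemma jordan_block_carrier': "jordan_block n (0::bit) \<in> carrier_mat n n"
  by simp

lemma frobenius_carrier: "frobenius_mat P \<in> carrier_mat (degree P) (degree P)"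
  by (simp add: frobenius_mat_def)

lemma block_card_None:
  assumes m: "m \<ge> 1" and D: "D \<ge> 1" "r \<in> vecs (Suc D)"
  shows "block_card (None, m) D r = (if r = 0 then 2 ^ ((m - D) + (m + D - 1)) else 2 ^ D)"
    "block_dim (None, m) = m + (m - 1)"
proof -
  note c = I_plus_minus_carrier[of m]
  show d: "block_dim (None, m) = m + (m - 1)"
    using off_diag_carrier[OF c(1)] by (simp add: block_dim_def canonical_pair_None)
  show "block_card (None, m) D r = (if r = 0 then 2 ^ ((m - D) + (m + D - 1)) else 2 ^ D)"
    unfolding block_card_def d canonical_pair_None fst_conv snd_conv card_sol_space_off_diag[OF c]
      card_sol_space_tall[OF m D] card_sol_space_wide[OF m D]
    by (simp add: power_add)
qed

lemma block_card_X2: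
  assumes m: "m \<ge> 1" and D: "D \<ge> 1" "r \<in> vecs (Suc D)"
  shows "block_card (Some X2, m) D r = card (cyclic_kernel (monom 1 m) (reverse_poly D r)) ^ 2"
    "block_dim (Some X2, m) = 2 * m"
proof -
  note c = jordan_block_carrier'[of m] one_carrier_mat[of m]
  let ?r = "reverse_poly D r" and ?P = "monom 1 m :: bit poly"
  have P: "degree ?P = m" by (simp add: degree_monom_eq)
  have P': "degree ?P > 0" using m by (simp add: P)
  show d: "block_dim (Some X2, m) = 2 * m"
    using off_diag_carrier[OF c(1)] by (simp add: block_dim_def canonical_pair_X2)
  have "block_card (Some X2, m) D r
    = card (sol_space m {..<m} (mat_fun (jordan_block m 0)) (mat_fun (1\<^sub>m m)) D r)
    * card (sol_space m {..<m} (\<lambda>k j. jordan_block m 0 $$ (j, k)) (\<lambda>k j. 1\<^sub>m m $$ (j, k)) D r)"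
    unfolding block_card_def d canonical_pair_X2 fst_conv snd_conv mult_2
    by (rule card_sol_space_off_diag[OF c])
  also have "card (sol_space m {..<m} (mat_fun (jordan_block m 0)) (mat_fun (1\<^sub>m m)) D r)
    = card (sol_space m {..<m} (mat_fun (1\<^sub>m m)) (mat_fun (jordan_block m 0)) D ?r)"
    by (rule card_sol_space_reverse[OF D])
  also have "sol_space m {..<m} (mat_fun (1\<^sub>m m)) (mat_fun (jordan_block m 0)) D ?r
    = sol_space m {..<m} (\<lambda>k j. 1\<^sub>m m $$ (j, k)) (\<lambda>k j. frobenius_mat ?P $$ (j, k)) D ?r"
    by (rule sol_space_cong) (auto simp: frobenius_monom simp del: index_mat)
  also have "card ... = card (cyclic_kernel ?P ?r)"
    using card_sol_space_frobenius_transpose[OF P' D(1) reverse_poly_vecs] by (simp only: P)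
  also have "card (sol_space m {..<m} (\<lambda>k j. jordan_block m 0 $$ (j, k)) (\<lambda>k j. 1\<^sub>m m $$ (j, k)) D r)
    = card (sol_space m {..<m} (\<lambda>k j. 1\<^sub>m m $$ (j, k)) (\<lambda>k j. jordan_block m 0 $$ (j, k)) D ?r)"
    by (rule card_sol_space_reverse[OF D])
  also have "sol_space m {..<m} (\<lambda>k j. 1\<^sub>m m $$ (j, k)) (\<lambda>k j. jordan_block m 0 $$ (j, k)) D ?r
    = sol_space m {..<m} (mat_fun (1\<^sub>m m)) (mat_fun (frobenius_mat ?P)) D ?r"
    by (rule sol_space_cong) (auto simp: frobenius_monom simp del: index_mat)
  also have "card ... = card (cyclic_kernel ?P ?r)"
    using card_sol_space_frobenius[OF P' D(1) reverse_poly_vecs] by (simp only: P)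
  finally show "block_card (Some X2, m) D r = card (cyclic_kernel (monom 1 m) ?r) ^ 2"
    by (simp add: power2_eq_square)
qed

lemma block_card_Some:
  assumes g: "g \<in> PP" "g ~= X2" and m: "m \<ge> 1" and D: "D \<ge> 1" "r \<in> vecs (Suc D)"
  shows "block_card (Some g, m) D r = card (cyclic_kernel (dehomogenize g ^ m) r) ^ 2"
    "block_dim (Some g, m) = 2 * (m * degree g)"
proof -
  let ?P = "dehomogenize g ^ m"
  have irr: "Factorial_Ring.irreducible (dehomogenize g)" by (rule dehomogenize_irreducible[OF g])
  then have P: "degree ?P = m * degree (dehomogenize g)"
    by (simp add: degree_power_bit irreducible_bit_poly)
  have P': "degree ?P > 0" unfolding P using irreducible_degree_pos[OF irr] m by simp
  note c = one_carrier_mat[of "degree ?P"] frobenius_carrier[of ?P]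
  have d: "block_dim (Some g, m) = degree ?P + degree ?P"
    using off_diag_carrier[OF c(1)] P by (simp add: block_dim_def canonical_pair_Some[OF g(2)])
  then show "block_dim (Some g, m) = 2 * (m * degree g)" using PP_hpolys(3)[OF g] by (simp add: P)
  show "block_card (Some g, m) D r = card (cyclic_kernel ?P r) ^ 2"
    unfolding block_card_def d canonical_pair_Some[OF g(2)] fst_conv snd_conv P[symmetric]
      card_sol_space_off_diag[OF c] card_sol_space_frobenius[OF P' D]
      card_sol_space_frobenius_transpose[OF P' D]
    by (simp add: power2_eq_square)
qed

text \<open>Logarithm of the count of a block for \<open>h = 0\<close>. Its second difference in
  \<open>D\<close> is zero except on \<open>\<epsilon>\<close>-blocks with \<open>m = D + 1\<close>.\<close>

definition generic_exponent :: "nat => index => nat" where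
  "generic_exponent D p = (case p of (None, m) => (m - D) + (m + D - 1) | (Some g, m) => 2 * (m * total_degree g))"

text \<open>Logarithm of the count of a block for \<open>h = g\<^sup>n\<close>. Its second difference in
  \<open>n\<close> is zero except on the block \<open>(g, n + 1)\<close>.\<close>

definition torsion_exponent :: "bipoly => nat => index => nat" where
  "torsion_exponent g n p = (case p of (None, m) => n * total_degree g
     | (Some h, m) => if h = g then 2 * (total_degree g * min n m) else 0)"

lemma block_dim_eq: "p \<in> indices ==> block_dim p = generic_exponent 0 p"
proof -
  assume p: "p \<in> indices"
  obtain h m where hm: "p = (h, m)" by (cases p)
  have m: "m \<ge> 1" using p hm by (simp add: indices_def)
  show ?thesis
  proof (cases h)
    case None
    then show ?thesis using block_card_None(2)[OF m order_refl subgrpD(1)[OF subgrp_vecs]] hm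
      by (simp add: generic_exponent_def)
  next
    case (Some g)
    then have g: "g \<in> PP" using p hm by (auto simp: indices_def PPe_def)
    show ?thesis
    proof (cases "g = X2")
      case True
      then show ?thesis using block_card_X2(2)[OF m order_refl subgrpD(1)[OF subgrp_vecs]] hm Some
        by (simp add: generic_exponent_def total_degree_def)
    next
      case False
      then show ?thesis using block_card_Some(2)[OF g False m order_refl subgrpD(1)[OF subgrp_vecs]] hm Some
        by (simp add: generic_exponent_def total_degree_def)
    qed
  qed
qed

lemma block_card_generic:
  assumes p: "p \<in> indices" and D: "D \<ge> 1"
  shows "block_card p D 0 = 2 ^ generic_exponent D p"
proof -
  obtain h m where hm: "p = (h, m)" by (cases p)
  have m: "m \<ge> 1" using p hm by (simp add: indices_def)
  note z = subgrpD(1)[OF subgrp_vecs, of "Suc D"]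
  show ?thesis
  proof (cases h)
    case None
    then show ?thesis using block_card_None(1)[OF m D z] hm by (simp add: generic_exponent_def)
  next
    case (Some g)
    then have g: "g \<in> PP" using p hm by (auto simp: indices_def PPe_def)
    show ?thesis
    proof (cases "g = X2")
      case True
      have "reverse_poly D 0 = 0" by (simp add: reverse_poly_def)
      then show ?thesis using block_card_X2(1)[OF m D z] hm Some True
        by (simp add: generic_exponent_def total_degree_def card_cyclic_kernel_0 degree_monom_eq power_mult[symmetric] mult.commute)
    next
      case False
      have "dehomogenize g ~= 0" using dehomogenize_irreducible[OF g False] by (simp add: irreducible_bit_poly)
      then show ?thesis using block_card_Some(1)[OF g False m D z] hm Some False PP_hpolys(3)[OF g False]
        by (simp add: generic_exponent_def total_degree_def card_cyclic_kernel_0 degree_power_bit power_mult[symmetric] mult.commute)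
    qed
  qed
qed

lemma block_card_torsion:
  assumes p: "p \<in> indices" and g: "g \<in> PP" and n: "n \<ge> 1"
  shows "block_card p (n * total_degree g) (dehomogenize (g ^ n)) = 2 ^ torsion_exponent g n p"
proof -
  let ?D = "n * total_degree g" and ?r = "dehomogenize (g ^ n)"
  obtain h m where hm: "p = (h, m)" by (cases p)
  have m: "m \<ge> 1" using p hm by (simp add: indices_def)
  have D: "?D \<ge> 1" using n total_degree_pos[OF g] by (simp add: Suc_le_eq)
  have r: "?r \<in> vecs (Suc ?D)" by (intro dehomogenize_vecs hpolys_power total_degree_hpolys g)
  have rp: "?r = dehomogenize g ^ n" by (simp add: dehom.hom_power)
  have rX: "?r = 1" if "g = X2" unfolding rp using that by simp
  have irr: "Factorial_Ring.irreducible (dehomogenize g)" if "g ~= X2"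
    using dehomogenize_irreducible[OF g that] .
  have r0: "?r ~= 0" using rX irr unfolding rp by (cases "g = X2") (auto simp: irreducible_bit_poly)
  show ?thesis
  proof (cases h)
    case None
    then show ?thesis using block_card_None(1)[OF m D r] r0 hm by (simp add: torsion_exponent_def)
  next
    case (Some h')
    then have h': "h' \<in> PP" using p hm by (auto simp: indices_def PPe_def)
    show ?thesis
    proof (cases "h' = X2")
      case True
      have c: "card (cyclic_kernel (monom 1 m) (reverse_poly ?D ?r)) = (if g = X2 then 2 ^ min n m else 1)"
      proof (cases "g = X2")
        case gX: True
        have "?D = n" using gX by (simp add: total_degree_def)
        then have "reverse_poly ?D ?r = monom 1 n"
          by (intro poly_eqI) (auto simp: coeff_reverse_poly rX[OF gX])
        then show ?thesis using gX card_cyclic_kernel_same[OF irreducible_linear, of m n] by (simp add: monom_power)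
      next
        case gX: False
        have f0: "dehomogenize g ~= 0" using irr[OF gX] by (simp add: irreducible_bit_poly)
        have "degree ?r = ?D"
          using PP_hpolys(3)[OF g gX] gX unfolding rp degree_power_bit[OF f0] by (simp add: total_degree_def)
        then have "coeff ?r ?D = 1" using r0 leading_coeff_0_iff[of ?r] by (cases "coeff ?r ?D") auto
        then have "coeff (reverse_poly ?D ?r) 0 = 1" by (simp add: coeff_reverse_poly)
        then have "\<not> [:0, 1:] dvd reverse_poly ?D ?r" by (auto simp: dvd_def)
        then show ?thesis using gX card_cyclic_kernel_coprime[OF irreducible_linear] by (simp add: monom_power)
      qed
      have "block_card p ?D ?r = (if g = X2 then 2 ^ min n m else 1) ^ 2"
        using block_card_X2(1)[OF m D r] unfolding c hm Some True .
      then show ?thesis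
        using hm Some True by (auto simp: torsion_exponent_def total_degree_def power_mult[symmetric] mult.commute)
    next
      case hX: False
      have c: "card (cyclic_kernel (dehomogenize h' ^ m) ?r) = (if h' = g then 2 ^ (total_degree g * min n m) else 1)"
      proof (cases "h' = g")
        case True
        have "degree (dehomogenize g) = total_degree g"
          using PP_hpolys(3)[OF h' hX] hX True by (simp add: total_degree_def)
        then show ?thesis
          using card_cyclic_kernel_same[OF irr, of m n] True hX unfolding rp by simp
      next
        case False
        let ?f = "dehomogenize h'"
        have f: "Factorial_Ring.irreducible ?f" by (rule dehomogenize_irreducible[OF h' hX])
        have "\<not> ?f dvd ?r"
        proof
          assume dv: "?f dvd ?r"
          show False
          proof (cases "g = X2")
            case True
            from dv have "?f dvd 1" unfolding rX[OF True] .
            then show False using f unfolding unit_bit_poly irreducible_bit_poly by blast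
          next
            case gX: False
            have pw: "?f dvd dehomogenize g" if "?f dvd dehomogenize g ^ l" for l
              using that
            proof (induction l)
              case 0
              then show ?case using f unfolding power_0 unit_bit_poly irreducible_bit_poly by blast
            next
              case (Suc l)
              then show ?case using irreducible_imp_prime[OF f, of "dehomogenize g" "dehomogenize g ^ l"] by auto
            qed
            then obtain s where "dehomogenize g = ?f * s" using dv unfolding rp dvd_def by blast
            then have "?f = 1 \<or> s = 1" using irr[OF gX] unfolding irreducible_bit_poly by blast
            then have "dehomogenize g = ?f" using f \<open>dehomogenize g = ?f * s\<close> by (auto simp: irreducible_bit_poly)
            then show False using dehomogenize_inj_PP[OF h' hX g gX] False by simp
          qed
        qed
        then show ?thesis using card_cyclic_kernel_coprime[OF f] False by simp
      qed
      have "block_card p ?D ?r = (if h' = g then 2 ^ (total_degree g * min n m) else 1) ^ 2"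
        using block_card_Some(1)[OF h' hX m D r] unfolding c hm Some .
      then show ?thesis using hm Some by (auto simp: torsion_exponent_def power_mult[symmetric] mult.commute)
    qed
  qed
qed

lemma canonical_pair_square:
  assumes "p \<in> indices"
  shows "square_mat (fst (canonical_pair p)) \<and> square_mat (snd (canonical_pair p)) \<and>
    dim_row (fst (canonical_pair p)) = dim_row (snd (canonical_pair p))"
proof -
  obtain h m where hm: "p = (h, m)" by (cases p)
  show ?thesis
  proof (cases h)
    case None
    then show ?thesis by (simp add: hm canonical_pair_None off_diag_def I_plus_def I_minus_def)
  next
    case (Some g)
    show ?thesis
    proof (cases "g = X2")
      case True
      then show ?thesis by (simp add: hm Some canonical_pair_X2 off_diag_def)
    next
      case False
      have g: "g \<in> PP" using assms hm Some by (auto simp: indices_def PPe_def)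
      have "degree (dehomogenize g ^ m) = m * degree (dehomogenize g)"
        using dehomogenize_irreducible[OF g False] by (simp add: degree_power_bit irreducible_bit_poly)
      then show ?thesis
        using False by (simp add: hm Some canonical_pair_Some off_diag_def frobenius_mat_def)
    qed
  qed
qed

lemma card_hom_space_canonical:
  assumes \<alpha>: "alt_form \<alpha>" and \<beta>: "alt_form \<beta>" and cb: "canonical_basis \<alpha> \<beta> V bs ps" and D: "D \<ge> 1"
  shows "card (hom_space \<alpha> \<beta> V D r) = prod_list (map (\<lambda>p. block_card p D r) ps)"
    "length bs = sum_list (map block_dim ps)"
proof -
  let ?Ms = "map canonical_pair ps"
  have fs: "map (fst \<circ> canonical_pair) ps = map fst ?Ms" "map (snd \<circ> canonical_pair) ps = map snd ?Ms" by simp_all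
  have gr: "gram \<alpha> bs = diag_block_mat (map fst ?Ms)" "gram \<beta> bs = diag_block_mat (map snd ?Ms)"
    using cb unfolding canonical_basis_def fs by simp_all
  have b: "basis bs V" and ps: "set ps \<subseteq> indices" using cb by (simp_all add: canonical_basis_def)
  have "length bs = dim_row (diag_block_mat (map fst ?Ms))" unfolding gr(1)[symmetric] by simp
  then have len: "length bs = sum_list (map (dim_row \<circ> fst) ?Ms)" by (simp add: dim_diag_block_mat comp_def)
  then show "length bs = sum_list (map block_dim ps)" by (simp add: block_dim_def[abs_def] comp_def)
  have sq: "square_mat A \<and> square_mat B \<and> dim_row A = dim_row B" if AB: "(A, B) \<in> set ?Ms" for A B
  proof -
    obtain p where "p \<in> set ps" "canonical_pair p = (A, B)" using AB by auto
    then show ?thesis using canonical_pair_square[of p] ps by auto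
  qed
  have "card (hom_space \<alpha> \<beta> V D r) = card (sol_space (length bs) {..<length bs}
      (\<lambda>k j. \<alpha> (bs ! k) (bs ! j)) (\<lambda>k j. \<beta> (bs ! k) (bs ! j)) D r)"
    by (rule card_hom_space_basis[OF b \<alpha> \<beta> D])
  also have "sol_space (length bs) {..<length bs} (\<lambda>k j. \<alpha> (bs ! k) (bs ! j)) (\<lambda>k j. \<beta> (bs ! k) (bs ! j)) D r
    = sol_space (length bs) {..<length bs} (mat_fun (gram \<alpha> bs)) (mat_fun (gram \<beta> bs)) D r"
    by (rule sol_space_cong) (simp_all add: gram_def)
  also have "card ... = prod_list (map (\<lambda>(A, B). card (sol_space (dim_row A) {..<dim_row A} (mat_fun A) (mat_fun B) D r)) ?Ms)"
    unfolding gr len by (rule card_sol_space_diag_block) (rule sq)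
  also have "... = prod_list (map (\<lambda>p. block_card p D r) ps)"
    by (simp add: block_card_def block_dim_def comp_def case_prod_unfold)
  finally show "card (hom_space \<alpha> \<beta> V D r) = prod_list (map (\<lambda>p. block_card p D r) ps)" .
qed

lemma prod_list_power2: "prod_list (map (\<lambda>p. 2 ^ e p) ps) = (2 :: nat) ^ sum_list (map e ps)"
  by (induction ps) (simp_all add: power_add)

text \<open>The second difference of the exponents isolates one kind of block, and so its multiplicity can be
  read off from the counts.\<close>

lemma sum_list_second_difference:
  assumes "!!n. sum_list (map (e n) ps) = sum_list (map (e' n) qs)"
    and "!!p. p \<in> set ps ==> int (e (Suc (Suc n)) p) + int (e n p) - 2 * int (e (Suc n) p) = (if p = a then c else 0)"
    and "!!p. p \<in> set qs ==> int (e' (Suc (Suc n)) p) + int (e' n p) - 2 * int (e' (Suc n) p) = (if p = b then c else 0)"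
  shows "c * int (count_list ps a) = c * int (count_list qs b)"
proof -
  have S: "int (sum_list (map (f (Suc (Suc n))) xs)) + int (sum_list (map (f n) xs)) - 2 * int (sum_list (map (f (Suc n)) xs))
    = c * int (count_list xs x)"
    if "!!p. p \<in> set xs ==> int (f (Suc (Suc n)) p) + int (f n p) - 2 * int (f (Suc n) p) = (if p = x then c else 0)"
    for f :: "nat => 'b => nat" and xs x
    using that
  proof (induction xs)
    case (Cons y xs)
    have "int (f (Suc (Suc n)) y) + int (f n y) - 2 * int (f (Suc n) y) = (if y = x then c else 0)"
      by (rule Cons.prems) simp
    moreover have "int (sum_list (map (f (Suc (Suc n))) xs)) + int (sum_list (map (f n) xs)) - 2 * int (sum_list (map (f (Suc n)) xs))
      = c * int (count_list xs x)" by (rule Cons.IH) (rule Cons.prems, simp)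
    ultimately show ?case by (auto simp: algebra_simps)
  qed simp
  have T: "int (sum_list (map (f (Suc (Suc n))) xs)) + int (sum_list (map (f n) xs)) - 2 * int (sum_list (map (f (Suc n)) xs))
    = c * int (count_list xs x)"
    if "!!p. p \<in> set xs ==> int (f (Suc (Suc n)) p) + int (f n p) - 2 * int (f (Suc n) p) = (if p = x then c else 0)"
    for f :: "nat => 'a => nat" and xs x
    using that
  proof (induction xs)
    case (Cons y xs)
    have "int (f (Suc (Suc n)) y) + int (f n y) - 2 * int (f (Suc n) y) = (if y = x then c else 0)"
      by (rule Cons.prems) simp
    moreover have "int (sum_list (map (f (Suc (Suc n))) xs)) + int (sum_list (map (f n) xs)) - 2 * int (sum_list (map (f (Suc n)) xs))
      = c * int (count_list xs x)" by (rule Cons.IH) (rule Cons.prems, simp)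
    ultimately show ?case by (auto simp: algebra_simps)
  qed simp
  show ?thesis using T[of ps e a, OF assms(2)] S[of qs e' b, OF assms(3)] unfolding assms(1) by linarith
qed

text \<open>Uniqueness half of the classification of pairs, in the form needed for groups: twisting a pair by
  \<open>Q\<close> moves its multiplicities by \<open>Q\<close>. The count for \<open>h\<close> of
  the twisted pair is the count for the substituted \<open>h\<close> of the original one, and second
  differences of both give the multiplicities. The case \<open>Q = 1\<close> is the uniqueness of
  the multiplicities.\<close>

theorem count_canonical_twist:
  assumes \<alpha>: "alt_form \<alpha>" and \<beta>: "alt_form \<beta>" and V: "subgrp V" "finite V"
    and QR: "inverse2 Q R" "inverse2 R Q"
    and cb: "canonical_basis \<alpha> \<beta> V bs ps"
    and cb': "canonical_basis (twist_fst Q \<alpha> \<beta>) (twist_snd Q \<alpha> \<beta>) V bs' ps'"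
  shows "count_list ps' = act Q (count_list ps)"
proof
  let ?\<alpha> = "twist_fst Q \<alpha> \<beta>" and ?\<beta> = "twist_snd Q \<alpha> \<beta>"
  note tw = alt_form_twist(1)[OF \<alpha> \<beta>, of Q] alt_form_twist(2)[OF \<alpha> \<beta>, of Q]
  have ps: "p \<in> indices" if "p \<in> set ps" for p using cb that by (auto simp: canonical_basis_def)
  have ps': "p \<in> indices" if "p \<in> set ps'" for p using cb' that by (auto simp: canonical_basis_def)
  fix p :: index
  obtain h m where hm: "p = (h, m)" by (cases p)
  show "count_list ps' p = act Q (count_list ps) p"
  proof (cases "p \<in> indices")
    case False
    then have "p \<notin> set ps'" using ps' by blast
    then show ?thesis using False hm by (simp add: act_def count_list_0_iff)
  next
    case True
    then obtain n where n: "m = Suc n" using hm by (cases m) (auto simp: indices_def)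
    show ?thesis
    proof (cases h)
      case None
      have e: "sum_list (map (generic_exponent D) ps) = sum_list (map (generic_exponent D) ps')" for D
      proof (cases "D \<ge> 1")
        case True
        have "(2::nat) ^ sum_list (map (generic_exponent D) ps) = card (hom_space \<alpha> \<beta> V D 0)"
          unfolding card_hom_space_canonical(1)[OF \<alpha> \<beta> cb True] prod_list_power2[symmetric]
          by (intro arg_cong[of _ _ prod_list] map_cong refl) (simp add: block_card_generic[OF ps True])
        also have "... = card (hom_space ?\<alpha> ?\<beta> V D 0)"
          using card_hom_space_twist[OF V \<alpha> \<beta> True subgrpD(1)[OF subgrp_hpolys] QR] by simp
        also have "... = 2 ^ sum_list (map (generic_exponent D) ps')"
          unfolding card_hom_space_canonical(1)[OF tw cb' True] prod_list_power2[symmetric]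
          by (intro arg_cong[of _ _ prod_list] map_cong refl) (simp add: block_card_generic[OF ps' True])
        finally show ?thesis by simp
      next
        case False
        have b: "basis bs V" "basis bs' V" using cb cb' by (simp_all add: canonical_basis_def)
        have "length bs = length bs'" using basis_card[OF b(1)] basis_card[OF b(2)] by simp
        then have "sum_list (map block_dim ps) = sum_list (map block_dim ps')"
          using card_hom_space_canonical(2)[OF \<alpha> \<beta> cb order_refl] card_hom_space_canonical(2)[OF tw cb' order_refl] by simp
        moreover have "map block_dim ps = map (generic_exponent 0) ps" "map block_dim ps' = map (generic_exponent 0) ps'"
          using ps ps' by (simp_all add: block_dim_eq)
        moreover have "D = 0" using False by simp
        ultimately show ?thesis by simp
      qed
      have d: "int (generic_exponent (Suc (Suc n)) q) + int (generic_exponent n q) - 2 * int (generic_exponent (Suc n) q)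
          = (if q = (None, Suc n) then 1 else 0)" if "q \<in> indices" for q
      proof -
        obtain h' m' where q: "q = (h', m')" by (cases q)
        have "m' \<ge> 1" using that q by (simp add: indices_def)
        then show ?thesis by (cases h') (auto simp: q generic_exponent_def)
      qed
      have "(1::int) * int (count_list ps (None, Suc n)) = 1 * int (count_list ps' (None, Suc n))"
        by (rule sum_list_second_difference[of generic_exponent ps generic_exponent ps' n, OF e d[OF ps] d[OF ps']])
      then show ?thesis using True hm n None by (simp add: act_def)
    next
      case (Some g)
      have g: "g \<in> PP" using True hm Some by (auto simp: indices_def PPe_def)
      let ?g = "subst_row Q g"
      have g': "?g \<in> PP" by (rule subst_row_PP[OF QR g])
      have td: "total_degree ?g = total_degree g"
        by (intro total_degree_unique g' subst_row_hpolys total_degree_hpolys g)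
      have e: "sum_list (map (torsion_exponent ?g k) ps) = sum_list (map (torsion_exponent g k) ps')" for k
      proof (cases "k \<ge> 1")
        case True
        let ?D = "k * total_degree g"
        have D: "?D \<ge> 1" using True total_degree_pos[OF g] by (simp add: Suc_le_eq)
        have h: "g ^ k \<in> hpolys ?D" by (intro hpolys_power total_degree_hpolys g)
        have "(2::nat) ^ sum_list (map (torsion_exponent ?g k) ps) = card (hom_space \<alpha> \<beta> V ?D (dehomogenize (?g ^ k)))"
          unfolding card_hom_space_canonical(1)[OF \<alpha> \<beta> cb D] prod_list_power2[symmetric]
          by (intro arg_cong[of _ _ prod_list] map_cong refl)
            (use block_card_torsion[OF ps g' True] td in simp)
        also have "... = card (hom_space ?\<alpha> ?\<beta> V ?D (dehomogenize (g ^ k)))"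
          using card_hom_space_twist[OF V \<alpha> \<beta> D h QR] by (simp add: subst_row.hom_power)
        also have "... = 2 ^ sum_list (map (torsion_exponent g k) ps')"
          unfolding card_hom_space_canonical(1)[OF tw cb' D] prod_list_power2[symmetric]
          by (intro arg_cong[of _ _ prod_list] map_cong refl) (use block_card_torsion[OF ps' g True] in simp)
        finally show ?thesis by simp
      next
        case False
        then have "torsion_exponent g k = (\<lambda>_. 0)" for g
          by (intro ext) (auto simp: torsion_exponent_def split: prod.splits option.splits)
        then show ?thesis by simp
      qed
      have d: "int (torsion_exponent g (Suc (Suc n)) q) + int (torsion_exponent g n q) - 2 * int (torsion_exponent g (Suc n) q)
          = (if q = (Some g, Suc n) then - 2 * int (total_degree g) else 0)" for g q
      proof -
        obtain h' m' where q: "q = (h', m')" by (cases q)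
        have mm: "int (min (Suc (Suc n)) m') + int (min n m') - 2 * int (min (Suc n) m') = (if m' = Suc n then - 1 else 0)"
          by (auto simp: min_def)
        show ?thesis
        proof (cases "h' = Some g")
          case True
          have "int (torsion_exponent g (Suc (Suc n)) q) + int (torsion_exponent g n q) - 2 * int (torsion_exponent g (Suc n) q)
            = 2 * int (total_degree g) * (int (min (Suc (Suc n)) m') + int (min n m') - 2 * int (min (Suc n) m'))"
            by (simp add: q True torsion_exponent_def algebra_simps)
          then show ?thesis unfolding mm using q True by simp
        next
          case False
          then show ?thesis by (cases h') (auto simp: q torsion_exponent_def algebra_simps)
        qed
      qed
      have "(- 2 * int (total_degree g)) * int (count_list ps (Some ?g, Suc n))
          = (- 2 * int (total_degree g)) * int (count_list ps' (Some g, Suc n))"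
        by (rule sum_list_second_difference[of "torsion_exponent ?g" ps "torsion_exponent g" ps' n,
              OF e d[of ?g, unfolded td] d[of g]])
      then have "count_list ps (Some ?g, Suc n) = count_list ps' (Some g, Suc n)"
        using total_degree_pos[OF g] by simp
      then show ?thesis using True hm n Some star_eq_subst_row[OF QR g] by (simp add: act_def)
    qed
  qed
qed


section \<open>Central copies of \<open>M\<^sup>(\<^sup>2\<^sup>)\<close> and products of lifts\<close>

lemma quasicyclic2_simps:
  "carrier quasicyclic2 = {z. \<exists>k::nat. z ^ (2 ^ k) = 1}"
  "x \<otimes>\<^bsub>quasicyclic2\<^esub> y = x * y" "\<one>\<^bsub>quasicyclic2\<^esub> = 1"
  by (simp_all add: quasicyclic2_def)

lemma quasicyclic2_mult:
  assumes "z \<in> carrier quasicyclic2" "w \<in> carrier quasicyclic2"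
  shows "z * w \<in> carrier quasicyclic2"
proof -
  obtain k l :: nat where kl: "z ^ (2 ^ k) = 1" "w ^ (2 ^ l) = 1" using assms by (auto simp: quasicyclic2_simps)
  have "z ^ (2 ^ (k + l)) = (z ^ (2 ^ k)) ^ (2 ^ l)" "w ^ (2 ^ (k + l)) = (w ^ (2 ^ l)) ^ (2 ^ k)"
    by (simp_all add: power_add power_mult[symmetric] mult.commute)
  then have "(z * w) ^ (2 ^ (k + l)) = 1" unfolding power_mult_distrib by (simp add: kl)
  then show ?thesis unfolding quasicyclic2_simps by blast
qed

lemma quasicyclic2_inverse: "z \<in> carrier quasicyclic2 ==> inverse z \<in> carrier quasicyclic2"
  by (auto simp: quasicyclic2_simps power_inverse)

lemma quasicyclic2_nonzero: "z \<in> carrier quasicyclic2 ==> z ~= 0"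
  by (auto simp: quasicyclic2_simps power_0_left)

lemma comm_group_quasicyclic2: "comm_group quasicyclic2"
proof (rule comm_groupI)
  show "\<one>\<^bsub>quasicyclic2\<^esub> \<in> carrier quasicyclic2" by (simp add: quasicyclic2_simps)
  show "\<exists>y\<in>carrier quasicyclic2. y \<otimes>\<^bsub>quasicyclic2\<^esub> x = \<one>\<^bsub>quasicyclic2\<^esub>"
    if "x \<in> carrier quasicyclic2" for x
    using that quasicyclic2_nonzero[OF that]
    by (intro bexI[of _ "inverse x"] quasicyclic2_inverse) (simp_all add: quasicyclic2_simps)
  show "x \<otimes>\<^bsub>quasicyclic2\<^esub> y \<in> carrier quasicyclic2"
    if "x \<in> carrier quasicyclic2" "y \<in> carrier quasicyclic2" for x y
    using quasicyclic2_mult[OF that] by (simp add: quasicyclic2_simps(2))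
qed (simp_all add: quasicyclic2_simps(2,3) mult.commute mult.left_commute)

lemma quasicyclic2_sqrt:
  assumes "z \<in> carrier quasicyclic2"
  shows "\<exists>w\<in>carrier quasicyclic2. w * w = z"
proof -
  obtain k :: nat where k: "z ^ (2 ^ k) = 1" using assms by (auto simp: quasicyclic2_simps)
  obtain w where w: "w\<^sup>2 = z" using nth_root_exists[of 2 z] by auto
  have "w ^ (2 ^ Suc k) = (w\<^sup>2) ^ (2 ^ k)" by (simp add: power_mult[symmetric])
  then have "w ^ (2 ^ Suc k) = 1" using w k by simp
  then have "w \<in> carrier quasicyclic2" unfolding quasicyclic2_simps by blast
  with w show ?thesis by (auto simp: power2_eq_square)
qed

lemma M2_simps:
  "carrier M2 = carrier quasicyclic2 \<times> carrier quasicyclic2"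
  "p \<otimes>\<^bsub>M2\<^esub> q = (fst p * fst q, snd p * snd q)" "\<one>\<^bsub>M2\<^esub> = (1, 1)"
  by (auto simp: M2_def DirProd_def quasicyclic2_simps split: prod.splits)

lemma comm_group_M2: "comm_group M2"
proof -
  interpret q: comm_group quasicyclic2 by (rule comm_group_quasicyclic2)
  have "group M2" unfolding M2_def by (rule DirProd_group) (rule q.is_group)+
  then show ?thesis
    by (rule group.group_comm_groupI) (simp add: M2_simps mult.commute)
qed

interpretation M2: comm_group M2
  by (rule comm_group_M2)

lemma M2_sqrt:
  assumes "m \<in> carrier M2"
  shows "\<exists>n\<in>carrier M2. n \<otimes>\<^bsub>M2\<^esub> n = m"
proof -
  obtain a b where "a \<in> carrier quasicyclic2" "a * a = fst m" "b \<in> carrier quasicyclic2" "b * b = snd m"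
    using assms quasicyclic2_sqrt[of "fst m"] quasicyclic2_sqrt[of "snd m"] by (auto simp: M2_simps)
  then show ?thesis by (intro bexI[of _ "(a, b)"]) (simp_all add: M2_simps)
qed

lemma order2_elem_carrier: "order2_elem a b \<in> carrier M2"
proof -
  have "(- 1 :: complex) ^ (2 ^ 1) = 1" "(1 :: complex) ^ (2 ^ 0) = 1" by simp_all
  then have "(- 1 :: complex) \<in> carrier quasicyclic2" "(1 :: complex) \<in> carrier quasicyclic2"
    unfolding quasicyclic2_simps by blast+
  then show ?thesis by (simp add: order2_elem_def M2_simps)
qed

lemma order2_elem_add: "order2_elem a b \<otimes>\<^bsub>M2\<^esub> order2_elem c d = order2_elem (a + c) (b + d)"
  by (cases a; cases b; cases c; cases d) (simp_all add: order2_elem_def M2_simps)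

lemma order2_elem_0: "order2_elem 0 0 = \<one>\<^bsub>M2\<^esub>"
  by (simp add: order2_elem_def M2_simps)

lemma order2_elem_inject: "order2_elem a b = order2_elem c d \<longleftrightarrow> a = c \<and> b = d"
  by (cases a; cases b; cases c; cases d) (simp_all add: order2_elem_def)

lemma order2_elem_exists:
  assumes "m \<otimes>\<^bsub>M2\<^esub> m = \<one>\<^bsub>M2\<^esub>"
  shows "\<exists>a b. m = order2_elem a b"
proof -
  have "(fst m)\<^sup>2 = 1" "(snd m)\<^sup>2 = 1" using assms by (simp_all add: M2_simps power2_eq_square)
  then have "fst m = 1 \<or> fst m = - 1" "snd m = 1 \<or> snd m = - 1" by (simp_all add: power2_eq_1_iff)
  then have "m = order2_elem (if fst m = 1 then 0 else 1) (if snd m = 1 then 0 else 1)"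
    by (cases m) (auto simp: order2_elem_def)
  then show ?thesis by blast
qed

text \<open>The product of those lifts in \<open>hs\<close> whose coefficient in \<open>x\<close> is one, in
  the order of the list.\<close>

primrec hprod :: "('a, 'b) monoid_scheme => 'a list => bit poly => 'a" where
  "hprod G [] x = \<one>\<^bsub>G\<^esub>"
| "hprod G (h # hs) x = (if coeff x 0 = 0 then hprod G hs (poly_shift 1 x)
     else h \<otimes>\<^bsub>G\<^esub> hprod G hs (poly_shift 1 x))"

lemma poly_shift_pCons [simp]: "poly_shift (Suc 0) (pCons c x) = x"
  by (rule poly_eqI) (simp add: coeff_poly_shift)

lemma hprod_pCons:
  "hprod G (h # hs) (pCons c x) = (if c = 0 then hprod G hs x else h \<otimes>\<^bsub>G\<^esub> hprod G hs x)"
  by simp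

lemma pCons_cases_bit: obtains c y where "(x :: bit poly) = pCons c y"
  by (cases x) auto

lemma hprod_0: "hprod G hs 0 = \<one>\<^bsub>G\<^esub>"
proof (induction hs)
  case (Cons h hs)
  have "hprod G (h # hs) (pCons 0 0) = hprod G hs 0" by (subst hprod_pCons) simp
  then show ?case using Cons by simp
qed simp

locale central_M2 = group G for G (structure) +
  fixes \<iota> :: "complex \<times> complex => 'a"
  assumes iota_hom: "\<iota> \<in> hom M2 G"
    and central: "m \<in> carrier M2 ==> x \<in> carrier G ==> \<iota> m \<otimes> x = x \<otimes> \<iota> m"
begin

lemma iota_closed [simp]: "m \<in> carrier M2 ==> \<iota> m \<in> carrier G"
  using iota_hom by (auto simp: hom_def)

lemma iota_mult: "m \<in> carrier M2 ==> n \<in> carrier M2 ==> \<iota> (m \<otimes>\<^bsub>M2\<^esub> n) = \<iota> m \<otimes> \<iota> n"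
  using iota_hom by (auto simp: hom_def)

lemma iota_one [simp]: "\<iota> \<one>\<^bsub>M2\<^esub> = \<one>"
  using hom_one[OF iota_hom M2.is_group is_group] .

lemma iota_inv: "m \<in> carrier M2 ==> \<iota> (inv\<^bsub>M2\<^esub> m) \<otimes> \<iota> m = \<one>"
  by (simp flip: iota_mult)

lemma iota_left_commute: "m \<in> carrier M2 ==> x \<in> carrier G ==> y \<in> carrier G ==>
    x \<otimes> (\<iota> m \<otimes> y) = \<iota> m \<otimes> (x \<otimes> y)"
  using central[of m x] by (simp add: m_assoc[symmetric])

definition eqv :: "'a => 'a => bool" where
  "eqv x y \<longleftrightarrow> (\<exists>c\<in>carrier M2. x = \<iota> c \<otimes> y)"

lemma eqvI: "c \<in> carrier M2 ==> x = \<iota> c \<otimes> y ==> eqv x y"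
  by (auto simp: eqv_def)

lemma eqvE:
  assumes "eqv x y" obtains c where "c \<in> carrier M2" "x = \<iota> c \<otimes> y"
  using assms by (auto simp: eqv_def)

lemma eqv_refl: "x \<in> carrier G ==> eqv x x"
  by (rule eqvI[of "\<one>\<^bsub>M2\<^esub>"]) simp_all

lemma eqv_sym:
  assumes "eqv x y" "y \<in> carrier G" shows "eqv y x"
proof -
  obtain c where c: "c \<in> carrier M2" "x = \<iota> c \<otimes> y" using assms(1) by (rule eqvE)
  show ?thesis
    by (rule eqvI[of "inv\<^bsub>M2\<^esub> c"]) (use c assms(2) in \<open>simp_all add: m_assoc[symmetric] iota_inv\<close>)
qed

lemma eqv_trans:
  assumes "eqv x y" "eqv y z" "z \<in> carrier G" shows "eqv x z"
proof -
  obtain c where c: "c \<in> carrier M2" "x = \<iota> c \<otimes> y" using assms(1) by (rule eqvE)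
  obtain d where d: "d \<in> carrier M2" "y = \<iota> d \<otimes> z" using assms(2) by (rule eqvE)
  show ?thesis
    by (rule eqvI[of "c \<otimes>\<^bsub>M2\<^esub> d"]) (use c d assms(3) in \<open>simp_all add: m_assoc iota_mult\<close>)
qed

lemma eqv_mult:
  assumes "eqv x x'" "eqv y y'" "x' \<in> carrier G" "y' \<in> carrier G" shows "eqv (x \<otimes> y) (x' \<otimes> y')"
proof -
  obtain c where c: "c \<in> carrier M2" "x = \<iota> c \<otimes> x'" using assms(1) by (rule eqvE)
  obtain d where d: "d \<in> carrier M2" "y = \<iota> d \<otimes> y'" using assms(2) by (rule eqvE)
  have "(\<iota> c \<otimes> x') \<otimes> (\<iota> d \<otimes> y') = \<iota> c \<otimes> (x' \<otimes> (\<iota> d \<otimes> y'))"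
    using c d assms(3,4) by (simp add: m_assoc)
  also have "x' \<otimes> (\<iota> d \<otimes> y') = \<iota> d \<otimes> (x' \<otimes> y')" by (rule iota_left_commute[OF d(1) assms(3,4)])
  also have "\<iota> c \<otimes> (\<iota> d \<otimes> (x' \<otimes> y')) = \<iota> (c \<otimes>\<^bsub>M2\<^esub> d) \<otimes> (x' \<otimes> y')"
    using c d assms(3,4) by (simp add: m_assoc iota_mult)
  finally show ?thesis unfolding c(2) d(2) using c d by (intro eqvI) simp_all
qed

lemma eqv_iota: "m \<in> carrier M2 ==> x \<in> carrier G ==> eqv (\<iota> m \<otimes> x) x"
  by (auto simp: eqv_def)

lemma hprod_closed: "set hs \<subseteq> carrier G ==> hprod G hs x \<in> carrier G"
  by (induction hs arbitrary: x) auto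

text \<open>Modulo the central subgroup the lifts commute and have square one, so a generator can be moved to
  its place.\<close>

lemma hprod_mult_generator:
  assumes "set hs \<subseteq> carrier G" "!!h k. h \<in> set hs ==> k \<in> set hs ==> eqv (h \<otimes> k) (k \<otimes> h)"
    and "!!h. h \<in> set hs ==> eqv (h \<otimes> h) \<one>" and "i < length hs"
  shows "eqv (hs ! i \<otimes> hprod G hs x) (hprod G hs (x + monom 1 i))"
  using assms
proof (induction hs arbitrary: x i)
  case (Cons h hs)
  obtain c y where x: "x = pCons c y" by (rule pCons_cases_bit)
  have hs: "h \<in> carrier G" "set hs \<subseteq> carrier G" using Cons.prems(1) by simp_all
  let ?P = "hprod G hs y"
  have P: "?P \<in> carrier G" by (rule hprod_closed[OF hs(2)])
  show ?case
  proof (cases i)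
    case 0
    show ?thesis
    proof (cases "c = 0")
      case True
      have "x + monom 1 0 = pCons 1 y" by (simp add: x True monom_0)
      then show ?thesis using True hs P 0 by (simp add: x hprod_pCons eqv_refl del: hprod.simps)
    next
      case False
      have e: "x + monom 1 0 = pCons 0 y" using False by (simp add: x monom_0)
      have "eqv ((h \<otimes> h) \<otimes> ?P) (\<one> \<otimes> ?P)"
        by (rule eqv_mult) (use Cons.prems(3)[of h] P in \<open>simp_all add: eqv_refl\<close>)
      then have "eqv (h \<otimes> (h \<otimes> ?P)) ?P" using hs P by (simp add: m_assoc)
      then show ?thesis using False 0 e by (simp add: x hprod_pCons del: hprod.simps)
    qed
  next
    case (Suc l)
    have l: "l < length hs" "hs ! l \<in> carrier G" using Cons.prems(4) Suc hs by auto
    have IH: "eqv (hs ! l \<otimes> ?P) (hprod G hs (y + monom 1 l))"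
    proof (rule Cons.IH)
      show "set hs \<subseteq> carrier G" by (rule hs(2))
      show "eqv (h' \<otimes> k) (k \<otimes> h')" if "h' \<in> set hs" "k \<in> set hs" for h' k
        by (rule Cons.prems(2)) (simp_all add: that)
      show "eqv (h' \<otimes> h') \<one>" if "h' \<in> set hs" for h' by (rule Cons.prems(3)) (simp add: that)
      show "l < length hs" by (rule l(1))
    qed
    let ?Q = "hprod G hs (y + monom 1 l)"
    have Q: "?Q \<in> carrier G" by (rule hprod_closed[OF hs(2)])
    have e: "x + monom 1 (Suc l) = pCons c (y + monom 1 l)" by (simp add: x monom_Suc)
    show ?thesis
    proof (cases "c = 0")
      case True
      then show ?thesis using IH Suc e by (simp add: x hprod_pCons del: hprod.simps)
    next
      case False
      have "eqv (hs ! l \<otimes> h) (h \<otimes> hs ! l)" using Cons.prems(2) l by simp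
      then have "eqv ((hs ! l \<otimes> h) \<otimes> ?P) ((h \<otimes> hs ! l) \<otimes> ?P)"
        by (rule eqv_mult[OF _ eqv_refl]) (use hs l P in simp_all)
      then have 1: "eqv (hs ! l \<otimes> (h \<otimes> ?P)) (h \<otimes> (hs ! l \<otimes> ?P))" using hs l P by (simp add: m_assoc)
      have "eqv (h \<otimes> (hs ! l \<otimes> ?P)) (h \<otimes> ?Q)" using hs l P Q IH by (intro eqv_mult[OF eqv_refl])
      then have "eqv (hs ! l \<otimes> (h \<otimes> ?P)) (h \<otimes> ?Q)" using 1 hs Q by (intro eqv_trans[OF 1]) simp_all
      then show ?thesis using False Suc e by (simp add: x hprod_pCons del: hprod.simps)
    qed
  qed
qed simp

definition commutes_up_to :: "'a => 'a => complex \<times> complex => bool" where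
  "commutes_up_to x y c \<longleftrightarrow> x \<otimes> y = \<iota> c \<otimes> (y \<otimes> x)"

lemma commutes_mult:
  assumes "commutes_up_to x z c" "commutes_up_to y z d" "x \<in> carrier G" "y \<in> carrier G" "z \<in> carrier G"
    "c \<in> carrier M2" "d \<in> carrier M2"
  shows "commutes_up_to (x \<otimes> y) z (c \<otimes>\<^bsub>M2\<^esub> d)"
proof -
  have "(x \<otimes> y) \<otimes> z = x \<otimes> (\<iota> d \<otimes> (z \<otimes> y))"
    using assms by (simp add: m_assoc commutes_up_to_def)
  also have "... = \<iota> d \<otimes> ((x \<otimes> z) \<otimes> y)" using assms by (simp add: iota_left_commute m_assoc)
  also have "... = \<iota> d \<otimes> (\<iota> c \<otimes> (z \<otimes> x) \<otimes> y)" using assms(1) by (simp add: commutes_up_to_def)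
  also have "... = \<iota> (c \<otimes>\<^bsub>M2\<^esub> d) \<otimes> (z \<otimes> (x \<otimes> y))"
    using assms by (simp add: iota_mult m_assoc M2.m_comm[of c d])
  finally show ?thesis by (simp add: commutes_up_to_def)
qed

lemma commutes_iota: "m \<in> carrier M2 ==> z \<in> carrier G ==> commutes_up_to (\<iota> m) z (order2_elem 0 0)"
  by (simp add: commutes_up_to_def order2_elem_0 central)

lemma commutes_sym:
  assumes "commutes_up_to x y (order2_elem a b)" "x \<in> carrier G" "y \<in> carrier G"
  shows "commutes_up_to y x (order2_elem a b)"
proof -
  have "\<iota> (order2_elem a b) \<otimes> (x \<otimes> y) = \<iota> (order2_elem a b \<otimes>\<^bsub>M2\<^esub> order2_elem a b) \<otimes> (y \<otimes> x)"
    using assms by (simp add: commutes_up_to_def iota_mult order2_elem_carrier m_assoc)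
  then show ?thesis using assms by (simp add: commutes_up_to_def order2_elem_add order2_elem_0)
qed

lemma commutes_hprod:
  assumes "set hs \<subseteq> carrier G" "z \<in> carrier G"
    and "!!i. i < length hs ==> commutes_up_to (hs ! i) z (order2_elem (a i) (b i))"
  shows "commutes_up_to (hprod G hs x) z
    (order2_elem (\<Sum>i<length hs. coeff x i * a i) (\<Sum>i<length hs. coeff x i * b i))"
  using assms
proof (induction hs arbitrary: x a b)
  case Nil
  then show ?case by (simp add: commutes_up_to_def order2_elem_0)
next
  case (Cons h hs)
  obtain c y where x: "x = pCons c y" by (rule pCons_cases_bit)
  have IH: "commutes_up_to (hprod G hs y) z
    (order2_elem (\<Sum>i<length hs. coeff y i * a (Suc i)) (\<Sum>i<length hs. coeff y i * b (Suc i)))"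
  proof (rule Cons.IH)
    show "set hs \<subseteq> carrier G" "z \<in> carrier G" using Cons.prems(1,2) by simp_all
    fix i assume "i < length hs"
    then show "commutes_up_to (hs ! i) z (order2_elem (a (Suc i)) (b (Suc i)))"
      using Cons.prems(3)[of "Suc i"] by simp
  qed
  have h: "commutes_up_to h z (order2_elem (a 0) (b 0))" using Cons.prems(3)[of 0] by simp
  show ?case
  proof (cases "c = 0")
    case True
    then show ?thesis using IH
      by (simp add: x hprod_pCons sum.lessThan_Suc_shift del: hprod.simps sum.lessThan_Suc)
  next
    case False
    have P: "hprod G hs y \<in> carrier G" using Cons.prems(1) by (intro hprod_closed) simp
    from commutes_mult[OF h IH _ P Cons.prems(2) order2_elem_carrier order2_elem_carrier] Cons.prems(1) False
    show ?thesis
      by (simp add: x hprod_pCons sum.lessThan_Suc_shift order2_elem_add del: hprod.simps sum.lessThan_Suc)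
  qed
qed


lemma commutes_imp_eqv:
  "commutes_up_to x y c ==> c \<in> carrier M2 ==> eqv (x \<otimes> y) (y \<otimes> x)"
  by (auto simp: commutes_up_to_def eqv_def)

definition elementary :: "'a list => bool" where
  "elementary hs \<longleftrightarrow> set hs \<subseteq> carrier G \<and>
     (\<forall>h\<in>set hs. \<forall>k\<in>set hs. eqv (h \<otimes> k) (k \<otimes> h)) \<and> (\<forall>h\<in>set hs. eqv (h \<otimes> h) \<one>)"

lemma hprod_add:
  assumes e: "elementary hs" and x: "x \<in> vecs (length hs)"
  shows "eqv (hprod G hs x \<otimes> hprod G hs y) (hprod G hs (x + y))"
proof -
  have hs: "set hs \<subseteq> carrier G" using e by (simp add: elementary_def)
  have P: "hprod G hs z \<in> carrier G" for z by (rule hprod_closed[OF hs])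
  have gen: "eqv (hs ! i \<otimes> hprod G hs z) (hprod G hs (z + monom 1 i))" if "i < length hs" for i z
    using e that by (intro hprod_mult_generator) (auto simp: elementary_def)
  have "n \<le> length hs ==> x \<in> vecs n ==> eqv (hprod G hs x \<otimes> hprod G hs y) (hprod G hs (x + y))" for n
  proof (induction n arbitrary: x y)
    case 0
    then show ?case by (simp add: vecs_0 hprod_0 P eqv_refl)
  next
    case (Suc n)
    show ?case
    proof (cases "coeff x n = 0")
      case True
      have "coeff x i = 0" if "n \<le> i" for i
        using that True Suc.prems(2) by (cases "i = n") (auto simp: vecs_def)
      then have "x \<in> vecs n" by (simp add: vecs_def)
      then show ?thesis using Suc.prems(1) by (intro Suc.IH) simp_all
    next
      case False
      let ?x = "x + monom 1 n"
      have "coeff ?x i = 0" if "n \<le> i" for i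
        using that False Suc.prems(2) by (cases "i = n") (auto simp: vecs_def)
      then have x': "?x \<in> vecs n" by (simp add: vecs_def)
      have n: "n < length hs" "hs ! n \<in> carrier G" using Suc.prems(1) hs by auto
      have "eqv (hs ! n \<otimes> hprod G hs ?x) (hprod G hs (?x + monom 1 n))" by (rule gen[OF n(1)])
      then have "eqv (hs ! n \<otimes> hprod G hs ?x) (hprod G hs x)" by (simp add: add.assoc)
      then have "eqv (hprod G hs x) (hs ! n \<otimes> hprod G hs ?x)" by (rule eqv_sym[OF _ P])
      then have 1: "eqv (hprod G hs x \<otimes> hprod G hs y) ((hs ! n \<otimes> hprod G hs ?x) \<otimes> hprod G hs y)"
        by (rule eqv_mult[OF _ eqv_refl]) (use P n in simp_all)
      have "eqv (hprod G hs ?x \<otimes> hprod G hs y) (hprod G hs (?x + y))"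
        using Suc.prems(1) x' by (intro Suc.IH) simp_all
      then have 2: "eqv (hs ! n \<otimes> (hprod G hs ?x \<otimes> hprod G hs y)) (hs ! n \<otimes> hprod G hs (?x + y))"
        using P n by (intro eqv_mult[OF eqv_refl]) simp_all
      have 3: "eqv (hs ! n \<otimes> hprod G hs (?x + y)) (hprod G hs (x + y))"
        using gen[OF n(1), of "?x + y"] by (simp add: add.assoc add.commute add.left_commute)
      have a: "(hs ! n \<otimes> hprod G hs ?x) \<otimes> hprod G hs y = hs ! n \<otimes> (hprod G hs ?x \<otimes> hprod G hs y)"
        using P n by (simp add: m_assoc)
      show ?thesis using eqv_trans[OF 1[unfolded a] eqv_trans[OF 2 3 P] P] .
    qed
  qed
  then show ?thesis using x by blast
qed

text \<open>If \<open>hs'\<close> consists, modulo the central subgroup, of the products belonging to the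
  vectors \<open>bs\<close>, then products of \<open>hs'\<close> are described by linear
  combinations of \<open>bs\<close>.\<close>

lemma hprod_comb:
  assumes e: "elementary hs"
    and "list_all2 (\<lambda>h b. b \<in> vecs (length hs) \<and> eqv h (hprod G hs b)) hs' bs"
  shows "eqv (hprod G hs' x) (hprod G hs (comb bs x))"
  using assms(2)
proof (induction arbitrary: x rule: list_all2_induct)
  case Nil
  then show ?case by (simp add: hprod_0 eqv_refl)
next
  case (Cons h hs' b bs)
  have hs: "set hs \<subseteq> carrier G" using e by (simp add: elementary_def)
  have P: "hprod G hs z \<in> carrier G" for z by (rule hprod_closed[OF hs])
  obtain c y where x: "x = pCons c y" by (rule pCons_cases_bit)
  show ?case
  proof (cases "c = 0")
    case True
    then show ?thesis using Cons.IH by (simp add: x hprod_pCons comb_pCons del: hprod.simps)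
  next
    case False
    have "eqv (h \<otimes> hprod G hs' y) (hprod G hs b \<otimes> hprod G hs (comb bs y))"
      using Cons P by (intro eqv_mult) simp_all
    moreover have "eqv (hprod G hs b \<otimes> hprod G hs (comb bs y)) (hprod G hs (b + comb bs y))"
      using Cons by (intro hprod_add[OF e]) simp
    ultimately have "eqv (h \<otimes> hprod G hs' y) (hprod G hs (b + comb bs y))"
      by (rule eqv_trans[OF _ _ P])
    then show ?thesis using False by (simp add: x hprod_pCons comb_pCons del: hprod.simps)
  qed
qed

end

definition matrix_form :: "nat => bit mat => bit poly => bit poly => bit" where
  "matrix_form n A x y = (\<Sum>i<n. coeff x i * (\<Sum>j<n. coeff y j * A $$ (i, j)))"

lemma matrix_form_add:
  "matrix_form n A (x + y) z = matrix_form n A x z + matrix_form n A y z"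
  "matrix_form n A x (y + z) = matrix_form n A x y + matrix_form n A x z"
  by (simp_all add: matrix_form_def algebra_simps sum.distrib)

lemma matrix_form_monom:
  assumes "i < n" "j < n"
  shows "matrix_form n A (monom 1 i) (monom 1 j) = A $$ (i, j)"
proof -
  have "(\<Sum>j'<n. coeff (monom 1 j) j' * A $$ (i', j')) = (\<Sum>j'<n. if j' = j then A $$ (i', j') else 0)" for i'
    by (intro sum.cong) auto
  then have "matrix_form n A (monom 1 i) (monom 1 j) = (\<Sum>i'<n. if i' = i then A $$ (i', j) else 0)"
    unfolding matrix_form_def using assms by (intro sum.cong) auto
  then show ?thesis using assms by simp
qed


text \<open>A group \<open>G\<close> recognized as \<open>G(A)\<close>: a central copy of
  \<open>M\<^sup>(\<^sup>2\<^sup>)\<close> and involutions that form a basis of the quotient and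
  whose commutators are given by \<open>A\<close>.\<close>

locale central_lifts = central_M2 G \<iota> for G (structure) and \<iota> +
  fixes hs :: "'a list" and A :: "bit mat \<times> bit mat"
  assumes lifts: "set hs \<subseteq> carrier G"
    and square: "h \<in> set hs ==> h \<otimes> h = \<one>"
    and commutators: "i < length hs ==> j < length hs ==>
      commutes_up_to (hs ! i) (hs ! j) (order2_elem (fst A $$ (i, j)) (snd A $$ (i, j)))"
    and iota_inj: "inj_on \<iota> (carrier M2)"
    and span: "g \<in> carrier G ==> \<exists>x\<in>vecs (length hs). eqv g (hprod G hs x)"
    and indep: "x \<in> vecs (length hs) ==> eqv (hprod G hs x) \<one> ==> x = 0"
begin

abbreviation "form1 \<equiv> matrix_form (length hs) (fst A)"
abbreviation "form2 \<equiv> matrix_form (length hs) (snd A)"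

lemma P_closed [simp]: "hprod G hs x \<in> carrier G"
  by (rule hprod_closed[OF lifts])

lemma elementary_hs: "elementary hs"
proof -
  have "eqv (h \<otimes> k) (k \<otimes> h)" if hk: "h \<in> set hs" "k \<in> set hs" for h k
  proof -
    obtain i where i: "i < length hs" "h = hs ! i" using hk(1) by (auto simp: in_set_conv_nth)
    obtain j where j: "j < length hs" "k = hs ! j" using hk(2) by (auto simp: in_set_conv_nth)
    show ?thesis unfolding i j by (rule commutes_imp_eqv[OF commutators[OF i(1) j(1)] order2_elem_carrier])
  qed
  then show ?thesis using lifts by (simp add: elementary_def square eqv_refl)
qed

lemma eqv_hprod_unique:
  assumes "x \<in> vecs (length hs)" "y \<in> vecs (length hs)" "eqv (hprod G hs x) (hprod G hs y)"
  shows "x = y"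
proof -
  have "eqv (hprod G hs x \<otimes> hprod G hs y) (hprod G hs (x + y))" by (rule hprod_add[OF elementary_hs assms(1)])
  then have 1: "eqv (hprod G hs (x + y)) (hprod G hs x \<otimes> hprod G hs y)" by (rule eqv_sym) simp
  have 2: "eqv (hprod G hs x \<otimes> hprod G hs y) (hprod G hs y \<otimes> hprod G hs y)"
    by (rule eqv_mult[OF assms(3) eqv_refl]) simp_all
  have 3: "eqv (hprod G hs y \<otimes> hprod G hs y) \<one>"
    using hprod_add[OF elementary_hs assms(2), of y] by (simp add: hprod_0)
  have "eqv (hprod G hs (x + y)) \<one>" by (rule eqv_trans[OF 1 eqv_trans[OF 2 3]]) simp_all
  then have "x + y = 0" using assms subgrpD(2)[OF subgrp_vecs] by (intro indep)
  then show ?thesis by (simp add: add_eq_0_iff_eq)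
qed

lemma iota_order2_inject:
  assumes "\<iota> (order2_elem a b) = \<iota> (order2_elem c d)" shows "a = c \<and> b = d"
proof -
  have "order2_elem a b = order2_elem c d" by (rule inj_onD[OF iota_inj assms order2_elem_carrier order2_elem_carrier])
  then show ?thesis by (simp add: order2_elem_inject)
qed

lemma commutes_hprod_hprod:
  "commutes_up_to (hprod G hs x) (hprod G hs y) (order2_elem (form1 x y) (form2 x y))"
proof -
  have "commutes_up_to (hs ! i) (hprod G hs y)
     (order2_elem (\<Sum>j<length hs. coeff y j * fst A $$ (i, j)) (\<Sum>j<length hs. coeff y j * snd A $$ (i, j)))"
    if i: "i < length hs" for i
  proof -
    have hi: "hs ! i \<in> carrier G" using lifts i by auto
    have "commutes_up_to (hprod G hs y) (hs ! i)
     (order2_elem (\<Sum>j<length hs. coeff y j * fst A $$ (i, j)) (\<Sum>j<length hs. coeff y j * snd A $$ (i, j)))"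
    proof (rule commutes_hprod[OF lifts hi])
      fix j assume j: "j < length hs"
      then have "hs ! j \<in> carrier G" using lifts by auto
      with commutators[OF i j] hi
      show "commutes_up_to (hs ! j) (hs ! i) (order2_elem (fst A $$ (i, j)) (snd A $$ (i, j)))"
        by (rule commutes_sym)
    qed
    then show ?thesis by (rule commutes_sym) (use hi in simp_all)
  qed
  from commutes_hprod[OF lifts P_closed this] show ?thesis by (simp add: matrix_form_def)
qed

lemma commutes_up_to_unique:
  assumes "commutes_up_to x y c" "commutes_up_to x y d" "c \<in> carrier M2" "d \<in> carrier M2"
    "x \<in> carrier G" "y \<in> carrier G"
  shows "\<iota> c = \<iota> d"
  using assms by (simp add: commutes_up_to_def)

text \<open>Every element commutes with itself.\<close>

lemma alt_forms: "alt_form form1" "alt_form form2"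
proof -
  have "form1 x x = 0 \<and> form2 x x = 0" for x
  proof -
    have "\<iota> (order2_elem (form1 x x) (form2 x x)) = \<iota> (order2_elem 0 0)"
      by (rule commutes_up_to_unique[OF commutes_hprod_hprod[of x x]])
        (simp_all add: order2_elem_carrier commutes_up_to_def order2_elem_0)
    then show ?thesis by (rule iota_order2_inject)
  qed
  then show "alt_form form1" "alt_form form2" by (simp_all add: alt_form_def matrix_form_add)
qed

end


context central_M2 begin

text \<open>Divisibility of the bottom: a square root of \<open>(g \<otimes> g)\<^sup>-\<^sup>1\<close>
  corrects \<open>g\<close> to an involution.\<close>

lemma square_one_translate:
  assumes g: "g \<in> carrier G" and sq: "eqv (g \<otimes> g) \<one>"
  shows "\<exists>n\<in>carrier M2. (\<iota> n \<otimes> g) \<otimes> (\<iota> n \<otimes> g) = \<one>"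
proof -
  obtain c where c: "c \<in> carrier M2" "g \<otimes> g = \<iota> c" using sq by (auto elim: eqvE)
  obtain n where n: "n \<in> carrier M2" "n \<otimes>\<^bsub>M2\<^esub> n = inv\<^bsub>M2\<^esub> c" using M2_sqrt[of "inv\<^bsub>M2\<^esub> c"] c by auto
  have "(\<iota> n \<otimes> g) \<otimes> (\<iota> n \<otimes> g) = \<iota> n \<otimes> (g \<otimes> (\<iota> n \<otimes> g))" using n g by (simp add: m_assoc)
  also have "g \<otimes> (\<iota> n \<otimes> g) = \<iota> n \<otimes> (g \<otimes> g)" using n g by (intro iota_left_commute) simp_all
  also have "\<iota> n \<otimes> (\<iota> n \<otimes> (g \<otimes> g)) = \<iota> (n \<otimes>\<^bsub>M2\<^esub> n) \<otimes> (g \<otimes> g)"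
    unfolding iota_mult[OF n(1) n(1)] using n(1) g by (simp add: m_assoc)
  also have "... = \<one>" using c n by (simp add: iota_inv)
  finally show ?thesis using n(1) by (rule bexI)
qed

end

context central_lifts begin

section \<open>Change of lifts\<close>

lemma commutes_translates:
  assumes m: "m \<in> carrier M2" "x = \<iota> m \<otimes> hprod G hs a"
    and n: "n \<in> carrier M2" "y = \<iota> n \<otimes> hprod G hs b"
  shows "commutes_up_to x y (order2_elem (form1 a b) (form2 a b))"
proof -
  have x: "x \<in> carrier G" and y: "y \<in> carrier G" using m n by simp_all
  have "commutes_up_to (\<iota> m \<otimes> hprod G hs a) (hprod G hs b) (order2_elem (0 + form1 a b) (0 + form2 a b))"
    unfolding order2_elem_add[symmetric] using m(1)
    by (intro commutes_mult commutes_iota commutes_hprod_hprod order2_elem_carrier) simp_all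
  then have "commutes_up_to x (hprod G hs b) (order2_elem (form1 a b) (form2 a b))" by (simp add: m(2))
  then have c: "commutes_up_to (hprod G hs b) x (order2_elem (form1 a b) (form2 a b))"
    by (rule commutes_sym) (use x in simp_all)
  have "commutes_up_to (\<iota> n \<otimes> hprod G hs b) x (order2_elem (0 + form1 a b) (0 + form2 a b))"
    unfolding order2_elem_add[symmetric] using n(1) x
    by (intro commutes_mult commutes_iota c order2_elem_carrier) simp_all
  then have "commutes_up_to y x (order2_elem (form1 a b) (form2 a b))" by (simp add: n(2))
  then show ?thesis by (rule commutes_sym) (rule y x)+
qed

text \<open>Another basis of the top gives another system of lifts, whose commutators form the Gram matrices
  of that basis. Hence congruent pairs of matrices give isomorphic groups.\<close>

lemma change_lifts:
  assumes bs: "basis bs (vecs (length hs))"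
  shows "\<exists>hs'. length hs' = length bs \<and> central_lifts G \<iota> hs' (gram form1 bs, gram form2 bs)"
proof -
  have bs_in: "set bs \<subseteq> vecs (length hs)"
    using nth_in_range_comb[of _ bs] basis_range[OF bs] by blast
  have ex: "\<exists>h\<in>carrier G. h \<otimes> h = \<one> \<and> (\<exists>n\<in>carrier M2. h = \<iota> n \<otimes> hprod G hs b)" if b: "b \<in> set bs" for b
  proof -
    have "eqv (hprod G hs b \<otimes> hprod G hs b) (hprod G hs (b + b))"
      using b bs_in by (intro hprod_add[OF elementary_hs]) blast
    then have "eqv (hprod G hs b \<otimes> hprod G hs b) \<one>" by (simp add: hprod_0)
    from square_one_translate[OF P_closed this] obtain n where n: "n \<in> carrier M2"
      "(\<iota> n \<otimes> hprod G hs b) \<otimes> (\<iota> n \<otimes> hprod G hs b) = \<one>" by (rule bexE)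
    then show ?thesis by (intro bexI[of _ "\<iota> n \<otimes> hprod G hs b"]) auto
  qed
  then obtain f where f: "!!b. b \<in> set bs ==> f b \<in> carrier G \<and> f b \<otimes> f b = \<one> \<and> (\<exists>n\<in>carrier M2. f b = \<iota> n \<otimes> hprod G hs b)"
    using bchoice[of "set bs" "\<lambda>b h. h \<in> carrier G \<and> h \<otimes> h = \<one> \<and> (\<exists>n\<in>carrier M2. h = \<iota> n \<otimes> hprod G hs b)"] by blast
  let ?hs = "map f bs"
  have rel: "list_all2 (\<lambda>h b. b \<in> vecs (length hs) \<and> eqv h (hprod G hs b)) ?hs bs"
    using f bs_in by (auto simp: list_all2_conv_all_nth eqv_def)
  have comb: "eqv (hprod G ?hs x) (hprod G hs (comb bs x))" for x by (rule hprod_comb[OF elementary_hs rel])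
  have "central_lifts G \<iota> ?hs (gram form1 bs, gram form2 bs)"
  proof
    show hs': "set ?hs \<subseteq> carrier G" using f by auto
    show "h \<otimes> h = \<one>" if "h \<in> set ?hs" for h using that f by auto
    show "inj_on \<iota> (carrier M2)" by (rule iota_inj)
    show "commutes_up_to (?hs ! i) (?hs ! j) (order2_elem (fst (gram form1 bs, gram form2 bs) $$ (i, j)) (snd (gram form1 bs, gram form2 bs) $$ (i, j)))"
      if ij: "i < length ?hs" "j < length ?hs" for i j
    proof -
      have lt: "i < length bs" "j < length bs" using ij by simp_all
      obtain m where m: "m \<in> carrier M2" "f (bs ! i) = \<iota> m \<otimes> hprod G hs (bs ! i)" using f[of "bs ! i"] lt by auto
      obtain n where n: "n \<in> carrier M2" "f (bs ! j) = \<iota> n \<otimes> hprod G hs (bs ! j)" using f[of "bs ! j"] lt by auto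
      have "commutes_up_to (f (bs ! i)) (f (bs ! j)) (order2_elem (form1 (bs ! i) (bs ! j)) (form2 (bs ! i) (bs ! j)))"
        by (rule commutes_translates[OF m n])
      then show ?thesis using lt by (simp add: gram_def)
    qed
    show "\<exists>x\<in>vecs (length ?hs). eqv g (hprod G ?hs x)" if g: "g \<in> carrier G" for g
    proof -
      obtain y where y: "y \<in> vecs (length hs)" "eqv g (hprod G hs y)" using span[OF g] by blast
      from y(1) have "y \<in> comb bs ` vecs (length bs)" using bs by (simp add: basis_def bij_betw_def)
      then obtain x where x: "x \<in> vecs (length bs)" "y = comb bs x" by blast
      have "eqv (hprod G hs y) (hprod G ?hs x)" unfolding x(2) by (rule eqv_sym[OF comb]) simp
      then have "eqv g (hprod G ?hs x)" by (rule eqv_trans[OF y(2)]) (rule hprod_closed[OF hs'])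
      then show ?thesis using x by auto
    qed
    show "x = 0" if x: "x \<in> vecs (length ?hs)" "eqv (hprod G ?hs x) \<one>" for x
    proof -
      have "eqv (hprod G hs (comb bs x)) (hprod G ?hs x)"
        by (rule eqv_sym[OF comb]) simp
      then have "eqv (hprod G hs (comb bs x)) \<one>" by (rule eqv_trans[OF _ x(2)]) simp
      then have "comb bs x = 0" using bs_in by (intro indep comb_in[OF subgrp_vecs])
      then show ?thesis using basis_indep[OF bs] x(1) by simp
    qed
  qed
  then show ?thesis by (intro exI[of _ ?hs]) simp
qed

lemma eqv_same_image:
  assumes "central_M2 G \<iota>'" "\<iota>' ` carrier M2 = \<iota> ` carrier M2"
  shows "central_M2.eqv G \<iota>' x y \<longleftrightarrow> eqv x y"
proof -
  interpret i': central_M2 G \<iota>' by (rule assms(1))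
  have "i'.eqv x y \<longleftrightarrow> (\<exists>z\<in>\<iota>' ` carrier M2. x = z \<otimes> y)" by (auto simp: i'.eqv_def)
  also have "... \<longleftrightarrow> eqv x y" unfolding assms(2) by (auto simp: eqv_def)
  finally show ?thesis .
qed

text \<open>Converse of the change of lifts, for two embeddings of the bottom with the same image: the second
  system of lifts has coordinates with respect to the first, and comparing the two expressions for
  its commutators gives the Gram matrices.\<close>

lemma coordinates_of_lifts:
  assumes c: "central_lifts G \<iota>' hs' A'" and im: "\<iota>' ` carrier M2 = \<iota> ` carrier M2"
    and Q: "!!a b. \<iota>' (order2_elem a b) = \<iota> (order2_elem (p * a + r * b) (q * a + s * b))"
  shows "\<exists>bs. length bs = length hs' \<and> basis bs (vecs (length hs)) \<and>
    (\<forall>i<length bs. \<forall>j<length bs.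
       form1 (bs ! i) (bs ! j) = p * fst A' $$ (i, j) + r * snd A' $$ (i, j) \<and>
       form2 (bs ! i) (bs ! j) = q * fst A' $$ (i, j) + s * snd A' $$ (i, j))"
proof -
  interpret c': central_lifts G \<iota>' hs' A' by (rule c)
  have eq: "c'.eqv x y = eqv x y" for x y by (rule eqv_same_image[OF c'.central_M2_axioms im])
  have "\<exists>x\<in>vecs (length hs). eqv h (hprod G hs x)" if "h \<in> set hs'" for h using that c'.lifts by (intro span) blast
  then obtain f where f: "!!h. h \<in> set hs' ==> f h \<in> vecs (length hs) \<and> eqv h (hprod G hs (f h))"
    using bchoice[of "set hs'" "\<lambda>h x. x \<in> vecs (length hs) \<and> eqv h (hprod G hs x)"] by blast
  let ?bs = "map f hs'"
  have bs_in: "set ?bs \<subseteq> vecs (length hs)" using f by auto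
  have rel: "list_all2 (\<lambda>h b. b \<in> vecs (length hs) \<and> eqv h (hprod G hs b)) hs' ?bs"
    using f by (auto simp: list_all2_conv_all_nth)
  have comb: "eqv (hprod G hs' x) (hprod G hs (comb ?bs x))" for x by (rule hprod_comb[OF elementary_hs rel])
  have comb': "eqv (hprod G hs (comb ?bs x)) (hprod G hs' x)" for x by (rule eqv_sym[OF comb]) simp
  have "basis ?bs (vecs (length hs))"
  proof (rule basisI)
    show "range (comb ?bs) = vecs (length hs)"
    proof (rule antisym)
      show "range (comb ?bs) \<subseteq> vecs (length hs)" using comb_in[OF subgrp_vecs bs_in] by auto
      show "vecs (length hs) \<subseteq> range (comb ?bs)"
      proof
        fix y assume y: "y \<in> vecs (length hs)"
        obtain x where x: "eqv (hprod G hs y) (hprod G hs' x)" using c'.span[of "hprod G hs y"] eq by auto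
        have "eqv (hprod G hs y) (hprod G hs (comb ?bs x))" by (rule eqv_trans[OF x comb]) simp
        then have "y = comb ?bs x" by (rule eqv_hprod_unique[OF y comb_in[OF subgrp_vecs bs_in]])
        then show "y \<in> range (comb ?bs)" by simp
      qed
    qed
    show "x = 0" if x: "x \<in> vecs (length ?bs)" "comb ?bs x = 0" for x
    proof (rule c'.indep)
      show "x \<in> vecs (length hs')" using x by simp
      show "c'.eqv (hprod G hs' x) \<one>" unfolding eq using comb[of x] by (simp add: x hprod_0)
    qed
  qed
  moreover have "form1 (?bs ! i) (?bs ! j) = p * fst A' $$ (i, j) + r * snd A' $$ (i, j) \<and>
       form2 (?bs ! i) (?bs ! j) = q * fst A' $$ (i, j) + s * snd A' $$ (i, j)"
    if ij: "i < length hs'" "j < length hs'" for i j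
  proof -
    let ?x = "f (hs' ! i)" and ?y = "f (hs' ! j)" and ?a = "fst A' $$ (i, j)" and ?b = "snd A' $$ (i, j)"
    have hi: "hs' ! i \<in> carrier G" and hj: "hs' ! j \<in> carrier G" using ij c'.lifts by auto
    obtain m where m: "m \<in> carrier M2" "hs' ! i = \<iota> m \<otimes> hprod G hs ?x" using f[of "hs' ! i"] ij by (auto elim: eqvE)
    obtain n where n: "n \<in> carrier M2" "hs' ! j = \<iota> n \<otimes> hprod G hs ?y" using f[of "hs' ! j"] ij by (auto elim: eqvE)
    have c3: "commutes_up_to (hs' ! i) (hs' ! j) (order2_elem (form1 ?x ?y) (form2 ?x ?y))"
      by (rule commutes_translates[OF m n])
    have c4: "commutes_up_to (hs' ! i) (hs' ! j) (order2_elem (p * ?a + r * ?b) (q * ?a + s * ?b))"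
      using c'.commutators[OF ij] by (simp add: commutes_up_to_def c'.commutes_up_to_def Q)
    have "\<iota> (order2_elem (form1 ?x ?y) (form2 ?x ?y)) = \<iota> (order2_elem (p * ?a + r * ?b) (q * ?a + s * ?b))"
      by (rule commutes_up_to_unique[OF c3 c4 order2_elem_carrier order2_elem_carrier hi hj])
    then show ?thesis using ij iota_order2_inject by simp
  qed
  ultimately show ?thesis by (intro exI[of _ ?bs]) simp
qed

text \<open>An automorphism of the bottom replaces both matrices by linear combinations of them.\<close>

lemma twist_iota:
  assumes th: "\<theta> \<in> hom M2 M2" "bij_betw \<theta> (carrier M2) (carrier M2)"
    and C: "!!i j. i < length hs ==> j < length hs ==>
      \<theta> (order2_elem (fst C $$ (i, j)) (snd C $$ (i, j))) = order2_elem (fst A $$ (i, j)) (snd A $$ (i, j))"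
  shows "central_lifts G (\<iota> \<circ> \<theta>) hs C"
proof -
  have th_in: "\<theta> m \<in> carrier M2" if "m \<in> carrier M2" for m using th that by (auto simp: hom_def)
  interpret c': central_M2 G "\<iota> \<circ> \<theta>"
  proof
    show "\<iota> \<circ> \<theta> \<in> hom M2 G" by (rule homI) (use th_in hom_mult[OF th(1)] in \<open>simp_all add: iota_mult\<close>)
    show "(\<iota> \<circ> \<theta>) m \<otimes> x = x \<otimes> (\<iota> \<circ> \<theta>) m" if "m \<in> carrier M2" "x \<in> carrier G" for m x
      using that central[OF th_in] by simp
  qed
  have im: "(\<iota> \<circ> \<theta>) ` carrier M2 = \<iota> ` carrier M2"
    using th(2) unfolding bij_betw_def by (simp only: image_comp[symmetric])
  have eq: "c'.eqv x y = eqv x y" for x y by (rule eqv_same_image[OF c'.central_M2_axioms im])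
  show ?thesis
  proof
    show "set hs \<subseteq> carrier G" by (rule lifts)
    show "h \<otimes> h = \<one>" if "h \<in> set hs" for h using that by (rule square)
    show "c'.commutes_up_to (hs ! i) (hs ! j) (order2_elem (fst C $$ (i, j)) (snd C $$ (i, j)))"
      if "i < length hs" "j < length hs" for i j
      using commutators[OF that] C[OF that] by (simp add: commutes_up_to_def c'.commutes_up_to_def)
    show "inj_on (\<iota> \<circ> \<theta>) (carrier M2)"
      using th(2) iota_inj by (intro comp_inj_on) (auto simp: bij_betw_def)
    show "\<exists>x\<in>vecs (length hs). c'.eqv g (hprod G hs x)" if "g \<in> carrier G" for g
      unfolding eq using that by (rule span)
    show "x = 0" if "x \<in> vecs (length hs)" "c'.eqv (hprod G hs x) \<one>" for x
      using that unfolding eq by (rule indep)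
  qed
qed

end

lemma hprod_hom:
  assumes "\<phi> \<in> hom G H" "group G" "group H" "set hs \<subseteq> carrier G"
  shows "\<phi> (hprod G hs x) = hprod H (map \<phi> hs) x"
  using assms(4)
proof (induction hs arbitrary: x)
  case Nil
  then show ?case using hom_one[OF assms(1-3)] by simp
next
  case (Cons h hs)
  interpret G: group G by (rule assms(2))
  have c: "hprod G hs y \<in> carrier G" for y
    using Cons.prems by (induction hs arbitrary: y) auto
  show ?case using Cons c hom_mult[OF assms(1)] by simp
qed

lemma central_lifts_iso:
  assumes c: "central_lifts G \<iota> hs A" and \<phi>: "\<phi> \<in> iso G H" and H: "group H"
  shows "central_lifts H (\<phi> \<circ> \<iota>) (map \<phi> hs) A"
proof -
  interpret c: central_lifts G \<iota> hs A by (rule c)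
  interpret H: group H by (rule H)
  have h: "\<phi> \<in> hom G H" and b: "bij_betw \<phi> (carrier G) (carrier H)" using \<phi> by (auto simp: iso_def)
  have m: "\<phi> (x \<otimes>\<^bsub>G\<^esub> y) = \<phi> x \<otimes>\<^bsub>H\<^esub> \<phi> y" if "x \<in> carrier G" "y \<in> carrier G" for x y
    using hom_mult[OF h that] .
  have cl: "\<phi> x \<in> carrier H" if "x \<in> carrier G" for x using h that by (auto simp: hom_def)
  have inj: "inj_on \<phi> (carrier G)" and su: "\<phi> ` carrier G = carrier H" using b by (auto simp: bij_betw_def)
  have one: "\<phi> \<one>\<^bsub>G\<^esub> = \<one>\<^bsub>H\<^esub>" by (rule hom_one[OF h c.is_group H])
  interpret c': central_M2 H "\<phi> \<circ> \<iota>"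
  proof
    show "\<phi> \<circ> \<iota> \<in> hom M2 H" by (rule homI) (use m cl in \<open>simp_all add: c.iota_mult\<close>)
    fix n x assume n: "n \<in> carrier M2" and x: "x \<in> carrier H"
    obtain y where y: "y \<in> carrier G" "x = \<phi> y" using x su by blast
    show "(\<phi> \<circ> \<iota>) n \<otimes>\<^bsub>H\<^esub> x = x \<otimes>\<^bsub>H\<^esub> (\<phi> \<circ> \<iota>) n" using n y c.central[of n y] by (simp flip: m)
  qed
  have P: "hprod H (map \<phi> hs) x = \<phi> (hprod G hs x)" for x by (rule hprod_hom[OF h c.is_group H c.lifts, symmetric])
  have eq: "c'.eqv (\<phi> x) (\<phi> y) \<longleftrightarrow> c.eqv x y" if "x \<in> carrier G" "y \<in> carrier G" for x y
    unfolding c'.eqv_def c.eqv_def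
  proof (intro bex_cong refl)
    fix n assume n: "n \<in> carrier M2"
    show "\<phi> x = (\<phi> \<circ> \<iota>) n \<otimes>\<^bsub>H\<^esub> \<phi> y \<longleftrightarrow> x = \<iota> n \<otimes>\<^bsub>G\<^esub> y"
      using that n inj_on_eq_iff[OF inj, of x "\<iota> n \<otimes>\<^bsub>G\<^esub> y"] by (simp flip: m)
  qed
  show ?thesis
  proof
    show "set (map \<phi> hs) \<subseteq> carrier H" using c.lifts cl by auto
    show "h \<otimes>\<^bsub>H\<^esub> h = \<one>\<^bsub>H\<^esub>" if "h \<in> set (map \<phi> hs)" for h
    proof -
      from that obtain k where k: "k \<in> set hs" "h = \<phi> k" by auto
      then have "k \<in> carrier G" using c.lifts by blast
      then show ?thesis using c.square[OF k(1)] m[of k k] one k(2) by simp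
    qed
    show "c'.commutes_up_to (map \<phi> hs ! i) (map \<phi> hs ! j) (order2_elem (fst A $$ (i, j)) (snd A $$ (i, j)))"
      if "i < length (map \<phi> hs)" "j < length (map \<phi> hs)" for i j
    proof -
      have ij: "i < length hs" "j < length hs" using that by simp_all
      let ?c = "order2_elem (fst A $$ (i, j)) (snd A $$ (i, j))"
      have hi: "hs ! i \<in> carrier G" and hj: "hs ! j \<in> carrier G" using ij c.lifts by auto
      have "\<phi> (hs ! i) \<otimes>\<^bsub>H\<^esub> \<phi> (hs ! j) = \<phi> (hs ! i \<otimes>\<^bsub>G\<^esub> hs ! j)" by (rule m[OF hi hj, symmetric])
      also have "... = \<phi> (\<iota> ?c \<otimes>\<^bsub>G\<^esub> (hs ! j \<otimes>\<^bsub>G\<^esub> hs ! i))"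
        by (rule arg_cong[OF c.commutators[OF ij, unfolded c.commutes_up_to_def]])
      also have "... = \<phi> (\<iota> ?c) \<otimes>\<^bsub>H\<^esub> (\<phi> (hs ! j) \<otimes>\<^bsub>H\<^esub> \<phi> (hs ! i))"
        using m[OF c.iota_closed[OF order2_elem_carrier] c.m_closed[OF hj hi]] m[OF hj hi] by simp
      finally show ?thesis using ij by (simp add: c'.commutes_up_to_def)
    qed
    show "inj_on (\<phi> \<circ> \<iota>) (carrier M2)"
    proof (rule comp_inj_on[OF c.iota_inj])
      have "\<iota> ` carrier M2 \<subseteq> carrier G" by (rule image_subsetI) (rule c.iota_closed)
      then show "inj_on \<phi> (\<iota> ` carrier M2)" by (rule inj_on_subset[OF inj])
    qed
    show "\<exists>x\<in>vecs (length (map \<phi> hs)). c'.eqv g (hprod H (map \<phi> hs) x)" if "g \<in> carrier H" for g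
    proof -
      have "g \<in> \<phi> ` carrier G" unfolding su by (rule that)
      then obtain y where y: "g = \<phi> y" "y \<in> carrier G" by (rule imageE)
      obtain x where x: "x \<in> vecs (length hs)" "c.eqv y (hprod G hs x)" using c.span[OF y(2)] by (rule bexE)
      have "c'.eqv g (hprod H (map \<phi> hs) x)" unfolding y(1) P eq[OF y(2) c.P_closed] by (rule x(2))
      with x(1) show ?thesis by (intro bexI[of _ x]) simp_all
    qed
    show "x = 0" if x: "x \<in> vecs (length (map \<phi> hs))" "c'.eqv (hprod H (map \<phi> hs) x) \<one>\<^bsub>H\<^esub>" for x
    proof (rule c.indep)
      show "x \<in> vecs (length hs)" using x(1) by simp
      show "c.eqv (hprod G hs x) \<one>\<^bsub>G\<^esub>" using x(2) unfolding P one[symmetric] eq[OF c.P_closed c.one_closed] .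
    qed
  qed
qed


section \<open>Groups given by generators and relations\<close>

locale presentation =
  fixes S :: "'g set" and rels :: "('g word \<times> 'g word) set"
  assumes rels_words: "(u, v) \<in> rels ==> u \<in> lists (S \<times> UNIV) \<and> v \<in> lists (S \<times> UNIV)"
begin

definition W :: "'g word set" where "W = lists (S \<times> UNIV)"

abbreviation eqw :: "'g word => 'g word => bool" where "eqw \<equiv> equivclp (word_step S rels)"

definition cls :: "'g word => 'g word set" where "cls u = {w \<in> W. eqw u w}"

lemma W_append: "u @ v \<in> W \<longleftrightarrow> u \<in> W \<and> v \<in> W"
  by (auto simp: W_def)

lemma step_context:
  assumes "word_step S rels u v" shows "word_step S rels (p @ u @ q) (p @ v @ q)"
  using assms
proof cases
  case (cancel x p' b q')
  then show ?thesis using word_step.cancel[of x S rels "p @ p'" b "q' @ q"] by simp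
next
  case (relation u' v' p' q')
  then show ?thesis using word_step.relation[of u' v' rels S "p @ p'" "q' @ q"] by simp
qed

lemma eqw_context: "eqw u v ==> eqw (p @ u @ q) (p @ v @ q)"
proof (induction rule: equivclp_induct)
  case base
  then show ?case by simp
next
  case (step y z)
  have "eqw (p @ y @ q) (p @ z @ q)"
    using step(2) step_context[of y z p q] step_context[of z y p q]
    by (auto intro: r_into_equivclp equivclp_sym)
  with step.IH show ?case by (rule equivclp_trans)
qed

lemma eqw_append:
  assumes "eqw u u'" "eqw v v'" shows "eqw (u @ v) (u' @ v')"
proof -
  have "eqw (u @ v) (u' @ v)" using eqw_context[OF assms(1), of "[]" v] by simp
  moreover have "eqw (u' @ v) (u' @ v')" using eqw_context[OF assms(2), of u' "[]"] by simp
  ultimately show ?thesis by (rule equivclp_trans)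
qed

lemma step_W: "word_step S rels u v ==> u \<in> W \<longleftrightarrow> v \<in> W"
  by (induction rule: word_step.induct) (use rels_words in \<open>auto simp: W_def\<close>)

lemma cls_self: "v \<in> W ==> v \<in> cls v"
  by (simp add: cls_def)

lemma cls_eq:
  assumes v: "v \<in> W" shows "cls u = cls v \<longleftrightarrow> eqw u v"
proof
  assume "cls u = cls v"
  then have "v \<in> cls u" using cls_self[OF v] by simp
  then show "eqw u v" by (simp add: cls_def)
next
  assume e: "eqw u v"
  have "eqw u w \<longleftrightarrow> eqw v w" for w
    by (rule iffI) (erule equivclp_trans[OF equivclp_sym[OF e]], erule equivclp_trans[OF e])
  then show "cls u = cls v" by (simp add: cls_def)
qed

lemma cls_relation:
  assumes "(u, v) \<in> rels" shows "cls u = cls v"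
proof -
  have "v \<in> W" using rels_words[OF assms] by (simp add: W_def)
  moreover have "word_step S rels ([] @ u @ []) ([] @ v @ [])" by (rule word_step.relation[OF assms])
  then have "eqw u v" by (intro r_into_equivclp) simp
  ultimately show ?thesis by (simp add: cls_eq)
qed

lemma presented_group_simps:
  "carrier (presented_group S rels) = cls ` W"
  "\<one>\<^bsub>presented_group S rels\<^esub> = cls []"
  "u \<in> W ==> v \<in> W ==> cls u \<otimes>\<^bsub>presented_group S rels\<^esub> cls v = cls (u @ v)"
proof -
  show "carrier (presented_group S rels) = cls ` W"
    unfolding presented_group_def Let_def W_def[symmetric] quotient_def by (auto simp: cls_def Image_def)
  show "\<one>\<^bsub>presented_group S rels\<^esub> = cls []"
    by (simp add: presented_group_def Let_def W_def[symmetric] cls_def)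
  assume uv: "u \<in> W" "v \<in> W"
  have "(\<exists>x\<in>cls u. \<exists>y\<in>cls v. eqw (x @ y) w) \<longleftrightarrow> eqw (u @ v) w" for w
  proof
    assume "\<exists>x\<in>cls u. \<exists>y\<in>cls v. eqw (x @ y) w"
    then obtain x y where xy: "eqw u x" "eqw v y" "eqw (x @ y) w" unfolding cls_def by (elim bexE CollectE conjE)
    show "eqw (u @ v) w" by (rule equivclp_trans[OF eqw_append[OF xy(1,2)] xy(3)])
  next
    assume "eqw (u @ v) w"
    then show "\<exists>x\<in>cls u. \<exists>y\<in>cls v. eqw (x @ y) w"
      by (intro bexI[of _ u] bexI[of _ v] cls_self uv)
  qed
  then show "cls u \<otimes>\<^bsub>presented_group S rels\<^esub> cls v = cls (u @ v)"
    by (simp add: presented_group_def Let_def W_def[symmetric] cls_def)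
qed

definition winv :: "'g word => 'g word" where "winv w = map (\<lambda>(x, b). (x, \<not> b)) (rev w)"

lemma winv: "w \<in> W ==> winv w \<in> W \<and> eqw (winv w @ w) []"
proof (induction w)
  case Nil
  then show ?case by (simp add: winv_def W_def)
next
  case (Cons l w)
  obtain x b where l: "l = (x, b)" by (cases l)
  have x: "x \<in> S" "w \<in> W" using Cons.prems by (auto simp: W_def l)
  have i: "winv (l # w) = winv w @ [(x, \<not> b)]" by (simp add: winv_def l)
  have "word_step S rels (winv w @ [(x, \<not> b), (x, \<not> (\<not> b))] @ w) (winv w @ w)"
    by (rule word_step.cancel[OF x(1)])
  then have "eqw (winv (l # w) @ l # w) (winv w @ w)" unfolding i by (simp add: l r_into_equivclp)
  then have "eqw (winv (l # w) @ l # w) []" by (rule equivclp_trans) (use Cons.IH[OF x(2)] in simp)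
  moreover have "winv (l # w) \<in> W" using Cons.IH[OF x(2)] x by (simp add: i W_append W_def)
  ultimately show ?case by simp
qed

lemma presented_group_group: "group (presented_group S rels)"
proof (rule groupI)
  have N: "[] \<in> W" by (simp add: W_def)
  show "\<one>\<^bsub>presented_group S rels\<^esub> \<in> carrier (presented_group S rels)"
    using N by (simp add: presented_group_simps)
  fix a assume "a \<in> carrier (presented_group S rels)"
  then obtain u where u: "u \<in> W" "a = cls u" by (auto simp: presented_group_simps)
  show "\<one>\<^bsub>presented_group S rels\<^esub> \<otimes>\<^bsub>presented_group S rels\<^esub> a = a" using u N by (simp add: presented_group_simps)
  show "\<exists>b\<in>carrier (presented_group S rels). b \<otimes>\<^bsub>presented_group S rels\<^esub> a = \<one>\<^bsub>presented_group S rels\<^esub>"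
    using u winv[OF u(1)] N by (intro bexI[of _ "cls (winv u)"]) (simp_all add: presented_group_simps cls_eq)
  fix b assume "b \<in> carrier (presented_group S rels)"
  then obtain v where v: "v \<in> W" "b = cls v" by (auto simp: presented_group_simps)
  show "a \<otimes>\<^bsub>presented_group S rels\<^esub> b \<in> carrier (presented_group S rels)"
    using u v by (simp add: presented_group_simps W_append)
  fix c assume "c \<in> carrier (presented_group S rels)"
  then obtain w where w: "w \<in> W" "c = cls w" by (auto simp: presented_group_simps)
  show "a \<otimes>\<^bsub>presented_group S rels\<^esub> b \<otimes>\<^bsub>presented_group S rels\<^esub> c = a \<otimes>\<^bsub>presented_group S rels\<^esub> (b \<otimes>\<^bsub>presented_group S rels\<^esub> c)"
    using u v w by (simp add: presented_group_simps W_append)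
qed

end

fun letter_value :: "('a, 'b) monoid_scheme => ('g => 'a) => 'g \<times> bool => 'a" where
  "letter_value G f (x, b) = (if b then f x else inv\<^bsub>G\<^esub> f x)"

primrec word_value :: "('a, 'b) monoid_scheme => ('g => 'a) => 'g word => 'a" where
  "word_value G f [] = \<one>\<^bsub>G\<^esub>"
| "word_value G f (l # w) = letter_value G f l \<otimes>\<^bsub>G\<^esub> word_value G f w"

context presentation begin

text \<open>Words can be evaluated in any group that satisfies the relations; the evaluation is constant on
  the classes because a single step does not change it.\<close>

lemma universal_property:
  assumes G: "group G" and f: "!!x. x \<in> S ==> f x \<in> carrier G"
    and r: "!!u v. (u, v) \<in> rels ==> word_value G f u = word_value G f v"
  shows "\<exists>\<phi>. \<phi> \<in> hom (presented_group S rels) G \<and> (\<forall>w\<in>W. \<phi> (cls w) = word_value G f w)"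
proof -
  interpret group G by (rule G)
  have l: "letter_value G f l \<in> carrier G" if "l \<in> S \<times> UNIV" for l
    using that f by (cases l) auto
  have c: "word_value G f w \<in> carrier G" if "w \<in> W" for w
    using that l by (induction w) (auto simp: W_def)
  have a: "word_value G f (u @ v) = word_value G f u \<otimes>\<^bsub>G\<^esub> word_value G f v" if "u \<in> W" "v \<in> W" for u v
    using that(1)
  proof (induction u)
    case Nil
    then show ?case using c[OF that(2)] by simp
  next
    case (Cons x u)
    have "x \<in> S \<times> UNIV" "u \<in> W" using Cons.prems by (auto simp: W_def)
    then show ?case using Cons.IH l[of x] c[of u] c[OF that(2)] by (simp add: m_assoc)
  qed
  have a3: "word_value G f (p @ u @ q) = word_value G f p \<otimes>\<^bsub>G\<^esub> (word_value G f u \<otimes>\<^bsub>G\<^esub> word_value G f q)"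
    if "p \<in> W" "u \<in> W" "q \<in> W" for p u q
    using a[OF that(1), of "u @ q"] a[OF that(2,3)] that by (simp add: W_append)
  have st: "word_value G f u = word_value G f v" if "word_step S rels u v" "u \<in> W" for u v
    using that
  proof cases
    case c1: (cancel x p b q)
    have W: "p \<in> W" "[(x, b), (x, \<not> b)] \<in> W" "q \<in> W" using c1 that(2) by (auto simp: W_def)
    have "word_value G f [(x, b), (x, \<not> b)] = \<one>\<^bsub>G\<^esub>" using f[OF c1(3)] by (cases b) simp_all
    then show ?thesis unfolding c1(1,2) a3[OF W] a[OF W(1,3)] using c[OF W(3)] by simp
  next
    case c2: (relation u' v' p q)
    have r': "(u', v') \<in> rels" using c2 by blast
    have W: "p \<in> W" "u' \<in> W" "q \<in> W" using c2 that(2) by (auto simp: W_def)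
    have v': "v' \<in> W" using rels_words[OF r'] by (simp add: W_def)
    show ?thesis using a3[OF W] a3[OF W(1) v' W(3)] r[OF r'] c2 by simp
  qed
  have ev: "w \<in> W \<and> word_value G f w = word_value G f u" if "eqw u w" "u \<in> W" for u w
    using that(1)
  proof (induction rule: equivclp_induct)
    case base
    then show ?case using that(2) by simp
  next
    case (step y z)
    from step(2) show ?case
    proof
      assume s: "word_step S rels y z"
      then show ?thesis using st[OF s] step_W[OF s] step.IH by simp
    next
      assume s: "word_step S rels z y"
      then show ?thesis using st[OF s] step_W[OF s] step.IH by simp
    qed
  qed
  define \<phi> where "\<phi> C = word_value G f (SOME w. w \<in> C)" for C
  have \<phi>: "\<phi> (cls w) = word_value G f w" if "w \<in> W" for w
  proof -
    define v where "v = (SOME v. v \<in> cls w)"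
    have "v \<in> cls w" unfolding v_def by (rule someI, rule cls_self[OF that])
    then have "eqw w v" by (simp add: cls_def)
    then have "word_value G f v = word_value G f w" using ev[OF _ that] by blast
    then show ?thesis by (simp only: \<phi>_def v_def[symmetric])
  qed
  have "\<phi> \<in> hom (presented_group S rels) G"
  proof (rule homI)
    fix C assume "C \<in> carrier (presented_group S rels)"
    then obtain u where u: "C = cls u" "u \<in> W" unfolding presented_group_simps(1) by (rule imageE)
    show "\<phi> C \<in> carrier G" unfolding u(1) \<phi>[OF u(2)] by (rule c[OF u(2)])
    fix D assume "D \<in> carrier (presented_group S rels)"
    then obtain v where v: "D = cls v" "v \<in> W" unfolding presented_group_simps(1) by (rule imageE)
    show "\<phi> (C \<otimes>\<^bsub>presented_group S rels\<^esub> D) = \<phi> C \<otimes>\<^bsub>G\<^esub> \<phi> D"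
      using u v by (simp add: presented_group_simps(3) \<phi> a W_append)
  qed
  then show ?thesis by (intro exI[of _ \<phi>] conjI ballI \<phi>)
qed

end


lemma gens_of_simps [simp]:
  "Bot m \<in> gens_of N \<longleftrightarrow> m \<in> carrier M2" "Lift i \<in> gens_of N \<longleftrightarrow> i < N"
  by (auto simp: gens_of_def)

lemma rels_of_cases:
  assumes "(u, v) \<in> rels_of A"
  obtains (bottom) a b where "a \<in> carrier M2" "b \<in> carrier M2" "u = [(Bot a, True), (Bot b, True)]"
      "v = [(Bot (a \<otimes>\<^bsub>M2\<^esub> b), True)]"
  | (square) i where "i < dim_row (fst A)" "u = [(Lift i, True), (Lift i, True)]" "v = []"
  | (central) i a where "i < dim_row (fst A)" "a \<in> carrier M2" "u = commutator_word (Lift i) (Bot a)" "v = []"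
  | (commutator) i j where "i < dim_row (fst A)" "j < dim_row (fst A)" "u = commutator_word (Lift i) (Lift j)"
      "v = [(Bot (order2_elem (fst A $$ (i, j)) (snd A $$ (i, j))), True)]"
  using assms unfolding rels_of_def Let_def by blast

lemma rels_ofI:
  "a \<in> carrier M2 ==> b \<in> carrier M2 ==> ([(Bot a, True), (Bot b, True)], [(Bot (a \<otimes>\<^bsub>M2\<^esub> b), True)]) \<in> rels_of A"
  "i < dim_row (fst A) ==> ([(Lift i, True), (Lift i, True)], []) \<in> rels_of A"
  "i < dim_row (fst A) ==> a \<in> carrier M2 ==> (commutator_word (Lift i) (Bot a), []) \<in> rels_of A"
  "i < dim_row (fst A) ==> j < dim_row (fst A) ==> (commutator_word (Lift i) (Lift j),
     [(Bot (order2_elem (fst A $$ (i, j)) (snd A $$ (i, j))), True)]) \<in> rels_of A"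
  unfolding rels_of_def Let_def by blast+

context
  fixes N :: nat and A :: "bit mat \<times> bit mat"
  assumes N: "N = dim_row (fst A)"
begin

interpretation p: presentation "gens_of N" "rels_of A"
proof
  fix u v assume "(u, v) \<in> rels_of A"
  then show "u \<in> lists (gens_of N \<times> UNIV) \<and> v \<in> lists (gens_of N \<times> UNIV)"
    by (cases rule: rels_of_cases) (simp_all add: N[symmetric] commutator_word_def order2_elem_carrier)
qed

abbreviation "PG \<equiv> presented_group (gens_of N) (rels_of A)"

definition bot_class :: "complex \<times> complex => gen word set" where
  "bot_class m = p.cls [(Bot m, True)]"

definition lift_class :: "nat => gen word set" where
  "lift_class i = p.cls [(Lift i, True)]"

lemma letter_W:
  "[] \<in> p.W" "m \<in> carrier M2 ==> (Bot m, b) # w \<in> p.W \<longleftrightarrow> w \<in> p.W"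
  "i < N ==> (Lift i, b) # w \<in> p.W \<longleftrightarrow> w \<in> p.W"
  by (simp_all add: p.W_def)

interpretation PG: group PG by (rule p.presented_group_group)

lemma class_closed: "u \<in> p.W ==> p.cls u \<in> carrier PG"
  by (simp add: p.presented_group_simps)

lemma bot_class_mult:
  assumes "a \<in> carrier M2" "b \<in> carrier M2"
  shows "bot_class (a \<otimes>\<^bsub>M2\<^esub> b) = bot_class a \<otimes>\<^bsub>PG\<^esub> bot_class b"
proof -
  have "([(Bot a, True), (Bot b, True)], [(Bot (a \<otimes>\<^bsub>M2\<^esub> b), True)]) \<in> rels_of A"
    by (rule rels_ofI(1)[OF assms])
  from p.cls_relation[OF this] show ?thesis
    using assms by (simp add: bot_class_def p.presented_group_simps letter_W)
qed

lemma commutator_relation: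
  assumes "x \<in> gens_of N" "y \<in> gens_of N" "v \<in> p.W" "(commutator_word x y, v) \<in> rels_of A"
  shows "p.cls [(x, True)] \<otimes>\<^bsub>PG\<^esub> p.cls [(y, True)] = p.cls v \<otimes>\<^bsub>PG\<^esub> (p.cls [(y, True)] \<otimes>\<^bsub>PG\<^esub> p.cls [(x, True)])"
proof -
  have W: "[(x, b)] \<in> p.W" "[(y, b)] \<in> p.W" for b using assms(1,2) by (auto simp: p.W_def)
  let ?x = "p.cls [(x, True)]" and ?y = "p.cls [(y, True)]"
  let ?x' = "p.cls [(x, False)]" and ?y' = "p.cls [(y, False)]"
  have c: "?x \<in> carrier PG" "?y \<in> carrier PG" "?x' \<in> carrier PG" "?y' \<in> carrier PG" "p.cls v \<in> carrier PG"
    using W assms(3) by (simp_all add: class_closed)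
  have inv: "p.cls [(z, False)] \<otimes>\<^bsub>PG\<^esub> p.cls [(z, True)] = \<one>\<^bsub>PG\<^esub>" if "z \<in> gens_of N" for z
  proof -
    have "word_step (gens_of N) (rels_of A) ([] @ [(z, False), (z, \<not> False)] @ []) ([] @ [])"
      by (rule word_step.cancel[OF that])
    then have "p.eqw [(z, False), (z, True)] []" by (intro r_into_equivclp) simp
    moreover have "[(z, b)] \<in> p.W" for b using that by (auto simp: p.W_def)
    ultimately show ?thesis by (simp add: p.presented_group_simps p.cls_eq letter_W(1))
  qed
  have "p.cls v = p.cls (commutator_word x y)" using p.cls_relation[OF assms(4)] by simp
  also have "commutator_word x y = [(x, True)] @ [(y, True)] @ [(x, False)] @ [(y, False)]"
    by (simp add: commutator_word_def)
  also have "p.cls ... = ?x \<otimes>\<^bsub>PG\<^esub> (?y \<otimes>\<^bsub>PG\<^esub> (?x' \<otimes>\<^bsub>PG\<^esub> ?y'))"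
    using W by (simp only: p.presented_group_simps(3) p.W_append simp_thms)
  finally have "p.cls v \<otimes>\<^bsub>PG\<^esub> (?y \<otimes>\<^bsub>PG\<^esub> ?x) = ?x \<otimes>\<^bsub>PG\<^esub> (?y \<otimes>\<^bsub>PG\<^esub> (?x' \<otimes>\<^bsub>PG\<^esub> ((?y' \<otimes>\<^bsub>PG\<^esub> ?y) \<otimes>\<^bsub>PG\<^esub> ?x)))"
    using c by (simp add: PG.m_assoc)
  also have "... = ?x \<otimes>\<^bsub>PG\<^esub> ?y" using inv[OF assms(1)] inv[OF assms(2)] c by simp
  finally show ?thesis by (rule sym)
qed

lemma lift_class_bot:
  assumes "i < N" "m \<in> carrier M2"
  shows "lift_class i \<otimes>\<^bsub>PG\<^esub> bot_class m = bot_class m \<otimes>\<^bsub>PG\<^esub> lift_class i"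
proof -
  have g: "Lift i \<in> gens_of N" "Bot m \<in> gens_of N" using assms by simp_all
  have r: "(commutator_word (Lift i) (Bot m), []) \<in> rels_of A"
    using assms by (intro rels_ofI(3)) (simp_all add: N)
  have "p.cls [] = \<one>\<^bsub>PG\<^esub>" by (simp add: p.presented_group_simps)
  then show ?thesis
    using commutator_relation[OF g letter_W(1) r] assms
    by (simp add: lift_class_def bot_class_def class_closed letter_W)
qed

lemma lift_class_square: "i < N ==> lift_class i \<otimes>\<^bsub>PG\<^esub> lift_class i = \<one>\<^bsub>PG\<^esub>"
proof -
  assume i: "i < N"
  then have "([(Lift i, True), (Lift i, True)], []) \<in> rels_of A" by (intro rels_ofI(2)) (simp add: N)
  from p.cls_relation[OF this] show ?thesis using i
    by (simp add: lift_class_def p.presented_group_simps letter_W)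
qed

lemma inverse_letter:
  assumes "x \<in> gens_of N" shows "p.cls [(x, False)] = inv\<^bsub>PG\<^esub> p.cls [(x, True)]"
proof -
  have "word_step (gens_of N) (rels_of A) ([] @ [(x, False), (x, \<not> False)] @ []) ([] @ [])"
    by (rule word_step.cancel[OF assms])
  then have "p.eqw [(x, False), (x, True)] []" by (intro r_into_equivclp) simp
  moreover have W: "[(x, b)] \<in> p.W" for b using assms by (auto simp: p.W_def)
  ultimately have "p.cls [(x, False)] \<otimes>\<^bsub>PG\<^esub> p.cls [(x, True)] = \<one>\<^bsub>PG\<^esub>"
    by (simp add: p.presented_group_simps p.cls_eq letter_W(1))
  then show ?thesis using PG.inv_equality[OF _ class_closed[OF W] class_closed[OF W]] by simp
qed

lemma class_induct [consumes 1]: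
  assumes "C \<in> carrier PG" "P \<one>\<^bsub>PG\<^esub>"
    and "!!m C. m \<in> carrier M2 ==> C \<in> carrier PG ==> P C ==> P (bot_class m \<otimes>\<^bsub>PG\<^esub> C)"
    and "!!i C. i < N ==> C \<in> carrier PG ==> P C ==> P (lift_class i \<otimes>\<^bsub>PG\<^esub> C)"
  shows "P C"
proof -
  have one: "bot_class \<one>\<^bsub>M2\<^esub> = \<one>\<^bsub>PG\<^esub>"
  proof (rule PG.l_cancel_one'[THEN iffD1])
    show "bot_class \<one>\<^bsub>M2\<^esub> \<in> carrier PG" by (simp add: bot_class_def class_closed letter_W)
    then show "bot_class \<one>\<^bsub>M2\<^esub> \<in> carrier PG" .
    show "bot_class \<one>\<^bsub>M2\<^esub> = bot_class \<one>\<^bsub>M2\<^esub> \<otimes>\<^bsub>PG\<^esub> bot_class \<one>\<^bsub>M2\<^esub>"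
      using bot_class_mult[of "\<one>\<^bsub>M2\<^esub>" "\<one>\<^bsub>M2\<^esub>"] by simp
  qed
  have "P (p.cls w)" if "w \<in> p.W" for w
    using that
  proof (induction w)
    case Nil
    then show ?case using assms(2) by (simp add: p.presented_group_simps)
  next
    case (Cons l w)
    obtain x b where l: "l = (x, b)" by (cases l)
    have x: "x \<in> gens_of N" and w: "w \<in> p.W" using Cons.prems by (auto simp: p.W_def l)
    have lW: "[(x, b)] \<in> p.W" for b using x by (auto simp: p.W_def)
    have IH: "P (p.cls w)" by (rule Cons.IH[OF w])
    have cw: "p.cls w \<in> carrier PG" by (rule class_closed[OF w])
    have e: "p.cls (l # w) = p.cls [(x, b)] \<otimes>\<^bsub>PG\<^esub> p.cls w" using w lW by (simp add: p.presented_group_simps l)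
    consider (bot) m where "m \<in> carrier M2" "x = Bot m" | (lift) i where "i < N" "x = Lift i"
      using x unfolding gens_of_def by blast
    then show ?case
    proof cases
      case bot
      have "\<exists>n\<in>carrier M2. p.cls [(x, b)] = bot_class n"
      proof (cases b)
        case True
        then show ?thesis using bot by (intro bexI[of _ m]) (simp_all add: bot_class_def)
      next
        case False
        have "bot_class (inv\<^bsub>M2\<^esub> m) \<otimes>\<^bsub>PG\<^esub> bot_class m = \<one>\<^bsub>PG\<^esub>"
          using bot_class_mult[of "inv\<^bsub>M2\<^esub> m" m] bot one by simp
        then have "inv\<^bsub>PG\<^esub> bot_class m = bot_class (inv\<^bsub>M2\<^esub> m)"
          using bot by (intro PG.inv_equality) (simp_all add: bot_class_def class_closed letter_W)
        then show ?thesis using False bot inverse_letter[OF x]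
          by (intro bexI[of _ "inv\<^bsub>M2\<^esub> m"]) (simp_all add: bot_class_def)
      qed
      then obtain n where n: "n \<in> carrier M2" "p.cls [(x, b)] = bot_class n" by (rule bexE)
      show ?thesis unfolding e n(2) by (rule assms(3)[OF n(1) cw IH])
    next
      case lift
      have "p.cls [(x, b)] = lift_class i"
      proof (cases b)
        case False
        have "inv\<^bsub>PG\<^esub> lift_class i = lift_class i"
          using lift lift_class_square[of i] by (intro PG.inv_equality) (simp_all add: lift_class_def class_closed letter_W)
        then show ?thesis using False lift inverse_letter[OF x] by (simp add: lift_class_def)
      qed (use lift in \<open>simp add: lift_class_def\<close>)
      then show ?thesis unfolding e using assms(4)[OF lift(1) cw IH] by simp
    qed
  qed
  moreover obtain w where "C = p.cls w" "w \<in> p.W" using assms(1) unfolding p.presented_group_simps(1) by (rule imageE)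
  ultimately show ?thesis by simp
qed

interpretation c: central_M2 PG bot_class
proof
  have bc: "bot_class n \<in> carrier PG" if "n \<in> carrier M2" for n
    using that by (simp add: bot_class_def class_closed letter_W)
  show "bot_class \<in> hom M2 PG" by (rule homI) (rule bc bot_class_mult, assumption+)+
  fix m C assume m: "m \<in> carrier M2" and C: "C \<in> carrier PG"
  have lc: "lift_class i \<in> carrier PG" if "i < N" for i
    using that by (simp add: lift_class_def class_closed letter_W)
  from C show "bot_class m \<otimes>\<^bsub>PG\<^esub> C = C \<otimes>\<^bsub>PG\<^esub> bot_class m"
  proof (induction rule: class_induct)
    case 1
    then show ?case using bc[OF m] by simp
  next
    case (2 n C)
    have "bot_class m \<otimes>\<^bsub>PG\<^esub> (bot_class n \<otimes>\<^bsub>PG\<^esub> C) = (bot_class m \<otimes>\<^bsub>PG\<^esub> bot_class n) \<otimes>\<^bsub>PG\<^esub> C"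
      using bc m 2 by (simp add: PG.m_assoc)
    also have "bot_class m \<otimes>\<^bsub>PG\<^esub> bot_class n = bot_class n \<otimes>\<^bsub>PG\<^esub> bot_class m"
      using 2 m by (simp add: M2.m_comm flip: bot_class_mult)
    also have "bot_class n \<otimes>\<^bsub>PG\<^esub> bot_class m \<otimes>\<^bsub>PG\<^esub> C = bot_class n \<otimes>\<^bsub>PG\<^esub> C \<otimes>\<^bsub>PG\<^esub> bot_class m"
      using bc m 2 by (simp add: PG.m_assoc)
    finally show ?case .
  next
    case (3 i C)
    have "bot_class m \<otimes>\<^bsub>PG\<^esub> (lift_class i \<otimes>\<^bsub>PG\<^esub> C) = (bot_class m \<otimes>\<^bsub>PG\<^esub> lift_class i) \<otimes>\<^bsub>PG\<^esub> C"
      using bc lc m 3 by (simp add: PG.m_assoc)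
    also have "bot_class m \<otimes>\<^bsub>PG\<^esub> lift_class i = lift_class i \<otimes>\<^bsub>PG\<^esub> bot_class m"
      using lift_class_bot[OF 3(1) m] by simp
    also have "lift_class i \<otimes>\<^bsub>PG\<^esub> bot_class m \<otimes>\<^bsub>PG\<^esub> C = lift_class i \<otimes>\<^bsub>PG\<^esub> C \<otimes>\<^bsub>PG\<^esub> bot_class m"
      using bc lc m 3 by (simp add: PG.m_assoc)
    finally show ?case .
  qed
qed

text \<open>Multiplying by a generator on the left keeps the form "bottom element times ordered product of
  lifts".\<close>

lemma normal_form:
  assumes "C \<in> carrier PG"
  shows "\<exists>x\<in>vecs N. c.eqv C (hprod PG (map lift_class [0..<N]) x)"
  using assms
proof (induction rule: class_induct)
  let ?hs = "map lift_class [0..<N]"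
  have lc: "lift_class i \<in> carrier PG" if "i < N" for i
    using that by (simp add: lift_class_def class_closed letter_W)
  have hs: "set ?hs \<subseteq> carrier PG" using lc by auto
  have P: "hprod PG ?hs x \<in> carrier PG" for x by (rule c.hprod_closed[OF hs])
  case 1
  show ?case by (rule bexI[of _ 0]) (simp_all add: hprod_0 c.eqv_refl subgrpD(1)[OF subgrp_vecs])
  {
    case (2 m C)
    then obtain x where x: "x \<in> vecs N" "c.eqv C (hprod PG ?hs x)" by blast
    have "c.eqv (bot_class m \<otimes>\<^bsub>PG\<^esub> C) (hprod PG ?hs x)"
      by (rule c.eqv_trans[OF c.eqv_iota x(2) P]) (use 2 in simp_all)
    with x(1) show ?case by (intro bexI[of _ x])
  next
    case (3 i C)
    then obtain x where x: "x \<in> vecs N" "c.eqv C (hprod PG ?hs x)" by blast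
    have comm: "c.eqv (h \<otimes>\<^bsub>PG\<^esub> k) (k \<otimes>\<^bsub>PG\<^esub> h)" if hk: "h \<in> set ?hs" "k \<in> set ?hs" for h k
    proof -
      obtain i j where ij: "i < N" "j < N" "h = lift_class i" "k = lift_class j" using hk by auto
      let ?o = "order2_elem (fst A $$ (i, j)) (snd A $$ (i, j))"
      have "(commutator_word (Lift i) (Lift j), [(Bot ?o, True)]) \<in> rels_of A"
        using ij by (intro rels_ofI(4)) (simp_all add: N)
      moreover have "Lift i \<in> gens_of N" "Lift j \<in> gens_of N" using ij by simp_all
      moreover have "[(Bot ?o, True)] \<in> p.W" by (simp add: letter_W order2_elem_carrier)
      ultimately show ?thesis unfolding ij(3,4)
        using commutator_relation[of "Lift i" "Lift j" "[(Bot ?o, True)]"]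
        by (intro c.eqvI[of ?o]) (simp_all add: order2_elem_carrier lift_class_def bot_class_def)
    qed
    have sq: "c.eqv (h \<otimes>\<^bsub>PG\<^esub> h) \<one>\<^bsub>PG\<^esub>" if h: "h \<in> set ?hs" for h
    proof -
      obtain i where i: "i < N" "h = lift_class i" using h by auto
      then show ?thesis by (simp add: lift_class_square c.eqv_refl)
    qed
    have "c.eqv (?hs ! i \<otimes>\<^bsub>PG\<^esub> hprod PG ?hs x) (hprod PG ?hs (x + monom 1 i))"
      by (rule c.hprod_mult_generator[OF hs comm sq]) (use 3 in simp_all)
    then have 1: "c.eqv (lift_class i \<otimes>\<^bsub>PG\<^esub> hprod PG ?hs x) (hprod PG ?hs (x + monom 1 i))" using 3 by simp
    have "c.eqv (lift_class i \<otimes>\<^bsub>PG\<^esub> C) (lift_class i \<otimes>\<^bsub>PG\<^esub> hprod PG ?hs x)"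
      by (rule c.eqv_mult[OF c.eqv_refl x(2)]) (use lc 3 P in simp_all)
    then have "c.eqv (lift_class i \<otimes>\<^bsub>PG\<^esub> C) (hprod PG ?hs (x + monom 1 i))" by (rule c.eqv_trans[OF _ 1 P])
    moreover have "x + monom 1 i \<in> vecs N" using x(1) 3 by (auto simp: vecs_def)
    ultimately show ?case by (intro bexI[of _ "x + monom 1 i"])
  }
qed

text \<open>The evaluation is onto since \<open>G\<close> is generated by the bottom and the lifts, and it is
  injective on normal forms because these are unique in \<open>G\<close>.\<close>

lemma iso_if_central_lifts:
  assumes "central_lifts G \<iota> hs A" "length hs = N"
  shows "group_of_pair A \<cong> G"
proof -
  interpret g: central_lifts G \<iota> hs A by (rule assms(1))
  define f where "f x = (case x of Bot m => \<iota> m | Lift i => hs ! i)" for x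
  have f: "f x \<in> carrier G" if "x \<in> gens_of N" for x
    using that g.lifts assms(2) by (auto simp: gens_of_def f_def)
  have comm: "word_value G f (commutator_word x y) = z"
    if "x \<in> gens_of N" "y \<in> gens_of N" "z \<in> carrier G" "f x \<otimes>\<^bsub>G\<^esub> f y = z \<otimes>\<^bsub>G\<^esub> (f y \<otimes>\<^bsub>G\<^esub> f x)" for x y z
  proof -
    have X: "f x \<in> carrier G" and Y: "f y \<in> carrier G" using f that(1,2) by simp_all
    have "word_value G f (commutator_word x y) = (f x \<otimes>\<^bsub>G\<^esub> f y) \<otimes>\<^bsub>G\<^esub> (inv\<^bsub>G\<^esub> f x \<otimes>\<^bsub>G\<^esub> inv\<^bsub>G\<^esub> f y)"
      using X Y by (simp add: commutator_word_def g.m_assoc)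
    also have "... = (z \<otimes>\<^bsub>G\<^esub> (f y \<otimes>\<^bsub>G\<^esub> f x)) \<otimes>\<^bsub>G\<^esub> inv\<^bsub>G\<^esub> (f y \<otimes>\<^bsub>G\<^esub> f x)"
      unfolding that(4) g.inv_mult_group[OF Y X] ..
    also have "... = z \<otimes>\<^bsub>G\<^esub> ((f y \<otimes>\<^bsub>G\<^esub> f x) \<otimes>\<^bsub>G\<^esub> inv\<^bsub>G\<^esub> (f y \<otimes>\<^bsub>G\<^esub> f x))"
      using X Y that(3) by (intro g.m_assoc) simp_all
    also have "... = z" unfolding g.r_inv[OF g.m_closed[OF Y X]] using that(3) by simp
    finally show ?thesis .
  qed
  have r: "word_value G f u = word_value G f v" if "(u, v) \<in> rels_of A" for u v
  proof -
    from that show ?thesis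
    proof (cases rule: rels_of_cases)
      case 1: (bottom a b)
      then show ?thesis by (simp add: f_def g.iota_mult)
    next
      case 2: (square i)
      have "hs ! i \<in> set hs" using 2(1) assms(2) by (simp add: N)
      then show ?thesis using 2 g.square[of "hs ! i"] g.lifts by (auto simp: f_def)
    next
      case 3: (central i a)
      have g': "Lift i \<in> gens_of N" "Bot a \<in> gens_of N" using 3 by (simp_all add: N)
      have "f (Lift i) \<otimes>\<^bsub>G\<^esub> f (Bot a) = \<one>\<^bsub>G\<^esub> \<otimes>\<^bsub>G\<^esub> (f (Bot a) \<otimes>\<^bsub>G\<^esub> f (Lift i))"
        using g.central[of a "f (Lift i)"] f[OF g'(1)] f[OF g'(2)] 3(2) by (simp add: f_def)
      then show ?thesis unfolding 3(3,4) by (simp add: comm[OF g'])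
    next
      case 4: (commutator i j)
      have g': "Lift i \<in> gens_of N" "Lift j \<in> gens_of N" using 4 by (simp_all add: N)
      let ?o = "order2_elem (fst A $$ (i, j)) (snd A $$ (i, j))"
      have "f (Lift i) \<otimes>\<^bsub>G\<^esub> f (Lift j) = \<iota> ?o \<otimes>\<^bsub>G\<^esub> (f (Lift j) \<otimes>\<^bsub>G\<^esub> f (Lift i))"
        using g.commutators[of i j] 4(1,2) assms(2) by (simp add: N f_def g.commutes_up_to_def)
      then show ?thesis unfolding 4(3,4) using comm[OF g'] by (simp add: f_def order2_elem_carrier)
    qed
  qed
  have "\<exists>\<phi>. \<phi> \<in> hom PG G \<and> (\<forall>w\<in>p.W. \<phi> (p.cls w) = word_value G f w)"
    by (rule p.universal_property[OF g.is_group]) (rule f r, assumption)+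
  then obtain \<phi> where \<phi>: "\<phi> \<in> hom PG G" "\<forall>w\<in>p.W. \<phi> (p.cls w) = word_value G f w"
    by (elim exE conjE)
  let ?hs = "map lift_class [0..<N]"
  have \<phi>b: "\<phi> (bot_class m) = \<iota> m" if "m \<in> carrier M2" for m
    using \<phi>(2) that by (simp add: bot_class_def letter_W f_def)
  have \<phi>l: "\<phi> (lift_class i) = hs ! i" if "i < N" for i
  proof -
    have "hs ! i \<in> carrier G" using that assms(2) g.lifts by auto
    then show ?thesis using \<phi>(2) that by (simp add: lift_class_def letter_W f_def)
  qed
  have lc: "lift_class i \<in> carrier PG" if "i < N" for i
    using that by (simp add: lift_class_def class_closed letter_W)
  have hs: "set ?hs \<subseteq> carrier PG" using lc by auto
  have P: "hprod PG ?hs x \<in> carrier PG" for x by (rule c.hprod_closed[OF hs])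
  have "map \<phi> ?hs = hs" using \<phi>l assms(2) by (intro nth_equalityI) simp_all
  then have \<phi>P: "\<phi> (hprod PG ?hs x) = hprod G hs x" for x
    using hprod_hom[OF \<phi>(1) PG.is_group g.is_group hs, of x] by simp
  have nf: "\<exists>m\<in>carrier M2. \<exists>x\<in>vecs N. C = bot_class m \<otimes>\<^bsub>PG\<^esub> hprod PG ?hs x" if "C \<in> carrier PG" for C
    using normal_form[OF that] by (auto simp: c.eqv_def)
  have \<phi>nf: "\<phi> (bot_class m \<otimes>\<^bsub>PG\<^esub> hprod PG ?hs x) = \<iota> m \<otimes>\<^bsub>G\<^esub> hprod G hs x" if "m \<in> carrier M2" for m x
    using hom_mult[OF \<phi>(1) c.iota_closed[OF that] P] by (simp add: \<phi>b[OF that] \<phi>P)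
  have "inj_on \<phi> (carrier PG)"
  proof (rule inj_onI)
    fix C D assume C: "C \<in> carrier PG" and D: "D \<in> carrier PG" and e: "\<phi> C = \<phi> D"
    obtain m x where m: "m \<in> carrier M2" "x \<in> vecs N" "C = bot_class m \<otimes>\<^bsub>PG\<^esub> hprod PG ?hs x"
      using nf[OF C] by (elim bexE)
    obtain n y where n: "n \<in> carrier M2" "y \<in> vecs N" "D = bot_class n \<otimes>\<^bsub>PG\<^esub> hprod PG ?hs y"
      using nf[OF D] by (elim bexE)
    have e': "\<iota> m \<otimes>\<^bsub>G\<^esub> hprod G hs x = \<iota> n \<otimes>\<^bsub>G\<^esub> hprod G hs y"
      using e unfolding m(3) n(3) \<phi>nf[OF m(1)] \<phi>nf[OF n(1)] .
    have "g.eqv (hprod G hs x) (\<iota> m \<otimes>\<^bsub>G\<^esub> hprod G hs x)" using m(1) by (intro g.eqv_sym[OF g.eqv_iota]) simp_all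
    moreover have "g.eqv (\<iota> m \<otimes>\<^bsub>G\<^esub> hprod G hs x) (hprod G hs y)"
      unfolding e' using n(1) by (intro g.eqv_iota) simp_all
    ultimately have "g.eqv (hprod G hs x) (hprod G hs y)" by (rule g.eqv_trans) simp
    then have xy: "x = y" using m(2) n(2) assms(2) by (intro g.eqv_hprod_unique) simp_all
    have "\<iota> m = \<iota> n" using e' unfolding xy by (rule g.r_cancel) (use m(1) n(1) in simp_all)
    then have "m = n" by (rule inj_onD[OF g.iota_inj _ m(1) n(1)])
    then show "C = D" by (simp add: m(3) n(3) xy)
  qed
  moreover have "\<phi> ` carrier PG = carrier G"
  proof (rule antisym)
    show "\<phi> ` carrier PG \<subseteq> carrier G" using \<phi>(1) by (auto simp: hom_def)
    show "carrier G \<subseteq> \<phi> ` carrier PG"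
    proof
      fix a assume "a \<in> carrier G"
      then obtain x where x: "x \<in> vecs (length hs)" "g.eqv a (hprod G hs x)" using g.span by blast
      obtain m where m: "m \<in> carrier M2" "a = \<iota> m \<otimes>\<^bsub>G\<^esub> hprod G hs x" using x(2) by (rule g.eqvE)
      show "a \<in> \<phi> ` carrier PG"
        unfolding m(2) \<phi>nf[OF m(1), symmetric] using m(1) P by (intro imageI PG.m_closed c.iota_closed)
    qed
  qed
  ultimately have "\<phi> \<in> iso PG G" using \<phi>(1) by (simp add: iso_def bij_betw_def)
  then show ?thesis by (auto simp: is_iso_def group_of_pair_def N[symmetric])
qed

lemma group_group_of_pair: "group (group_of_pair A)"
  using p.presented_group_group by (simp add: group_of_pair_def N[symmetric])

end


section \<open>A concrete model of \<open>G(A)\<close>\<close>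

text \<open>The lower triangular part of \<open>B\<close>: a bilinear form whose antisymmetrization is the
  alternating form of \<open>B\<close>, and which vanishes on pairs of equal unit vectors.\<close>

definition cocycle :: "nat => bit mat => bit poly => bit poly => bit" where
  "cocycle n B x y = (\<Sum>i<n. \<Sum>j<i. coeff x i * coeff y j * B $$ (i, j))"

lemma cocycle_add:
  "cocycle n B (x + x') y = cocycle n B x y + cocycle n B x' y"
  "cocycle n B x (y + y') = cocycle n B x y + cocycle n B x y'"
  by (simp_all add: cocycle_def algebra_simps sum.distrib)

lemma cocycle_0 [simp]: "cocycle n B 0 y = 0" "cocycle n B x 0 = 0"
  by (simp_all add: cocycle_def)

lemma cocycle_monom:
  assumes "k < n"
  shows "cocycle n B (monom 1 k) (monom 1 l) = (if l < k then B $$ (k, l) else 0)"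
proof -
  have "(\<Sum>j<i. coeff (monom 1 k) i * coeff (monom 1 l) j * B $$ (i, j)) = (if i = k then if l < k then B $$ (k, l) else 0 else 0)" for i
  proof (cases "i = k")
    case True
    have "(\<Sum>j<i. coeff (monom 1 k) i * coeff (monom 1 l) j * B $$ (i, j)) = (\<Sum>j<i. if j = l then B $$ (k, l) else 0)"
      using True by (intro sum.cong) auto
    then show ?thesis using True by simp
  qed simp
  then show ?thesis using assms by (simp add: cocycle_def)
qed

text \<open>The central extension of \<open>F\<^sub>2\<^sup>N\<close> by
  \<open>M\<^sup>(\<^sup>2\<^sup>)\<close> with this cocycle. It shows that the presentation does
  not collapse.\<close>

definition model :: "nat => bit mat \<times> bit mat => ((complex \<times> complex) \<times> bit poly) monoid" where
  "model N A = \<lparr>carrier = carrier M2 \<times> vecs N,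
     Group.monoid.mult = (\<lambda>(m, x) (n, y). (m \<otimes>\<^bsub>M2\<^esub> n \<otimes>\<^bsub>M2\<^esub>
        order2_elem (cocycle N (fst A) x y) (cocycle N (snd A) x y), x + y)),
     one = (\<one>\<^bsub>M2\<^esub>, 0)\<rparr>"

definition alternating_mat :: "nat => bit mat => bool" where
  "alternating_mat n B \<longleftrightarrow> (\<forall>i<n. B $$ (i, i) = 0) \<and> (\<forall>i<n. \<forall>j<n. B $$ (i, j) = B $$ (j, i))"

definition unit_basis :: "nat => bit poly list" where
  "unit_basis n = map (monom 1) [0..<n]"

lemma comb_unit_basis:
  assumes "x \<in> vecs n" shows "comb (unit_basis n) x = x"
proof -
  have "comb (unit_basis n) x = (\<Sum>i<n. monom (coeff x i) i)"
    unfolding comb_def unit_basis_def by (intro sum.cong) (simp_all add: scl_def)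
  also have "... = x"
  proof (rule poly_eqI)
    fix j
    have "coeff (\<Sum>i<n. monom (coeff x i) i) j = (\<Sum>i<n. if i = j then coeff x j else 0)"
      unfolding coeff_sum by (intro sum.cong) auto
    then show "coeff (\<Sum>i<n. monom (coeff x i) i) j = coeff x j" using assms by (auto simp: vecs_def)
  qed
  finally show ?thesis .
qed

lemma basis_unit_basis: "basis (unit_basis n) (vecs n)"
proof -
  have l: "length (unit_basis n) = n" by (simp add: unit_basis_def)
  have "bij_betw (comb (unit_basis n)) (vecs n) (vecs n) \<longleftrightarrow> bij_betw (\<lambda>x. x) (vecs n) (vecs n)"
    by (intro bij_betw_cong comb_unit_basis)
  then show ?thesis unfolding basis_def l by (simp add: bij_betw_def)
qed

lemma gram_unit_basis:
  assumes "B \<in> carrier_mat n n" shows "gram (matrix_form n B) (unit_basis n) = B"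
  using assms by (intro eq_matI) (simp_all add: gram_def unit_basis_def matrix_form_monom)

context
  fixes N :: nat and A :: "bit mat \<times> bit mat"
  assumes alt: "alternating_mat N (fst A)" "alternating_mat N (snd A)"
begin

abbreviation "E \<equiv> model N A"

definition coc :: "bit poly => bit poly => complex \<times> complex" where
  "coc x y = order2_elem (cocycle N (fst A) x y) (cocycle N (snd A) x y)"

lemma coc_simps:
  "coc x y \<in> carrier M2" "coc (x + x') y = coc x y \<otimes>\<^bsub>M2\<^esub> coc x' y" "coc x (y + y') = coc x y \<otimes>\<^bsub>M2\<^esub> coc x y'"
  "coc 0 y = \<one>\<^bsub>M2\<^esub>" "coc x 0 = \<one>\<^bsub>M2\<^esub>" "coc x y \<otimes>\<^bsub>M2\<^esub> coc x y = \<one>\<^bsub>M2\<^esub>"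
  by (simp_all add: coc_def order2_elem_carrier order2_elem_add cocycle_add order2_elem_0)

lemma model_simps:
  "carrier E = carrier M2 \<times> vecs N" "\<one>\<^bsub>E\<^esub> = (\<one>\<^bsub>M2\<^esub>, 0)"
  "(m, x) \<otimes>\<^bsub>E\<^esub> (n, y) = (m \<otimes>\<^bsub>M2\<^esub> n \<otimes>\<^bsub>M2\<^esub> coc x y, x + y)"
  by (simp_all add: model_def coc_def)

lemma model_group: "group E"
proof (rule groupI)
  note v = subgrpD[OF subgrp_vecs[of N]]
  show "\<one>\<^bsub>E\<^esub> \<in> carrier E" using v by (simp add: model_simps)
  fix a assume "a \<in> carrier E"
  then obtain m x where a: "a = (m, x)" "m \<in> carrier M2" "x \<in> vecs N" by (auto simp: model_simps)
  show "\<one>\<^bsub>E\<^esub> \<otimes>\<^bsub>E\<^esub> a = a" using a by (simp add: model_simps coc_simps)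
  have swap: "u \<otimes>\<^bsub>M2\<^esub> v \<otimes>\<^bsub>M2\<^esub> w \<otimes>\<^bsub>M2\<^esub> v = (u \<otimes>\<^bsub>M2\<^esub> w) \<otimes>\<^bsub>M2\<^esub> (v \<otimes>\<^bsub>M2\<^esub> v)"
    if "u \<in> carrier M2" "v \<in> carrier M2" "w \<in> carrier M2" for u v w
    using that by (simp add: M2.m_ac)
  show "\<exists>b\<in>carrier E. b \<otimes>\<^bsub>E\<^esub> a = \<one>\<^bsub>E\<^esub>"
  proof (rule bexI[of _ "(inv\<^bsub>M2\<^esub> m \<otimes>\<^bsub>M2\<^esub> coc x x, x)"])
    have "inv\<^bsub>M2\<^esub> m \<otimes>\<^bsub>M2\<^esub> coc x x \<otimes>\<^bsub>M2\<^esub> m \<otimes>\<^bsub>M2\<^esub> coc x x = (inv\<^bsub>M2\<^esub> m \<otimes>\<^bsub>M2\<^esub> m) \<otimes>\<^bsub>M2\<^esub> (coc x x \<otimes>\<^bsub>M2\<^esub> coc x x)"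
      by (rule swap) (use a(2) coc_simps(1)[of x x] in simp_all)
    also have "... = \<one>\<^bsub>M2\<^esub>" using a(2) by (simp add: coc_simps(6))
    finally show "(inv\<^bsub>M2\<^esub> m \<otimes>\<^bsub>M2\<^esub> coc x x, x) \<otimes>\<^bsub>E\<^esub> a = \<one>\<^bsub>E\<^esub>" by (simp add: a model_simps)
    show "(inv\<^bsub>M2\<^esub> m \<otimes>\<^bsub>M2\<^esub> coc x x, x) \<in> carrier E" using a by (simp add: model_simps coc_simps)
  qed
  fix b assume "b \<in> carrier E"
  then obtain n y where b: "b = (n, y)" "n \<in> carrier M2" "y \<in> vecs N" by (auto simp: model_simps)
  show "a \<otimes>\<^bsub>E\<^esub> b \<in> carrier E" using a b v by (simp add: model_simps coc_simps)
  fix c assume "c \<in> carrier E"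
  then obtain k z where c: "c = (k, z)" "k \<in> carrier M2" "z \<in> vecs N" by (auto simp: model_simps)
  show "a \<otimes>\<^bsub>E\<^esub> b \<otimes>\<^bsub>E\<^esub> c = a \<otimes>\<^bsub>E\<^esub> (b \<otimes>\<^bsub>E\<^esub> c)"
    using a(2) b(2) c(2) by (simp add: a(1) b(1) c(1) model_simps coc_simps M2.m_ac add.assoc)
qed

lemma model_central_lifts:
  "central_lifts E (\<lambda>m. (m, 0)) (map (\<lambda>i. (\<one>\<^bsub>M2\<^esub>, monom 1 i)) [0..<N]) A"
proof -
  note v = subgrpD[OF subgrp_vecs[of N]]
  let ?hs = "map (\<lambda>i. (\<one>\<^bsub>M2\<^esub>, monom (1 :: bit) i)) [0..<N]"
  interpret E: group E by (rule model_group)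
  interpret c: central_M2 E "\<lambda>m. (m, 0)"
  proof
    show "(\<lambda>m. (m, 0)) \<in> hom M2 E" using v by (intro homI) (simp_all add: model_simps coc_simps)
    show "(m, 0) \<otimes>\<^bsub>E\<^esub> a = a \<otimes>\<^bsub>E\<^esub> (m, 0)" if "m \<in> carrier M2" "a \<in> carrier E" for m a
      using that by (cases a) (simp add: model_simps coc_simps M2.m_comm)
  qed
  \<comment> \<open>In this group it rewrites \<open>\<one>\<close> in a circle with the description of the unit.\<close>
  note c.iota_one [simp del]
  have eqv: "c.eqv (m, x) (n, y) \<longleftrightarrow> x = y" if "m \<in> carrier M2" "n \<in> carrier M2" for m x n y
  proof
    assume "c.eqv (m, x) (n, y)"
    then show "x = y" by (rule c.eqvE) (simp add: model_simps)
  next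
    assume "x = y"
    then show "c.eqv (m, x) (n, y)" using that
      by (intro c.eqvI[of "m \<otimes>\<^bsub>M2\<^esub> inv\<^bsub>M2\<^esub> n"]) (simp_all add: model_simps coc_simps M2.m_assoc)
  qed
  have m: "monom 1 i \<in> vecs N" if "i < N" for i using that by (simp add: vecs_def)
  have hs: "set ?hs \<subseteq> carrier E"
  proof (rule subsetI)
    fix h assume "h \<in> set ?hs"
    then obtain i where "i < N" "h = (\<one>\<^bsub>M2\<^esub>, monom 1 i)" by auto
    then show "h \<in> carrier E" by (simp add: model_simps m)
  qed
  have snd: "snd (hprod E hs x) = comb (map snd hs) x" if "set hs \<subseteq> carrier E" for hs x
    using that
  proof (induction hs arbitrary: x)
    case Nil
    then show ?case by (simp add: model_simps)
  next
    case (Cons h hs)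
    obtain b y where x: "x = pCons b y" by (rule pCons_cases_bit)
    have "snd (h \<otimes>\<^bsub>E\<^esub> hprod E hs y) = snd h + snd (hprod E hs y)"
      by (cases h; cases "hprod E hs y") (simp add: model_simps)
    moreover have "snd (hprod E hs y) = comb (map snd hs) y" using Cons.prems by (intro Cons.IH) simp
    ultimately show ?case by (cases "b = 0") (simp_all add: x hprod_pCons comb_pCons scl_def del: hprod.simps)
  qed
  have "map snd ?hs = unit_basis N" by (simp add: unit_basis_def)
  then have snd': "snd (hprod E ?hs x) = x" if "x \<in> vecs N" for x
    using snd[OF hs] comb_unit_basis[OF that] by simp
  have P: "\<exists>n\<in>carrier M2. hprod E ?hs x = (n, x)" if "x \<in> vecs N" for x
    using snd'[OF that] c.hprod_closed[OF hs, of x] by (cases "hprod E ?hs x") (simp add: model_simps)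
  show ?thesis
  proof
    show "set ?hs \<subseteq> carrier E" by (rule hs)
    show "h \<otimes>\<^bsub>E\<^esub> h = \<one>\<^bsub>E\<^esub>" if "h \<in> set ?hs" for h
    proof -
      from that obtain i where i: "i < N" "h = (\<one>\<^bsub>M2\<^esub>, monom 1 i)" by auto
      have "coc (monom 1 i) (monom 1 i) = \<one>\<^bsub>M2\<^esub>" using i(1) by (simp add: coc_def cocycle_monom order2_elem_0)
      then show ?thesis by (simp add: i model_simps)
    qed
    show "c.commutes_up_to (?hs ! i) (?hs ! j) (order2_elem (fst A $$ (i, j)) (snd A $$ (i, j)))"
      if ij: "i < length ?hs" "j < length ?hs" for i j
    proof -
      have lt: "i < N" "j < N" using ij by simp_all
      have sym: "B $$ (i, j) = B $$ (j, i)" "i = j ==> B $$ (i, j) = 0" if "alternating_mat N B" for B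
        using that lt by (auto simp: alternating_mat_def)
      have "cocycle N B (monom 1 i) (monom 1 j) = B $$ (i, j) + cocycle N B (monom 1 j) (monom 1 i)"
        if B: "alternating_mat N B" for B
        using sym[OF B] lt by (cases i j rule: linorder_cases) (simp_all add: cocycle_monom)
      then have "coc (monom 1 i) (monom 1 j) = order2_elem (fst A $$ (i, j)) (snd A $$ (i, j)) \<otimes>\<^bsub>M2\<^esub> coc (monom 1 j) (monom 1 i)"
        by (simp add: coc_def order2_elem_add alt)
      then show ?thesis using lt
        by (simp add: c.commutes_up_to_def model_simps coc_simps order2_elem_carrier add.commute)
    qed
    show "inj_on (\<lambda>m. (m, 0)) (carrier M2)" by (simp add: inj_on_def)
    show "\<exists>x\<in>vecs (length ?hs). c.eqv a (hprod E ?hs x)" if "a \<in> carrier E" for a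
    proof -
      from that obtain m x where a: "a = (m, x)" "m \<in> carrier M2" "x \<in> vecs N" by (auto simp: model_simps)
      obtain n where "n \<in> carrier M2" "hprod E ?hs x = (n, x)" using P[OF a(3)] by (rule bexE)
      then show ?thesis using a by (intro bexI[of _ x]) (simp_all add: eqv)
    qed
    show "x = 0" if x: "x \<in> vecs (length ?hs)" "c.eqv (hprod E ?hs x) \<one>\<^bsub>E\<^esub>" for x
    proof -
      have "x \<in> vecs N" using x(1) by simp
      then obtain n where "n \<in> carrier M2" "hprod E ?hs x = (n, x)" using P by blast
      then show ?thesis using x(2) by (simp add: model_simps eqv)
    qed
  qed
qed

end

lemma off_diag_index:
  assumes "i < dim_row B + dim_col B" "j < dim_row B + dim_col B"
  shows "off_diag B $$ (i, j) = (if i < dim_row B \<and> dim_row B \<le> j then B $$ (i, j - dim_row B)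
    else if dim_row B \<le> i \<and> j < dim_row B then B $$ (j, i - dim_row B) else 0)"
  using assms by (auto simp: off_diag_def)

lemma alternating_off_diag: "alternating_mat (dim_row (off_diag B)) (off_diag B)"
proof -
  have "dim_row (off_diag B) = dim_row B + dim_col B" by (simp add: off_diag_def)
  then show ?thesis by (auto simp: alternating_mat_def off_diag_index)
qed

lemma alternating_diag_block_mat:
  assumes "!!B. B \<in> set Bs ==> alternating_mat (dim_row B) B \<and> dim_col B = dim_row B"
  shows "alternating_mat (dim_row (diag_block_mat Bs)) (diag_block_mat Bs) \<and>
    dim_col (diag_block_mat Bs) = dim_row (diag_block_mat Bs)"
  using assms
proof (induction Bs)
  case Nil
  then show ?case by (simp add: alternating_mat_def)
next
  case (Cons B Bs)
  have IH: "alternating_mat (dim_row (diag_block_mat Bs)) (diag_block_mat Bs)" "dim_col (diag_block_mat Bs) = dim_row (diag_block_mat Bs)"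
    using Cons by auto
  have B: "alternating_mat (dim_row B) B" "dim_col B = dim_row B" using Cons.prems by auto
  let ?D = "diag_block_mat Bs" and ?E = "diag_block_mat (B # Bs)"
  have dim: "dim_row ?E = dim_row B + dim_row ?D" "dim_col ?E = dim_row B + dim_row ?D"
    using IH(2) B(2) by (simp_all add: Let_def)
  have e: "?E $$ (i, j) = (if i < dim_row B then if j < dim_row B then B $$ (i, j) else 0
      else if j < dim_row B then 0 else ?D $$ (i - dim_row B, j - dim_row B))"
    if "i < dim_row B + dim_row ?D" "j < dim_row B + dim_row ?D" for i j
    using that IH(2) B(2) by (simp add: Let_def)
  have "?E $$ (i, j) = ?E $$ (j, i) \<and> ?E $$ (i, i) = 0"
    if ij: "i < dim_row B + dim_row ?D" "j < dim_row B + dim_row ?D" for i j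
    unfolding e[OF ij] e[OF ij(2,1)] e[OF ij(1,1)] using IH(1) B(1) ij
    by (cases "i < dim_row B"; cases "j < dim_row B") (simp_all add: alternating_mat_def)
  then show ?case unfolding alternating_mat_def dim by blast
qed


context central_lifts begin

section \<open>Comparison of two embeddings of the bottom\<close>

text \<open>A square lies in the bottom, and every element of the bottom is a fourth power. So the image of
  the embedding is an invariant of \<open>G\<close>.\<close>

lemma iota_image_fourth_powers:
  "\<iota> ` carrier M2 = (\<lambda>g. (g \<otimes> g) \<otimes> (g \<otimes> g)) ` carrier G"
proof (rule antisym)
  show "\<iota> ` carrier M2 \<subseteq> (\<lambda>g. (g \<otimes> g) \<otimes> (g \<otimes> g)) ` carrier G"
  proof (rule image_subsetI)
    fix m assume m: "m \<in> carrier M2"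
    obtain n where n: "n \<in> carrier M2" "n \<otimes>\<^bsub>M2\<^esub> n = m" using M2_sqrt[OF m] by (rule bexE)
    obtain k where k: "k \<in> carrier M2" "k \<otimes>\<^bsub>M2\<^esub> k = n" using M2_sqrt[OF n(1)] by (rule bexE)
    have "\<iota> m = (\<iota> k \<otimes> \<iota> k) \<otimes> (\<iota> k \<otimes> \<iota> k)"
      using iota_mult[OF k(1) k(1)] iota_mult[OF n(1) n(1)] by (simp add: k n)
    then show "\<iota> m \<in> (\<lambda>g. (g \<otimes> g) \<otimes> (g \<otimes> g)) ` carrier G" by (rule image_eqI) (simp add: k)
  qed
  show "(\<lambda>g. (g \<otimes> g) \<otimes> (g \<otimes> g)) ` carrier G \<subseteq> \<iota> ` carrier M2"
  proof (rule image_subsetI)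
    fix g assume g: "g \<in> carrier G"
    obtain x where x: "x \<in> vecs (length hs)" "eqv g (hprod G hs x)" using span[OF g] by (rule bexE)
    have "eqv (g \<otimes> g) (hprod G hs x \<otimes> hprod G hs x)" by (rule eqv_mult[OF x(2) x(2)]) simp_all
    moreover have "eqv (hprod G hs x \<otimes> hprod G hs x) \<one>"
      using hprod_add[OF elementary_hs x(1), of x] by (simp add: hprod_0)
    ultimately have "eqv (g \<otimes> g) \<one>" by (rule eqv_trans) simp
    then obtain c where c: "c \<in> carrier M2" "g \<otimes> g = \<iota> c \<otimes> \<one>" by (rule eqvE)
    have "(g \<otimes> g) \<otimes> (g \<otimes> g) = \<iota> (c \<otimes>\<^bsub>M2\<^esub> c)" unfolding c(2) using c(1) by (simp add: iota_mult)
    then show "(g \<otimes> g) \<otimes> (g \<otimes> g) \<in> \<iota> ` carrier M2" using c(1) by simp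
  qed
qed

text \<open>Two embeddings with the same image differ by an automorphism of
  \<open>M\<^sup>(\<^sup>2\<^sup>)\<close>, which acts linearly on the elements of order two.\<close>

lemma iota_transition:
  assumes "central_lifts G \<iota>' hs' A'"
  shows "\<exists>p q r s. \<forall>a b. \<iota>' (order2_elem a b) = \<iota> (order2_elem (p * a + r * b) (q * a + s * b))"
proof -
  interpret c': central_lifts G \<iota>' hs' A' by (rule assms)
  have im: "\<iota>' ` carrier M2 = \<iota> ` carrier M2"
    unfolding iota_image_fourth_powers c'.iota_image_fourth_powers ..
  have ex: "\<exists>c d. \<iota>' (order2_elem a b) = \<iota> (order2_elem c d)" for a b
  proof -
    have "\<iota>' (order2_elem a b) \<in> \<iota> ` carrier M2" unfolding im[symmetric] by (intro imageI order2_elem_carrier)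
    then obtain m where m: "\<iota>' (order2_elem a b) = \<iota> m" "m \<in> carrier M2" by (rule imageE)
    have "\<iota> (m \<otimes>\<^bsub>M2\<^esub> m) = \<iota>' (order2_elem a b \<otimes>\<^bsub>M2\<^esub> order2_elem a b)"
      by (simp add: iota_mult c'.iota_mult m order2_elem_carrier)
    also have "... = \<iota> \<one>\<^bsub>M2\<^esub>" by (simp add: order2_elem_add order2_elem_0)
    finally have "m \<otimes>\<^bsub>M2\<^esub> m = \<one>\<^bsub>M2\<^esub>" using m(2) by (intro inj_onD[OF iota_inj]) simp_all
    from order2_elem_exists[OF this] obtain c d where "m = order2_elem c d" by (elim exE)
    then show ?thesis using m(1) by (intro exI[of _ c] exI[of _ d]) simp
  qed
  obtain p q where pq: "\<iota>' (order2_elem 1 0) = \<iota> (order2_elem p q)" using ex[of 1 0] by (elim exE)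
  obtain r s where rs: "\<iota>' (order2_elem 0 1) = \<iota> (order2_elem r s)" using ex[of 0 1] by (elim exE)
  have 11: "\<iota>' (order2_elem 1 1) = \<iota> (order2_elem (p + r) (q + s))"
  proof -
    have "\<iota>' (order2_elem 1 1) = \<iota>' (order2_elem 1 0 \<otimes>\<^bsub>M2\<^esub> order2_elem 0 1)" by (simp add: order2_elem_add)
    also have "... = \<iota> (order2_elem p q) \<otimes> \<iota> (order2_elem r s)"
      by (simp only: c'.iota_mult[OF order2_elem_carrier order2_elem_carrier] pq rs)
    also have "... = \<iota> (order2_elem (p + r) (q + s))"
      by (simp only: iota_mult[OF order2_elem_carrier order2_elem_carrier, symmetric] order2_elem_add)
    finally show ?thesis .
  qed
  have 00: "\<iota>' (order2_elem 0 0) = \<iota> (order2_elem 0 0)" by (simp add: order2_elem_0)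
  have "\<iota>' (order2_elem a b) = \<iota> (order2_elem (p * a + r * b) (q * a + s * b))" for a b
    by (cases a; cases b) (simp_all add: pq rs 11 00)
  then show ?thesis by (intro exI allI)
qed

lemma transition_inverse:
  assumes c: "central_lifts G \<iota>' hs' A'"
    and Q: "!!a b. \<iota>' (order2_elem a b) = \<iota> (order2_elem (p * a + r * b) (q * a + s * b))"
    and R: "!!a b. \<iota> (order2_elem a b) = \<iota>' (order2_elem (p' * a + r' * b) (q' * a + s' * b))"
  shows "p * p' + r * q' = 1 \<and> q * p' + s * q' = 0 \<and> p * r' + r * s' = 0 \<and> q * r' + s * s' = 1"
proof -
  have "\<iota> (order2_elem a b) = \<iota> (order2_elem (p * (p' * a + r' * b) + r * (q' * a + s' * b))
      (q * (p' * a + r' * b) + s * (q' * a + s' * b)))" for a b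
    unfolding R[of a b] Q ..
  from iota_order2_inject[OF this[of 1 0]] iota_order2_inject[OF this[of 0 1]] show ?thesis by simp
qed

end

definition bit_int :: "bit => int" where "bit_int c = (if c = 0 then 0 else 1)"

lemma powi_carrier: "z \<in> carrier quasicyclic2 ==> z powi n \<in> carrier quasicyclic2"
proof -
  assume z: "z \<in> carrier quasicyclic2"
  have "w ^ k \<in> carrier quasicyclic2" if "w \<in> carrier quasicyclic2" for w and k :: nat
  proof (induction k)
    case 0
    show ?case using comm_group_quasicyclic2 by (simp add: quasicyclic2_simps exI[of _ 0])
  next
    case (Suc k)
    then show ?case using quasicyclic2_mult[OF that] by simp
  qed
  then show ?thesis using z quasicyclic2_inverse[OF z] by (simp add: power_int_def)
qed

text \<open>Lift the matrix to an integer matrix with entries 0 and 1. Its determinant is odd and lies between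
  -1 and 1, so it is invertible over the integers and acts on
  \<open>M\<^sup>(\<^sup>2\<^sup>)\<close> by monomials.\<close>

lemma automorphism_realising:
  fixes a b c d :: bit
  assumes det: "a * d + b * c = 1"
  shows "\<exists>\<theta>. \<theta> \<in> hom M2 M2 \<and> bij_betw \<theta> (carrier M2) (carrier M2) \<and>
    (\<forall>u v. \<theta> (order2_elem u v) = order2_elem (a * u + b * v) (c * u + d * v))"
proof -
  let ?a = "bit_int a" and ?b = "bit_int b" and ?c = "bit_int c" and ?d = "bit_int d"
  \<comment> \<open>The determinant over the integers, which is its own inverse.\<close>
  define s where "s = ?a * ?d - ?b * ?c"
  have s: "s * (?a * ?d - ?b * ?c) = 1"
    using det unfolding s_def bit_int_def by (cases a; cases b; cases c; cases d) simp_all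
  define f where "f x y u v m = (fst m powi x * snd m powi y, fst m powi u * snd m powi v)"
    for x y u v and m :: "complex \<times> complex"
  have f_in: "f x y u v m \<in> carrier M2" if "m \<in> carrier M2" for x y u v m
    using that by (auto simp: f_def M2_simps intro!: quasicyclic2_mult powi_carrier)
  have f_f: "f x y u v (f x' y' u' v' m) = f (x * x' + y * u') (x * y' + y * v') (u * x' + v * u') (u * y' + v * v') m"
    if "m \<in> carrier M2" for x y u v x' y' u' v' m
  proof -
    have n: "fst m ~= 0" "snd m ~= 0" using that quasicyclic2_nonzero by (auto simp: M2_simps)
    show ?thesis
      by (simp add: f_def power_int_mult_distrib power_int_add n mult.commute mult.left_commute flip: power_int_mult)
  qed
  have f1: "f 1 0 0 1 m = m" for m by (simp add: f_def)
  let ?f = "f ?a ?b ?c ?d" and ?g = "f (s * ?d) (- s * ?b) (- s * ?c) (s * ?a)"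
  have "bij_betw ?f (carrier M2) (carrier M2)"
  proof (rule bij_betw_byWitness[of _ ?g])
    show "\<forall>m\<in>carrier M2. ?g (?f m) = m"
    proof
      fix m assume m: "m \<in> carrier M2"
      have "s * ?d * ?a + - s * ?b * ?c = 1" "s * ?d * ?b + - s * ?b * ?d = 0"
        "- s * ?c * ?a + s * ?a * ?c = 0" "- s * ?c * ?b + s * ?a * ?d = 1"
        using s by (simp_all add: algebra_simps)
      then show "?g (?f m) = m" unfolding f_f[OF m] by (simp only: f1)
    qed
    show "\<forall>m\<in>carrier M2. ?f (?g m) = m"
    proof
      fix m assume m: "m \<in> carrier M2"
      have "?a * (s * ?d) + ?b * (- s * ?c) = 1" "?a * (- s * ?b) + ?b * (s * ?a) = 0"
        "?c * (s * ?d) + ?d * (- s * ?c) = 0" "?c * (- s * ?b) + ?d * (s * ?a) = 1"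
        using s by (simp_all add: algebra_simps)
      then show "?f (?g m) = m" unfolding f_f[OF m] by (simp only: f1)
    qed
    show "?f ` carrier M2 \<subseteq> carrier M2" "?g ` carrier M2 \<subseteq> carrier M2" using f_in by blast+
  qed
  moreover have "?f \<in> hom M2 M2"
    by (rule homI) (simp_all add: f_in, simp add: f_def M2_simps power_int_mult_distrib)
  moreover have "?f (order2_elem u v) = order2_elem (a * u + b * v) (c * u + d * v)" for u v
    by (cases a; cases b; cases c; cases d; cases u; cases v) (simp_all add: f_def order2_elem_def bit_int_def)
  ultimately show ?thesis by (intro exI[of _ ?f] conjI allI)
qed


section \<open>The order of the blocks\<close>

text \<open>The span only depends on the set of vectors, and a spanning family of the right length is a basis.\<close>

lemma basis_permute:
  assumes "basis bs V" "set bs' = set bs" "length bs' = length bs"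
  shows "basis bs' V"
proof -
  have sub: "range (comb cs) \<subseteq> range (comb ds)" if "set cs = set ds" for cs ds :: "'a list"
  proof -
    have "set cs \<subseteq> range (comb ds)" unfolding that by (rule subsetI) (rule nth_in_range_comb)
    then show ?thesis by (intro image_subsetI comb_in[OF subgrp_range_comb])
  qed
  have r: "range (comb bs') = V"
    using sub[OF assms(2)] sub[OF assms(2)[symmetric]] basis_range[OF assms(1)] by simp
  have im: "comb bs' ` vecs (length bs') = V" using r by (simp add: range_comb)
  have "card (comb bs' ` vecs (length bs')) = card (vecs (length bs'))"
    using im basis_card[OF assms(1)] assms(3) by (simp add: card_vecs)
  then have "inj_on (comb bs') (vecs (length bs'))" by (rule eq_card_imp_inj_on[OF finite_vecs])
  then show ?thesis unfolding basis_def bij_betw_def by (rule conjI[OF _ im])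
qed

lemma gram_split:
  assumes g: "gram \<alpha> bs = diag_block_mat (A # As)" and d: "dim_row A = k" "dim_col A = k"
  shows "gram \<alpha> (take k bs) = A \<and> gram \<alpha> (drop k bs) = diag_block_mat As \<and>
    (\<forall>b\<in>set (take k bs). \<forall>c\<in>set (drop k bs). \<alpha> b c = 0)"
proof -
  let ?D = "diag_block_mat As"
  have r: "length bs = k + dim_row ?D" and c: "length bs = k + dim_col ?D"
    using arg_cong[OF g, of dim_row] arg_cong[OF g, of dim_col] d by (simp_all add: Let_def)
  have e: "\<alpha> (bs ! i) (bs ! j) = (if i < k then if j < k then A $$ (i, j) else 0
      else if j < k then 0 else ?D $$ (i - k, j - k))" if "i < length bs" "j < length bs" for i j
  proof -
    have "\<alpha> (bs ! i) (bs ! j) = gram \<alpha> bs $$ (i, j)" using that by (simp add: gram_def)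
    also have "... = diag_block_mat (A # As) $$ (i, j)" by (simp only: g)
    finally show ?thesis using that r c d by (simp add: Let_def)
  qed
  have "gram \<alpha> (take k bs) = A"
    using d r by (intro eq_matI) (simp_all add: gram_def e)
  moreover have "gram \<alpha> (drop k bs) = ?D"
    using r c by (intro eq_matI) (simp_all add: gram_def e)
  moreover have "\<alpha> x y = 0" if xy: "x \<in> set (take k bs)" "y \<in> set (drop k bs)" for x y
  proof -
    obtain i where i: "i < k" "i < length bs" "x = bs ! i" using xy(1) by (auto simp: in_set_conv_nth)
    obtain j where j: "k + j < length bs" "y = bs ! (k + j)" using xy(2) r by (auto simp: in_set_conv_nth)
    show ?thesis using e[of i "k + j"] i j by simp
  qed
  ultimately show ?thesis by blast
qed

text \<open>Cut the basis into the pieces belonging to the blocks. Pieces of different blocks are orthogonal,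
  so they can be put together in any order.\<close>

lemma permute_blocks:
  assumes alt: "alt_form \<alpha>" "alt_form \<beta>"
    and "gram \<alpha> bs = diag_block_mat (map f ps)" "gram \<beta> bs = diag_block_mat (map g ps)"
    and "!!p. p \<in> set ps ==> square_mat (f p) \<and> square_mat (g p) \<and> dim_row (f p) = dim_row (g p)"
    and "mset ps = mset qs"
  shows "\<exists>bs'. set bs' = set bs \<and> length bs' = length bs \<and>
    gram \<alpha> bs' = diag_block_mat (map f qs) \<and> gram \<beta> bs' = diag_block_mat (map g qs)"
proof -
  define F where "F bs ps \<longleftrightarrow> gram \<alpha> bs = diag_block_mat (map f ps) \<and> gram \<beta> bs = diag_block_mat (map g ps)" for bs ps
  define Orth where "Orth bs cs \<longleftrightarrow> (\<forall>b\<in>set bs. \<forall>c\<in>set cs. \<alpha> b c = 0 \<and> \<beta> b c = 0)" for bs cs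
  define S where "S p \<longleftrightarrow> square_mat (f p) \<and> square_mat (g p) \<and> dim_row (f p) = dim_row (g p)" for p
  have sym: "Orth cs bs" if "Orth bs cs" for bs cs
    unfolding Orth_def
  proof (intro ballI)
    fix c b assume "c \<in> set cs" "b \<in> set bs"
    then show "\<alpha> c b = 0 \<and> \<beta> c b = 0"
      using that alt_sym[OF alt(1), of c b] alt_sym[OF alt(2), of c b] by (simp add: Orth_def)
  qed
  have head: "F (b0 @ br) (p # ps)" if "gram \<alpha> b0 = f p" "gram \<beta> b0 = g p" "F br ps" "Orth b0 br" for b0 br p ps
    using that diag_block_mat_gram_append[OF alt(1), of b0 br "f p" "map f ps"]
      diag_block_mat_gram_append[OF alt(2), of b0 br "g p" "map g ps"] by (simp add: F_def Orth_def)
  have unhead: "\<exists>b0 br. bs = b0 @ br \<and> gram \<alpha> b0 = f p \<and> gram \<beta> b0 = g p \<and> F br ps \<and> Orth b0 br"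
    if "F bs (p # ps)" "S p" for bs p ps
  proof -
    let ?k = "dim_row (f p)"
    have 1: "gram \<alpha> (take ?k bs) = f p \<and> gram \<alpha> (drop ?k bs) = diag_block_mat (map f ps) \<and>
        (\<forall>b\<in>set (take ?k bs). \<forall>c\<in>set (drop ?k bs). \<alpha> b c = 0)"
      using that by (intro gram_split) (auto simp: F_def S_def)
    have 2: "gram \<beta> (take ?k bs) = g p \<and> gram \<beta> (drop ?k bs) = diag_block_mat (map g ps) \<and>
        (\<forall>b\<in>set (take ?k bs). \<forall>c\<in>set (drop ?k bs). \<beta> b c = 0)"
      using that by (intro gram_split) (auto simp: F_def S_def)
    show ?thesis
      by (rule exI[of _ "take ?k bs"], rule exI[of _ "drop ?k bs"]) (use 1 2 in \<open>simp add: F_def Orth_def\<close>)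
  qed
  have append: "F (bs @ cs) (ps @ qs)" if "F bs ps" "F cs qs" "Orth bs cs" "\<forall>p\<in>set ps. S p" for bs cs ps qs
    using that
  proof (induction ps arbitrary: bs)
    case Nil
    have "length bs = 0" using arg_cong[of _ _ dim_row, OF conjunct1[OF Nil.prems(1)[unfolded F_def]]] by simp
    then show ?case using Nil.prems(2) by simp
  next
    case (Cons p ps)
    have "S p" using Cons.prems(4) by simp
    from unhead[OF Cons.prems(1) this] obtain b0 br where b: "bs = b0 @ br" "gram \<alpha> b0 = f p" "gram \<beta> b0 = g p" "F br ps" "Orth b0 br"
      by (elim exE conjE)
    have "F (br @ cs) (ps @ qs)"
      by (rule Cons.IH[OF b(4) Cons.prems(2)]) (use Cons.prems(3,4) in \<open>simp_all add: b(1) Orth_def\<close>)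
    moreover have "Orth b0 (br @ cs)" using b(5) Cons.prems(3) unfolding b(1) Orth_def by auto
    ultimately show ?case using head[OF b(2,3)] by (simp add: b(1))
  qed
  have unappend: "\<exists>b1 b2. bs = b1 @ b2 \<and> F b1 ps \<and> F b2 qs \<and> Orth b1 b2"
    if "F bs (ps @ qs)" "\<forall>p\<in>set ps. S p" for bs ps qs
    using that
  proof (induction ps arbitrary: bs)
    case Nil
    have "gram \<alpha> ([] :: 'a list) = 0\<^sub>m 0 0" "gram \<beta> ([] :: 'a list) = 0\<^sub>m 0 0" by (auto simp: gram_def)
    then have "F [] []" by (simp add: F_def)
    then show ?case using Nil.prems(1) by (intro exI[of _ "[]"] exI[of _ bs]) (simp add: Orth_def)
  next
    case (Cons p ps)
    have "F bs (p # (ps @ qs))" "S p" using Cons.prems by simp_all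
    from unhead[OF this] obtain b0 br where b: "bs = b0 @ br" "gram \<alpha> b0 = f p" "gram \<beta> b0 = g p" "F br (ps @ qs)" "Orth b0 br"
      by (elim exE conjE)
    have "\<forall>p\<in>set ps. S p" using Cons.prems(2) by simp
    from Cons.IH[OF b(4) this] obtain b1 b2 where c: "br = b1 @ b2" "F b1 ps" "F b2 qs" "Orth b1 b2" by (elim exE conjE)
    have "F (b0 @ b1) (p # ps)" by (rule head[OF b(2,3) c(2)]) (use b(5) in \<open>simp add: c(1) Orth_def\<close>)
    moreover have "Orth (b0 @ b1) b2" using b(5) c(4) unfolding c(1) Orth_def by auto
    ultimately show ?case using c(3) by (intro exI[of _ "b0 @ b1"] exI[of _ b2]) (simp add: b(1) c(1))
  qed
  have "\<exists>bs'. set bs' = set bs \<and> length bs' = length bs \<and> F bs' qs"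
    if "F bs ps" "\<forall>p\<in>set ps. S p" "mset ps = mset qs" for bs ps qs
    using that
  proof (induction qs arbitrary: bs ps)
    case Nil
    then show ?case by (intro exI[of _ bs]) simp
  next
    case (Cons q qs)
    have "q \<in> set ps" using Cons.prems(3) by (metis list.set_intros(1) set_mset_mset)
    then obtain ps1 ps2 where ps: "ps = ps1 @ q # ps2" by (auto simp: in_set_conv_decomp)
    have "F bs (ps1 @ (q # ps2))" "\<forall>p\<in>set ps1. S p" using Cons.prems by (simp_all add: ps)
    from unappend[OF this] obtain b1 b23 where b: "bs = b1 @ b23" "F b1 ps1" "F b23 (q # ps2)" "Orth b1 b23" by (elim exE conjE)
    have "S q" using Cons.prems(2) by (simp add: ps)
    from unhead[OF b(3) this] obtain b2 b3 where c: "b23 = b2 @ b3" "gram \<alpha> b2 = f q" "gram \<beta> b2 = g q" "F b3 ps2" "Orth b2 b3"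
      by (elim exE conjE)
    have "Orth b1 b3" "Orth b1 b2" using b(4) by (simp_all add: c(1) Orth_def)
    have 1: "F (b1 @ b3) (ps1 @ ps2)"
      by (rule append[OF b(2) c(4) \<open>Orth b1 b3\<close>]) (use Cons.prems(2) in \<open>simp add: ps\<close>)
    have 2: "\<forall>p\<in>set (ps1 @ ps2). S p" "mset (ps1 @ ps2) = mset qs" using Cons.prems(2,3) by (simp_all add: ps)
    from Cons.IH[OF 1 2] obtain bs' where bs': "set bs' = set (b1 @ b3)" "length bs' = length (b1 @ b3)" "F bs' qs"
      by (elim exE conjE)
    have "Orth b2 bs'" using c(5) sym[OF \<open>Orth b1 b2\<close>] bs'(1) by (auto simp: Orth_def)
    from head[OF c(2,3) bs'(3) this] show ?case
      using bs'(1,2) by (intro exI[of _ "b2 @ bs'"]) (auto simp: b(1) c(1))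
  qed
  from this[of bs ps qs] assms(3-6) show ?thesis unfolding F_def S_def by simp
qed

lemma canonical_basis_permute:
  assumes alt: "alt_form \<alpha>" "alt_form \<beta>" and c: "canonical_basis \<alpha> \<beta> V bs ps" and "mset ps = mset qs"
    and sq: "!!p. p \<in> set ps ==> square_mat (fst (canonical_pair p)) \<and> square_mat (snd (canonical_pair p)) \<and>
      dim_row (fst (canonical_pair p)) = dim_row (snd (canonical_pair p))"
  shows "\<exists>bs'. canonical_basis \<alpha> \<beta> V bs' qs"
proof -
  have "\<exists>bs'. set bs' = set bs \<and> length bs' = length bs \<and>
    gram \<alpha> bs' = diag_block_mat (map (fst \<circ> canonical_pair) qs) \<and> gram \<beta> bs' = diag_block_mat (map (snd \<circ> canonical_pair) qs)"
    using c sq by (intro permute_blocks[OF alt _ _ _ assms(4)]) (simp_all add: canonical_basis_def)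
  then obtain bs' where b: "set bs' = set bs" "length bs' = length bs"
    "gram \<alpha> bs' = diag_block_mat (map (fst \<circ> canonical_pair) qs)" "gram \<beta> bs' = diag_block_mat (map (snd \<circ> canonical_pair) qs)"
    by (elim exE conjE)
  have "set qs = set ps" using assms(4) by (metis set_mset_mset)
  then show ?thesis using c b basis_permute[OF _ b(1,2)] by (intro exI[of _ bs']) (simp add: canonical_basis_def)
qed


context central_M2 begin

section \<open>Lifts in a nilpotent Chernikov group\<close>

text \<open>Since \<open>x\<^sup>2\<close> is central, \<open>[x, y]\<^sup>2 = [x\<^sup>2, y] = 1\<close>.\<close>

lemma commutator_order2:
  assumes inj: "inj_on \<iota> (carrier M2)" and xy: "x \<in> carrier G" "y \<in> carrier G"
    and sq: "eqv (x \<otimes> x) \<one>" and comm: "eqv (x \<otimes> y) (y \<otimes> x)"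
  shows "\<exists>a b. commutes_up_to x y (order2_elem a b)"
proof -
  obtain c where c: "c \<in> carrier M2" "x \<otimes> y = \<iota> c \<otimes> (y \<otimes> x)" using comm by (rule eqvE)
  obtain d where d: "d \<in> carrier M2" "x \<otimes> x = \<iota> d" using sq by (auto elim: eqvE)
  have cu: "commutes_up_to x y c" using c(2) by (simp add: commutes_up_to_def)
  have "commutes_up_to (x \<otimes> x) y (c \<otimes>\<^bsub>M2\<^esub> c)" by (rule commutes_mult[OF cu cu]) (use c xy in simp_all)
  then have "\<iota> d \<otimes> y = \<iota> (c \<otimes>\<^bsub>M2\<^esub> c) \<otimes> (y \<otimes> \<iota> d)" unfolding d(2) commutes_up_to_def .
  moreover have "y \<otimes> \<iota> d = \<iota> d \<otimes> y" using central[OF d(1) xy(2)] by simp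
  ultimately have "\<one> \<otimes> (\<iota> d \<otimes> y) = \<iota> (c \<otimes>\<^bsub>M2\<^esub> c) \<otimes> (\<iota> d \<otimes> y)" using d xy by simp
  then have "\<one> = \<iota> (c \<otimes>\<^bsub>M2\<^esub> c)" by (rule r_cancel) (use c d xy in simp_all)
  then have "\<iota> (c \<otimes>\<^bsub>M2\<^esub> c) = \<iota> \<one>\<^bsub>M2\<^esub>" by simp
  then have "c \<otimes>\<^bsub>M2\<^esub> c = \<one>\<^bsub>M2\<^esub>" using c(1) by (intro inj_onD[OF inj]) simp_all
  then have "\<exists>a b. c = order2_elem a b" by (rule order2_elem_exists)
  then show ?thesis using cu by (elim exE) (simp, intro exI)
qed

text \<open>A longest independent family of involutions spans modulo the bottom: an element outside its span
  could be corrected to an involution and added. The finiteness of the quotient bounds the length.\<close>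

lemma exists_central_lifts:
  fixes F :: "'a => 'c"
  assumes inj: "inj_on \<iota> (carrier M2)"
    and sq: "!!x. x \<in> carrier G ==> eqv (x \<otimes> x) \<one>"
    and comm: "!!x y. x \<in> carrier G ==> y \<in> carrier G ==> eqv (x \<otimes> y) (y \<otimes> x)"
    and F: "finite (F ` carrier G)" "!!x y. x \<in> carrier G ==> y \<in> carrier G ==> F x = F y ==> eqv x y"
  shows "\<exists>hs A. central_lifts G \<iota> hs A"
proof -
  \<comment> \<open>Involutions that are independent modulo the bottom.\<close>
  define I where "I hs \<longleftrightarrow> set hs \<subseteq> carrier G \<and> (\<forall>h\<in>set hs. h \<otimes> h = \<one>) \<and>
    (\<forall>x\<in>vecs (length hs). eqv (hprod G hs x) \<one> --> x = 0)" for hs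
  have el: "elementary hs" if "set hs \<subseteq> carrier G" for hs
    unfolding elementary_def using that comm sq by (meson subsetD)
  have cancel: "eqv z (hprod G hs y)" if hs: "set hs \<subseteq> carrier G" and y: "y \<in> vecs (length hs)"
      and z: "z \<in> carrier G" "eqv (z \<otimes> hprod G hs y) \<one>" for hs y z
  proof -
    let ?P = "hprod G hs y"
    have P: "?P \<in> carrier G" by (rule hprod_closed[OF hs])
    have "eqv (?P \<otimes> ?P) \<one>" by (rule sq[OF P])
    then have "eqv (z \<otimes> (?P \<otimes> ?P)) (z \<otimes> \<one>)" by (rule eqv_mult[OF eqv_refl[OF z(1)] _ z(1) one_closed])
    then have 1: "eqv z (z \<otimes> (?P \<otimes> ?P))" using z P by (intro eqv_sym[of "z \<otimes> (?P \<otimes> ?P)" z]) simp_all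
    have "eqv ((z \<otimes> ?P) \<otimes> ?P) (\<one> \<otimes> ?P)" by (rule eqv_mult[OF z(2) eqv_refl[OF P] one_closed P])
    then have 2: "eqv (z \<otimes> (?P \<otimes> ?P)) ?P" using z P by (simp add: m_assoc)
    show ?thesis by (rule eqv_trans[OF 1 2 P])
  qed
  have bound: "length hs \<le> card (F ` carrier G)" if "I hs" for hs
  proof -
    have hs: "set hs \<subseteq> carrier G" using that by (simp add: I_def)
    have P: "hprod G hs x \<in> carrier G" for x by (rule hprod_closed[OF hs])
    have "inj_on (\<lambda>x. F (hprod G hs x)) (vecs (length hs))"
    proof (rule inj_onI)
      fix x y assume x: "x \<in> vecs (length hs)" and y: "y \<in> vecs (length hs)" and e: "F (hprod G hs x) = F (hprod G hs y)"
      have "eqv (hprod G hs x) (hprod G hs y)" by (rule F(2)[OF P P e])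
      then have 2: "eqv (hprod G hs x \<otimes> hprod G hs y) (hprod G hs y \<otimes> hprod G hs y)"
        by (rule eqv_mult[OF _ eqv_refl[OF P] P P])
      have 1: "eqv (hprod G hs (x + y)) (hprod G hs x \<otimes> hprod G hs y)"
        by (rule eqv_sym[OF hprod_add[OF el[OF hs] x] P])
      have "eqv (hprod G hs (x + y)) \<one>"
        by (rule eqv_trans[OF 1 eqv_trans[OF 2 sq[OF P] one_closed] one_closed])
      moreover have "x + y \<in> vecs (length hs)" by (rule subgrpD(2)[OF subgrp_vecs x y])
      ultimately have "x + y = 0" using that unfolding I_def by blast
      then show "x = y" by (simp add: add_eq_0_iff_eq)
    qed
    then have "card (vecs (length hs)) \<le> card (F ` carrier G)"
      by (rule card_inj_on_le[OF _ _ F(1)]) (use P in auto)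
    then have "2 ^ length hs \<le> card (F ` carrier G)" by (simp add: card_vecs)
    then show ?thesis using less_exp[of "length hs"] by linarith
  qed
  have "I []" by (simp add: I_def vecs_0)
  moreover have "\<forall>ks. I ks --> length ks < Suc (card (F ` carrier G))" using bound by (simp add: less_Suc_eq_le)
  ultimately have "\<exists>hs. I hs \<and> (\<forall>ks. I ks --> length ks \<le> length hs)" by (rule ex_has_greatest_nat)
  then obtain hs where hs: "I hs" "\<forall>ks. I ks --> length ks \<le> length hs" by (elim exE conjE)
  have hsG: "set hs \<subseteq> carrier G" using hs(1) by (simp add: I_def)
  have P: "hprod G hs x \<in> carrier G" for x by (rule hprod_closed[OF hsG])
  have span: "\<exists>x\<in>vecs (length hs). eqv g (hprod G hs x)" if g: "g \<in> carrier G" for g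
  proof (rule ccontr)
    assume no: "\<not> (\<exists>x\<in>vecs (length hs). eqv g (hprod G hs x))"
    obtain n where n: "n \<in> carrier M2" "(\<iota> n \<otimes> g) \<otimes> (\<iota> n \<otimes> g) = \<one>"
      using square_one_translate[OF g sq[OF g]] by (rule bexE)
    let ?h = "\<iota> n \<otimes> g"
    have h: "?h \<in> carrier G" "eqv g ?h" using n g eqv_sym[OF eqv_iota[OF n(1) g] g] by simp_all
    have "I (?h # hs)"
      unfolding I_def
    proof (intro conjI ballI impI)
      show "set (?h # hs) \<subseteq> carrier G" using h hsG by simp
      show "k \<otimes> k = \<one>" if "k \<in> set (?h # hs)" for k using that n(2) hs(1) by (auto simp: I_def)
      fix x assume x: "x \<in> vecs (length (?h # hs))" and e: "eqv (hprod G (?h # hs) x) \<one>"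
      from x obtain c y where cy: "x = pCons c y" "y \<in> vecs (length hs)" by (auto simp: vecs_Suc)
      have "c = 0"
      proof (rule ccontr)
        assume "c ~= 0"
        then have "eqv (?h \<otimes> hprod G hs y) \<one>" using e unfolding cy(1) hprod_pCons by simp
        then have "eqv ?h (hprod G hs y)" by (rule cancel[OF hsG cy(2) h(1)])
        then have "eqv g (hprod G hs y)" by (rule eqv_trans[OF h(2) _ P])
        then show False using no cy(2) by blast
      qed
      moreover have "y = 0" using e \<open>c = 0\<close> hs(1) cy(2) unfolding cy(1) hprod_pCons I_def by simp
      ultimately show "x = 0" by (simp add: cy(1))
    qed
    then have "length (?h # hs) \<le> length hs" using hs(2) by blast
    then show False by simp
  qed
  have "\<exists>c. commutes_up_to x y (order2_elem (fst c) (snd c))" if "x \<in> carrier G" "y \<in> carrier G" for x y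
    using commutator_order2[OF inj that sq[OF that(1)] comm[OF that]] by (elim exE) (rule exI[of _ "(_, _)"], simp)
  then obtain c where c: "!!x y. x \<in> carrier G ==> y \<in> carrier G ==>
      commutes_up_to x y (order2_elem (fst (c x y)) (snd (c x y)))"
    by metis
  let ?n = "length hs"
  let ?A = "(mat ?n ?n (\<lambda>(i, j). fst (c (hs ! i) (hs ! j))), mat ?n ?n (\<lambda>(i, j). snd (c (hs ! i) (hs ! j))))"
  have "central_lifts G \<iota> hs ?A"
  proof
    show "set hs \<subseteq> carrier G" by (rule hsG)
    show "h \<otimes> h = \<one>" if "h \<in> set hs" for h using that hs(1) by (simp add: I_def)
    show "commutes_up_to (hs ! i) (hs ! j) (order2_elem (fst ?A $$ (i, j)) (snd ?A $$ (i, j)))"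
      if "i < length hs" "j < length hs" for i j
    proof -
      have "hs ! i \<in> carrier G" "hs ! j \<in> carrier G" using that hsG by auto
      from c[OF this] show ?thesis using that by simp
    qed
    show "inj_on \<iota> (carrier M2)" by (rule inj)
    show "\<exists>x\<in>vecs (length hs). eqv g (hprod G hs x)" if "g \<in> carrier G" for g by (rule span[OF that])
    show "x = 0" if "x \<in> vecs (length hs)" "eqv (hprod G hs x) \<one>" for x
      using that hs(1) unfolding I_def by blast
  qed
  then show ?thesis by (intro exI)
qed

end

text \<open>Let \<open>C m = [m, g]\<close> on the bottom. As \<open>g\<^sup>2\<close> acts trivially,
  \<open>C (C m) = (C m)\<^sup>2 = C (m\<^sup>2)\<close>. Every \<open>m\<close> is a square
  \<open>n\<^sup>2\<close>, so \<open>C m = C (C n)\<close>, and by induction \<open>C m\<close>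
  lies in every term of the lower central series.\<close>

lemma chernikov_central:
  fixes G (structure)
  assumes G: "group G" and M: "M \<subseteq> carrier G" "!!m n. m \<in> M ==> n \<in> M ==> m \<otimes> n = n \<otimes> m" "M \<lhd> G"
    and div: "!!m. m \<in> M ==> \<exists>n\<in>M. n \<otimes> n = m"
    and sq: "!!x. x \<in> carrier G ==> x \<otimes> x \<in> M"
    and nil: "lower_central G K = {\<one>}"
    and m: "m \<in> M" and g: "g \<in> carrier G"
  shows "m \<otimes> g = g \<otimes> m"
proof -
  interpret group G by (rule G)
  interpret N: normal M G by (rule M(3))
  have MG: "m \<in> carrier G" if "m \<in> M" for m using that M(1) by blast
  have ab: "m \<otimes> n = n \<otimes> m" if "m \<in> M" "n \<in> M" for m n
    using M(2)[OF that] .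
  define t where "t m = g \<otimes> m \<otimes> inv g" for m
  define C where "C m = m \<otimes> inv (t m)" for m
  have tM: "t m \<in> M" if "m \<in> M" for m using N.inv_op_closed2[OF g that] by (simp add: t_def)
  have CM: "C m \<in> M" if "m \<in> M" for m using that tM by (simp add: C_def N.m_closed N.m_inv_closed)
  have tm: "t (m \<otimes> n) = t m \<otimes> t n" if "m \<in> M" "n \<in> M" for m n
  proof -
    have "inv g \<otimes> (g \<otimes> (n \<otimes> inv g)) = n \<otimes> inv g"
      using g MG[OF that(2)] by (simp add: m_assoc[symmetric])
    then show ?thesis using g MG[OF that(1)] MG[OF that(2)] by (simp add: t_def m_assoc)
  qed
  have ti: "t (inv m) = inv (t m)" if "m \<in> M" for m
    using g MG[OF that] by (simp add: t_def inv_mult_group m_assoc)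
  have tt: "t (t m) = m" if "m \<in> M" for m
  proof -
    have "t (t m) = (g \<otimes> g) \<otimes> m \<otimes> inv (g \<otimes> g)"
      using g MG[OF that] by (simp add: t_def inv_mult_group m_assoc)
    also have "(g \<otimes> g) \<otimes> m = m \<otimes> (g \<otimes> g)" by (rule ab[OF sq[OF g] that])
    finally show ?thesis using g MG[OF that] by (simp add: m_assoc del: inv_mult_group)
  qed
  have Cm: "C (m \<otimes> n) = C m \<otimes> C n" if mn: "m \<in> M" "n \<in> M" for m n
  proof -
    have i: "inv (t m) \<in> M" "inv (t n) \<in> M" using tM mn by (simp_all add: N.m_inv_closed)
    have "C (m \<otimes> n) = m \<otimes> (n \<otimes> (inv (t n) \<otimes> inv (t m)))"
      using mn MG[OF tM] by (simp add: C_def tm inv_mult_group MG m_assoc)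
    also have "n \<otimes> (inv (t n) \<otimes> inv (t m)) = inv (t m) \<otimes> (n \<otimes> inv (t n))"
      using ab[OF CM[OF mn(2)] i(1)] mn i by (simp add: C_def MG m_assoc)
    finally show ?thesis using mn i by (simp add: C_def MG m_assoc)
  qed
  have CC: "C (C m) = C m \<otimes> C m" if mm: "m \<in> M" for m
  proof -
    have i: "inv (t m) \<in> M" using tM mm by (simp add: N.m_inv_closed)
    have "t (C m) = t m \<otimes> inv m"
      using tm[OF mm i] ti[OF tM[OF mm]] tt[OF mm] by (simp add: C_def)
    then have "inv (t (C m)) = C m" using MG[OF mm] MG[OF tM[OF mm]] by (simp add: C_def inv_mult_group)
    then show ?thesis by (simp add: C_def[of "C m"])
  qed
  have lc: "C m \<in> lower_central G k" if "m \<in> M" for m k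
    using that
  proof (induction k arbitrary: m)
    case 0
    then show ?case using MG[OF CM] by simp
  next
    case (Suc k)
    obtain n where n: "n \<in> M" "n \<otimes> n = m" using div[OF Suc.prems] by (rule bexE)
    have "C m = C (C n)" using Cm[OF n(1) n(1)] CC[OF n(1)] n(2) by simp
    also have "... = C n \<otimes> g \<otimes> inv (C n) \<otimes> inv g"
      unfolding C_def[of "C n"] t_def using g MG[OF CM[OF n(1)]] by (simp add: inv_mult_group m_assoc)
    finally have e: "C m = C n \<otimes> g \<otimes> inv (C n) \<otimes> inv g" .
    have "C n \<in> lower_central G k" by (rule Suc.IH[OF n(1)])
    then show ?case unfolding e lower_central.simps using g by (intro generate.incl) blast
  qed
  have "C m = \<one>" using lc[OF m, of K] nil by simp
  moreover have "m = C m \<otimes> t m" using MG[OF m] MG[OF tM[OF m]] by (simp add: C_def m_assoc)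
  ultimately have "m = t m" using MG[OF tM[OF m]] by simp
  then have "m \<otimes> g = t m \<otimes> g" by simp
  then show ?thesis using g MG[OF m] by (simp add: t_def m_assoc)
qed


lemma central_lifts_nilpotent_chernikov:
  fixes G (structure)
  assumes ch: "chernikov_2_group G M" and nil: "nilpotent_group G"
    and el: "elementary_abelian_2_group (G Mod M)" and iso: "G\<lparr>carrier := M\<rparr> \<cong> M2"
  shows "\<exists>\<iota> hs A. central_lifts G \<iota> hs A"
proof -
  have N: "M \<lhd> G" and fin: "finite (carrier (G Mod M))"
    using ch by (simp_all add: chernikov_2_group_def finite_2_group_def)
  interpret normal M G by (rule N)
  have MG: "M \<subseteq> carrier G" by (rule subset)
  have "group (G\<lparr>carrier := M\<rparr>)" by (rule subgroup.subgroup_is_group[OF subgroup_axioms is_group])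
  then have "M2 \<cong> G\<lparr>carrier := M\<rparr>" using iso by (rule group.iso_sym)
  then obtain \<psi> where \<psi>: "\<psi> \<in> iso M2 (G\<lparr>carrier := M\<rparr>)" by (auto simp: is_iso_def)
  have im: "\<psi> ` carrier M2 = M" and inj: "inj_on \<psi> (carrier M2)"
    using \<psi> by (auto simp: iso_def bij_betw_def)
  have mult: "\<psi> (m \<otimes>\<^bsub>M2\<^esub> n) = \<psi> m \<otimes> \<psi> n" if "m \<in> carrier M2" "n \<in> carrier M2" for m n
    using \<psi> that by (auto simp: iso_def hom_def)
  have \<psi>M: "\<psi> m \<in> M" if "m \<in> carrier M2" for m using im that by blast
  have pre: "\<exists>a\<in>carrier M2. m = \<psi> a" if "m \<in> M" for m using that im by blast
  have ab: "m \<otimes> n = n \<otimes> m" if "m \<in> M" "n \<in> M" for m n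
  proof -
    from pre[OF that(1)] obtain a where a: "a \<in> carrier M2" "m = \<psi> a" by (rule bexE)
    from pre[OF that(2)] obtain b where b: "b \<in> carrier M2" "n = \<psi> b" by (rule bexE)
    show ?thesis unfolding a(2) b(2) mult[OF a(1) b(1), symmetric] mult[OF b(1) a(1), symmetric]
      by (simp add: M2.m_comm[OF a(1) b(1)])
  qed
  have div: "\<exists>n\<in>M. n \<otimes> n = m" if "m \<in> M" for m
  proof -
    from pre[OF that] obtain a where a: "a \<in> carrier M2" "m = \<psi> a" by (rule bexE)
    obtain b where b: "b \<in> carrier M2" "b \<otimes>\<^bsub>M2\<^esub> b = a" using M2_sqrt[OF a(1)] by (rule bexE)
    show ?thesis using mult[OF b(1) b(1)] \<psi>M[OF b(1)] by (intro bexI[of _ "\<psi> b"]) (simp_all add: b a)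
  qed
  have coset: "M #> x \<in> carrier (G Mod M)" if "x \<in> carrier G" for x
    using that by (auto simp: FactGroup_def RCOSETS_def)
  have coset_mult: "(M #> x) \<otimes>\<^bsub>G Mod M\<^esub> (M #> y) = M #> (x \<otimes> y)"
    if "x \<in> carrier G" "y \<in> carrier G" for x y
    using rcos_sum[OF that] by (simp add: FactGroup_def)
  have self: "x \<in> M #> x" if "x \<in> carrier G" for x by (rule rcos_self[OF that is_subgroup])
  have sq: "x \<otimes> x \<in> M" if x: "x \<in> carrier G" for x
  proof -
    have "(M #> x) \<otimes>\<^bsub>G Mod M\<^esub> (M #> x) = \<one>\<^bsub>G Mod M\<^esub>"
      using el coset[OF x] by (simp add: elementary_abelian_2_group_def)
    then have "M #> (x \<otimes> x) = M" unfolding coset_mult[OF x x] by (simp add: FactGroup_def)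
    then show ?thesis using self[of "x \<otimes> x"] x by simp
  qed
  obtain K where K: "lower_central G K = {\<one>}" using nil by (auto simp: nilpotent_group_def)
  have cent: "m \<otimes> g = g \<otimes> m" if "m \<in> M" "g \<in> carrier G" for m g
    by (rule chernikov_central[OF is_group MG ab N div sq K that])
  interpret c: central_M2 G \<psi>
  proof
    show "\<psi> \<in> hom M2 G"
    proof (rule homI)
      show "\<psi> m \<in> carrier G" if "m \<in> carrier M2" for m using \<psi>M[OF that] MG by blast
    qed (rule mult)
    show "\<psi> m \<otimes> x = x \<otimes> \<psi> m" if "m \<in> carrier M2" "x \<in> carrier G" for m x
      by (rule cent[OF \<psi>M[OF that(1)] that(2)])
  qed
  have eqv: "c.eqv x y" if "x \<in> M #> y" for x y
  proof -
    from that obtain m where m: "m \<in> M" "x = m \<otimes> y" by (auto simp: r_coset_def)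
    obtain a where "m = \<psi> a" "a \<in> carrier M2" using m(1) unfolding im[symmetric] by (rule imageE)
    then show ?thesis using m(2) by (intro c.eqvI) simp_all
  qed
  have "\<exists>hs A. central_lifts G \<psi> hs A"
  proof (rule c.exists_central_lifts[OF inj])
    show "c.eqv (x \<otimes> x) \<one>" if x: "x \<in> carrier G" for x
    proof -
      from pre[OF sq[OF x]] obtain a where a: "a \<in> carrier M2" "x \<otimes> x = \<psi> a" by (rule bexE)
      show ?thesis
      proof (rule c.eqvI[OF a(1)])
        show "x \<otimes> x = \<psi> a \<otimes> \<one>" unfolding a(2) using c.iota_closed[OF a(1)] by simp
      qed
    qed
    show "c.eqv (x \<otimes> y) (y \<otimes> x)" if x: "x \<in> carrier G" "y \<in> carrier G" for x y
    proof (rule eqv)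
      have "comm_group (G Mod M)" using el by (simp add: elementary_abelian_2_group_def)
      from comm_groupE(4)[OF this coset[OF x(1)] coset[OF x(2)]]
      have "M #> (x \<otimes> y) = M #> (y \<otimes> x)" unfolding coset_mult[OF x] coset_mult[OF x(2,1)] .
      then show "x \<otimes> y \<in> M #> (y \<otimes> x)" using self[of "x \<otimes> y"] x by simp
    qed
    show "finite ((\<lambda>x. M #> x) ` carrier G)"
      by (rule finite_subset[OF _ fin]) (use coset in blast)
    show "c.eqv x y" if "x \<in> carrier G" "y \<in> carrier G" "M #> x = M #> y" for x y
      using self[OF that(1)] unfolding that(3) by (rule eqv)
  qed
  then show ?thesis by (rule exI[of _ \<psi>])
qed

section \<open>The classification\<close>

lemma count_summands:
  assumes "\<rho> \<in> FF" shows "count_list (summands \<rho>) = \<rho>"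
proof -
  have "finite {p. \<rho> p > 0}" using assms by (simp add: FF_def)
  then have "count (Abs_multiset \<rho>) = \<rho>" by (rule count_Abs_multiset)
  moreover obtain ps where "mset ps = Abs_multiset \<rho>" using ex_mset by blast
  ultimately have "\<forall>p. count_list ps p = \<rho> p" by (metis count_mset)
  then have "\<exists>ps. \<forall>p. count_list ps p = \<rho> p" by (rule exI)
  then have c: "\<forall>p. count_list (summands \<rho>) p = \<rho> p" unfolding summands_def by (rule someI_ex)
  show ?thesis by (rule ext) (rule c[THEN spec])
qed

lemma set_summands: "\<rho> \<in> FF ==> set (summands \<rho>) \<subseteq> indices"
proof
  fix p assume \<rho>: "\<rho> \<in> FF" and "p \<in> set (summands \<rho>)"
  then have "\<rho> p ~= 0" using count_list_0_iff[of "summands \<rho>" p] by (simp add: count_summands)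
  then show "p \<in> indices" using \<rho> by (auto simp: FF_def)
qed

lemma count_list_FF: "set ps \<subseteq> indices ==> count_list ps \<in> FF"
proof -
  assume "set ps \<subseteq> indices"
  moreover have "{p. count_list ps p ~= 0} = set ps" by (auto simp: count_list_0_iff)
  ultimately show ?thesis by (simp add: FF_def)
qed

lemma canonical_pair_alternating:
  assumes "p \<in> indices" "B = fst (canonical_pair p) \<or> B = snd (canonical_pair p)"
  shows "alternating_mat (dim_row B) B \<and> dim_col B = dim_row B"
proof -
  have "\<exists>C. B = off_diag C"
    using assms(2) by (cases p; cases "fst p") (auto simp: canonical_pair_def Let_def)
  then show ?thesis using alternating_off_diag canonical_pair_square[OF assms(1)] assms(2) by auto
qed

lemma dim_row_diag_block_mat_cong:
  "(!!p. p \<in> set ps ==> dim_row (f p) = dim_row (g p)) ==>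
    dim_row (diag_block_mat (map f ps)) = dim_row (diag_block_mat (map g ps))"
  by (induction ps) (simp_all add: Let_def)

lemma pair_of_alternating:
  assumes \<rho>: "\<rho> \<in> FF" and N: "N = dim_row (fst (pair_of \<rho>))"
  shows "alternating_mat N (fst (pair_of \<rho>)) \<and> alternating_mat N (snd (pair_of \<rho>)) \<and>
    fst (pair_of \<rho>) \<in> carrier_mat N N \<and> snd (pair_of \<rho>) \<in> carrier_mat N N"
proof -
  let ?ps = "summands \<rho>"
  note i = set_summands[OF \<rho>]
  have 1: "alternating_mat (dim_row (fst (pair_of \<rho>))) (fst (pair_of \<rho>)) \<and>
      dim_col (fst (pair_of \<rho>)) = dim_row (fst (pair_of \<rho>))"
    unfolding pair_of_def fst_conv by (rule alternating_diag_block_mat) (use i canonical_pair_alternating in auto)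
  have 2: "alternating_mat (dim_row (snd (pair_of \<rho>))) (snd (pair_of \<rho>)) \<and>
      dim_col (snd (pair_of \<rho>)) = dim_row (snd (pair_of \<rho>))"
    unfolding pair_of_def snd_conv by (rule alternating_diag_block_mat) (use i canonical_pair_alternating in auto)
  have "dim_row (fst (pair_of \<rho>)) = dim_row (snd (pair_of \<rho>))"
    unfolding pair_of_def fst_conv snd_conv
    by (rule dim_row_diag_block_mat_cong) (use i canonical_pair_square in auto)
  then show ?thesis using 1 2 unfolding N by (metis carrier_matI)
qed

lemma canonical_basis_pair_of:
  assumes \<rho>: "\<rho> \<in> FF" and N: "N = dim_row (fst (pair_of \<rho>))"
  shows "canonical_basis (matrix_form N (fst (pair_of \<rho>))) (matrix_form N (snd (pair_of \<rho>)))
    (vecs N) (unit_basis N) (summands \<rho>)"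
  using pair_of_alternating[OF assms] set_summands[OF \<rho>]
  by (simp add: canonical_basis_def basis_unit_basis gram_unit_basis) (simp add: pair_of_def)

lemma model_group_of:
  assumes \<rho>: "\<rho> \<in> FF"
  shows "\<exists>\<iota> hs. central_lifts (model (dim_row (fst (pair_of \<rho>))) (pair_of \<rho>)) \<iota> hs (pair_of \<rho>) \<and>
    length hs = dim_row (fst (pair_of \<rho>))"
  using model_central_lifts[of "dim_row (fst (pair_of \<rho>))" "pair_of \<rho>"] pair_of_alternating[OF \<rho> refl]
  by (intro exI conjI) (simp, simp)

text \<open>Transport from the concrete model, to which \<open>G(\<rho>)\<close> is isomorphic.\<close>

lemma central_lifts_of_iso:
  assumes G: "group G" and \<rho>: "\<rho> \<in> FF" and iso: "G \<cong> group_of \<rho>"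
  shows "\<exists>\<iota> hs. central_lifts G \<iota> hs (pair_of \<rho>) \<and> length hs = dim_row (fst (pair_of \<rho>))"
proof -
  let ?E = "model (dim_row (fst (pair_of \<rho>))) (pair_of \<rho>)"
  obtain \<iota> hs where c: "central_lifts ?E \<iota> hs (pair_of \<rho>)" and l: "length hs = dim_row (fst (pair_of \<rho>))"
    using model_group_of[OF \<rho>] by (elim exE conjE)
  have "group_of \<rho> \<cong> ?E" unfolding group_of_def by (rule iso_if_central_lifts[OF refl c l])
  with iso have "G \<cong> ?E" by (rule iso_trans)
  then have "?E \<cong> G" by (rule group.iso_sym[OF G])
  then obtain \<phi> where "\<phi> \<in> iso ?E G" by (auto simp: is_iso_def)
  from central_lifts_iso[OF c this G] l show ?thesis by (intro exI conjI) (assumption, simp)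
qed

lemma inverse2_entries:
  assumes "inverse2 Q R"
  shows "Q $$ (0, 0) * R $$ (0, 0) + Q $$ (0, 1) * R $$ (1, 0) = 1"
    "Q $$ (0, 0) * R $$ (0, 1) + Q $$ (0, 1) * R $$ (1, 1) = 0"
    "Q $$ (1, 0) * R $$ (0, 0) + Q $$ (1, 1) * R $$ (1, 0) = 0"
    "Q $$ (1, 0) * R $$ (0, 1) + Q $$ (1, 1) * R $$ (1, 1) = 1"
  using assms by (simp_all add: inverse2_def)

lemma inverse2_det:
  assumes "inverse2 Q R"
  shows "R $$ (1, 1) * R $$ (0, 0) + R $$ (0, 1) * R $$ (1, 0) = 1"
  using inverse2_entries[OF assms]
  by (cases "R $$ (0, 0)"; cases "R $$ (0, 1)"; cases "R $$ (1, 0)"; cases "R $$ (1, 1)") auto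

lemma linear_substitution:
  fixes x y :: bit
  shows "a * (p * x + r * y) + b * (q * x + s * y) = (a * p + b * q) * x + (a * r + b * s) * y"
  by (simp add: algebra_simps)

text \<open>The embeddings differ by a matrix \<open>Q\<close> on the elements of order two, so the second
  pair of matrices is the pair of Gram matrices, in some basis, of the first pair twisted by
  \<open>Q\<close>; the multiplicities follow.\<close>

lemma same_group_imp_same_orbit:
  assumes \<rho>: "\<rho> \<in> FF" and \<rho>': "\<rho>' \<in> FF"
    and c: "central_lifts G \<iota> hs (pair_of \<rho>)" "length hs = dim_row (fst (pair_of \<rho>))"
    and c': "central_lifts G \<iota>' hs' (pair_of \<rho>')" "length hs' = dim_row (fst (pair_of \<rho>'))"
  shows "\<exists>Q\<in>carrier GL2. \<rho>' = act Q \<rho>"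
proof -
  interpret c: central_lifts G \<iota> hs "pair_of \<rho>" by (rule c(1))
  interpret c': central_lifts G \<iota>' hs' "pair_of \<rho>'" by (rule c'(1))
  obtain p q r s where T: "\<forall>a b. \<iota>' (order2_elem a b) = \<iota> (order2_elem (p * a + r * b) (q * a + s * b))"
    using c.iota_transition[OF c'(1)] by (elim exE)
  obtain p' q' r' s' where T': "\<forall>a b. \<iota> (order2_elem a b) = \<iota>' (order2_elem (p' * a + r' * b) (q' * a + s' * b))"
    using c'.iota_transition[OF c(1)] by (elim exE)
  note i = c.transition_inverse[OF c'(1) T[rule_format] T'[rule_format]]
  note i' = c'.transition_inverse[OF c(1) T'[rule_format] T[rule_format]]
  \<comment> \<open>The twist acts on a pair with both indices reversed, hence the flipped transition matrix.\<close>
  define Q where "Q = mat 2 2 (\<lambda>(i, j). if i = 0 then if j = 0 then s' else r' else if j = 0 then q' else p')"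
  define R where "R = mat 2 2 (\<lambda>(i, j). if i = 0 then if j = 0 then s else r else if j = 0 then q else p)"
  have QR: "inverse2 Q R" "inverse2 R Q"
    using i i' by (auto simp: inverse2_def Q_def R_def less_2_cases_iff algebra_simps)
  have Q: "Q \<in> carrier GL2" by (rule GL2I[OF _ _ QR]) (simp_all add: Q_def R_def)
  have im: "\<iota>' ` carrier M2 = \<iota> ` carrier M2"
    unfolding c.iota_image_fourth_powers c'.iota_image_fourth_powers ..
  obtain bs where bs: "length bs = length hs'" "basis bs (vecs (length hs))"
    "\<forall>i<length bs. \<forall>j<length bs.
       c.form1 (bs ! i) (bs ! j) = p * fst (pair_of \<rho>') $$ (i, j) + r * snd (pair_of \<rho>') $$ (i, j) \<and>
       c.form2 (bs ! i) (bs ! j) = q * fst (pair_of \<rho>') $$ (i, j) + s * snd (pair_of \<rho>') $$ (i, j)"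
    using c.coordinates_of_lifts[OF c'(1) im T[rule_format]] by (elim exE conjE)
  note alt' = pair_of_alternating[OF \<rho>' c'(2)]
  have e: "twist_fst Q c.form1 c.form2 (bs ! i) (bs ! j) = fst (pair_of \<rho>') $$ (i, j)"
      "twist_snd Q c.form1 c.form2 (bs ! i) (bs ! j) = snd (pair_of \<rho>') $$ (i, j)"
    if "i < length bs" "j < length bs" for i j
    using bs(3) that i' by (simp_all add: twist_fst_def twist_snd_def Q_def linear_substitution)
  have "gram (twist_fst Q c.form1 c.form2) bs = fst (pair_of \<rho>')"
    "gram (twist_snd Q c.form1 c.form2) bs = snd (pair_of \<rho>')"
    using alt' bs(1) by (auto simp: gram_def e intro!: eq_matI)
  then have b': "canonical_basis (twist_fst Q c.form1 c.form2) (twist_snd Q c.form1 c.form2) (vecs (length hs)) bs (summands \<rho>')"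
    using bs(2) set_summands[OF \<rho>'] by (simp add: canonical_basis_def pair_of_def)
  have b: "canonical_basis c.form1 c.form2 (vecs (length hs)) (unit_basis (length hs)) (summands \<rho>)"
    by (rule canonical_basis_pair_of[OF \<rho> c(2)])
  have "count_list (summands \<rho>') = act Q (count_list (summands \<rho>))"
    by (rule count_canonical_twist[OF c.alt_forms subgrp_vecs finite_vecs QR b b'])
  then show ?thesis using Q by (intro bexI[of _ Q]) (simp_all add: count_summands \<rho> \<rho>')
qed

text \<open>\<open>\<rho>0\<close> lists the blocks of the commutator pair of \<open>G\<close>. For another
  member of its orbit, twist the pair by \<open>Q\<close>, take a canonical basis, which then has
  the prescribed blocks, and undo the twist by an automorphism of the bottom.\<close>

lemma group_of_in_orbit:
  assumes c: "central_lifts G \<iota> hs A"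
  shows "\<exists>\<rho>0\<in>FF. \<forall>\<rho>\<in>FF. (\<exists>Q\<in>carrier GL2. \<rho> = act Q \<rho>0) --> group_of \<rho> \<cong> G"
proof -
  interpret c: central_lifts G \<iota> hs A by (rule c)
  let ?V = "vecs (length hs)"
  obtain bs ps where b: "canonical_basis c.form1 c.form2 ?V bs ps"
    using exists_canonical_basis[OF c.alt_forms finite_vecs[of "length hs"] subgrp_vecs] by (elim exE)
  have "group_of \<rho> \<cong> G" if \<rho>: "\<rho> \<in> FF" and Q: "Q \<in> carrier GL2" "\<rho> = act Q (count_list ps)" for \<rho> Q
  proof -
    obtain R where QR: "inverse2 Q R" "inverse2 R Q" using Units_ring_mat_2[OF Q(1)] by (elim exE conjE)
    let ?f = "twist_fst Q c.form1 c.form2" and ?g = "twist_snd Q c.form1 c.form2"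
    have alt: "alt_form ?f" "alt_form ?g" using alt_form_twist[OF c.alt_forms] by auto
    obtain bs1 ps1 where b1: "canonical_basis ?f ?g ?V bs1 ps1"
      using exists_canonical_basis[OF alt finite_vecs[of "length hs"] subgrp_vecs] by (elim exE)
    have "count_list ps1 = \<rho>"
      unfolding Q(2) by (rule count_canonical_twist[OF c.alt_forms subgrp_vecs finite_vecs QR b b1])
    then have "mset ps1 = mset (summands \<rho>)"
      by (intro multiset_eqI) (simp add: count_mset count_summands[OF \<rho>])
    then obtain bs2 where b2: "canonical_basis ?f ?g ?V bs2 (summands \<rho>)"
      using canonical_basis_permute[OF alt b1] b1 canonical_pair_square unfolding canonical_basis_def by blast
    have pair: "pair_of \<rho> = (gram ?f bs2, gram ?g bs2)" using b2 by (simp add: canonical_basis_def pair_of_def)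
    have "basis bs2 ?V" using b2 by (simp add: canonical_basis_def)
    then obtain hs2 where h2: "length hs2 = length bs2" "central_lifts G \<iota> hs2 (gram c.form1 bs2, gram c.form2 bs2)"
      using c.change_lifts by blast
    interpret d: central_lifts G \<iota> hs2 "(gram c.form1 bs2, gram c.form2 bs2)" by (rule h2(2))
    obtain \<theta> where th: "\<theta> \<in> hom M2 M2" "bij_betw \<theta> (carrier M2) (carrier M2)"
      "\<forall>u v. \<theta> (order2_elem u v) = order2_elem (R $$ (1, 1) * u + R $$ (0, 1) * v) (R $$ (1, 0) * u + R $$ (0, 0) * v)"
      using automorphism_realising[OF inverse2_det[OF QR(1)]] by (elim exE conjE)
    have "central_lifts G (\<iota> \<circ> \<theta>) hs2 (pair_of \<rho>)"
    proof (rule d.twist_iota[OF th(1,2)])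
      fix i j assume ij: "i < length hs2" "j < length hs2"
      let ?x = "c.form1 (bs2 ! i) (bs2 ! j)" and ?y = "c.form2 (bs2 ! i) (bs2 ! j)"
      have "R $$ (1, 1) * (Q $$ (1, 1) * ?x + Q $$ (0, 1) * ?y) + R $$ (0, 1) * (Q $$ (1, 0) * ?x + Q $$ (0, 0) * ?y) = ?x"
        "R $$ (1, 0) * (Q $$ (1, 1) * ?x + Q $$ (0, 1) * ?y) + R $$ (0, 0) * (Q $$ (1, 0) * ?x + Q $$ (0, 0) * ?y) = ?y"
        unfolding linear_substitution using inverse2_entries[OF QR(1)] by (simp_all add: algebra_simps)
      then show "\<theta> (order2_elem (fst (pair_of \<rho>) $$ (i, j)) (snd (pair_of \<rho>) $$ (i, j)))
          = order2_elem (fst (gram c.form1 bs2, gram c.form2 bs2) $$ (i, j)) (snd (gram c.form1 bs2, gram c.form2 bs2) $$ (i, j))"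
        using ij h2(1) by (simp add: pair gram_def th(3) twist_fst_def twist_snd_def)
    qed
    moreover have "length hs2 = dim_row (fst (pair_of \<rho>))" by (simp add: pair h2(1))
    ultimately show ?thesis unfolding group_of_def by (rule iso_if_central_lifts[OF refl])
  qed
  moreover have "count_list ps \<in> FF" using b by (intro count_list_FF) (simp add: canonical_basis_def)
  ultimately show ?thesis by (intro bexI[of _ "count_list ps"]) auto
qed

theorem theorem3p3:
  fixes G :: "('a, 'b) monoid_scheme" and M :: "'a set" and R :: "(index \<Rightarrow> nat) set"
  assumes "orbit_representatives R"
    and "chernikov_2_group G M"
    and "nilpotent_group G"
    and "elementary_abelian_2_group (G Mod M)"
    and "G\<lparr>carrier := M\<rparr> \<cong> M2"
  shows "\<exists>!\<rho>. \<rho> \<in> R \<and> G \<cong> group_of \<rho>"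
proof -
  have G: "group G" using assms(3) by (simp add: nilpotent_group_def)
  have RF: "R \<subseteq> FF" and orb: "!!\<rho>. \<rho> \<in> FF ==> \<exists>!\<sigma>. \<sigma> \<in> R \<and> \<sigma> \<in> orbit GL2 act \<rho>"
    using assms(1) by (auto simp: orbit_representatives_def orbits_def)
  obtain \<iota> hs A where c: "central_lifts G \<iota> hs A"
    using central_lifts_nilpotent_chernikov[OF assms(2-5)] by (elim exE)
  obtain \<rho>0 where \<rho>0: "\<rho>0 \<in> FF" "\<forall>\<rho>\<in>FF. (\<exists>Q\<in>carrier GL2. \<rho> = act Q \<rho>0) --> group_of \<rho> \<cong> G"
    using group_of_in_orbit[OF c] by (rule bexE)
  obtain \<rho> where \<rho>: "\<rho> \<in> R" "\<rho> \<in> orbit GL2 act \<rho>0" using orb[OF \<rho>0(1)] by (elim ex1E conjE)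
  have "group_of \<rho> \<cong> G" using \<rho>0(2) \<rho> RF by (auto simp: orbit_def)
  moreover have "group (group_of \<rho>)" unfolding group_of_def by (rule group_group_of_pair[OF refl])
  ultimately have iso: "G \<cong> group_of \<rho>" by (rule group.iso_sym[rotated])
  show ?thesis
  proof (rule ex1I[of _ \<rho>])
    show "\<rho> \<in> R \<and> G \<cong> group_of \<rho>" using \<rho>(1) iso by simp
    fix \<sigma> assume \<sigma>: "\<sigma> \<in> R \<and> G \<cong> group_of \<sigma>"
    have F: "\<rho> \<in> FF" "\<sigma> \<in> FF" using \<rho>(1) \<sigma> RF by auto
    obtain \<iota>1 hs1 where c1: "central_lifts G \<iota>1 hs1 (pair_of \<rho>)" "length hs1 = dim_row (fst (pair_of \<rho>))"
      using central_lifts_of_iso[OF G F(1) iso] by (elim exE conjE)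
    obtain \<iota>2 hs2 where c2: "central_lifts G \<iota>2 hs2 (pair_of \<sigma>)" "length hs2 = dim_row (fst (pair_of \<sigma>))"
      using central_lifts_of_iso[OF G F(2)] \<sigma> by (elim exE conjE) auto
    have "\<sigma> \<in> orbit GL2 act \<rho>"
      using same_group_imp_same_orbit[OF F c1 c2] by (auto simp: orbit_def)
    moreover have "\<rho> \<in> orbit GL2 act \<rho>"
      using same_group_imp_same_orbit[OF F(1) F(1) c1 c1] by (auto simp: orbit_def)
    ultimately show "\<sigma> = \<rho>" using orb[OF F(1)] \<rho>(1) \<sigma> by (metis (no_types))
  qed
qed

end
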